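(* Let $d\geq 3$, let $A\subset\mathbb{R}^d$ be a set with positive reach with $\dim A\leq 2$, and let $a\in A$ be such that $\dim(\operatorname{Tan}(A,a))=1$. Then there exist a $\operatorname{B}$-set $B\subset\mathbb{R}^2\subset\mathbb{R}^d$, a multirotation $\rho:\mathbb{R}^d\to\mathbb{R}^d$ associated with $T_1(B)$, an open set $U\subset\mathbb{R}^d$ and a $C^{1,1}$-diffeomorphism $\Phi:U\to\mathbb{R}^d$ such that $0\in U$, $a=\Phi(0)$, $\rho(B)\subset U$ and $\Phi(\rho(B))$ is a neighbourhood of $a$ in $A$. Moreover, conversely: if $B\subset\mathbb{R}^2\subset\mathbb{R}^d$ is a $\operatorname{B}$-set, $\rho:\mathbb{R}^d\to\mathbb{R}^d$ is a multirotation associated with $T_1(B)$, $U\subset\mathbb{R}^d$ is open, $\Phi:U\to\mathbb{R}^d$ is a $C^{1,1}$-diffeomorphism, $0\in U$, $\rho(B)\subset U$ and $a=\Phi(0)$, then there exist a set $A\subset\mathbb{R}^d$ with positive reach satisfying $\dim A\leq 2$ and $\dim(\operatorname{Tan}(A,a))=1$ and $\varepsilon>0$ such that $\Phi(\rho(B))\cap B(a,\varepsilon)=A\cap B(a,\varepsilon)$.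
   Context: A set $A\subset\mathbb{R}^d$ has positive reach if there is $\varepsilon>0$ such that every $x\in\mathbb{R}^d$ with $\mathrm{dist}(x,A)<\varepsilon$ has a unique nearest point in $A$. $\dim A$ is the topological dimension. For $a\in A$, $\operatorname{Tan}(A,a)$ is the tangent cone: $u\in\operatorname{Tan}(A,a)$ iff $u=0$ or there are $a\neq a_i\in A$, $r_i>0$ with $a_i\to a$ and $r_i(a_i-a)\to u$; $\dim\operatorname{Tan}(A,a)$ means the dimension of its linear span. For $k\in\{0,\dots,d\}$, $T_k(A)$ is the set of points $x\in A$ with $\dim\operatorname{Tan}(A,x)=k$. A $C^{1,1}$-diffeomorphism $\Phi:U\to\mathbb{R}^d$ is an injective map on an open set $U$ with $\Phi(U)$ open, such that $\Phi$ and $\Phi^{-1}$ have Lipschitz derivatives. A set $N\subset A$ is a neighbourhood of $a$ in $A$ if $A\cap B(a,\varepsilon)\subset N$ for some $\varepsilon>0$. A real function $f$ on an open interval $I$ is semiconcave if $x\mapsto f(x)-\frac c2x^2$ is concave on $I$ for some $c\geq 0$; $f$ is semiconvex if $-f$ is semiconcave. We identify $\mathbb{R}^2$ with $\operatorname{span}\{e_1,e_2\}\subset\mathbb{R}^d$ and $\mathbb{R}$ with $\operatorname{span}\{e_1\}$. $\operatorname{B}$-sets: $M\subset\mathbb{R}^2$ is a $\operatorname{B}_-$-set if there are $r>0$ and Lipschitz functions $\psi\leq 0\leq\varphi$ on $[0,r]$ with $\varphi$ semiconcave on $(0,r)$, $\psi$ semiconvex on $(0,r)$, $\varphi(0)=\psi(0)=0$,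 $\varphi'_+(0)=\psi'_+(0)=0$ and $M=\{(x,y):x\in[0,r],\ \psi(x)\leq y\leq\varphi(x)\}$; $M$ is a $\operatorname{B}_+$-set if the same holds with $[-r,r]$, $(-r,r)$ in place of $[0,r]$, $(0,r)$ and with $\varphi'(0)=\psi'(0)=0$ (two-sided derivatives); a $\operatorname{B}$-set is a $\operatorname{B}_-$-set or a $\operatorname{B}_+$-set. (For a $\operatorname{B}$-set $B$, $T_1(B)$ is a nonempty compact subset of $\operatorname{span}\{e_1\}$.) Multirotations: a rotation $R\in SO(d)$ is a 2-rotation if there is a two-dimensional subspace $T\perp e_1$ with $Rv=v$ for all $v\in T^\perp$. Let $\pi$ be the orthogonal projection onto $\operatorname{span}\{e_1\}$. For a nonempty compact $C\subset\operatorname{span}\{e_1\}$, let $\Lambda$ be the family of components (open intervals) of $\operatorname{span}\{e_1\}\setminus C$. A map $\rho:\mathbb{R}^d\to\mathbb{R}^d$ is a multirotation associated with $C$ if $\rho(x)=x$ whenever $\pi(x)\in C$ and for each $\lambda\in\Lambda$ there is a 2-rotation $R_\lambda$ with $\rho|_{\pi^{-1}(\lambda)}=R_\lambda|_{\pi^{-1}(\lambda)}$. *)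

theory Defs
  imports "HOL-Analysis.Analysis"
begin

text \<open>Euclidean space R^d is real^'n with d = CARD('n). The standard basis vectors
  e1, e2 are axis i1 1 and axis i2 1 for two distinct indices i1, i2.\<close>

definition std_e :: "'n::finite \<Rightarrow> real^'n" where
  "std_e i = axis i 1"

definition positive_reach :: "('a::metric_space) set \<Rightarrow> bool" where
  "positive_reach A \<longleftrightarrow> (\<exists>\<epsilon>>0. \<forall>x. (\<exists>y\<in>A. dist x y < \<epsilon>) \<longrightarrow>
      (\<exists>!y. y \<in> A \<and> (\<forall>z\<in>A. dist x y \<le> dist x z)))"

definition covering_dim_le :: "('a::topological_space) set \<Rightarrow> nat \<Rightarrow> bool" where
  "covering_dim_le A n \<longleftrightarrow>
    (\<forall>\<U>. finite \<U> \<and> (\<forall>U\<in>\<U>. openin (top_of_set A) U) \<and> A \<subseteq> \<Union>\<U> \<longrightarrow>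
      (\<exists>\<V>. finite \<V> \<and> (\<forall>V\<in>\<V>. openin (top_of_set A) V) \<and> A \<subseteq> \<Union>\<V> \<and>
           (\<forall>V\<in>\<V>. \<exists>U\<in>\<U>. V \<subseteq> U) \<and>
           (\<forall>x\<in>A. card {V\<in>\<V>. x \<in> V} \<le> n + 1)))"

definition Tan :: "('a::real_normed_vector) set \<Rightarrow> 'a \<Rightarrow> 'a set" where
  "Tan A a = {u. u = 0 \<or> (\<exists>(ai::nat \<Rightarrow> 'a) (ri::nat \<Rightarrow> real).
      (\<forall>i. ai i \<in> A \<and> ai i \<noteq> a \<and> ri i > 0) \<and> ai \<longlonglongrightarrow> a \<and>
      (\<lambda>i. ri i *\<^sub>R (ai i - a)) \<longlonglongrightarrow> u)}"

definition Tk :: "nat \<Rightarrow> ('a::euclidean_space) set \<Rightarrow> 'a set" where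
  "Tk k A = {x\<in>A. dim (Tan A x) = k}"

definition nbhd_in :: "('a::metric_space) set \<Rightarrow> 'a \<Rightarrow> 'a set \<Rightarrow> bool" where
  "nbhd_in A a N \<longleftrightarrow> N \<subseteq> A \<and> (\<exists>\<epsilon>>0. A \<inter> ball a \<epsilon> \<subseteq> N)"

definition C11_on :: "('a::euclidean_space) set \<Rightarrow> ('a \<Rightarrow> 'a) \<Rightarrow> bool" where
  "C11_on U f \<longleftrightarrow> (\<exists>(D::'a \<Rightarrow> 'a \<Rightarrow>\<^sub>L 'a) L.
      (\<forall>x\<in>U. (f has_derivative blinfun_apply (D x)) (at x)) \<and> L-lipschitz_on U D)"

definition C11_diffeo :: "('a::euclidean_space) set \<Rightarrow> ('a \<Rightarrow> 'a) \<Rightarrow> bool" where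
  "C11_diffeo U \<Phi> \<longleftrightarrow> open U \<and> inj_on \<Phi> U \<and> open (\<Phi> ` U) \<and>
      C11_on U \<Phi> \<and> C11_on (\<Phi> ` U) (inv_into U \<Phi>)"

definition semiconcave_on :: "real set \<Rightarrow> (real \<Rightarrow> real) \<Rightarrow> bool" where
  "semiconcave_on I f \<longleftrightarrow> (\<exists>c\<ge>0. concave_on I (\<lambda>x. f x - c / 2 * x\<^sup>2))"

definition semiconvex_on :: "real set \<Rightarrow> (real \<Rightarrow> real) \<Rightarrow> bool" where
  "semiconvex_on I f \<longleftrightarrow> semiconcave_on I (\<lambda>x. - f x)"

definition Bminus_set :: "'n::finite \<Rightarrow> 'n \<Rightarrow> (real^'n) set \<Rightarrow> bool" where
  "Bminus_set i1 i2 M \<longleftrightarrow> (\<exists>r \<phi> \<psi>. r > 0 \<and>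
      (\<exists>L. L-lipschitz_on {0..r} \<phi>) \<and> (\<exists>L. L-lipschitz_on {0..r} \<psi>) \<and>
      (\<forall>x\<in>{0..r}. \<psi> x \<le> 0 \<and> 0 \<le> \<phi> x) \<and>
      semiconcave_on {0<..<r} \<phi> \<and> semiconvex_on {0<..<r} \<psi> \<and>
      \<phi> 0 = 0 \<and> \<psi> 0 = 0 \<and>
      (\<phi> has_real_derivative 0) (at 0 within {0..r}) \<and>
      (\<psi> has_real_derivative 0) (at 0 within {0..r}) \<and>
      M = {x *\<^sub>R std_e i1 + y *\<^sub>R std_e i2 | x y. x \<in> {0..r} \<and> \<psi> x \<le> y \<and> y \<le> \<phi> x})"

definition Bplus_set :: "'n::finite \<Rightarrow> 'n \<Rightarrow> (real^'n) set \<Rightarrow> bool" where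
  "Bplus_set i1 i2 M \<longleftrightarrow> (\<exists>r \<phi> \<psi>. r > 0 \<and>
      (\<exists>L. L-lipschitz_on {-r..r} \<phi>) \<and> (\<exists>L. L-lipschitz_on {-r..r} \<psi>) \<and>
      (\<forall>x\<in>{-r..r}. \<psi> x \<le> 0 \<and> 0 \<le> \<phi> x) \<and>
      semiconcave_on {-r<..<r} \<phi> \<and> semiconvex_on {-r<..<r} \<psi> \<and>
      \<phi> 0 = 0 \<and> \<psi> 0 = 0 \<and>
      (\<phi> has_real_derivative 0) (at 0) \<and>
      (\<psi> has_real_derivative 0) (at 0) \<and>
      M = {x *\<^sub>R std_e i1 + y *\<^sub>R std_e i2 | x y. x \<in> {-r..r} \<and> \<psi> x \<le> y \<and> y \<le> \<phi> x})"

definition B_set :: "'n::finite \<Rightarrow> 'n \<Rightarrow> (real^'n) set \<Rightarrow> bool" where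
  "B_set i1 i2 M \<longleftrightarrow> Bminus_set i1 i2 M \<or> Bplus_set i1 i2 M"

definition rotation :: "(real^'n::finite \<Rightarrow> real^'n) \<Rightarrow> bool" where
  "rotation R \<longleftrightarrow> orthogonal_transformation R \<and> det (matrix R) = 1"

definition two_rotation :: "'n::finite \<Rightarrow> (real^'n \<Rightarrow> real^'n) \<Rightarrow> bool" where
  "two_rotation i1 R \<longleftrightarrow> rotation R \<and>
     (\<exists>T. subspace T \<and> dim T = 2 \<and> (\<forall>v\<in>T. v \<bullet> std_e i1 = 0) \<and>
          (\<forall>v. (\<forall>t\<in>T. v \<bullet> t = 0) \<longrightarrow> R v = v))"

definition proj1 :: "'n::finite \<Rightarrow> real^'n \<Rightarrow> real^'n" where
  "proj1 i1 x = (x \<bullet> std_e i1) *\<^sub>R std_e i1"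

definition multirotation :: "'n::finite \<Rightarrow> (real^'n) set \<Rightarrow> (real^'n \<Rightarrow> real^'n) \<Rightarrow> bool" where
  "multirotation i1 C \<rho> \<longleftrightarrow>
     (\<forall>x. proj1 i1 x \<in> C \<longrightarrow> \<rho> x = x) \<and>
     (\<forall>I\<in>components (span {std_e i1} - C).
        \<exists>R. two_rotation i1 R \<and> (\<forall>x. proj1 i1 x \<in> I \<longrightarrow> \<rho> x = R x))"

end

theory Submission imports Defs "HOL-Complex_Analysis.Great_Picard" begin

text \<open>Positive reach amounts to a midpoint condition with quadratic error. If points at
  distance less than r from A have a unique nearest point in A, then the points of a chord of length
  l < r are within a multiple of l^2/r of A (\<open>chord\<close>), and the chord itself is that
  close to the tangent cone (\<open>chord_near_Tan\<close>). Conversely, a closed set that comes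
  quadratically near the midpoint of any two of its close points has positive reach
  (\<open>positive_reach_midpointI\<close>). Maps of class C^{1,1} preserve this condition
  (\<open>jet_mid\<close>), which is why they are the right changes of coordinates.

  Existence of the chart. The tangent cone at a is a line or a half-line with direction e, so near a
  the set lies in a paraboloid around e and consists of slices x.e = t depending on t in a Lipschitz
  way: a \<open>ribbon\<close> (\<open>obtain_ribbon\<close>). Covering dimension at most 2 bounds
  the dimension of every tangent cone by 2, by Brouwer's theorem (\<open>dim_Tan_le_2\<close>);
  hence at each point a plane contains all chords up to quadratic error. Polygons of least energy
  with one vertex in each slice of a grid converge to a C^{1,1} curve through all slices
  (\<open>C11_section\<close>), and a shear turns this curve into the axis
  (\<open>straighten\<close>). Let Z be the closed set of heights whose slice is a single point.
  Over a gap of Z the planes vary in a Lipschitz way with a constant that is the same for all gaps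
  (\<open>Pr_lipschitz\<close>). Parallel transport yields a Lipschitz frame that carries all planes
  of a gap to one plane (\<open>frame\<close>). After affine interpolation of the frame in each gap
  and projection onto this plane, one obtains a C^{1,1} Whitney jet on the ribbon
  (\<open>flatten\<close>): inside a gap by direct computation, across c in Z because the ribbon is
  within a multiple of (t - c)^2 of the axis. The image is planar over each gap, so it is a B-set
  whose gaps have been rotated; the midpoint condition makes its boundary functions semiconcave and
  semiconvex, and T_1(B) is the set of axis points with height in Z (\<open>B_set_rotated\<close>).
  Whitney extension (\<open>whitney_C11\<close>) and the inverse function theorem in the class
  C^{1,1} (\<open>C11_local_diffeo\<close>) turn the jet into a chart (\<open>B_set_chart\<close>).

  Converse. A nonnegative semiconcave function lies below a multiple of (t - c)^2 around a suitable
  zero c (\<open>semiconcave_zero_quadratic\<close>). Take two points of the rotated B-set, cut to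
  half its length. Either no point of T_1(B) lies between them; then the rotation is the same for
  both and semiconcavity provides a near-midpoint. Or such a point lies between them; then both are
  quadratically close to the axis and an axis point is a near-midpoint. So the image under the
  diffeomorphism has positive reach. It is homeomorphic to a planar compactum, hence of covering
  dimension at most 2 (\<open>covering_dim_le_planar\<close>), and linearization at 0 shows that its
  tangent cone at a is one-dimensional (\<open>rotated_B_set_image\<close>).\<close>

section \<open>Nearest points\<close>

lemma positive_reach_closed:
  assumes "positive_reach A" shows "closed A"
proof -
  obtain a where a: "a > 0" "\<And>x. \<exists>y\<in>A. dist x y < a \<Longrightarrow>
      \<exists>!y. y \<in> A \<and> (\<forall>z\<in>A. dist x y \<le> dist x z)"
    using assms unfolding positive_reach_def by blast
  have "x \<in> A" if x: "x \<in> closure A" for x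
  proof -
    have app: "\<exists>y\<in>A. dist x y < e" if "e > 0" for e
      using x that by (auto simp: closure_approachable dist_commute)
    obtain y where y: "y \<in> A" "\<And>z. z \<in> A \<Longrightarrow> dist x y \<le> dist x z"
      using a(2)[OF app[OF a(1)]] by blast
    have "\<not> dist x y > 0" using app[of "dist x y"] y(2) by (meson not_le)
    thus ?thesis using y(1) by simp
  qed
  thus ?thesis using closure_subset_eq by blast
qed

lemma infdist_closest_point:
  fixes A :: "'a::euclidean_space set"
  assumes "closed A" "A \<noteq> {}"
  shows "closest_point A x \<in> A" "dist x (closest_point A x) = infdist x A"
proof -
  show 1: "closest_point A x \<in> A" using assms closest_point_in_set by blast
  have "infdist x A \<le> dist x (closest_point A x)" using 1 by (rule infdist_le)
  moreover obtain z where "z \<in> A" "infdist x A = dist x z" using infdist_attains_inf[OF assms] by blast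
  ultimately show "dist x (closest_point A x) = infdist x A" using closest_point_le[OF assms(1), of z x] by simp
qed

text \<open>Stewart's identity for a point dividing a segment.\<close>

lemma norm_convex_comb_sq:
  fixes u v :: "'a::real_inner"
  shows "(1 - s) * (norm u)\<^sup>2 + s * (norm v)\<^sup>2
    = (norm ((1 - s) *\<^sub>R u + s *\<^sub>R v))\<^sup>2 + s * (1 - s) * (norm (u - v))\<^sup>2"
  unfolding power2_norm_eq_inner inner_add_left inner_add_right inner_diff_left inner_diff_right
    inner_scaleR_left inner_scaleR_right inner_commute[of v u] by (simp add: algebra_simps)

text \<open>Working form of positive reach. Nearest points exist because \<open>A\<close> is closed
  and nonempty, so only uniqueness is assumed, below a fixed radius \<open>r\<close> that enters the
  constants of all later estimates.\<close>

locale unique_nearest =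
  fixes A :: "'a::euclidean_space set" and r :: real
  assumes closed: "closed A" and nonempty: "A \<noteq> {}" and r_pos: "r > 0"
    and unique: "\<And>x y z. \<lbrakk>infdist x A < r; y \<in> A; z \<in> A; dist x y = infdist x A;
        dist x z = infdist x A\<rbrakk> \<Longrightarrow> y = z"
begin

abbreviation "P \<equiv> closest_point A"

lemmas P_in = infdist_closest_point(1)[OF closed nonempty]
lemmas dist_P = infdist_closest_point(2)[OF closed nonempty]

text \<open>Compactness: along a sequence tending to x the nearest points are bounded, every limit
  of a subsequence realizes the distance from x, and uniqueness identifies it with
  \<open>P x\<close>.\<close>

lemma continuous_P: "continuous_on {x. infdist x A < r} P"
proof (rule ccontr)
  assume "\<not> ?thesis"
  hence "\<exists>x e. infdist x A < r \<and> 0 < e \<and> (\<forall>d>0. \<exists>y. dist y x < d \<and> \<not> dist (P y) (P x) < e)"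
    unfolding continuous_on_iff by blast
  then obtain x e where x: "infdist x A < r" and e: "e > 0"
    and *: "\<And>d. d > 0 \<Longrightarrow> \<exists>y. dist y x < d \<and> \<not> dist (P y) (P x) < e" by blast
  have "\<forall>n. \<exists>y. dist y x < 1 / Suc n \<and> \<not> dist (P y) (P x) < e" using * by simp
  from choice[OF this] obtain u where u: "\<And>n. dist (u n) x < 1 / Suc n"
    and far: "\<And>n. dist (P (u n)) (P x) \<ge> e" unfolding not_less by blast
  have "(\<lambda>n. dist (u n) x) \<longlonglongrightarrow> 0"
    by (rule Lim_null_comparison[OF _ LIMSEQ_inverse_real_of_nat])
       (use less_imp_le[OF u] in \<open>simp add: inverse_eq_divide\<close>)
  hence ux: "u \<longlonglongrightarrow> x" by (rule tendsto_dist_iff[THEN iffD2])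
  have "bounded (range (\<lambda>n. P (u n)))"
  proof -
    have B: "dist x (u n) \<le> 1" for n
    proof -
      have "1 / real (Suc n) \<le> 1" by simp
      thus ?thesis using u[of n] by (simp only: dist_commute)
    qed
    have "dist x (P (u n)) \<le> 1 + (infdist x A + 1)" for n
    proof -
      have "dist x (P (u n)) \<le> dist x (u n) + dist (u n) (P (u n))" by (rule dist_triangle)
      also have "dist (u n) (P (u n)) \<le> infdist x A + dist (u n) x" unfolding dist_P by (rule infdist_triangle)
      finally show ?thesis using B[of n] by (simp add: dist_commute)
    qed
    thus ?thesis unfolding bounded_def by blast
  qed
  then obtain l s where s: "strict_mono s" and l: "((\<lambda>n. P (u n)) \<circ> s) \<longlonglongrightarrow> l"
    using bounded_imp_convergent_subsequence by blast
  have "l \<in> A" using closed_sequentially[OF closed _ l] P_in by auto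
  have us: "(u \<circ> s) \<longlonglongrightarrow> x" using LIMSEQ_subseq_LIMSEQ[OF ux s] .
  have "(\<lambda>n. dist (u (s n)) (P (u (s n)))) \<longlonglongrightarrow> dist x l"
    using us l by (auto intro!: tendsto_dist simp: o_def)
  moreover have "(\<lambda>n. infdist (u (s n)) A) \<longlonglongrightarrow> infdist x A"
    using us by (auto intro!: tendsto_infdist simp: o_def)
  ultimately have "dist x l = infdist x A" unfolding dist_P by (rule LIMSEQ_unique)
  hence "l = P x" using unique[OF x \<open>l \<in> A\<close> P_in] dist_P by simp
  hence "(\<lambda>n. dist (P (u (s n))) (P x)) \<longlonglongrightarrow> 0"
    using tendsto_dist_iff[THEN iffD1, OF l] by (simp add: o_def)
  hence "e \<le> 0" by (rule LIMSEQ_le_const) (use far in blast)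
  thus False using e by simp
qed

text \<open>A fixed point of \<open>y \<mapsto> x + a (x - P y) / |x - P y|\<close> lies on the ray from \<open>P x\<close> through \<open>x\<close>,
  strictly beyond \<open>x\<close>; so the distance function keeps growing along normal rays.\<close>

lemma infdist_ray_step:
  assumes p: "p \<in> A" and n: "norm n = 1" and b: "b > 0" and bd: "infdist (p + b *\<^sub>R n) A = b"
    and a: "a > 0" "b + a < r"
  shows "infdist (p + (b + a) *\<^sub>R n) A = b + a"
proof -
  define x where "x = p + b *\<^sub>R n"
  define F where "F y = x + (a / norm (x - P y)) *\<^sub>R (x - P y)" for y
  have far: "norm (x - P y) \<ge> b" for y using infdist_le[OF P_in[of y], of x] bd by (simp add: x_def dist_norm)
  hence nz: "norm (x - P y) \<noteq> 0" "x \<noteq> P y" for y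
    using b by (metis not_le, metis not_le norm_zero right_minus_eq)
  have near: "infdist y A < r" if "y \<in> cball x a" for y using infdist_triangle[of y A x] that bd a
    by (auto simp: x_def[symmetric] dist_commute)
  have "continuous_on (cball x a) F" unfolding F_def using near
    by (intro continuous_intros continuous_on_subset[OF continuous_P]) (simp_all add: nz subset_iff)
  moreover have "F \<in> cball x a \<rightarrow> cball x a" using a by (auto simp: F_def dist_norm nz)
  ultimately obtain y where y: "y \<in> cball x a" "F y = y" using brouwer[of "cball x a" F] a by auto
  define k where "k = norm (x - P y)"
  have k: "k \<ge> b" "k > 0" using far[of y] b nz by (simp_all add: k_def)
  have "y - P y = (1 + a / k) *\<^sub>R (x - P y)" using y(2) by (simp add: F_def k_def algebra_simps)
  hence "dist y (P y) = (1 + a / k) * k" using k a by (simp add: dist_norm k_def)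
  hence dy: "dist y (P y) = k + a" using k by (simp add: distrib_right)
  have dyx: "dist y x \<le> a" using y(1) by (simp add: dist_commute)
  have dxp: "dist x p = b" using b n by (simp add: x_def dist_norm)
  \<comment> \<open>Here dist y (P y) = k + a, while dist y p is at most a + b. Together with k
    \<ge> b this forces k = b, so \<open>P y\<close> is a nearest point of x and equals p.\<close>
  have "dist y (P y) \<le> dist y p" using infdist_le[OF p, of y] by (simp add: dist_P)
  hence "k = b" using dy dyx dxp dist_triangle[of y p x] k by linarith
  hence "P y = p" using unique[of x "P y" p] P_in p bd dxp a by (simp add: x_def[symmetric] k_def dist_norm)
  hence "y = p + (b + a) *\<^sub>R n"
    using y(2) \<open>k = b\<close> b unfolding F_def k_def[symmetric] by (simp add: x_def k_def algebra_simps)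
  moreover have "infdist y A = b + a" using dy \<open>k = b\<close> by (simp add: dist_P)
  ultimately show ?thesis by simp
qed

text \<open>The parameters for which p is still a nearest point form a closed initial segment. If it
  ended before t, \<open>infdist_ray_step\<close> would prolong it beyond its maximum.\<close>

lemma infdist_ray:
  assumes p: "p \<in> A" and n: "norm n = 1" and d: "d > 0" "infdist (p + d *\<^sub>R n) A = d"
    and t: "0 \<le> t" "t < r"
  shows "infdist (p + t *\<^sub>R n) A = t"
proof (rule ccontr)
  assume nQ: "infdist (p + t *\<^sub>R n) A \<noteq> t"
  have le: "infdist (p + s *\<^sub>R n) A \<le> s" if "s \<ge> 0" for s
    using infdist_le[OF p, of "p + s *\<^sub>R n"] n that by (simp add: dist_norm)
  have down: "infdist (p + s *\<^sub>R n) A = s"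
    if "infdist (p + s' *\<^sub>R n) A = s'" "0 \<le> s" "s \<le> s'" for s s'
  proof -
    have "dist (p + s' *\<^sub>R n) (p + s *\<^sub>R n) = s' - s"
      using n that by (simp add: dist_norm flip: scaleR_left_diff_distrib)
    thus ?thesis using infdist_triangle[of "p + s' *\<^sub>R n" A "p + s *\<^sub>R n"] that le[of s] by linarith
  qed
  have "d < t" using nQ down[OF d(2), of t] t by force
  define S where "S = {s \<in> {0..t}. infdist (p + s *\<^sub>R n) A = s}"
  have "compact S"
  proof -
    have "S = {0..t} \<inter> {s. infdist (p + s *\<^sub>R n) A = s}" by (auto simp: S_def)
    moreover have "closed {s. infdist (p + s *\<^sub>R n) A = s}" by (intro closed_Collect_eq continuous_intros)
    ultimately show ?thesis by (simp add: compact_Int_closed)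
  qed
  moreover have "d \<in> S" using d \<open>d < t\<close> by (simp add: S_def)
  ultimately obtain a where a: "a \<in> S" "\<And>s. s \<in> S \<Longrightarrow> s \<le> a"
    using compact_attains_sup[of S] by blast
  have "a \<ge> d" using a \<open>d \<in> S\<close> by blast
  moreover have "a \<noteq> t" "a \<le> t" using a(1) nQ by (auto simp: S_def)
  ultimately have "infdist (p + (a + (t - a)) *\<^sub>R n) A = a + (t - a)"
    using a(1) d t by (intro infdist_ray_step[OF p n]) (auto simp: S_def)
  thus False using nQ by simp
qed

text \<open>Federer's inequality for normal vectors. By \<open>infdist_ray\<close> the ball of
  radius r/2 touching A at \<open>P m\<close> in the direction of m has no point of A in its
  interior; the claim is |a - centre| \<ge> r/2, squared and scaled by d.\<close>

lemma normal_bound: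
  assumes d: "infdist m A = d" "0 < d" "d < r" and a: "a \<in> A"
  shows "r * ((a - P m) \<bullet> (m - P m)) \<le> d * (norm (a - P m))\<^sup>2"
proof -
  define n where "n = (1/d) *\<^sub>R (m - P m)"
  have nd: "norm (m - P m) = d" using dist_P[of m] d by (simp add: dist_norm)
  have m: "m = P m + d *\<^sub>R n" using d by (simp add: n_def)
  have n1: "norm n = 1" using nd d by (simp add: n_def)
  have "infdist (P m + (r/2) *\<^sub>R n) A = r/2" using infdist_ray[OF P_in n1 d(2), of m "r/2"] d m r_pos by simp
  hence "r/2 \<le> norm (P m + (r/2) *\<^sub>R n - a)"
    using infdist_le[OF a, of "P m + (r/2) *\<^sub>R n"] by (simp add: dist_norm)
  hence "(r/2)\<^sup>2 \<le> (norm ((r/2) *\<^sub>R n - (a - P m)))\<^sup>2"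
    using r_pos by (intro power_mono) (auto simp: algebra_simps)
  also have "\<dots> = (r/2)\<^sup>2 - r * (n \<bullet> (a - P m)) + (norm (a - P m))\<^sup>2"
  proof -
    have "n \<bullet> n = 1" using n1 by (simp add: norm_eq_1)
    thus ?thesis
      unfolding power2_norm_eq_inner inner_diff_left[of "(r/2) *\<^sub>R n"] inner_diff_right[of _ "(r/2) *\<^sub>R n"]
        inner_scaleR_left inner_scaleR_right inner_commute[of "a - P m" n]
      by (simp add: power2_eq_square right_diff_distrib)
  qed
  finally have "r * (n \<bullet> (a - P m)) \<le> (norm (a - P m))\<^sup>2" by simp
  hence "d * (r * (n \<bullet> (a - P m))) \<le> d * (norm (a - P m))\<^sup>2" using d by simp
  moreover have "m - P m = d *\<^sub>R n" using m by (metis add_diff_cancel_left')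
  ultimately show ?thesis by (simp add: inner_commute mult.left_commute)
qed

text \<open>With p the nearest point of the chord point m, add \<open>normal_bound\<close> for x and
  for y with weights 1 - s and s. The left sides add up to r d^2, and Stewart's identity evaluates
  the right side, so r d \<le> d^2 + s (1 - s) |x - y|^2. Since d < r/2, the term d^2 is absorbed,
  which costs the factor 2.\<close>

lemma chord:
  assumes x: "x \<in> A" and y: "y \<in> A" and xy: "dist x y < r" and s: "0 \<le> s" "s \<le> 1"
  shows "infdist (x + s *\<^sub>R (y - x)) A \<le> 2 / r * (s * (1 - s) * (dist x y)\<^sup>2)"
proof -
  define m where "m = x + s *\<^sub>R (y - x)"
  define d where "d = infdist m A"
  have "d \<le> s * dist x y" using infdist_le[OF x, of m] s by (simp add: m_def d_def dist_norm norm_minus_commute)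
  moreover have "m - y = (1 - s) *\<^sub>R (x - y)" by (simp add: m_def algebra_simps)
  hence "d \<le> (1 - s) * dist x y" using infdist_le[OF y, of m] s by (simp add: d_def dist_norm)
  hence "d \<le> dist x y - s * dist x y" by (simp add: left_diff_distrib)
  ultimately have "d \<le> dist x y / 2" by linarith
  hence d2: "d < r / 2" using xy by simp
  show ?thesis
  proof (cases "d = 0")
    case True
    thus ?thesis using s r_pos by (simp add: d_def m_def)
  next
    case False
    hence d0: "d > 0" using infdist_nonneg[of m A] by (simp add: d_def)
    define p where "p = P m"
    have nb: "r * ((a - p) \<bullet> (m - p)) \<le> d * (norm (a - p))\<^sup>2" if "a \<in> A" for a
      unfolding p_def using that d0 d2 r_pos by (intro normal_bound) (auto simp: d_def)
    have mp: "norm (m - p) = d" using dist_P[of m] by (simp add: dist_norm d_def p_def)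
    have mm: "(1 - s) *\<^sub>R (x - p) + s *\<^sub>R (y - p) = m - p" by (simp add: m_def algebra_simps)
    define a b where "a = (x - p) \<bullet> (m - p)" and "b = (y - p) \<bullet> (m - p)"
    have "(1 - s) * a + s * b = ((1 - s) *\<^sub>R (x - p) + s *\<^sub>R (y - p)) \<bullet> (m - p)"
      unfolding a_def b_def by (simp only: inner_add_left inner_scaleR_left)
    also have "\<dots> = d\<^sup>2" using mp unfolding mm by (simp add: power2_norm_eq_inner[symmetric])
    finally have "r * d\<^sup>2 = r * ((1 - s) * a + s * b)" by simp
    also have "\<dots> = (1 - s) * (r * ((x - p) \<bullet> (m - p))) + s * (r * ((y - p) \<bullet> (m - p)))"
      unfolding a_def[symmetric] b_def[symmetric] by (simp add: algebra_simps)
    also have "\<dots> \<le> (1 - s) * (d * (norm (x - p))\<^sup>2) + s * (d * (norm (y - p))\<^sup>2)"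
      using s nb[OF x] nb[OF y] by (intro add_mono mult_left_mono) auto
    also have "\<dots> = d * ((norm ((1 - s) *\<^sub>R (x - p) + s *\<^sub>R (y - p)))\<^sup>2 + s * (1 - s) * (norm ((x - p) - (y - p)))\<^sup>2)"
      unfolding norm_convex_comb_sq[symmetric] by (simp add: algebra_simps)
    also have "\<dots> = d * (d\<^sup>2 + s * (1 - s) * (dist x y)\<^sup>2)" unfolding mm mp by (simp add: dist_norm)
    finally have "d * (r * d) \<le> d * (d\<^sup>2 + s * (1 - s) * (dist x y)\<^sup>2)"
      by (simp add: power2_eq_square mult.left_commute)
    hence "r * d \<le> d\<^sup>2 + s * (1 - s) * (dist x y)\<^sup>2" using d0 by simp
    moreover have "d\<^sup>2 \<le> r / 2 * d" using d2 d0 by (simp add: power2_eq_square)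
    ultimately have "r * d \<le> 2 * (s * (1 - s) * (dist x y)\<^sup>2)" by linarith
    thus ?thesis using r_pos by (simp add: field_simps d_def m_def)
  qed
qed

end

lemma positive_reach_unique_nearest:
  fixes A :: "'a::euclidean_space set"
  assumes "positive_reach A" "A \<noteq> {}"
  obtains r where "unique_nearest A r"
proof -
  obtain b where b: "b > 0" "\<And>x. \<exists>y\<in>A. dist x y < b \<Longrightarrow>
      \<exists>!y. y \<in> A \<and> (\<forall>z\<in>A. dist x y \<le> dist x z)"
    using assms unfolding positive_reach_def by blast
  have "unique_nearest A b"
  proof
    show "closed A" using assms positive_reach_closed by blast
    fix x y z assume *: "infdist x A < b" "y \<in> A" "z \<in> A" "dist x y = infdist x A" "dist x z = infdist x A"
    hence "\<exists>y\<in>A. dist x y < b" by metis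
    from b(2)[OF this] show "y = z" using * infdist_le[of _ A x] by (metis (no_types))
  qed (use assms b in auto)
  thus ?thesis using that by blast
qed

text \<open>If y and z are both nearest to x, at distance R from x and D from each other, their
  midpoint m satisfies |x - m|^2 = R^2 - D^2/4. A point of A within C D^2 of m is not closer to x
  than R, which for small R is possible only if D = 0.\<close>

lemma positive_reach_midpointI:
  fixes A :: "'a::euclidean_space set"
  assumes "closed A" "b > 0" and C: "C \<ge> 0"
    and mid: "\<And>x y. \<lbrakk>x \<in> A; y \<in> A; dist x y < b\<rbrakk> \<Longrightarrow> \<exists>p\<in>A. dist p (midpoint x y) \<le> C * (dist x y)\<^sup>2"
  shows "positive_reach A" unfolding positive_reach_def
proof (intro exI conjI allI impI)
  \<comment> \<open>The first bound gives D \<le> 2R < b, so that \<open>mid\<close> applies to y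
    and z. The second gives 8 C R < 1, which makes R - C D^2 nonnegative before squaring and yields
    the contradiction at the end.\<close>
  define c where "c = min (b / 2) (1 / (8 * (C + 1)))"
  show "c > 0" using assms by (simp add: c_def)
  fix x assume "\<exists>y\<in>A. dist x y < c"
  then obtain w where w: "w \<in> A" "dist x w < c" by blast
  hence "A \<noteq> {}" by blast
  show "\<exists>!y. y \<in> A \<and> (\<forall>z\<in>A. dist x y \<le> dist x z)"
  proof (rule ex_ex1I)
    show "\<exists>y. y \<in> A \<and> (\<forall>z\<in>A. dist x y \<le> dist x z)"
      by (rule distance_attains_inf[OF \<open>closed A\<close> \<open>A \<noteq> {}\<close>, of x]) blast
    fix y z assume y: "y \<in> A \<and> (\<forall>z\<in>A. dist x y \<le> dist x z)" and z: "z \<in> A \<and> (\<forall>y\<in>A. dist x z \<le> dist x y)"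
    define R where "R = dist x y"
    define D where "D = dist y z"
    have Rz: "dist x z = R" using y z by (simp add: R_def order_antisym)
    have Rc: "R < c" using y w order_le_less_trans by (auto simp: R_def)
    show "y = z"
    proof (rule ccontr)
      assume "y \<noteq> z"
      hence D0: "D > 0" by (simp add: D_def)
      have D2R: "D \<le> 2 * R" using dist_triangle[of y z x] Rz by (simp add: D_def R_def dist_commute)
      hence "D < b" using Rc by (simp add: c_def)
      then obtain p where p: "p \<in> A" "dist p (midpoint y z) \<le> C * D\<^sup>2"
        using mid y z unfolding D_def by blast
      define m where "m = midpoint y z"
      have "(norm (x - m))\<^sup>2 = ((norm (x - y))\<^sup>2 + (norm (x - z))\<^sup>2) / 2 - (norm (y - z))\<^sup>2 / 4"
        unfolding m_def midpoint_def power2_norm_eq_inner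
        by (simp add: inner_add_left inner_add_right inner_diff_left inner_diff_right
            inner_commute field_simps)
      hence m2: "(norm (x - m))\<^sup>2 = R\<^sup>2 - D\<^sup>2 / 4" using Rz by (simp add: R_def D_def dist_norm)
      have "R \<le> dist x p" using y p by (simp add: R_def)
      also have "\<dots> \<le> norm (x - m) + C * D\<^sup>2"
        using dist_triangle[of x p m] p by (simp add: m_def dist_norm norm_minus_commute)
      finally have 1: "R - C * D\<^sup>2 \<le> norm (x - m)" by simp
      have "R * (8 * (C + 1)) < 1" using Rc C by (simp add: c_def field_simps)
      hence CR: "8 * (C * R) < 1" using D0 D2R by (simp add: algebra_simps)
      have "D\<^sup>2 \<le> (2 * R)\<^sup>2" using D2R D0 by (intro power_mono) auto
      hence "C * D\<^sup>2 \<le> C * (2 * R)\<^sup>2" using C by (rule mult_left_mono)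
      also have "\<dots> = R * (4 * (C * R))" by (simp add: power2_eq_square)
      also have "\<dots> \<le> R * 1" using CR D2R D0 by (intro mult_left_mono) auto
      finally have "(R - C * D\<^sup>2)\<^sup>2 \<le> (norm (x - m))\<^sup>2" using 1 by (intro power_mono) auto
      hence "D\<^sup>2 / 4 \<le> 2 * R * (C * D\<^sup>2) - (C * D\<^sup>2)\<^sup>2"
        unfolding m2 by (simp add: power2_diff)
      hence "D\<^sup>2 / 4 \<le> 2 * R * (C * D\<^sup>2)" using zero_le_power2[of "C * D\<^sup>2"] by linarith
      hence "D\<^sup>2 * 1 \<le> D\<^sup>2 * (8 * (C * R))" by (simp add: algebra_simps)
      thus False using CR D0 by (simp add: mult_le_cancel_left)
    qed
  qed
qed

section \<open>Tangent cones of sets with positive reach\<close>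

text \<open>The adjacent cone: it asks for o(l)-closeness for all small l, where \<open>Tan\<close>
  asks only for a sequence. For positive reach a vector of \<open>Tan\<close> has this stronger
  property, which is the one that behaves well under addition.\<close>

definition tangent_dir :: "('a::real_normed_vector) set \<Rightarrow> 'a \<Rightarrow> 'a \<Rightarrow> bool" where
  "tangent_dir A x u \<longleftrightarrow>
    (\<forall>\<eta>>0. \<exists>l0>0. \<forall>l. 0 < l \<and> l \<le> l0 \<longrightarrow> infdist (x + l *\<^sub>R u) A \<le> \<eta> * l)"

lemma tangent_dirE:
  assumes "tangent_dir A x u" "h > 0"
  obtains l0 where "l0 > 0" "\<And>l. 0 < l \<Longrightarrow> l \<le> l0 \<Longrightarrow> infdist (x + l *\<^sub>R u) A \<le> h * l"
  using assms(1)[unfolded tangent_dir_def, rule_format, OF assms(2)] that by blast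

lemma tangent_dir_scaleR:
  assumes u: "tangent_dir A x u" and c: "c \<ge> 0" and x: "x \<in> A"
  shows "tangent_dir A x (c *\<^sub>R u)"
proof (cases "c = 0")
  case True
  thus ?thesis using x unfolding tangent_dir_def by (auto intro!: exI[of _ 1])
next
  case False
  hence c: "c > 0" using c by simp
  show ?thesis unfolding tangent_dir_def
  proof (intro allI impI)
    fix h :: real assume "h > 0"
    hence "h / c > 0" using c by simp
    from tangent_dirE[OF u this] obtain l0 where
      l0: "l0 > 0" "\<And>l. 0 < l \<Longrightarrow> l \<le> l0 \<Longrightarrow> infdist (x + l *\<^sub>R u) A \<le> h / c * l" by blast
    have "infdist (x + l *\<^sub>R (c *\<^sub>R u)) A \<le> h * l" if "0 < l" "l \<le> l0 / c" for l
      using l0(2)[of "l * c"] that c by (simp add: field_simps)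
    thus "\<exists>l0>0. \<forall>l. 0 < l \<and> l \<le> l0 \<longrightarrow> infdist (x + l *\<^sub>R c *\<^sub>R u) A \<le> h * l"
      using l0(1) c by (intro exI[of _ "l0 / c"]) auto
  qed
qed

context unique_nearest
begin

text \<open>For each tolerance a single member of the approximating sequence is enough: along the
  chord from x to it, \<open>chord\<close> bounds the distance to A linearly in l, with a factor
  that is small because the member is close to x.\<close>

lemma tangent_dir_Tan:
  assumes x: "x \<in> A" and u: "u \<in> Tan A x"
  shows "tangent_dir A x u"
proof (cases "u = 0")
  case True
  thus ?thesis using x unfolding tangent_dir_def by (auto intro!: exI[of _ 1])
next
  case False
  then obtain ai ri where ai: "\<And>i::nat. ai i \<in> A" "\<And>i. ri i > (0::real)" "ai \<longlonglongrightarrow> x"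
    and lim: "(\<lambda>i. ri i *\<^sub>R (ai i - x)) \<longlonglongrightarrow> u" using u unfolding Tan_def by auto
  define v where "v i = ri i *\<^sub>R (ai i - x)" for i
  define M where "M = norm u + 1"
  have M: "M > 0" using norm_ge_zero[of u] unfolding M_def by linarith
  show ?thesis unfolding tangent_dir_def
  proof (intro allI impI)
    fix h :: real assume h: "h > 0"
    \<comment> \<open>With this bound on |ai i - x| the chord error 2/r * l * |v i| * |ai i - x| is
      at most h l / 2.\<close>
    define e where "e = min r (r * h / (4 * M))"
    have e: "e > 0" using r_pos h M by (simp add: e_def)
    have "\<forall>\<^sub>F i in sequentially. dist (ai i) x < e \<and> dist (v i) u < min 1 (h / 2)"
      using tendstoD[OF ai(3) e] tendstoD[OF lim, of "min 1 (h/2)"] h unfolding v_def by (auto intro: eventually_conj)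
    then obtain i where i: "dist (ai i) x < e" "dist (v i) u < 1" "dist (v i) u < h / 2"
      by (auto simp: eventually_sequentially)
    have vM: "norm (v i) \<le> M" using i(2) norm_triangle_sub[of "v i" u] by (simp add: M_def dist_norm)
    have "infdist (x + l *\<^sub>R u) A \<le> h * l" if l: "0 < l" "l \<le> 1 / ri i" for l
    proof -
      define s where "s = l * ri i"
      have s: "0 \<le> s" "s \<le> 1" using l ai(2)[of i] by (auto simp: s_def field_simps)
      have "infdist (x + s *\<^sub>R (ai i - x)) A \<le> 2 / r * (s * (1 - s) * (dist x (ai i))\<^sup>2)"
        using i(1) s by (intro chord x ai) (auto simp: e_def dist_commute)
      also have "\<dots> \<le> 2 / r * (s * 1 * (dist x (ai i))\<^sup>2)"
        using s r_pos by (intro mult_left_mono mult_right_mono) auto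
      also have "s * 1 * (dist x (ai i))\<^sup>2 = l * norm (v i) * dist x (ai i)" using ai(2)[of i] l
        by (simp add: s_def v_def dist_norm norm_minus_commute power2_eq_square)
      also have "2 / r * (l * norm (v i) * dist x (ai i)) \<le> 2 / r * (l * M * (r * h / (4 * M)))"
        using l vM i(1) r_pos M h by (intro mult_left_mono mult_mono) (auto simp: e_def dist_commute)
      also have "\<dots> = h / 2 * l" using r_pos M by (simp add: field_simps)
      finally have 1: "infdist (x + l *\<^sub>R v i) A \<le> h / 2 * l" by (simp add: s_def v_def)
      have "dist (x + l *\<^sub>R u) (x + l *\<^sub>R v i) = l * dist (v i) u"
        using l by (simp add: dist_norm norm_minus_commute flip: scaleR_right_diff_distrib)
      also have "\<dots> \<le> l * (h / 2)" using i(3) l by (intro mult_left_mono) auto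
      finally show ?thesis
        using 1 infdist_triangle[of "x + l *\<^sub>R u" A "x + l *\<^sub>R v i"] by (simp add: field_simps)
    qed
    thus "\<exists>l0>0. \<forall>l. 0 < l \<and> l \<le> l0 \<longrightarrow> infdist (x + l *\<^sub>R u) A \<le> h * l"
      using ai(2)[of i] by (intro exI[of _ "1 / ri i"]) auto
  qed
qed

text \<open>The nearest points p, q of x + 2l u and x + 2l v have a midpoint close to x + l (u + v),
  and \<open>chord\<close> puts this midpoint within O(l^2) of A. With scaling this makes the
  tangent cone convex.\<close>

lemma tangent_dir_add:
  assumes u: "tangent_dir A x u" and v: "tangent_dir A x v"
  shows "tangent_dir A x (u + v)" unfolding tangent_dir_def
proof (intro allI impI)
  fix h :: real assume h: "h > 0"
  have h4: "h / 4 > 0" using h by simp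
  obtain a where a: "a > 0" "\<And>l. 0 < l \<Longrightarrow> l \<le> a \<Longrightarrow> infdist (x + l *\<^sub>R u) A \<le> h / 4 * l"
    using tangent_dirE[OF u h4] by blast
  obtain b where b: "b > 0" "\<And>l. 0 < l \<Longrightarrow> l \<le> b \<Longrightarrow> infdist (x + l *\<^sub>R v) A \<le> h / 4 * l"
    using tangent_dirE[OF v h4] by blast
  define M where "M = 2 * norm u + 2 * norm v + h"
  have M: "M > 0" using h norm_ge_zero[of u] norm_ge_zero[of v] unfolding M_def by linarith
  define l0 where "l0 = Min {a / 2, b / 2, r / (2 * M), r * h / M\<^sup>2}"
  have l0: "l0 > 0" using a b r_pos M h by (simp add: l0_def)
  have "infdist (x + l *\<^sub>R (u + v)) A \<le> h * l" if l: "0 < l" "l \<le> l0" for l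
  proof -
    have la: "2 * l \<le> a" "2 * l \<le> b" "l * M < r" "l * M\<^sup>2 \<le> r * h"
      using l r_pos M by (auto simp: l0_def field_simps)
    define p where "p = P (x + (2 * l) *\<^sub>R u)"
    define q where "q = P (x + (2 * l) *\<^sub>R v)"
    have pd: "dist (x + (2 * l) *\<^sub>R u) p \<le> h * l / 2"
      using a(2)[of "2 * l"] la l by (simp add: p_def dist_P)
    have qd: "dist (x + (2 * l) *\<^sub>R v) q \<le> h * l / 2"
      using b(2)[of "2 * l"] la l by (simp add: q_def dist_P)
    have "dist (x + (2 * l) *\<^sub>R u) (x + (2 * l) *\<^sub>R v) \<le> 2 * l * (norm u + norm v)"
      using l norm_triangle_ineq4[of u v] by (simp add: dist_norm flip: scaleR_right_diff_distrib)
    hence "dist p q \<le> l * M" using pd qd dist_triangle[of p q "x + (2 * l) *\<^sub>R u"]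
        dist_triangle[of "x + (2 * l) *\<^sub>R u" q "x + (2 * l) *\<^sub>R v"]
      by (simp add: M_def dist_commute algebra_simps)
    hence "(dist p q)\<^sup>2 \<le> (l * M)\<^sup>2" "dist p q < r" using la by (auto intro!: power_mono)
    hence "infdist (p + (1/2) *\<^sub>R (q - p)) A \<le> 2 / r * ((1/2) * (1 - 1/2) * (l * M)\<^sup>2)" using r_pos
      by (intro order_trans[OF chord[of p q "1/2"]] mult_left_mono) (auto simp: p_def q_def P_in)
    also have "\<dots> = l * (l * M\<^sup>2) / (2 * r)" by (simp add: power2_eq_square)
    also have "\<dots> \<le> l * (r * h) / (2 * r)" using la l r_pos by (intro divide_right_mono mult_left_mono) auto
    also have "\<dots> = h * l / 2" using r_pos by simp
    finally have 1: "infdist (p + (1/2) *\<^sub>R (q - p)) A \<le> h * l / 2" .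
    have "x + l *\<^sub>R (u + v) - (p + (1/2) *\<^sub>R (q - p))
        = (1/2) *\<^sub>R ((x + (2 * l) *\<^sub>R u) - p) + (1/2) *\<^sub>R ((x + (2 * l) *\<^sub>R v) - q)"
    proof -
      have "2 *\<^sub>R (x + l *\<^sub>R (u + v) - (p + (1/2) *\<^sub>R (q - p)))
          = 2 *\<^sub>R ((1/2) *\<^sub>R ((x + (2 * l) *\<^sub>R u) - p) + (1/2) *\<^sub>R ((x + (2 * l) *\<^sub>R v) - q))"
        by (simp add: algebra_simps scaleR_2)
      thus ?thesis by (simp only: scaleR_cancel_left) simp
    qed
    hence "norm (x + l *\<^sub>R (u + v) - (p + (1/2) *\<^sub>R (q - p))) \<le> h * l / 2"
      using pd qd norm_triangle_ineq[of "(1/2) *\<^sub>R ((x + (2 * l) *\<^sub>R u) - p)" "(1/2) *\<^sub>R ((x + (2 * l) *\<^sub>R v) - q)"]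
      by (simp add: dist_norm)
    thus ?thesis using 1 infdist_triangle[of "x + l *\<^sub>R (u + v)" A "p + (1/2) *\<^sub>R (q - p)"]
      unfolding dist_norm by (simp add: mult.commute)
  qed
  thus "\<exists>l0>0. \<forall>l. 0 < l \<and> l \<le> l0 \<longrightarrow> infdist (x + l *\<^sub>R (u + v)) A \<le> h * l"
    using l0 by blast
qed

lemma tangent_dir_sum:
  assumes "finite I" "x \<in> A" "\<And>i. i \<in> I \<Longrightarrow> tangent_dir A x (u i)" "\<And>i. i \<in> I \<Longrightarrow> c i \<ge> 0"
  shows "tangent_dir A x (\<Sum>i\<in>I. c i *\<^sub>R u i)" using assms
proof (induction I rule: finite_induct)
  case empty
  thus ?case unfolding tangent_dir_def by (auto intro!: exI[of _ 1])
next
  case (insert i I)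
  thus ?case by (auto intro!: tangent_dir_add tangent_dir_scaleR)
qed

text \<open>Project the points x + s (y - x) to A and rescale by 1/s. By \<open>chord\<close> the
  resulting vectors stay within 2/r |x - y|^2 of y - x, and a limit along a subsequence with s -> 0
  is a tangent vector.\<close>

lemma chord_near_Tan:
  assumes x: "x \<in> A" and y: "y \<in> A" and xy: "dist x y < r"
  shows "\<exists>u\<in>Tan A x. norm (y - x - u) \<le> 2 / r * (dist x y)\<^sup>2"
proof -
  define s where "s n = inverse (real (Suc n))" for n
  have s: "s n > 0" "s n \<le> 1" for n by (auto simp: s_def field_simps)
  have s0: "s \<longlonglongrightarrow> 0" unfolding s_def by (rule LIMSEQ_inverse_real_of_nat)
  define p where "p n = P (x + s n *\<^sub>R (y - x))" for n
  define v where "v n = inverse (s n) *\<^sub>R (p n - x)" for n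
  define c where "c = 2 / r * (dist x y)\<^sup>2"
  have vb: "norm (v n - (y - x)) \<le> c" for n
  proof -
    have "dist (x + s n *\<^sub>R (y - x)) (p n) \<le> 2 / r * (s n * (1 - s n) * (dist x y)\<^sup>2)"
      unfolding p_def dist_P using s[of n] by (intro chord x y xy) auto
    also have "\<dots> \<le> 2 / r * (s n * 1 * (dist x y)\<^sup>2)"
      using s[of n] r_pos by (intro mult_left_mono mult_right_mono) auto
    finally have "norm (p n - x - s n *\<^sub>R (y - x)) \<le> s n * c"
      by (simp add: c_def dist_norm norm_minus_commute algebra_simps)
    moreover have "p n - x - s n *\<^sub>R (y - x) = s n *\<^sub>R (v n - (y - x))"
      using s[of n] by (simp add: v_def scaleR_right_diff_distrib)
    ultimately show ?thesis using s[of n] by simp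
  qed
  have "v n \<in> cball (y - x) c" for n using vb[of n] by (simp add: dist_norm norm_minus_commute)
  then obtain u k where k: "strict_mono k" and u: "(v \<circ> k) \<longlonglongrightarrow> u" "u \<in> cball (y - x) c"
    using compact_cball[of "y - x" c] unfolding compact_def by (metis)
  have "u \<in> Tan A x"
  proof (cases "u = 0")
    case True
    thus ?thesis by (simp add: Tan_def)
  next
    case False
    hence "\<forall>\<^sub>F n in sequentially. (v \<circ> k) n \<noteq> 0"
      using tendsto_imp_eventually_ne[OF u(1)] by simp
    then obtain N where N: "\<And>n. n \<ge> N \<Longrightarrow> v (k n) \<noteq> 0"
      by (auto simp: eventually_sequentially)
    have sk: "(s \<circ> k) \<longlonglongrightarrow> 0" using LIMSEQ_subseq_LIMSEQ[OF s0 k] .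
    have pv: "p n = x + s n *\<^sub>R v n" for n using s[of n] by (simp add: v_def)
    have "(\<lambda>n. x + (s \<circ> k) n *\<^sub>R (v \<circ> k) n) \<longlonglongrightarrow> x + 0 *\<^sub>R u"
      by (intro tendsto_intros u sk)
    hence "(\<lambda>n. p (k n)) \<longlonglongrightarrow> x" by (simp add: pv)
    hence 1: "(\<lambda>n. p (k (n + N))) \<longlonglongrightarrow> x" by (rule LIMSEQ_ignore_initial_segment)
    have "(\<lambda>n. v (k (n + N))) \<longlonglongrightarrow> u"
      using LIMSEQ_ignore_initial_segment[OF u(1), of N] by simp
    hence 2: "(\<lambda>n. inverse (s (k (n + N))) *\<^sub>R (p (k (n + N)) - x)) \<longlonglongrightarrow> u"
      by (simp add: v_def)
    have "p (k (n + N)) \<noteq> x" for n using N[of "n + N"] by (auto simp: v_def)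
    hence "\<forall>n. p (k (n + N)) \<in> A \<and> p (k (n + N)) \<noteq> x \<and> inverse (s (k (n + N))) > 0"
      using s by (simp add: p_def P_in)
    thus ?thesis unfolding Tan_def
      by (intro CollectI disjI2 exI[of _ "\<lambda>n. p (k (n + N))"] exI[of _ "\<lambda>n. inverse (s (k (n + N)))"]
          conjI 1 2)
  qed
  moreover have "norm (y - x - u) \<le> c" using u(2) by (simp add: dist_norm)
  ultimately show ?thesis unfolding c_def by blast
qed

end

section \<open>The covering dimension bounds the tangent cones\<close>

section \<open>Covering dimension and the dimension of tangent cones\<close>

text \<open>Mapping to a nerve: pull back a cover by small balls, refine it so that at most three
  members meet at a point, and replace \<open>f\<close> by the partition of unity with the ball
  centres as vertices. The values then lie in finitely many triangles, a null set in R^3, which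
  cannot cover a ball.\<close>

lemma covering_dim_le_perturb:
  fixes f :: "'a::metric_space \<Rightarrow> real^3"
  assumes dim: "covering_dim_le A 2" and f: "continuous_on A f" "bounded (f ` A)"
    and p: "p > 0" and m: "m > 0"
  obtains g c' where "continuous_on A g" "\<And>x. x \<in> A \<Longrightarrow> dist (g x) (f x) \<le> p"
    "c' \<in> ball c m" "c' \<notin> g ` A"
proof -
  obtain T where T: "finite T" "closure (f ` A) \<subseteq> (\<Union>y\<in>T. ball y p)"
    using f(2) p unfolding compact_closure[symmetric] compact_eq_totally_bounded by blast
  define h where "h = (\<lambda>y. A \<inter> f -` ball y p) ` T"
  have "finite h" using T by (simp add: h_def)
  moreover have "openin (top_of_set A) U" if "U \<in> h" for U
    using that f(1) by (auto simp: h_def intro: continuous_openin_preimage_gen)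
  moreover have "A \<subseteq> \<Union>h" using T(2) closure_subset[of "f ` A"] by (fastforce simp: h_def)
  ultimately obtain k where V: "finite k" "\<And>V. V \<in> k \<Longrightarrow> openin (top_of_set A) V" "A \<subseteq> \<Union>k"
    "\<And>V. V \<in> k \<Longrightarrow> \<exists>U\<in>h. V \<subseteq> U" and card: "\<And>x. x \<in> A \<Longrightarrow> card {V \<in> k. x \<in> V} \<le> 3"
    using dim[unfolded covering_dim_le_def, rule_format, of h] by auto
  have "\<forall>V\<in>k. \<exists>y\<in>T. V \<subseteq> f -` ball y p" using V(4) by (fastforce simp: h_def)
  then obtain y where y: "\<And>V. V \<in> k \<Longrightarrow> y V \<in> T" "\<And>V x. V \<in> k \<Longrightarrow> x \<in> V \<Longrightarrow> dist (y V) (f x) < p"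
    by (metis mem_ball subsetD vimage_eq)
  \<comment> \<open>\<open>infdist\<close> to the empty set is 0, so a member containing all of A
    needs a positive value of its own.\<close>
  define q where "q V x = (if A \<subseteq> V then 1 else infdist x (A - V))" for V x
  have q0: "q V x \<ge> 0" for V x by (simp add: q_def infdist_nonneg)
  have qpos: "q V x > 0" if "V \<in> k" "x \<in> V" "x \<in> A" for V x
  proof (cases "A \<subseteq> V")
    case False
    obtain W where W: "open W" "V = A \<inter> W" using V(2)[OF \<open>V \<in> k\<close>] by (auto simp: openin_open)
    then obtain e where e: "e > 0" "ball x e \<subseteq> W" using \<open>x \<in> V\<close> openE by blast
    have "e \<le> infdist x (A - V)" using False e W by (auto simp: infdist_def intro!: cINF_greatest)
    thus ?thesis using False e by (simp add: q_def)
  qed (simp add: q_def)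
  have qout: "q V x = 0" if "x \<in> A" "x \<notin> V" for V x using that by (auto simp: q_def)
  define S where "S x = (\<Sum>V\<in>k. q V x)" for x
  have S: "S x > 0" if xA: "x \<in> A" for x
  proof -
    obtain V where "V \<in> k" "x \<in> V" using V(3) xA by blast
    thus ?thesis unfolding S_def using V(1) q0 qpos xA by (intro sum_pos2[of _ V]) auto
  qed
  define g where "g x = (\<Sum>V\<in>k. (q V x / S x) *\<^sub>R y V)" for x
  have S1: "(\<Sum>V\<in>k. q V x / S x) = 1" if "x \<in> A" for x
    using S[OF that] by (simp add: S_def flip: sum_divide_distrib)
  have contq: "continuous_on A (q V)" for V
    unfolding q_def by (cases "A \<subseteq> V") (auto intro!: continuous_intros)
  have contg: "continuous_on A g" unfolding g_def S_def using S contq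
    by (intro continuous_intros) (auto simp: S_def less_le)
  have gf: "dist (g x) (f x) \<le> p" if x: "x \<in> A" for x
  proof -
    have "g x - f x = (\<Sum>V\<in>k. (q V x / S x) *\<^sub>R (y V - f x))"
      by (simp add: g_def scaleR_right_diff_distrib sum_subtractf S1[OF x] flip: scaleR_left.sum)
    also have "norm \<dots> \<le> (\<Sum>V\<in>k. (q V x / S x) * p)"
    proof (rule sum_norm_le)
      fix V assume "V \<in> k"
      show "norm ((q V x / S x) *\<^sub>R (y V - f x)) \<le> q V x / S x * p"
      proof (cases "x \<in> V")
        case True
        thus ?thesis using y(2)[OF \<open>V \<in> k\<close> True] q0[of V x] S[OF x]
          by (simp add: dist_norm mult_left_mono divide_right_mono)
      qed (simp add: qout[OF x])
    qed
    also have "\<dots> = (\<Sum>V\<in>k. q V x / S x) * p" by (simp only: sum_distrib_right)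
    also have "\<dots> = p" using S1[OF x] by simp
    finally show ?thesis by (simp add: dist_norm)
  qed
  define b where "b = (\<lambda>Q. convex hull Q) ` {Q. Q \<subseteq> T \<and> card Q \<le> 3}"
  have "finite b" using T(1) by (simp add: b_def)
  have sub: "g ` A \<subseteq> \<Union>b"
  proof
    fix z assume "z \<in> g ` A"
    then obtain x where x: "x \<in> A" "z = g x" by blast
    define W where "W = {V \<in> k. x \<in> V}"
    have W: "finite W" "card W \<le> 3" using V(1) card[OF x(1)] by (auto simp: W_def)
    have out0: "q V x / S x = 0" if "V \<in> k - W" for V using that qout[OF x(1)] by (auto simp: W_def)
    have "g x = (\<Sum>V\<in>W. (q V x / S x) *\<^sub>R y V)"
      unfolding g_def using V(1) out0 by (intro sum.mono_neutral_right) (auto simp: W_def)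
    also have "\<dots> \<in> convex hull (y ` W)"
    proof (rule convex_sum[OF W(1) convex_convex_hull])
      have "(\<Sum>V\<in>W. q V x / S x) = (\<Sum>V\<in>k. q V x / S x)"
        using V(1) out0 by (intro sum.mono_neutral_left) (auto simp: W_def)
      thus "(\<Sum>V\<in>W. q V x / S x) = 1" using S1[OF x(1)] by simp
    qed (use q0 S[OF x(1)] in \<open>auto intro: hull_inc\<close>)
    finally have "z \<in> convex hull (y ` W)" using x by simp
    moreover have "y ` W \<subseteq> T" "card (y ` W) \<le> 3"
      using y(1) W card_image_le[OF W(1), of y] by (auto simp: W_def)
    ultimately show "z \<in> \<Union>b" unfolding b_def by blast
  qed
  have "negligible (\<Union>b)"
  proof (rule negligible_Union[OF \<open>finite b\<close>])
    fix Z assume "Z \<in> b"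
    then obtain Q where Q: "Q \<subseteq> T" "card Q \<le> 3" "Z = convex hull Q" by (auto simp: b_def)
    hence "interior Z = {}" using finite_subset[OF Q(1) T(1)] by (auto intro!: empty_interior_convex_hull)
    thus "negligible Z" using Q(3) by (simp add: negligible_convex_interior)
  qed
  hence "\<not> ball c m \<subseteq> \<Union>b"
    using negligible_subset[of "\<Union>b" "ball c m"] open_not_negligible[OF open_ball, of c m] m
    by (metis ball_eq_empty not_le)
  then obtain c' where "c' \<in> ball c m" "c' \<notin> g ` A" using sub by blast
  thus ?thesis using that contg gf by blast
qed

context unique_nearest
begin

text \<open>Three independent tangent vectors span, by \<open>tangent_dir_sum\<close>, a solid cone
  which A follows closely at a small scale l. Nearest points then map a 3-ball into A so that the
  linear coordinates \<open>h\<close> undo the map up to a small error. A perturbation of these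
  coordinates on A that misses a point c' near the centre contradicts Brouwer's theorem.\<close>

theorem dim_Tan_le_2:
  assumes dim: "covering_dim_le A 2" and x: "x \<in> A"
  shows "dim (Tan A x) \<le> 2"
proof (rule ccontr)
  assume "\<not> dim (Tan A x) \<le> 2"
  moreover obtain B where B: "B \<subseteq> Tan A x" "independent B" "Tan A x \<subseteq> span B" "card B = dim (Tan A x)"
    by (rule basis_exists)
  ultimately obtain B' where B': "B' \<subseteq> B" "card B' = 3" "finite B'"
    using obtain_subset_with_card_n[of 3 B] by auto
  then obtain u :: "3 \<Rightarrow> 'a" where u: "bij_betw u UNIV B'"
    using finite_same_card_bij[of "UNIV :: 3 set" B'] by auto
  have ind: "independent B'" using B B' independent_mono by blast
  from linear_independent_extend[OF ind, of "\<lambda>b. axis (inv_into UNIV u b) 1"]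
  obtain G :: "'a \<Rightarrow> real^3" where G: "linear G" "\<forall>b\<in>B'. G b = axis (inv_into UNIV u b) 1"
    by (elim exE conjE)
  have Gu: "G (u i) = axis i 1" for i using G(2) u by (simp add: bij_betw_def bij_betwE inv_f_f image_iff)
  define q where "q c = (\<Sum>i\<in>UNIV. (c $ i) *\<^sub>R u i)" for c :: "real^3"
  have "linear q" unfolding q_def by (auto intro!: linearI simp: scaleR_add_left sum.distrib scaleR_right.sum)
  obtain Lq where Lq: "Lq > 0" "\<And>c. norm (q c) \<le> Lq * norm c"
    using linear_bounded_pos[OF \<open>linear q\<close>] by (metis mult.commute)
  have Gq: "G (q c) = c" for c unfolding q_def linear_sum[OF G(1)] linear_cmul[OF G(1)] Gu
    by (simp add: vec_eq_iff axis_def if_distrib[of "\<lambda>x. _ * x"] cong: if_cong)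
  obtain b where b: "b > 0" "\<And>v. norm (G v) \<le> b * norm v"
    using linear_bounded_pos[OF G(1)] by (metis mult.commute)
  \<comment> \<open>An error of k l in space becomes at most 1/8 in the coordinates
    \<open>h\<close>, since b bounds \<open>G\<close> and \<open>h\<close> divides by l.\<close>
  define k where "k = 1 / (8 * b)"
  have k: "k > 0" using b by (simp add: k_def)
  \<comment> \<open>All points of this ball have positive coordinates, so each \<open>q c\<close> is
    a nonnegative combination of tangent vectors.\<close>
  define K where "K = cball (vec 1 :: real^3) (1/2)"
  have K0: "c $ i \<ge> 0" if "c \<in> K" for c i
    using that component_le_norm_cart[of "vec 1 - c" i] by (simp add: K_def dist_norm)
  have tq: "tangent_dir A x (q c)" if "c \<in> K" for c unfolding q_def using u B(1) B'(1) K0[OF that] x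
    by (intro tangent_dir_sum tangent_dir_Tan) (auto simp: bij_betw_def)
  obtain T where T: "finite T" "T \<subseteq> K" "K \<subseteq> (\<Union>c\<in>T. ball c (k / (2 * Lq)))"
    using compactE_image[of K K "\<lambda>c. ball c (k / (2 * Lq))"] k Lq by (force simp: K_def)
  have "\<forall>c\<in>T. \<exists>l0>0. \<forall>l. 0 < l \<and> l \<le> l0 \<longrightarrow> infdist (x + l *\<^sub>R q c) A \<le> k / 2 * l"
    using tq T(2) k unfolding tangent_dir_def by (meson half_gt_zero subsetD)
  then obtain l0 where l0: "\<And>c. c \<in> T \<Longrightarrow> l0 c > 0"
    "\<And>c l. c \<in> T \<Longrightarrow> 0 < l \<Longrightarrow> l \<le> l0 c \<Longrightarrow> infdist (x + l *\<^sub>R q c) A \<le> k / 2 * l"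
    by metis
  define l where "l = Min (insert (r / (2 * k)) (l0 ` T))"
  have l: "l > 0" "l \<le> r / (2 * k)" "\<And>c. c \<in> T \<Longrightarrow> l \<le> l0 c"
    using T(1) l0(1) r_pos k by (auto simp: l_def)
  have near: "infdist (x + l *\<^sub>R q c) A \<le> k * l" if c: "c \<in> K" for c
  proof -
    obtain c' where c': "c' \<in> T" "dist c' c < k / (2 * Lq)" using T(3) c by auto
    have "dist (x + l *\<^sub>R q c) (x + l *\<^sub>R q c') = l * norm (q (c - c'))"
      using l(1) by (simp add: dist_norm linear_diff[OF \<open>linear q\<close>] flip: scaleR_right_diff_distrib)
    also have "\<dots> \<le> l * (Lq * (k / (2 * Lq)))" using l(1) c'(2) Lq(1)
      by (intro mult_left_mono order_trans[OF Lq(2)]) (auto simp: dist_norm norm_minus_commute)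
    also have "\<dots> = k / 2 * l" using Lq(1) by simp
    finally show ?thesis using l0(2)[OF c'(1) l(1) l(3)[OF c'(1)]]
        infdist_triangle[of "x + l *\<^sub>R q c" A "x + l *\<^sub>R q c'"] by linarith
  qed
  have "k * l < r" using l(2) k r_pos by (simp add: field_simps)
  hence near_r: "infdist (x + l *\<^sub>R q c) A < r" if "c \<in> K" for c using near[OF that] by simp
  define s where "s c = P (x + l *\<^sub>R q c)" for c
  have conts: "continuous_on K s" unfolding s_def
  proof (rule continuous_on_compose2[OF continuous_P])
    show "continuous_on K (\<lambda>c. x + l *\<^sub>R q c)"
      using linear_continuous_on[of q K] \<open>linear q\<close>
      by (intro continuous_intros) (simp add: linear_conv_bounded_linear)
  qed (use near_r in auto)
  have sA: "s ` K \<subseteq> A" by (auto simp: s_def P_in)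
  define h where "h y = G ((1 / l) *\<^sub>R (y - x))" for y
  define D where "D = cball (vec 1 :: real^3) 1"
  \<comment> \<open>The retraction to D makes the map bounded on A, as the perturbation requires,
    and leaves \<open>h\<close> unchanged on the image of K because 1/2 + 1/8 \<le> 1.\<close>
  define f where "f y = closest_point D (h y)" for y
  have hs: "dist (h (s c)) c \<le> 1/8" if "c \<in> K" for c
  proof -
    have "h (s c) - c = G ((1 / l) *\<^sub>R (s c - x) - q c)" by (simp add: h_def linear_diff[OF G(1)] Gq)
    also have "(1 / l) *\<^sub>R (s c - x) - q c = (1 / l) *\<^sub>R (s c - (x + l *\<^sub>R q c))"
      using l(1) by (simp add: algebra_simps)
    also have "norm (G \<dots>) \<le> b * ((1 / l) * (k * l))"
      using l(1) b(1) near[OF that] dist_P[of "x + l *\<^sub>R q c"] by (intro order_trans[OF b(2)] mult_left_mono)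
         (auto simp: s_def dist_norm norm_minus_commute pos_divide_le_eq)
    also have "\<dots> = 1/8" using l(1) b(1) by (simp add: k_def)
    finally show ?thesis by (simp add: dist_norm)
  qed
  have fs: "f (s c) = h (s c)" if "c \<in> K" for c
  proof -
    have "h (s c) \<in> D" using hs[OF that] that dist_triangle[of "vec 1" "h (s c)" c]
      by (simp add: K_def D_def dist_commute)
    thus ?thesis by (simp add: f_def closest_point_self)
  qed
  have contf: "continuous_on A f" unfolding f_def D_def
  proof (rule continuous_on_compose2[OF continuous_on_closest_point[of _ UNIV]])
    show "continuous_on A h" unfolding h_def by (rule continuous_on_compose2[OF linear_continuous_on[of G UNIV]])
         (use G(1) in \<open>auto intro!: continuous_intros simp: linear_conv_bounded_linear\<close>)
  qed auto
  have "f ` A \<subseteq> D" unfolding f_def D_def by (auto intro!: closest_point_in_set simp del: mem_cball)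
  hence "bounded (f ` A)" unfolding D_def by (rule bounded_subset[OF bounded_cball])
  from covering_dim_le_perturb[OF dim contf this, of "1/8" "1/8" "vec 1"]
  obtain g c' where g: "continuous_on A g" "\<And>x. x \<in> A \<Longrightarrow> dist (g x) (f x) \<le> 1/8"
    "c' \<in> ball (vec 1) (1/8)" "c' \<notin> g ` A" by auto
  \<comment> \<open>A fixed point means g (s c) = c'. The three errors of 1/8 (of \<open>h\<close>,
    of \<open>g\<close> and of c') keep F inside the ball of radius 1/2.\<close>
  define F where "F c = c - (g (s c) - c')" for c
  have "continuous_on K F" unfolding F_def by (intro continuous_intros continuous_on_compose2[OF g(1) conts] sA)
  moreover have "F c \<in> K" if c: "c \<in> K" for c
  proof -
    have eq: "F c - vec 1 = (c - h (s c)) + (f (s c) - g (s c)) + (c' - vec 1)" using fs[OF c] by (simp add: F_def)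
    have "norm (F c - vec 1) \<le> norm (c - h (s c)) + norm (f (s c) - g (s c)) + norm (c' - vec 1)"
      unfolding eq using norm_triangle_ineq[of "(c - h (s c)) + (f (s c) - g (s c))" "c' - vec 1"]
        norm_triangle_ineq[of "c - h (s c)" "f (s c) - g (s c)"] by linarith
    also have "\<dots> \<le> 1/8 + 1/8 + 1/8" using hs[OF c] g(2)[of "s c"] g(3) sA c
      by (intro add_mono) (auto simp: dist_norm norm_minus_commute less_imp_le)
    finally show ?thesis by (simp add: K_def dist_norm norm_minus_commute)
  qed
  ultimately obtain c where "c \<in> K" "F c = c" using brouwer[of K F] by (auto simp: K_def)
  hence "c' = g (s c)" by (simp add: F_def)
  thus False using g(4) sA \<open>c \<in> K\<close> by blast
qed

end

section \<open>Tools in the class C^{1,1}: extension, inversion, calculus of jets\<close>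

section \<open>Extension of Whitney jets of class \<open>C\<^sup>1\<^sup>,\<^sup>1\<close>\<close>

text \<open>Separate the epigraph from the open vertical ray below (z, u z). Since \<open>u\<close>
  is finite everywhere, the separating hyperplane cannot be vertical.\<close>

lemma convex_subgradient:
  fixes u :: "'a::euclidean_space \<Rightarrow> real"
  assumes "convex_on UNIV u"
  obtains p where "\<And>y. u y \<ge> u z + p \<bullet> (y - z)"
proof -
  define S where "S = {z} \<times> {..<u z}"
  define T where "T = epigraph UNIV u"
  have "convex T" using assms by (simp add: T_def convex_epigraph)
  moreover have "convex S" unfolding S_def by (intro convex_Times) auto
  moreover have "S \<noteq> {}" "T \<noteq> {}" "S \<inter> T = {}" unfolding S_def T_def epigraph_def by (auto intro: lt_ex)
  ultimately obtain a b where ab: "a \<noteq> 0" "\<forall>x\<in>S. a \<bullet> x \<le> b" "\<forall>x\<in>T. a \<bullet> x \<ge> b"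
    using separating_hyperplane_sets[of S T] by blast
  obtain a1 a2 where a: "a = (a1, a2)" by (cases a)
  have S: "a1 \<bullet> z + a2 * r \<le> b" if "r < u z" for r using ab(2) that by (auto simp: S_def a)
  have T: "a1 \<bullet> y + a2 * r \<ge> b" if "r \<ge> u y" for y r
    using ab(3) that by (auto simp: T_def epigraph_def a)
  have "a2 * (u z - 1) \<le> a2 * u z" using S[of "u z - 1"] T[of z "u z"] by simp
  hence "a2 \<ge> 0" by (simp add: algebra_simps)
  have Sz: "a1 \<bullet> z + a2 * u z \<le> b"
  proof (rule field_le_epsilon)
    fix e :: real assume "e > 0"
    define d where "d = e / (a2 + 1)"
    have "d > 0" "a2 * d \<le> e" using \<open>e > 0\<close> \<open>a2 \<ge> 0\<close> by (auto simp: d_def field_simps)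
    thus "a1 \<bullet> z + a2 * u z \<le> b + e" using S[of "u z - d"] by (simp add: algebra_simps)
  qed
  have "a2 \<noteq> 0"
  proof
    assume "a2 = 0"
    hence "a1 \<bullet> z \<le> a1 \<bullet> (z - a1)" using Sz T[of "z - a1" "u (z - a1)"] by simp
    hence "a1 \<bullet> a1 \<le> 0" by (simp add: inner_diff_right)
    hence "a1 = 0" by (metis inner_gt_zero_iff not_le)
    thus False using \<open>a2 = 0\<close> ab(1) a by (simp add: zero_prod_def)
  qed
  hence "a2 > 0" using \<open>a2 \<ge> 0\<close> by simp
  have "u y \<ge> u z + (- (1 / a2) *\<^sub>R a1) \<bullet> (y - z)" for y
  proof -
    have "a2 * u z \<le> a2 * u y + a1 \<bullet> (y - z)" using Sz T[of y "u y"] by (simp add: inner_diff_right)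
    thus ?thesis using \<open>a2 > 0\<close> by (simp add: field_simps)
  qed
  thus ?thesis using that by blast
qed

text \<open>Expand at x and at y towards the same point y + w, with w of length |y - x| in the
  direction of q y - q x. The three remainders contribute 4B + B + B.\<close>

lemma gradient_lipschitz:
  fixes u :: "'a::euclidean_space \<Rightarrow> real"
  assumes q: "\<And>y w. \<bar>u (y + w) - u y - q y \<bullet> w\<bar> \<le> B * (norm w)\<^sup>2"
  shows "norm (q y - q x) \<le> 6 * B * norm (y - x)"
proof -
  obtain b :: 'a where "norm b = 1" using norm_Basis nonempty_Basis by blast
  hence B: "B \<ge> 0" using q[of 0 b] by (simp add: abs_le_iff)
  show ?thesis
  proof (cases "y = x \<or> q y = q x")
    case False
    define k where "k = y - x"
    define d where "d = q y - q x"
    define w where "w = (norm k / norm d) *\<^sub>R d"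
    have nw: "norm w = norm k" using False by (simp add: w_def d_def)
    have y: "y = x + k" by (simp add: k_def)
    have "d \<bullet> w = (u (x + k + w) - u x - q x \<bullet> (k + w)) - (u (y + w) - u y - q y \<bullet> w) - (u (x + k) - u x - q x \<bullet> k)"
      by (simp add: y d_def inner_diff_left inner_add_right add.assoc)
    also have "\<dots> \<le> B * (norm (k + w))\<^sup>2 + B * (norm w)\<^sup>2 + B * (norm k)\<^sup>2"
      using q[of x "k + w"] q[of y w] q[of x k] by (simp add: add.assoc abs_le_iff)
    also have "\<dots> \<le> B * (norm k + norm k)\<^sup>2 + B * (norm k)\<^sup>2 + B * (norm k)\<^sup>2"
      using B nw norm_triangle_ineq[of k w] by (intro add_mono mult_left_mono power_mono) auto
    finally have "d \<bullet> w \<le> 6 * B * norm k * norm k" by (simp add: power2_eq_square algebra_simps)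
    moreover have "d \<bullet> w = norm k * norm d"
      using False by (simp add: w_def d_def[symmetric] power2_norm_eq_inner[symmetric] power2_eq_square)
    ultimately have "norm k * norm d \<le> norm k * (6 * B * norm k)" by (simp add: mult_ac)
    thus ?thesis using False by (simp add: k_def d_def)
  qed (use B in auto)
qed

text \<open>The extension is the largest function below all upper paraboloids whose sum with
  \<open>A |y|\<^sup>2\<close> is convex. It is also semiconcave: averaging two translates of it gives another competitor.\<close>

lemma whitney_scalar:
  fixes f :: "'a::euclidean_space \<Rightarrow> real" and p :: "'a \<Rightarrow> 'a"
  assumes "K \<noteq> {}" and M: "M \<ge> 0"
    and f: "\<And>x y. \<lbrakk>x \<in> K; y \<in> K\<rbrakk> \<Longrightarrow> \<bar>f y - f x - p x \<bullet> (y - x)\<bar> \<le> M * (norm (y - x))\<^sup>2"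
    and p: "\<And>x y. \<lbrakk>x \<in> K; y \<in> K\<rbrakk> \<Longrightarrow> norm (p y - p x) \<le> M * norm (y - x)"
  obtains H q B where "B \<ge> 0" "\<And>y w. \<bar>H (y + w) - H y - q y \<bullet> w\<bar> \<le> B * (norm w)\<^sup>2"
    "\<And>x. x \<in> K \<Longrightarrow> H x = f x" "\<And>x. x \<in> K \<Longrightarrow> q x = p x"
proof -
  \<comment> \<open>Lower paraboloids must lie below upper ones, which needs M (d^2 + d a) \<le> A
    (a^2 + b^2); 4M is enough for this, and the summand 1 keeps A positive when M = 0.\<close>
  define A where "A = 4 * M + 1"
  have A: "A > 0" using M by (simp add: A_def)
  define up where "up x y = f x + p x \<bullet> (y - x) + A * (norm (y - x))\<^sup>2" for x y
  define low where "low x y = f x + p x \<bullet> (y - x) - A * (norm (y - x))\<^sup>2" for x y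
  have low_up: "low x y \<le> up z y" if "x \<in> K" "z \<in> K" for x y z
  proof -
    define a b d where "a = norm (y - z)" and "b = norm (y - x)" and "d = norm (z - x)"
    have "d \<le> a + b" using norm_triangle_ineq4[of "y - x" "y - z"] by (simp add: a_def b_def d_def)
    have nn: "0 \<le> a" "0 \<le> b" "0 \<le> d" by (auto simp: a_def b_def d_def)
    have "up z y - low x y = (f z - f x - p x \<bullet> (z - x)) + (p z - p x) \<bullet> (y - z) + A * (a\<^sup>2 + b\<^sup>2)"
      by (simp add: up_def low_def a_def b_def algebra_simps)
    moreover have "\<bar>f z - f x - p x \<bullet> (z - x)\<bar> \<le> M * d\<^sup>2" using f that by (simp add: d_def)
    moreover have "\<bar>(p z - p x) \<bullet> (y - z)\<bar> \<le> M * d * a"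
      using Cauchy_Schwarz_ineq2[of "p z - p x" "y - z"] p[OF that(1,2)]
      by (fastforce simp: a_def d_def intro: order_trans mult_right_mono)
    moreover have "M * d\<^sup>2 + M * d * a \<le> A * (a\<^sup>2 + b\<^sup>2)"
    proof -
      have "d\<^sup>2 \<le> (a + b)\<^sup>2" using \<open>d \<le> a + b\<close> nn by (intro power_mono) auto
      hence d2: "d\<^sup>2 \<le> 2 * (a\<^sup>2 + b\<^sup>2)" using sum_squares_bound[of a b] by (simp add: power2_sum)
      have da: "d * a \<le> (d\<^sup>2 + a\<^sup>2) / 2" using sum_squares_bound[of d a] by simp
      have gen: "P + S \<le> 4 * (Q + R)"
        if "S \<le> (P + Q) / 2" "P \<le> 2 * (Q + R)" "0 \<le> Q" "0 \<le> R" for P Q R S :: real using that by argo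
      have "d\<^sup>2 + d * a \<le> 4 * (a\<^sup>2 + b\<^sup>2)" by (rule gen[OF da d2]) auto
      hence "M * (d\<^sup>2 + d * a) \<le> M * (4 * (a\<^sup>2 + b\<^sup>2))" using M by (rule mult_left_mono)
      moreover have "M * d\<^sup>2 + M * d * a = M * (d\<^sup>2 + d * a)" by (simp add: algebra_simps)
      ultimately have "M * d\<^sup>2 + M * d * a \<le> M * (4 * (a\<^sup>2 + b\<^sup>2)) + 0" by simp
      also have "\<dots> \<le> M * (4 * (a\<^sup>2 + b\<^sup>2)) + (a\<^sup>2 + b\<^sup>2)" by (intro add_left_mono) simp
      also have "\<dots> = A * (a\<^sup>2 + b\<^sup>2)" by (simp add: A_def algebra_simps)
      finally show ?thesis .
    qed
    ultimately show ?thesis by linarith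
  qed
  obtain x0 where x0: "x0 \<in> K" using \<open>K \<noteq> {}\<close> by blast
  define k where "k = {h. convex_on UNIV (\<lambda>y. h y + A * (norm y)\<^sup>2) \<and> (\<forall>x\<in>K. \<forall>y. h y \<le> up x y)}"
  have lowk: "low x \<in> k" if "x \<in> K" for x
  proof -
    have "(\<lambda>y. low x y + A * (norm y)\<^sup>2)
        = (\<lambda>y. (f x - p x \<bullet> x - A * (norm x)\<^sup>2) + (p x + (2 * A) *\<^sub>R x) \<bullet> y)"
      by (auto simp: low_def power2_norm_eq_inner algebra_simps inner_commute)
    moreover have "convex_on UNIV \<dots>" by (intro convex_onI) (auto simp: inner_add_right algebra_simps)
    ultimately show ?thesis using that low_up by (simp add: k_def)
  qed
  define H where "H y = (SUP h\<in>k. h y)" for y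
  have bdd: "bdd_above ((\<lambda>h. h y) ` k)" for y
    using x0 unfolding k_def by (intro bdd_aboveI2[of _ _ "up x0 y"]) blast
  have ne: "k \<noteq> {}" using lowk[OF x0] by blast
  have H_ge: "h y \<le> H y" if "h \<in> k" for h y unfolding H_def using that bdd by (intro cSUP_upper)
  have H_le: "H y \<le> c" if "\<And>h. h \<in> k \<Longrightarrow> h y \<le> c" for y c
    unfolding H_def using ne that by (intro cSUP_least) auto
  have H_up: "H y \<le> up x y" if "x \<in> K" for x y using that by (intro H_le) (auto simp: k_def)
  define u where "u y = H y + A * (norm y)\<^sup>2" for y
  have "convex_on UNIV u"
  proof (intro convex_onI)
    fix t :: real and x y :: 'a assume t: "0 < t" "t < 1"
    define z where "z = (1 - t) *\<^sub>R x + t *\<^sub>R y"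
    have "H z \<le> (1 - t) * u x + t * u y - A * (norm z)\<^sup>2"
    proof (rule H_le)
      fix h assume h: "h \<in> k"
      hence "h z + A * (norm z)\<^sup>2 \<le> (1 - t) * (h x + A * (norm x)\<^sup>2) + t * (h y + A * (norm y)\<^sup>2)"
        using t unfolding z_def k_def by (auto dest!: convex_onD[of _ _ t x y])
      also have "\<dots> \<le> (1 - t) * u x + t * u y"
        unfolding u_def using H_ge[OF h] t A by (intro add_mono mult_left_mono) auto
      finally show "h z \<le> (1 - t) * u x + t * u y - A * (norm z)\<^sup>2" by simp
    qed
    thus "u ((1 - t) *\<^sub>R x + t *\<^sub>R y) \<le> (1 - t) * u x + t * u y"
      unfolding z_def[symmetric] u_def[of z] by simp
  qed auto
  have par: "(norm (y + w))\<^sup>2 + (norm (y - w))\<^sup>2 = 2 * (norm y)\<^sup>2 + 2 * (norm w)\<^sup>2" for y w :: 'a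
    by (simp add: power2_norm_eq_inner inner_add_left inner_add_right inner_diff_left inner_diff_right)
  have scale: "A * p + A * q = 2 * A * r + 2 * A * s" if "p + q = 2 * r + 2 * s" for p q r s
  proof -
    have "A * (p + q) = A * (2 * r + 2 * s)" using that by simp
    thus ?thesis by (simp add: algebra_simps)
  qed
  have avg: "(h1 + h2) / 2 - a + p = (1/2) * ((h1 + q1) + (h2 + q2)) + - 2 * a"
    if "q1 + q2 = 2 * p + 2 * a" for h1 h2 a p q1 q2 :: real using that by (simp add: field_simps)
  have H2: "H (y + w) + H (y - w) - 2 * H y \<le> 2 * A * (norm w)\<^sup>2" for y w
  proof -
    define h where "h y = (H (y + w) + H (y - w)) / 2 - A * (norm w)\<^sup>2" for y
    have "h \<in> k" unfolding k_def
    proof (intro CollectI conjI ballI allI)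
      have shift: "convex_on UNIV (\<lambda>y. u (y + v))" for v
      proof (intro convex_onI)
        fix t :: real and x y :: 'a assume t: "0 < t" "t < 1"
        have "(1 - t) *\<^sub>R x + t *\<^sub>R y + v = (1 - t) *\<^sub>R (x + v) + t *\<^sub>R (y + v)"
          by (simp add: algebra_simps)
        thus "u ((1 - t) *\<^sub>R x + t *\<^sub>R y + v) \<le> (1 - t) * u (x + v) + t * u (y + v)"
          using convex_onD[OF \<open>convex_on UNIV u\<close>, of t "x + v" "y + v"] t by simp
      qed auto
      have eq: "(\<lambda>y. h y + A * (norm y)\<^sup>2) = (\<lambda>y. (1/2) * (u (y + w) + u (y + - w)) + - 2 * (A * (norm w)\<^sup>2))"
      proof
        fix y
        have "A * (norm (y + w))\<^sup>2 + A * (norm (y - w))\<^sup>2 = 2 * A * (norm y)\<^sup>2 + 2 * A * (norm w)\<^sup>2"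
          by (rule scale[OF par])
        thus "h y + A * (norm y)\<^sup>2 = (1/2) * (u (y + w) + u (y + - w)) + - 2 * (A * (norm w)\<^sup>2)"
          unfolding h_def u_def add_uminus_conv_diff by (intro avg) (simp add: mult.assoc)
      qed
      show "convex_on UNIV (\<lambda>y. h y + A * (norm y)\<^sup>2)" unfolding eq
        by (intro convex_on_add[OF convex_on_cmul[OF _ convex_on_add[OF shift shift]]])
           (auto intro!: convex_onI simp: algebra_simps)
      fix x y assume x: "x \<in> K"
      have "A * (norm (y - x + w))\<^sup>2 + A * (norm (y - x - w))\<^sup>2 = 2 * A * (norm (y - x))\<^sup>2 + 2 * A * (norm w)\<^sup>2"
        by (rule scale[OF par])
      moreover have "y + w - x = y - x + w" "y - w - x = y - x - w" by simp_all
      ultimately have "A * (norm (y + w - x))\<^sup>2 + A * (norm (y - w - x))\<^sup>2 = 2 * A * (norm (y - x))\<^sup>2 + 2 * A * (norm w)\<^sup>2"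
        by (simp only:)
      hence "(up x (y + w) + up x (y - w)) / 2 = up x y + A * (norm w)\<^sup>2"
        by (simp add: up_def inner_add_right inner_diff_right field_simps)
      thus "h y \<le> up x y" using H_up[OF x, of "y + w"] H_up[OF x, of "y - w"] by (simp add: h_def field_simps)
    qed
    from H_ge[OF this, of y] show ?thesis unfolding h_def by (simp add: field_simps)
  qed
  have "\<exists>g. \<forall>y. u y \<ge> u z + g \<bullet> (y - z)" for z
    using convex_subgradient[OF \<open>convex_on UNIV u\<close>, of z] by metis
  then obtain g where g: "\<And>z y. u y \<ge> u z + g z \<bullet> (y - z)" by metis
  define q where "q y = g y - (2 * A) *\<^sub>R y" for y
  have quad: "\<bar>H (y + w) - H y - q y \<bullet> w\<bar> \<le> 5 * A * (norm w)\<^sup>2" for y w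
  proof -
    have 1: "0 \<le> u (y + w) - u y - g y \<bullet> w" "0 \<le> u (y - w) - u y + g y \<bullet> w"
      using g[of y "y + w"] g[of y "y - w"] by auto
    have sq: "u (y + w) + u (y - w) - 2 * u y = H (y + w) + H (y - w) - 2 * H y + 2 * A * (norm w)\<^sup>2"
      using arg_cong[OF par[of y w], of "\<lambda>t. A * t"] by (simp add: u_def algebra_simps)
    have "u (y + w) - u y - g y \<bullet> w = H (y + w) - H y - q y \<bullet> w + A * (norm w)\<^sup>2"
      by (simp add: u_def q_def power2_norm_eq_inner inner_add_left inner_add_right inner_diff_left
          inner_commute algebra_simps)
    thus ?thesis using 1 sq H2[of y w] A zero_le_power2[of "norm w"] by (simp add: abs_le_iff)
  qed
  have HK: "H x = f x" if "x \<in> K" for x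
    using H_up[OF that, of x] H_ge[OF lowk[OF that], of x] by (simp add: up_def low_def)
  have qK: "q x = p x" if x: "x \<in> K" for x
  proof (rule ccontr)
    assume "q x \<noteq> p x"
    define d where "d = q x - p x"
    have d: "norm d > 0" using \<open>q x \<noteq> p x\<close> by (simp add: d_def)
    \<comment> \<open>H touches the upper paraboloid at x from below, so the difference of the two
      gradients is dominated by a quadratic function of w and must vanish; testing w = s d for small
      s shows this.\<close>
    have *: "d \<bullet> w \<le> 6 * A * (norm w)\<^sup>2" for w using quad[of x w] H_up[OF x, of "x + w"] HK[OF x]
      by (simp add: up_def d_def inner_diff_left abs_le_iff)
    define s where "s = 1 / (12 * A)"
    have s: "s > 0" "6 * A * s = 1/2" using A by (auto simp: s_def)
    have "s * (norm d)\<^sup>2 \<le> (6 * A * s) * s * (norm d)\<^sup>2" using *[of "s *\<^sub>R d"] s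
      by (simp add: power_mult_distrib power2_eq_square mult_ac dot_square_norm)
    hence "s * (norm d)\<^sup>2 \<le> 0" unfolding s(2) by simp
    thus False using s d by (simp add: mult_le_0_iff)
  qed
  show ?thesis by (rule that[of "5 * A" H q]) (use A quad HK qK in auto)
qed

text \<open>Whitney's compatibility conditions in the class C^{1,1}. Here \<open>D\<close> is
  prescribed data and not a derivative of \<open>f\<close>, since K may have empty interior.\<close>

definition jet :: "'a::euclidean_space set \<Rightarrow> ('a \<Rightarrow> 'b::euclidean_space) \<Rightarrow> ('a \<Rightarrow> 'a \<Rightarrow>\<^sub>L 'b) \<Rightarrow> real \<Rightarrow> bool" where
  "jet K f D M \<longleftrightarrow> (\<forall>x\<in>K. \<forall>y\<in>K. norm (f y - f x - D x (y - x)) \<le> M * (norm (y - x))\<^sup>2 \<and>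
     norm (D y - D x) \<le> M * norm (y - x))"

lemma quadratic_has_derivative:
  fixes F :: "'a::real_normed_vector \<Rightarrow> 'b::real_normed_vector"
  assumes "bounded_linear D" and B: "\<And>w. norm (F (x + w) - F x - D w) \<le> B * (norm w)\<^sup>2"
  shows "(F has_derivative D) (at x)" unfolding has_derivative_at
proof
  show "(\<lambda>w. norm (F (x + w) - F x - D w) / norm w) \<midarrow>0\<rightarrow> 0"
  proof (rule Lim_null_comparison)
    have "norm (norm (F (x + w) - F x - D w) / norm w) \<le> B * norm w" for w
    proof (cases "w = 0")
      case False
      thus ?thesis using B[of w] by (simp add: divide_le_eq power2_eq_square mult.assoc)
    qed simp
    thus "\<forall>\<^sub>F w in at 0. norm (norm (F (x + w) - F x - D w) / norm w) \<le> B * norm w" by simp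
    show "(\<lambda>w. B * norm w) \<midarrow>0\<rightarrow> 0" by (auto intro!: tendsto_eq_intros)
  qed
qed (fact assms)

text \<open>Each component is extended by \<open>whitney_scalar\<close>; the two-sided quadratic
  estimate there gives differentiability, and \<open>gradient_lipschitz\<close> the Lipschitz bound
  for the derivative.\<close>

theorem whitney_C11:
  fixes f :: "'a::euclidean_space \<Rightarrow> 'b::euclidean_space"
  assumes jet: "jet K f D M" and "K \<noteq> {}"
  obtains F D' L where "\<And>x. (F has_derivative blinfun_apply (D' x)) (at x)" "L-lipschitz_on UNIV D'"
    "\<And>x. x \<in> K \<Longrightarrow> F x = f x" "\<And>x. x \<in> K \<Longrightarrow> D' x = D x"
proof -
  define M' where "M' = max M 0"
  have J1: "norm (f y - f x - D x (y - x)) \<le> M' * (norm (y - x))\<^sup>2"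
    and J2: "norm (D y - D x) \<le> M' * norm (y - x)" if "x \<in> K" "y \<in> K" for x y
    using jet that unfolding jet_def M'_def
    by (meson max.cobounded1 mult_right_mono norm_ge_zero order_trans zero_le_power2)+
  define p where "p b x = (\<Sum>i\<in>Basis. (D x i \<bullet> b) *\<^sub>R i)" for b x
  have p: "p b x \<bullet> v = D x v \<bullet> b" for b x v
  proof -
    have "D x v = (\<Sum>i\<in>Basis. (v \<bullet> i) *\<^sub>R D x i)"
      by (metis (no_types, lifting) blinfun.scaleR_right blinfun.sum_right euclidean_representation sum.cong)
    thus ?thesis by (simp add: p_def inner_sum_left inner_sum_right inner_commute mult.commute)
  qed
  have "\<exists>H q B. B \<ge> 0 \<and> (\<forall>y w. \<bar>H (y + w) - H y - q y \<bullet> w\<bar> \<le> B * (norm w)\<^sup>2) \<and>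
      (\<forall>x\<in>K. H x = f x \<bullet> b \<and> q x = p b x)" if b: "b \<in> Basis" for b :: 'b
  proof -
    have nb: "norm b = 1" using b by simp
    have "\<bar>f y \<bullet> b - f x \<bullet> b - p b x \<bullet> (y - x)\<bar> \<le> M' * (norm (y - x))\<^sup>2" if "x \<in> K" "y \<in> K" for x y
    proof -
      have "f y \<bullet> b - f x \<bullet> b - p b x \<bullet> (y - x) = (f y - f x - D x (y - x)) \<bullet> b"
        by (simp add: p inner_diff_left)
      thus ?thesis using Cauchy_Schwarz_ineq2[of "f y - f x - D x (y - x)" b] J1[OF that] nb by simp
    qed
    moreover have "norm (p b y - p b x) \<le> M' * norm (y - x)" if "x \<in> K" "y \<in> K" for x y
    proof (cases "p b y = p b x")
      case False
      define v where "v = p b y - p b x"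
      have "v \<bullet> v = (D y - D x) v \<bullet> b"
        by (simp add: v_def[symmetric] p[symmetric] blinfun.diff_left inner_diff_left) (simp add: v_def inner_diff_left)
      also have "\<dots> \<le> norm ((D y - D x) v)" using Cauchy_Schwarz_ineq2[of "(D y - D x) v" b] nb by simp
      also have "\<dots> \<le> M' * norm (y - x) * norm v"
        using norm_blinfun[of "D y - D x" v] J2[OF that] by (meson mult_right_mono norm_ge_zero order_trans)
      finally show ?thesis using False by (simp add: power2_norm_eq_inner[symmetric] power2_eq_square v_def)
    qed (simp add: M'_def)
    ultimately show ?thesis
      using whitney_scalar[of K M' "\<lambda>x. f x \<bullet> b" "p b"] \<open>K \<noteq> {}\<close> by (metis M'_def max.cobounded2)
  qed
  then obtain H q B where B: "\<And>b. b \<in> Basis \<Longrightarrow> B b \<ge> 0"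
    and H: "\<And>b y w. b \<in> Basis \<Longrightarrow> \<bar>H b (y + w) - H b y - q b y \<bullet> w\<bar> \<le> B b * (norm w)\<^sup>2"
    and HK: "\<And>b x. b \<in> Basis \<Longrightarrow> x \<in> K \<Longrightarrow> H b x = f x \<bullet> b"
    and qK: "\<And>b x. b \<in> Basis \<Longrightarrow> x \<in> K \<Longrightarrow> q b x = p b x" by metis
  define F where "F x = (\<Sum>b\<in>Basis. H b x *\<^sub>R b)" for x
  define D' where "D' x = Blinfun (\<lambda>v. \<Sum>b\<in>Basis. (q b x \<bullet> v) *\<^sub>R b)" for x
  have D': "D' x v = (\<Sum>b\<in>Basis. (q b x \<bullet> v) *\<^sub>R b)" for x v
    unfolding D'_def by (subst bounded_linear_Blinfun_apply) (auto intro!: bounded_linear_intros)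
  define C where "C = (\<Sum>b\<in>(Basis :: 'b set). B b)"
  have "norm (F (x + w) - F x - D' x w) \<le> C * (norm w)\<^sup>2" for x w
  proof -
    have "F (x + w) - F x - D' x w = (\<Sum>b\<in>Basis. (H b (x + w) - H b x - q b x \<bullet> w) *\<^sub>R b)"
      by (simp add: F_def D' scaleR_left_diff_distrib sum_subtractf)
    also have "norm \<dots> \<le> (\<Sum>b\<in>Basis. B b * (norm w)\<^sup>2)" using H by (intro sum_norm_le) auto
    finally show ?thesis by (simp add: C_def sum_distrib_right)
  qed
  hence "(F has_derivative blinfun_apply (D' x)) (at x)" for x
    by (intro quadratic_has_derivative blinfun.bounded_linear_right)
  moreover have "(6 * C)-lipschitz_on UNIV D'"
  proof (rule lipschitz_onI)
    fix x y
    have "norm ((D' x - D' y) v) \<le> 6 * C * norm (x - y) * norm v" for v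
    proof -
      have "(D' x - D' y) v = (\<Sum>b\<in>Basis. ((q b x - q b y) \<bullet> v) *\<^sub>R b)"
        by (simp add: blinfun.diff_left D' inner_diff_left scaleR_left_diff_distrib sum_subtractf)
      also have "norm \<dots> \<le> (\<Sum>b\<in>Basis. (6 * B b * norm (x - y)) * norm v)"
      proof (rule sum_norm_le)
        fix b :: 'b assume b: "b \<in> Basis"
        show "norm (((q b x - q b y) \<bullet> v) *\<^sub>R b) \<le> 6 * B b * norm (x - y) * norm v"
          using gradient_lipschitz[OF H[OF b], of x y] Cauchy_Schwarz_ineq2[of "q b x - q b y" v] b
          by (simp, meson mult_right_mono norm_ge_zero order_trans)
      qed
      finally show ?thesis by (simp add: C_def sum_distrib_left sum_distrib_right)
    qed
    thus "dist (D' x) (D' y) \<le> 6 * C * dist x y"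
      using B by (auto simp: dist_norm C_def intro!: norm_blinfun_bound sum_nonneg mult_nonneg_nonneg)
  qed (use B in \<open>auto simp: C_def intro!: sum_nonneg\<close>)
  moreover have "F x = f x" if "x \<in> K" for x using HK[OF _ that] by (simp add: F_def euclidean_representation)
  moreover have "D' x = D x" if "x \<in> K" for x
    using qK[OF _ that] by (intro blinfun_eqI) (simp add: D' p euclidean_representation)
  ultimately show ?thesis using that by blast
qed

lemma blinfun_compose_assoc: "(a o\<^sub>L b) o\<^sub>L c = a o\<^sub>L (b o\<^sub>L c)" by (rule blinfun_eqI) simp

lemma blinfun_compose_id: "a o\<^sub>L id_blinfun = a" "id_blinfun o\<^sub>L a = a" by (rule blinfun_eqI, simp)+

lemmas blinfun_compose_diff_right = bounded_bilinear.diff_right[OF bounded_bilinear_blinfun_compose]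
lemmas blinfun_compose_diff_left = bounded_bilinear.diff_left[OF bounded_bilinear_blinfun_compose]

section \<open>Local inversion in the class \<open>C\<^sup>1\<^sup>,\<^sup>1\<close>\<close>

text \<open>The inverse function theorem supplies a local homeomorphism. On a ball where E o D x is
  within 1/2 of the identity, F shrinks distances at most by the factor 2e and the inverse
  derivatives G are bounded by 2e. Then G y - G z = G y (D (g z) - D (g y)) G z makes G
  Lipschitz.\<close>

theorem C11_local_diffeo:
  fixes F :: "'a::euclidean_space \<Rightarrow> 'a"
  assumes F: "\<And>x. (F has_derivative blinfun_apply (D x)) (at x)" and L: "L-lipschitz_on UNIV D"
    and E: "E o\<^sub>L D x0 = id_blinfun"
  obtains b where "b > 0" "C11_diffeo (ball x0 b) F"
proof -
  have L0: "L \<ge> 0" using L lipschitz_on_nonneg by blast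
  have "continuous_on UNIV D" using L lipschitz_on_continuous_on by blast
  then obtain U V g g' where U: "open U" "x0 \<in> U" and "open V" and hom: "homeomorphism U V F g"
    and g: "\<And>y. y \<in> V \<Longrightarrow> (g has_derivative (g' y)) (at y)"
    and g': "\<And>y. y \<in> V \<Longrightarrow> g' y = inv (blinfun_apply (D (g y)))"
    and bij: "\<And>y. y \<in> V \<Longrightarrow> bij (blinfun_apply (D (g y)))"
    by (rule inverse_function_theorem[OF open_UNIV F _ UNIV_I E]) blast+
  define e where "e = norm E + 1"
  have e: "e > 0" "norm E \<le> e" using norm_ge_zero[of E] unfolding e_def by linarith+
  obtain b0 where b0: "b0 > 0" "ball x0 b0 \<subseteq> U" using U openE by blast
  \<comment> \<open>On the ball of this radius |E o (D x - D x0)| \<le> e L b \<le> 1/2.\<close>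
  define b where "b = min b0 (1 / (2 * e * (L + 1)))"
  have b: "b > 0" "ball x0 b \<subseteq> U" using b0 e L0 by (auto simp: b_def)
  let ?B = "ball x0 b"
  have ED: "norm ((E o\<^sub>L D x) - id_blinfun) \<le> 1/2" if "x \<in> ?B" for x
  proof -
    have "(E o\<^sub>L D x) - id_blinfun = E o\<^sub>L (D x - D x0)" using E by (metis blinfun_compose_diff_right)
    also have "norm \<dots> \<le> norm E * norm (D x - D x0)" by (rule norm_blinfun_compose)
    also have "\<dots> \<le> e * (L * b)"
    proof (intro mult_mono)
      have "norm (D x - D x0) \<le> L * dist x x0" using lipschitz_onD[OF L, of x x0] by (simp add: dist_norm)
      also have "\<dots> \<le> L * b" using that L0 by (intro mult_left_mono) (auto simp: dist_commute)
      finally show "norm (D x - D x0) \<le> L * b" .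
    qed (use e in auto)
    also have "\<dots> \<le> e * (L * (1 / (2 * e * (L + 1))))"
      using e L0 by (intro mult_left_mono) (auto simp: b_def)
    also have "\<dots> = (L / (L + 1)) / 2"
    proof -
      have "L + 1 > 0" using L0 by simp
      thus ?thesis using e(1) by (simp add: divide_simps)
    qed
    also have "\<dots> \<le> 1/2" using L0 by simp
    finally show ?thesis .
  qed
  have "norm (E (F x - F y) - (x - y)) \<le> 1/2 * norm (x - y)" if "x \<in> ?B" "y \<in> ?B" for x y
  proof -
    have "norm ((E (F x) - x) - (E (F y) - y)) \<le> 1/2 * norm (x - y)"
    proof (rule differentiable_bound[of ?B "\<lambda>x. E (F x) - x" "\<lambda>x v. ((E o\<^sub>L D x) - id_blinfun) v"])
      fix z assume "z \<in> ?B"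
      show "((\<lambda>x. E (F x) - x) has_derivative (\<lambda>v. ((E o\<^sub>L D z) - id_blinfun) v)) (at z within ?B)"
        by (rule has_derivative_at_withinI)
           (auto intro!: derivative_eq_intros F[of z] simp: blinfun.diff_left)
      show "onorm (\<lambda>v. ((E o\<^sub>L D z) - id_blinfun) v) \<le> 1/2"
        using ED[OF \<open>z \<in> ?B\<close>] by (simp add: norm_blinfun.rep_eq)
    qed (use that in auto)
    thus ?thesis by (simp add: blinfun.diff_right algebra_simps)
  qed
  hence lower: "norm (x - y) \<le> 2 * e * norm (F x - F y)" if "x \<in> ?B" "y \<in> ?B" for x y
  proof -
    have "norm (x - y) \<le> norm (E (F x - F y)) + 1/2 * norm (x - y)"
      using \<open>\<And>y x. x \<in> ?B \<Longrightarrow> y \<in> ?B \<Longrightarrow> norm (E (F x - F y) - (x - y)) \<le> 1/2 * norm (x - y)\<close>[OF that]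
        norm_triangle_sub[of "x - y" "E (F x - F y)"] by (simp add: norm_minus_commute)
    moreover have "norm (E (F x - F y)) \<le> e * norm (F x - F y)"
      using norm_blinfun[of E "F x - F y"] e by (meson mult_right_mono norm_ge_zero order_trans)
    ultimately show ?thesis by simp
  qed
  have inj: "inj_on F ?B" using lower by (intro inj_onI) force
  have FV: "F ` ?B \<subseteq> V" using hom b(2) by (auto simp: homeomorphism_def)
  have gF: "g (F x) = x" if "x \<in> ?B" for x using hom b(2) that by (auto simp: homeomorphism_def)
  have op: "open (F ` ?B)"
  proof -
    have "F ` ?B = V \<inter> g -` ?B" using hom b(2) FV by (auto simp: homeomorphism_def image_iff subset_iff)
    moreover have "open (V \<inter> g -` ?B)"
      using hom \<open>open V\<close> by (auto simp: homeomorphism_def intro!: continuous_open_preimage)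
    ultimately show ?thesis by simp
  qed
  have invg: "inv_into ?B F y = g y" if "y \<in> F ` ?B" for y using that inj gF by (auto simp: inv_into_f_f)
  define G where "G y = Blinfun (inv (blinfun_apply (D (g y))))" for y
  have G: "blinfun_apply (G y) = inv (blinfun_apply (D (g y)))" if "y \<in> V" for y
    unfolding G_def using g[OF that] g'[OF that]
    by (intro bounded_linear_Blinfun_apply) (metis has_derivative_bounded_linear)
  have GD: "D (g y) o\<^sub>L G y = id_blinfun" "G y o\<^sub>L D (g y) = id_blinfun" if "y \<in> V" for y
    using bij[OF that] G[OF that] by (auto intro!: blinfun_eqI simp: bij_is_surj surj_f_inv_f bij_is_inj inv_f_f)
  have Gb: "norm (G y) \<le> 2 * e" if y: "y \<in> F ` ?B" for y
  proof -
    have yV: "y \<in> V" and gy: "g y \<in> ?B" using y FV gF by auto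
    define X where "X = ((E o\<^sub>L D (g y)) - id_blinfun) o\<^sub>L G y"
    have "G y = E - X"
      by (simp add: X_def blinfun_compose_diff_left blinfun_compose_assoc GD[OF yV] blinfun_compose_id)
    hence "norm (G y) \<le> norm E + norm X" using norm_triangle_ineq4[of E X] by simp
    also have "\<dots> \<le> e + 1/2 * norm (G y)" using e ED[OF gy] unfolding X_def
      by (intro add_mono order_trans[OF norm_blinfun_compose] mult_right_mono) auto
    finally show ?thesis by simp
  qed
  have "C11_on ?B F" unfolding C11_on_def using F L lipschitz_on_subset by blast
  moreover have "C11_on (F ` ?B) (inv_into ?B F)" unfolding C11_on_def
  proof (intro exI[of _ G] exI[of _ "(2 * e) * (L * (2 * e)) * (2 * e)"] conjI ballI)
    fix y assume y: "y \<in> F ` ?B"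
    hence "y \<in> V" using FV by blast
    hence "(g has_derivative blinfun_apply (G y)) (at y)" using g[of y] g'[of y] G[of y] by simp
    thus "(inv_into ?B F has_derivative blinfun_apply (G y)) (at y)"
      by (rule has_derivative_transform_within_open[OF _ op y]) (simp add: invg)
  next
    show "((2 * e) * (L * (2 * e)) * (2 * e))-lipschitz_on (F ` ?B) G"
    proof (rule lipschitz_onI)
      fix y z assume yz: "y \<in> F ` ?B" "z \<in> F ` ?B"
      hence V: "y \<in> V" "z \<in> V" and gb: "g y \<in> ?B" "g z \<in> ?B" and Fg: "F (g y) = y" "F (g z) = z"
        using FV gF by auto
      have "G y - G z = G y o\<^sub>L (D (g z) - D (g y)) o\<^sub>L G z"
        by (simp add: blinfun_compose_diff_left blinfun_compose_diff_right GD[OF V(1)] GD[OF V(2)]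
            blinfun_compose_assoc blinfun_compose_id)
      also have "norm \<dots> \<le> norm (G y) * norm (D (g z) - D (g y)) * norm (G z)"
        by (meson mult_right_mono norm_blinfun_compose norm_ge_zero order_trans)
      also have "\<dots> \<le> (2 * e) * (L * (2 * e * norm (y - z))) * (2 * e)"
      proof (intro mult_mono)
        have "norm (D (g z) - D (g y)) \<le> L * norm (g y - g z)"
          using lipschitz_onD[OF L, of "g y" "g z"] by (simp add: dist_norm norm_minus_commute)
        also have "\<dots> \<le> L * (2 * e * norm (y - z))" using lower[OF gb] Fg L0 by (intro mult_left_mono) auto
        finally show "norm (D (g z) - D (g y)) \<le> L * (2 * e * norm (y - z))" .
      qed (use Gb yz e L0 in auto)
      finally show "dist (G y) (G z) \<le> (2 * e) * (L * (2 * e)) * (2 * e) * dist y z"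
        by (simp add: dist_norm mult_ac)
    qed (use e L0 in auto)
  qed
  ultimately have "C11_diffeo ?B F" using inj op by (simp add: C11_diffeo_def)
  thus ?thesis using that b(1) by blast
qed

section \<open>Calculus of jets\<close>

lemma linear_blinfun: "linear (blinfun_apply A)" using blinfun.bounded_linear_right bounded_linear.linear by blast

lemma norm_blinfun_le: "norm A \<le> b \<Longrightarrow> norm (blinfun_apply A v) \<le> b * norm v"
  by (rule order_trans[OF norm_blinfun]) (simp add: mult_right_mono)

definition rank_one :: "'a::real_inner \<Rightarrow> 'b::real_normed_vector \<Rightarrow> 'a \<Rightarrow>\<^sub>L 'b" where
  "rank_one e z = blinfun_scaleR_left z o\<^sub>L blinfun_inner_left e"

lemma rank_one_apply [simp]: "rank_one e z v = (v \<bullet> e) *\<^sub>R z" by (simp add: rank_one_def inner_commute)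

lemma abs_inner_le_norm: "norm e = 1 \<Longrightarrow> \<bar>v \<bullet> e\<bar> \<le> norm v"
  using Cauchy_Schwarz_ineq2[of v e] by simp

lemma half_split:
  fixes p a b :: "'a::real_vector"
  shows "p - a = (p - (1/2) *\<^sub>R (a + b)) - (1/2) *\<^sub>R (a - b)"
proof -
  have "a = (1/2) *\<^sub>R (a + b) + (1/2) *\<^sub>R (a - b)" by (simp flip: scaleR_add_right)
  from arg_cong[OF this, of "\<lambda>w. p - w"] show ?thesis by (simp only: diff_diff_eq)
qed

lemma half_diff:
  fixes a b p :: "'a::real_vector"
  shows "(1/2) *\<^sub>R (a + b) - p = (1/2) *\<^sub>R ((a - p) + (b - p))"
proof -
  have "(1/2) *\<^sub>R (p + p) = p" by (simp flip: scaleR_2)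
  moreover have "(a - p) + (b - p) = (a + b) - (p + p)" by simp
  ultimately show ?thesis by (simp only: scaleR_diff_right)
qed

lemma jetD:
  assumes "jet K f D M" "x \<in> K" "y \<in> K"
  shows "norm (f y - f x - D x (y - x)) \<le> M * (norm (y - x))\<^sup>2" "norm (D y - D x) \<le> M * norm (y - x)"
  using assms by (auto simp: jet_def)

lemma jet_subset: "jet K f D M \<Longrightarrow> K' \<subseteq> K \<Longrightarrow> jet K' f D M"
  by (auto simp: jet_def)

lemma jet_lipschitz:
  assumes K: "bounded K" and jet: "jet K f D M" and M: "M \<ge> 0"
  obtains l where "l \<ge> 0" "\<And>x. x \<in> K \<Longrightarrow> norm (D x) \<le> l"
    "\<And>x y. \<lbrakk>x \<in> K; y \<in> K\<rbrakk> \<Longrightarrow> norm (f y - f x) \<le> l * norm (y - x)"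
proof (cases "K = {}")
  case False
  then obtain k where k: "k \<in> K" by blast
  obtain R where R: "R > 0" "\<And>x. x \<in> K \<Longrightarrow> norm x \<le> R" using K bounded_pos by blast
  have MR: "M * norm (y - x) \<le> M * (2 * R)" if "x \<in> K" "y \<in> K" for x y
    using R(2)[OF that(1)] R(2)[OF that(2)] norm_triangle_ineq4[of y x] M by (intro mult_left_mono) linarith+
  define b where "b = norm (D k) + M * (2 * R)"
  have b: "norm (D x) \<le> b" if "x \<in> K" for x
    using jetD(2)[OF jet k that] MR[OF k that] norm_triangle_sub[of "D x" "D k"] by (simp add: b_def)
  have MR0: "0 \<le> M * (2 * R)" using M R(1) by simp
  have "norm (f y - f x) \<le> (b + M * (2 * R)) * norm (y - x)" if "x \<in> K" "y \<in> K" for x y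
  proof -
    have "M * (norm (y - x))\<^sup>2 \<le> M * (2 * R) * norm (y - x)"
      using mult_right_mono[OF MR[OF that], of "norm (y - x)"] by (simp add: power2_eq_square mult.assoc)
    thus ?thesis
      using jetD(1)[OF jet that] norm_triangle_sub[of "f y - f x" "D x (y - x)"] norm_blinfun_le[OF b[OF that(1)], of "y - x"]
      unfolding distrib_right by linarith
  qed
  moreover have "b + M * (2 * R) \<ge> 0" using MR0 by (simp add: b_def)
  moreover have "norm (D x) \<le> b + M * (2 * R)" if "x \<in> K" for x using b[OF that] MR0 by linarith
  ultimately show ?thesis by (intro that)
qed (use that[of 0] in simp)

text \<open>Taylor expansion of f at p towards x and towards y: the linear parts average to D p
  applied to (x + y)/2 - p, which is quadratically small, and the remainders are quadratic because
  on a bounded K both |x - p| and |y - p| are at most a multiple of |x - y|. The bound G converts |x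
  - y| into the distance of the images.\<close>

lemma jet_mid:
  fixes f :: "'a::euclidean_space \<Rightarrow> 'b::euclidean_space"
  assumes K: "bounded K" and jet: "jet K f D M" and M: "M \<ge> 0" and C: "C \<ge> 0"
    and G: "\<And>x y. \<lbrakk>x \<in> K; y \<in> K\<rbrakk> \<Longrightarrow> norm (y - x) \<le> G * norm (f y - f x)"
  obtains C' where "C' \<ge> 0" "\<And>x y p. \<lbrakk>x \<in> K; y \<in> K; p \<in> K; norm (p - (1/2) *\<^sub>R (x + y)) \<le> C * (norm (x - y))\<^sup>2\<rbrakk> \<Longrightarrow>
    norm (f p - (1/2) *\<^sub>R (f x + f y)) \<le> C' * (norm (f x - f y))\<^sup>2"
proof -
  obtain l where l: "l \<ge> 0" "\<And>x. x \<in> K \<Longrightarrow> norm (D x) \<le> l" using jet_lipschitz[OF K jet M] by metis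
  obtain R where R: "R > 0" "\<And>x. x \<in> K \<Longrightarrow> norm x \<le> R" using K bounded_pos by blast
  define k C' where "k = 1 + 2 * (C * R)" and "C' = (M * k\<^sup>2 + l * C) * G\<^sup>2"
  have C': "C' \<ge> 0" "M * k\<^sup>2 + l * C \<ge> 0" using M l(1) C by (simp_all add: C'_def)
  have "norm (f p - (1/2) *\<^sub>R (f x + f y)) \<le> C' * (norm (f x - f y))\<^sup>2"
    if x: "x \<in> K" and y: "y \<in> K" and p: "p \<in> K" and m: "norm (p - (1/2) *\<^sub>R (x + y)) \<le> C * (norm (x - y))\<^sup>2" for x y p
  proof -
    define d where "d = norm (x - y)"
    have "d \<le> 2 * R" using R(2)[OF x] R(2)[OF y] norm_triangle_ineq4[of x y] by (simp add: d_def)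
    hence "C * d * d \<le> C * (2 * R) * d" using C by (intro mult_right_mono mult_left_mono) (auto simp: d_def)
    hence Cd: "C * d\<^sup>2 \<le> 2 * (C * R) * d" by (simp add: power2_eq_square mult_ac)
    have near: "norm (z - p) \<le> k * d" if "norm (p - (1/2) *\<^sub>R (z + z')) \<le> C * d\<^sup>2" "norm (z - z') = d" for z z'
    proof -
      have "norm (p - z) \<le> C * d\<^sup>2 + 1/2 * d"
        unfolding half_split[of p z z'] by (rule order_trans[OF norm_triangle_ineq4 add_mono]) (use that in simp_all)
      moreover have "0 \<le> d" by (simp add: d_def)
      ultimately show ?thesis using Cd unfolding k_def distrib_right norm_minus_commute[of z p] by linarith
    qed
    have A: "norm (f z - f p - D p (z - p)) \<le> M * (k\<^sup>2 * d\<^sup>2)" if "z \<in> K" "norm (z - p) \<le> k * d" for z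
    proof -
      have "M * (norm (z - p))\<^sup>2 \<le> M * (k * d)\<^sup>2" using that(2) M by (intro mult_left_mono power_mono) auto
      thus ?thesis using jetD(1)[OF jet p that(1)] by (simp add: power_mult_distrib)
    qed
    have B: "norm (f x - f p - D p (x - p)) \<le> M * (k\<^sup>2 * d\<^sup>2)" "norm (f y - f p - D p (y - p)) \<le> M * (k\<^sup>2 * d\<^sup>2)"
      using m by (intro A x y near[of x y] near[of y x]; simp add: d_def add.commute norm_minus_commute)+
    have "D p ((1/2) *\<^sub>R (x + y) - p) = (1/2) *\<^sub>R (D p (x - p) + D p (y - p))"
      unfolding half_diff[of x y p] by (simp only: blinfun.scaleR_right blinfun.add_right)
    hence eq: "(1/2) *\<^sub>R (f x + f y) - f p = (1/2) *\<^sub>R ((f x - f p - D p (x - p)) + (f y - f p - D p (y - p))) + D p ((1/2) *\<^sub>R (x + y) - p)"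
      unfolding half_diff by (simp add: scaleR_add_right scaleR_diff_right)
    have "norm (D p ((1/2) *\<^sub>R (x + y) - p)) \<le> l * (C * d\<^sup>2)"
      by (rule order_trans[OF norm_blinfun_le[OF l(2)[OF p]] mult_left_mono[OF _ l(1)]]) (use m in \<open>simp add: d_def norm_minus_commute\<close>)
    hence "norm ((1/2) *\<^sub>R (f x + f y) - f p) \<le> M * (k\<^sup>2 * d\<^sup>2) + l * (C * d\<^sup>2)"
      unfolding eq by (intro order_trans[OF norm_triangle_ineq add_mono])
        (use B norm_triangle_ineq[of "f x - f p - D p (x - p)" "f y - f p - D p (y - p)"] in simp_all)
    also have "\<dots> = (M * k\<^sup>2 + l * C) * d\<^sup>2" by (simp add: algebra_simps)
    also have "\<dots> \<le> (M * k\<^sup>2 + l * C) * (G * norm (f x - f y))\<^sup>2"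
      unfolding d_def using G[OF y x] C'(2) by (intro mult_left_mono power_mono) auto
    finally show ?thesis by (simp add: C'_def power_mult_distrib norm_minus_commute mult.assoc)
  qed
  thus ?thesis using that C'(1) by blast
qed

lemma jet_compose:
  fixes f :: "'a::euclidean_space \<Rightarrow> 'b::euclidean_space" and g :: "'b \<Rightarrow> 'c::euclidean_space"
  assumes K: "bounded K" and f: "jet K f D M" and g: "jet (f ` K) g D' M'" and M: "M \<ge> 0" "M' \<ge> 0"
  obtains M'' where "jet K (g \<circ> f) (\<lambda>x. D' (f x) o\<^sub>L D x) M''"
proof -
  obtain l where l: "l \<ge> 0" "\<And>x. x \<in> K \<Longrightarrow> norm (D x) \<le> l" "\<And>x y. \<lbrakk>x \<in> K; y \<in> K\<rbrakk> \<Longrightarrow> norm (f y - f x) \<le> l * norm (y - x)"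
    by (rule jet_lipschitz[OF K f M(1)]) (rule that)
  have "l-lipschitz_on K f" using l by (intro lipschitz_onI) (auto simp: dist_norm norm_minus_commute)
  hence "bounded (f ` K)" using K lipschitz_on_uniformly_continuous bounded_uniformly_continuous_image by blast
  from jet_lipschitz[OF this g M(2)] obtain l' where l': "l' \<ge> 0" "\<And>x. x \<in> K \<Longrightarrow> norm (D' (f x)) \<le> l'" by (metis imageI)
  define M'' where "M'' = (M' * l\<^sup>2 + l' * M) + (M' * l * l + l' * M)"
  have M'': "M' * l\<^sup>2 + l' * M \<le> M''" "M' * l * l + l' * M \<le> M''" using M l(1) l'(1) by (simp_all add: M''_def)
  have "jet K (g \<circ> f) (\<lambda>x. D' (f x) o\<^sub>L D x) M''" unfolding jet_def
  proof (intro ballI conjI)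
    fix x y assume x: "x \<in> K" and y: "y \<in> K"
    define d where "d = norm (y - x)"
    have d0: "d \<ge> 0" by (simp add: d_def)
    note gJ = jetD[OF g imageI[OF x] imageI[OF y]]
    have eq: "(g \<circ> f) y - (g \<circ> f) x - (D' (f x) o\<^sub>L D x) (y - x) =
      (g (f y) - g (f x) - D' (f x) (f y - f x)) + D' (f x) (f y - f x - D x (y - x))"
      by (simp add: blinfun.diff_right)
    have "M' * (norm (f y - f x))\<^sup>2 \<le> M' * (l * d)\<^sup>2"
      unfolding d_def using l(3)[OF x y] M by (intro mult_left_mono power_mono) auto
    hence 1: "norm (g (f y) - g (f x) - D' (f x) (f y - f x)) \<le> M' * l\<^sup>2 * d\<^sup>2"
      using gJ(1) by (simp add: power_mult_distrib mult.assoc)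
    have 2: "norm (D' (f x) (f y - f x - D x (y - x))) \<le> l' * (M * d\<^sup>2)"
      by (rule order_trans[OF norm_blinfun_le[OF l'(2)[OF x]] mult_left_mono[OF _ l'(1)]]) (use jetD(1)[OF f x y] in \<open>simp add: d_def\<close>)
    have "norm ((g \<circ> f) y - (g \<circ> f) x - (D' (f x) o\<^sub>L D x) (y - x)) \<le> M' * l\<^sup>2 * d\<^sup>2 + l' * (M * d\<^sup>2)"
      unfolding eq by (rule order_trans[OF norm_triangle_ineq add_mono[OF 1 2]])
    also have "\<dots> = (M' * l\<^sup>2 + l' * M) * d\<^sup>2" by (simp add: distrib_right)
    also have "\<dots> \<le> M'' * d\<^sup>2" using M''(1) by (intro mult_right_mono) auto
    finally show "norm ((g \<circ> f) y - (g \<circ> f) x - (D' (f x) o\<^sub>L D x) (y - x)) \<le> M'' * (norm (y - x))\<^sup>2"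
      by (simp add: d_def)
    have eq': "(D' (f y) o\<^sub>L D y) - (D' (f x) o\<^sub>L D x) = ((D' (f y) - D' (f x)) o\<^sub>L D y) + (D' (f x) o\<^sub>L (D y - D x))"
      by (simp add: blinfun_compose_diff_left blinfun_compose_diff_right)
    have "norm (D' (f y) - D' (f x)) \<le> M' * (l * d)"
      using gJ(2) mult_left_mono[OF l(3)[OF x y] M(2)] by (simp add: d_def)
    hence 3: "norm ((D' (f y) - D' (f x)) o\<^sub>L D y) \<le> (M' * (l * d)) * l"
      using l(2)[OF y] l(1) M d0 by (intro order_trans[OF norm_blinfun_compose] mult_mono) auto
    have 4: "norm (D' (f x) o\<^sub>L (D y - D x)) \<le> l' * (M * d)"
      unfolding d_def using l'(2)[OF x] l'(1) jetD(2)[OF f x y] by (intro order_trans[OF norm_blinfun_compose] mult_mono) auto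
    have "norm ((D' (f y) o\<^sub>L D y) - (D' (f x) o\<^sub>L D x)) \<le> (M' * (l * d)) * l + l' * (M * d)"
      unfolding eq' by (rule order_trans[OF norm_triangle_ineq add_mono[OF 3 4]])
    also have "\<dots> = (M' * l * l + l' * M) * d" by (simp add: algebra_simps)
    also have "\<dots> \<le> M'' * d" using M''(2) d0 by (intro mult_right_mono)
    finally show "norm ((D' (f y) o\<^sub>L D y) - (D' (f x) o\<^sub>L D x)) \<le> M'' * norm (y - x)"
      by (simp add: d_def)
  qed
  thus ?thesis by (rule that)
qed

text \<open>Since |(y - x) . e| \<le> |y - x|, the shear inherits the constant of \<open>g\<close>.
  This serves \<open>straighten\<close> for the shear there and for its inverse.\<close>

lemma shear_jet:
  fixes e :: "'a::euclidean_space"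
  assumes e: "norm e = 1" and M: "M \<ge> 0" and J: "\<And>x. x \<in> K \<Longrightarrow> x \<bullet> e \<in> J"
    and g: "\<And>s t. \<lbrakk>s \<in> J; t \<in> J\<rbrakk> \<Longrightarrow> norm (g t - g s - (t - s) *\<^sub>R g' s) \<le> M * (t - s)\<^sup>2"
    and g': "\<And>s t. \<lbrakk>s \<in> J; t \<in> J\<rbrakk> \<Longrightarrow> norm (g' t - g' s) \<le> M * \<bar>t - s\<bar>"
  shows "jet K (\<lambda>x. x + g (x \<bullet> e)) (\<lambda>x. id_blinfun + rank_one e (g' (x \<bullet> e))) M"
  unfolding jet_def
proof (intro ballI conjI)
  fix x y assume x: "x \<in> K" and y: "y \<in> K"
  define t s where "t = y \<bullet> e" and "s = x \<bullet> e"
  have ts: "t - s = (y - x) \<bullet> e" by (simp add: t_def s_def inner_diff_left)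
  have "\<bar>t - s\<bar> \<le> norm (y - x)" unfolding ts by (rule abs_inner_le_norm[OF e])
  hence "M * (t - s)\<^sup>2 \<le> M * (norm (y - x))\<^sup>2" and le: "M * \<bar>t - s\<bar> \<le> M * norm (y - x)"
    using M by (auto intro!: mult_left_mono simp: power2_le_iff_abs_le)
  moreover have eq: "(y + g t) - (x + g s) - (id_blinfun + rank_one e (g' s)) (y - x) = g t - g s - (t - s) *\<^sub>R g' s"
    by (simp add: ts blinfun.add_left)
  ultimately show "norm ((y + g (y \<bullet> e)) - (x + g (x \<bullet> e)) - (id_blinfun + rank_one e (g' (x \<bullet> e))) (y - x)) \<le> M * (norm (y - x))\<^sup>2"
    using g[OF J[OF x] J[OF y]] unfolding t_def[symmetric] s_def[symmetric] eq by linarith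
  show "norm ((id_blinfun + rank_one e (g' (y \<bullet> e))) - (id_blinfun + rank_one e (g' (x \<bullet> e)))) \<le> M * norm (y - x)"
  proof (rule norm_blinfun_bound)
    fix v
    have "norm (((id_blinfun + rank_one e (g' t)) - (id_blinfun + rank_one e (g' s))) v) = \<bar>v \<bullet> e\<bar> * norm (g' t - g' s)"
      by (simp add: blinfun.diff_left blinfun.add_left flip: scaleR_diff_right)
    also have "\<dots> \<le> norm v * (M * norm (y - x))"
      using abs_inner_le_norm[OF e] g'[OF J[OF x] J[OF y]] le by (intro mult_mono) (auto simp: t_def s_def)
    finally show "norm (((id_blinfun + rank_one e (g' (y \<bullet> e))) - (id_blinfun + rank_one e (g' (x \<bullet> e)))) v) \<le> M * norm (y - x) * norm v"
      by (simp add: t_def s_def mult.commute)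
  qed (use M in simp)
qed

text \<open>W need not be convex. For |y - x| \<le> h the segment lies in U and the mean value
  inequality applies; for larger distances the remainder is bounded on W, and division by h^2 makes
  it quadratic.\<close>

lemma C11_on_jet:
  fixes f :: "'a::euclidean_space \<Rightarrow> 'a"
  assumes f: "C11_on U f" and U: "open U" and W: "compact W" "W \<subseteq> U"
  obtains D M where "M \<ge> 0" "jet W f D M"
proof -
  obtain D L where D: "\<And>x. x \<in> U \<Longrightarrow> (f has_derivative blinfun_apply (D x)) (at x)" and L: "L-lipschitz_on U D"
    using f by (auto simp: C11_on_def)
  have L0: "L \<ge> 0" using L lipschitz_on_nonneg by blast
  obtain h where h: "h > 0" "(\<Union>x\<in>W. cball x h) \<subseteq> U"
    by (rule compact_subset_open_imp_cball_epsilon_subset[OF W(1) U W(2)])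
  have cont: "continuous_on W D" using L W(2) lipschitz_on_continuous_on continuous_on_subset by blast
  have "continuous_on W f" using D W(2) has_derivative_continuous by (metis continuous_at_imp_continuous_on subsetD)
  hence "bounded (f ` W)" "bounded (D ` W)" "bounded W"
    using cont W(1) compact_continuous_image compact_imp_bounded by blast+
  then obtain a b c where abc: "\<And>x. x \<in> W \<Longrightarrow> norm (f x) \<le> a" "b > 0" "\<And>x. x \<in> W \<Longrightarrow> norm (D x) \<le> b" "\<And>x. x \<in> W \<Longrightarrow> norm x \<le> c"
    unfolding bounded_pos by (metis imageI)
  define q where "q = 2 * \<bar>a\<bar> + b * (2 * c)"
  define M where "M = L + \<bar>q\<bar> / h\<^sup>2"
  have M: "L \<le> M" "\<bar>q\<bar> / h\<^sup>2 \<le> M" using L0 by (simp_all add: M_def)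
  have "norm (f y - f x - D x (y - x)) \<le> M * (norm (y - x))\<^sup>2" if x: "x \<in> W" and y: "y \<in> W" for x y
  proof (cases "norm (y - x) \<le> h")
    case True
    have "closed_segment x y \<subseteq> cball x h"
      by (rule closed_segment_subset) (use True h(1) in \<open>auto simp: dist_norm norm_minus_commute\<close>)
    hence seg: "closed_segment x y \<subseteq> U" using h(2) x by blast
    have "norm (f y - f x - D x (y - x)) \<le> norm (y - x) * (L * norm (y - x))"
    proof (rule differentiable_bound_linearization[where S = "closed_segment x y" and f' = "\<lambda>z. blinfun_apply (D z)"])
      show "x + t *\<^sub>R (y - x) \<in> closed_segment x y" if "t \<in> {0..1}" for t
        using that unfolding in_segment by (intro exI[of _ t]) (auto simp: algebra_simps)
      show "(f has_derivative blinfun_apply (D z)) (at z within closed_segment x y)" if "z \<in> closed_segment x y" for z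
        by (rule has_derivative_at_withinI[OF D]) (use that seg in blast)
      show "onorm (blinfun_apply (D z) - blinfun_apply (D x)) \<le> L * norm (y - x)" if z: "z \<in> closed_segment x y" for z
      proof -
        have "blinfun_apply (D z) - blinfun_apply (D x) = blinfun_apply (D z - D x)"
          by (rule ext) (simp add: blinfun.diff_left)
        hence "onorm (blinfun_apply (D z) - blinfun_apply (D x)) = norm (D z - D x)" by (simp add: norm_blinfun.rep_eq)
        also have "\<dots> \<le> L * norm (z - x)"
          using lipschitz_onD[OF L, of z x] z seg by (simp add: dist_norm subset_eq)
        also have "\<dots> \<le> L * norm (y - x)" using L0 segment_bound(1)[OF z] by (intro mult_left_mono) auto
        finally show ?thesis .
      qed
    qed simp
    also have "\<dots> = L * (norm (y - x))\<^sup>2" by (simp add: power2_eq_square)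
    also have "\<dots> \<le> M * (norm (y - x))\<^sup>2" using M(1) by (intro mult_right_mono) auto
    finally show ?thesis .
  next
    case False
    have "norm (y - x) \<le> 2 * c" using abc(4)[OF x] abc(4)[OF y] norm_triangle_ineq4[of y x] by linarith
    hence "norm (D x (y - x)) \<le> b * (2 * c)"
      using norm_blinfun_le[OF abc(3)[OF x], of "y - x"] mult_left_mono[of "norm (y - x)" "2 * c" b] abc(2) by linarith
    hence "norm (f y - f x - D x (y - x)) \<le> \<bar>q\<bar>"
      using norm_triangle_ineq4[of "f y - f x" "D x (y - x)"] norm_triangle_ineq4[of "f y" "f x"] abc(1)[OF x] abc(1)[OF y]
      unfolding q_def by linarith
    also have "\<dots> = \<bar>q\<bar> / h\<^sup>2 * h\<^sup>2" using h(1) by simp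
    also have "\<dots> \<le> M * (norm (y - x))\<^sup>2" using M L0 False h(1) by (intro mult_mono power_mono) auto
    finally show ?thesis .
  qed
  moreover have "norm (D y - D x) \<le> M * norm (y - x)" if "x \<in> W" "y \<in> W" for x y
    using lipschitz_onD[OF L, of y x] that W(2) mult_right_mono[OF M(1), of "norm (y - x)"] by (force simp: dist_norm)
  ultimately show ?thesis using that[of M D] M L0 by (simp add: jet_def)
qed

section \<open>Planar dimension, limits along grids, midpoint convexity\<close>

section \<open>The covering dimension of planar compacta\<close>

text \<open>Cells, edges and vertices of the square grid, thickened so that sets of the same kind are
  disjoint: \<open>box 0\<close> are the cells, \<open>box 1\<close> and \<open>box 2\<close> the edges, \<open>box 3\<close> the vertices.\<close>

definition box :: "nat \<Rightarrow> int \<Rightarrow> int \<Rightarrow> real \<Rightarrow> real \<Rightarrow> bool" where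
  "box k i j x y \<longleftrightarrow>
    k = 0 \<and> i + 1/9 < x \<and> x < i + 8/9 \<and> j + 1/9 < y \<and> y < j + 8/9 \<or>
    k = 1 \<and> i + 1/5 < x \<and> x < i + 4/5 \<and> j - 1/8 < y \<and> y < j + 1/8 \<or>
    k = 2 \<and> i - 1/8 < x \<and> x < i + 1/8 \<and> j + 1/5 < y \<and> y < j + 4/5 \<or>
    k = 3 \<and> i - 1/4 < x \<and> x < i + 1/4 \<and> j - 1/4 < y \<and> y < j + 1/4"

lemma box_indices:
  assumes "box k i j x y"
  shows "(k, i, j) \<in> {(0, \<lfloor>x\<rfloor>, \<lfloor>y\<rfloor>), (3, \<lfloor>x + 1/4\<rfloor>, \<lfloor>y + 1/4\<rfloor>),
    (1, \<lfloor>x\<rfloor>, \<lfloor>y + 1/8\<rfloor>), (2, \<lfloor>x + 1/8\<rfloor>, \<lfloor>y\<rfloor>)}"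
proof -
  show ?thesis using assms unfolding box_def by (elim disjE conjE) (auto intro!: floor_unique[symmetric])
qed

lemma box_edges_disjoint: "box 1 i j x y \<Longrightarrow> \<not> box 2 i' j' x y"
proof
  assume "box 1 i j x y" "box 2 i' j' x y"
  hence "real_of_int j' < real_of_int j" "real_of_int j < real_of_int j' + 1" unfolding box_def by auto
  hence "j' < j" "j < j' + 1" by linarith+
  thus False by simp
qed

text \<open>A point lies in at most one box of each of the four kinds, and never in a horizontal and
  a vertical edge at once.\<close>

lemma card_boxes:
  shows "finite {(k, i, j). box k i j x y}" "card {(k, i, j). box k i j x y} \<le> 3"
proof -
  define a b c d where "a = (0::nat, \<lfloor>x\<rfloor>, \<lfloor>y\<rfloor>)" and "b = (3::nat, \<lfloor>x + 1/4\<rfloor>, \<lfloor>y + 1/4\<rfloor>)"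
    and "c = (1::nat, \<lfloor>x\<rfloor>, \<lfloor>y + 1/8\<rfloor>)" and "d = (2::nat, \<lfloor>x + 1/8\<rfloor>, \<lfloor>y\<rfloor>)"
  let ?S = "{(k, i, j). box k i j x y}"
  have sub: "?S \<subseteq> {a, b, c, d}" using box_indices unfolding a_def b_def c_def d_def by blast
  thus "finite ?S" by (rule finite_subset) simp
  have "c \<notin> ?S \<or> d \<notin> ?S" using box_edges_disjoint by (auto simp: c_def d_def)
  hence "?S \<subseteq> {a, b, c} \<or> ?S \<subseteq> {a, b, d}" using sub by blast
  moreover have "card {a, b, c} \<le> 3" "card {a, b, d} \<le> 3" by (auto simp: card_insert_if)
  ultimately show "card ?S \<le> 3" by (meson card_mono finite.emptyI finite.insertI order_trans)
qed

lemma box_cover: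
  obtains k i j where "box k i j x y" "\<bar>real_of_int i\<bar> \<le> \<bar>x\<bar> + 1" "\<bar>real_of_int j\<bar> \<le> \<bar>y\<bar> + 1" "k \<le> 3"
proof -
  define i j where "i = \<lfloor>x\<rfloor>" and "j = \<lfloor>y\<rfloor>"
  have i: "i \<le> x" "x < i + 1" and j: "j \<le> y" "y < j + 1" by (auto simp: i_def j_def)
  have bi: "\<bar>real_of_int i\<bar> \<le> \<bar>x\<bar> + 1" "\<bar>real_of_int (i + 1)\<bar> \<le> \<bar>x\<bar> + 1" using i by (auto simp: abs_le_iff abs_if)
  have bj: "\<bar>real_of_int j\<bar> \<le> \<bar>y\<bar> + 1" "\<bar>real_of_int (j + 1)\<bar> \<le> \<bar>y\<bar> + 1" using j by (auto simp: abs_le_iff abs_if)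
  have near: "real_of_int i' - a < z \<and> z < real_of_int i' + a" if "\<bar>z - i'\<bar> < a" for z a i'
    using that by auto
  consider (cell) "i + 1/9 < x \<and> x < i + 8/9 \<and> j + 1/9 < y \<and> y < j + 8/9"
    | (x) i' where "i' \<in> {i, i + 1}" "\<bar>x - i'\<bar> < 1/8"
    | (y) j' where "j' \<in> {j, j + 1}" "\<bar>y - j'\<bar> < 1/8"
  proof -
    have "\<bar>x - i\<bar> < 1/8" if "x \<le> i + 1/9" using that i by auto
    moreover have "\<bar>x - (i + 1)\<bar> < 1/8" if "x \<ge> i + 8/9" using that i by auto
    moreover have "\<bar>y - j\<bar> < 1/8" if "y \<le> j + 1/9" using that j by auto
    moreover have "\<bar>y - (j + 1)\<bar> < 1/8" if "y \<ge> j + 8/9" using that j by auto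
    ultimately show ?thesis using cell x[of i] x[of "i + 1"] y[of j] y[of "j + 1"] by (force simp: not_less)
  qed
  thus ?thesis
  proof cases
    case cell
    hence "box 0 i j x y" by (simp add: box_def)
    thus ?thesis using that bi bj by simp
  next
    case (x i')
    consider "j + 1/5 < y \<and> y < j + 4/5" | "\<bar>y - j\<bar> < 1/4" | "\<bar>y - (j + 1)\<bar> < 1/4" using j by force
    thus ?thesis
    proof cases
      case 1
      hence "box 2 i' j x y" using near[OF x(2)] by (simp add: box_def)
      thus ?thesis using that bi bj x(1) by auto
    next
      case 2
      hence "box 3 i' j x y" using near[OF x(2)] near[of y j "1/4"] by (simp add: box_def)
      thus ?thesis using that bi bj x(1) by auto
    next
      case 3
      hence "box 3 i' (j + 1) x y" using near[OF x(2)] near[of y "j + 1" "1/4"] by (simp add: box_def)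
      thus ?thesis using that[of 3 i' "j + 1"] bi bj x(1) by auto
    qed
  next
    case (y j')
    consider "i + 1/5 < x \<and> x < i + 4/5" | "\<bar>x - i\<bar> < 1/4" | "\<bar>x - (i + 1)\<bar> < 1/4" using i by force
    thus ?thesis
    proof cases
      case 1
      hence "box 1 i j' x y" using near[OF y(2)] by (simp add: box_def)
      thus ?thesis using that bi bj y(1) by auto
    next
      case 2
      hence "box 3 i j' x y" using near[OF y(2)] near[of x i "1/4"] by (simp add: box_def)
      thus ?thesis using that bi bj y(1) by auto
    next
      case 3
      hence "box 3 (i + 1) j' x y" using near[OF y(2)] near[of x "i + 1" "1/4"] by (simp add: box_def)
      thus ?thesis using that[of 3 "i + 1" j'] bi bj y(1) by auto
    qed
  qed
qed

lemma box_diam: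
  assumes "box k i j x y" "box k i j x' y'" shows "\<bar>x - x'\<bar> < 1" "\<bar>y - y'\<bar> < 1"
  using assms unfolding box_def by (auto simp: abs_less_iff)

text \<open>Lebesgue's argument: transport the cover to the plane set S, take a Lebesgue number e,
  and pull back by \<open>h\<close> the thickened grid of mesh e/2. Its order is bounded by
  \<open>card_boxes\<close>, and finitely many boxes suffice as S is bounded.\<close>

theorem covering_dim_le_planar:
  fixes S :: "(real \<times> real) set" and A :: "'a::metric_space set"
  assumes "compact S" and hom: "homeomorphism S A g h"
  shows "covering_dim_le A 2" unfolding covering_dim_le_def
proof (intro allI impI, elim conjE)
  fix c assume "finite c" and op: "\<forall>U\<in>c. openin (top_of_set A) U" and cov: "A \<subseteq> \<Union>c"
  have g: "continuous_on S g" "g ` S = A" and h: "continuous_on A h" "h ` A = S"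
    and gh: "\<And>y. y \<in> A \<Longrightarrow> g (h y) = y" using hom by (auto simp: homeomorphism_def)
  show "\<exists>f. finite f \<and> (\<forall>V\<in>f. openin (top_of_set A) V) \<and> A \<subseteq> \<Union>f \<and> (\<forall>V\<in>f. \<exists>U\<in>c. V \<subseteq> U) \<and>
      (\<forall>x\<in>A. card {V \<in> f. x \<in> V} \<le> 2 + 1)"
  proof (cases "A = {}")
    case True
    thus ?thesis by (intro exI[of _ "{}"]) auto
  next
    case False
    have "\<exists>W. open W \<and> S \<inter> g -` U = S \<inter> W" if "U \<in> c" for U
    proof -
      have "openin (top_of_set S) (S \<inter> g -` U)"
        using op that g by (intro continuous_openin_preimage[of _ _ A]) auto
      thus ?thesis by (auto simp: openin_open)
    qed
    then obtain W where W: "\<And>U. U \<in> c \<Longrightarrow> open (W U)" "\<And>U. U \<in> c \<Longrightarrow> S \<inter> g -` U = S \<inter> W U"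
      by metis
    have sub: "S \<subseteq> \<Union>(W ` c)"
    proof
      fix s assume s: "s \<in> S"
      then obtain U where "U \<in> c" "g s \<in> U" using cov g by blast
      thus "s \<in> \<Union>(W ` c)" using W(2) s by blast
    qed
    have opW: "\<And>G. G \<in> W ` c \<Longrightarrow> open G" using W(1) by blast
    obtain e where e: "e > 0" "\<And>s. s \<in> S \<Longrightarrow> \<exists>G\<in>W ` c. ball s e \<subseteq> G"
      using Heine_Borel_lemma[OF \<open>compact S\<close> sub opW] by blast
    define n where "n = 2 / e"
    have n: "n > 0" using e by (simp add: n_def)
    obtain B where B: "\<And>s. s \<in> S \<Longrightarrow> norm s \<le> B"
      using compact_imp_bounded[OF \<open>compact S\<close>] by (auto simp: bounded_iff)
    define N where "N = \<lceil>n * B + 1\<rceil>"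
    define V where "V = (\<lambda>(k, i, j). {x \<in> A. box k i j (n * fst (h x)) (n * snd (h x))})"
    define Q where "Q = {..3::nat} \<times> {-N..N} \<times> {-N..N}"
    define f where "f = V ` Q"
    have fin: "finite f" by (simp add: f_def Q_def)
    have opn: "openin (top_of_set A) U" if U: "U \<in> f" for U
    proof -
      obtain k i j where U: "U = V (k, i, j)" using U by (auto simp: f_def)
      have "open {p. box k i j (n * fst p) (n * snd p)}" unfolding box_def
        by (intro open_Collect_disj open_Collect_conj open_Collect_const open_Collect_less continuous_intros)
      moreover have "U = A \<inter> h -` {p. box k i j (n * fst p) (n * snd p)}" by (auto simp: U V_def)
      ultimately show ?thesis using h(1) continuous_openin_preimage_gen by metis
    qed
    have cvr: "A \<subseteq> \<Union>f"
    proof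
      fix x assume x: "x \<in> A"
      define s where "s = h x"
      have s: "s \<in> S" using x h by (auto simp: s_def)
      obtain k i j where b: "box k i j (n * fst s) (n * snd s)" "\<bar>real_of_int i\<bar> \<le> \<bar>n * fst s\<bar> + 1"
        "\<bar>real_of_int j\<bar> \<le> \<bar>n * snd s\<bar> + 1" "k \<le> 3" using box_cover by blast
      have "\<bar>fst s\<bar> \<le> B" "\<bar>snd s\<bar> \<le> B"
        using B[OF s] norm_fst_le[of "fst s" "snd s"] norm_snd_le[of "snd s" "fst s"] by auto
      hence "\<bar>n * fst s\<bar> \<le> n * B" "\<bar>n * snd s\<bar> \<le> n * B" using n by (auto simp: abs_mult)
      hence "\<bar>real_of_int i\<bar> \<le> N" "\<bar>real_of_int j\<bar> \<le> N" using b(2,3) unfolding N_def by linarith+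
      hence "(k, i, j) \<in> Q" using b(4) by (auto simp: Q_def)
      moreover have "x \<in> V (k, i, j)" using b(1) x by (simp add: V_def s_def)
      ultimately show "x \<in> \<Union>f" unfolding f_def by blast
    qed
    have ref: "\<exists>U'\<in>c. U \<subseteq> U'" if U: "U \<in> f" for U
    proof (cases "U = {}")
      case True
      thus ?thesis using cov False by blast
    next
      case False
      obtain k i j where U: "U = V (k, i, j)" using U by (auto simp: f_def)
      obtain x where x: "x \<in> U" using False by blast
      hence xA: "x \<in> A" by (simp add: U V_def)
      then obtain U' where U': "U' \<in> c" "ball (h x) e \<subseteq> W U'" using e(2)[of "h x"] h by blast
      have "y \<in> U'" if y: "y \<in> U" for y
      proof -
        have yA: "y \<in> A" using y by (simp add: U V_def)
        have "\<bar>n * fst (h x) - n * fst (h y)\<bar> < 1" "\<bar>n * snd (h x) - n * snd (h y)\<bar> < 1"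
          using x y by (auto simp: U V_def intro: box_diam)
        hence "n * \<bar>fst (h x) - fst (h y)\<bar> < 1" "n * \<bar>snd (h x) - snd (h y)\<bar> < 1"
          using n by (simp_all add: abs_mult flip: right_diff_distrib)
        hence "\<bar>fst (h x) - fst (h y)\<bar> < e / 2" "\<bar>snd (h x) - snd (h y)\<bar> < e / 2"
          using e(1) by (simp_all add: n_def mult.commute pos_less_divide_eq)
        moreover have "norm (h x - h y) \<le> \<bar>fst (h x) - fst (h y)\<bar> + \<bar>snd (h x) - snd (h y)\<bar>"
          using norm_Pair_le[of "fst (h x - h y)" "snd (h x - h y)", unfolded prod.collapse] by simp
        ultimately have "dist (h x) (h y) < e" by (simp add: dist_norm)
        hence "h y \<in> S \<inter> W U'" using U'(2) yA h by auto
        hence "g (h y) \<in> U'" using W(2)[OF U'(1)] by blast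
        thus ?thesis using gh yA by simp
      qed
      thus ?thesis using U'(1) by blast
    qed
    have crd: "card {U \<in> f. x \<in> U} \<le> 2 + 1" for x
    proof -
      let ?I = "{(k, i, j). box k i j (n * fst (h x)) (n * snd (h x))}"
      have "{U \<in> f. x \<in> U} \<subseteq> V ` ?I" by (auto simp: f_def V_def)
      hence "card {U \<in> f. x \<in> U} \<le> card (V ` ?I)" by (intro card_mono finite_imageI card_boxes)
      also have "\<dots> \<le> card ?I" by (intro card_image_le card_boxes)
      also have "\<dots> \<le> 3" by (rule card_boxes)
      finally show ?thesis by simp
    qed
    show ?thesis by (intro exI[of _ "f"] conjI ballI fin opn cvr ref crd)
  qed
qed

section \<open>Limits of functions on grids\<close>

lemma compact_PiE_UNIV:
  assumes "\<And>i. compact (S i)"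
  shows "compact (PiE UNIV S)"
proof -
  have "compactin (product_topology (\<lambda>i. euclidean) UNIV) (PiE UNIV S)"
    by (rule compactin_PiE[THEN iffD2]) (simp add: assms)
  hence "compactin euclidean (PiE UNIV S)" by (simp only: euclidean_product_topology)
  thus ?thesis by simp
qed

text \<open>Tychonoff's theorem takes the place of Arzela-Ascoli: F is a cluster point of the
  sequence in a product of copies of S. Neighbourhoods that restrict two coordinates are enough to
  pass closed conditions on pairs of values to the limit.\<close>

lemma pairwise_cluster:
  fixes g :: "nat \<Rightarrow> 'i \<Rightarrow> 'b::metric_space"
  assumes S: "compact S" and g: "\<And>n t. g n t \<in> S"
  obtains F where "\<And>t. F t \<in> S"
    "\<And>s t k a. a > 0 \<Longrightarrow> \<exists>n\<ge>k. dist (g n s) (F s) < a \<and> dist (g n t) (F t) < a"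
proof -
  have ev: "eventually (\<lambda>G. G \<in> PiE UNIV (\<lambda>_. S)) (filtermap g sequentially)"
    using g by (simp add: eventually_filtermap PiE_UNIV_domain Pi_iff)
  obtain F where F: "F \<in> PiE UNIV (\<lambda>_. S)" "inf (nhds F) (filtermap g sequentially) \<noteq> bot"
    using compact_filter[THEN iffD1, rule_format, OF compact_PiE_UNIV[of "\<lambda>_. S", OF S] _ ev]
    by (auto simp: filtermap_bot_iff)
  have near: "\<exists>n\<ge>k. dist (g n s) (F s) < a \<and> dist (g n t) (F t) < a" if a: "a > 0" for s t k a
  proof (rule ccontr)
    assume far: "\<not> ?thesis"
    let ?A = "{G. dist (G s) (F s) < a} \<inter> {G. dist (G t) (F t) < a}"
    have "open ?A" by (intro open_Int open_Collect_less continuous_intros continuous_on_product_coordinates)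
    hence 1: "eventually (\<lambda>G. G \<in> ?A) (nhds F)" using a by (intro eventually_nhds_in_open) auto
    have 2: "eventually (\<lambda>G. G \<in> g ` {k..}) (filtermap g sequentially)"
      unfolding eventually_filtermap by (rule eventually_sequentiallyI[of k]) simp
    have "eventually (\<lambda>_. False) (inf (nhds F) (filtermap g sequentially))"
      unfolding eventually_inf using 1 2 far by (intro exI conjI allI impI) auto
    thus False using F(2) by (simp add: trivial_limit_def)
  qed
  have "F t \<in> S" for t using F(1) by auto
  thus ?thesis by (rule that) (rule near)
qed

lemma grid_lipschitz:
  fixes f :: "nat \<Rightarrow> 'b::real_normed_vector"
  assumes f: "\<And>i. i < n \<Longrightarrow> norm (f (Suc i) - f i) \<le> L * h" and h: "0 \<le> h" "0 \<le> L" and ij: "i \<le> n" "j \<le> n"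
  shows "norm (f j - f i) \<le> L * \<bar>real j * h - real i * h\<bar>"
proof -
  have up: "i \<le> j \<Longrightarrow> j \<le> n \<Longrightarrow> norm (f j - f i) \<le> L * (real j * h - real i * h)" for i j
  proof (induction j rule: dec_induct)
    case (step j)
    thus ?case using f[of j] norm_triangle_ineq[of "f (Suc j) - f j" "f j - f i"] by (simp add: algebra_simps)
  qed simp
  have "L * z \<le> L * \<bar>z\<bar>" for z using h(2) by (intro mult_left_mono) auto
  thus ?thesis using order_trans[OF up[of i j]] order_trans[OF up[of j i]] ij
    by (metis abs_minus_commute nat_le_linear norm_minus_commute)
qed

text \<open>The limit F of functions on ever finer grids is one function for all arguments; only the
  subsequence and the grid points depend on the pair s, t. So F inherits every closed estimate that
  involves two grid points at a time.\<close>

lemma grid_cluster: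
  fixes f :: "nat \<Rightarrow> nat \<Rightarrow> 'b::metric_space" and a b :: real
  assumes S: "compact S" and f: "\<And>n i. \<lbrakk>n > 0; i \<le> n\<rbrakk> \<Longrightarrow> f n i \<in> S" and ab: "a < b"
  obtains F where "\<And>t. F t \<in> S" "\<And>s t. \<lbrakk>s \<in> {a..b}; t \<in> {a..b}\<rbrakk> \<Longrightarrow> \<exists>r i j. (\<forall>k. 0 < r k \<and> i k \<le> r k \<and> j k \<le> r k) \<and>
    (\<lambda>k. a + real (i k) * ((b - a) / r k)) \<longlonglongrightarrow> s \<and> (\<lambda>k. a + real (j k) * ((b - a) / r k)) \<longlonglongrightarrow> t \<and>
    (\<lambda>k. f (r k) (i k)) \<longlonglongrightarrow> F s \<and> (\<lambda>k. f (r k) (j k)) \<longlonglongrightarrow> F t"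
proof -
  define z where "z n t = real n * ((t - a) / (b - a))" for n t
  \<comment> \<open>\<open>min\<close> and \<open>nat\<close> keep the index between 0 and n even
    for t outside [a, b], where F must still take values in S.\<close>
  define m where "m n t = min n (nat \<lfloor>z n t\<rfloor>)" for n t
  have m: "\<bar>a + real (m n t) * ((b - a) / n) - t\<bar> \<le> (b - a) / n" if t: "t \<in> {a..b}" and n: "n > 0" for n t
  proof -
    have z: "0 \<le> z n t" "z n t \<le> n" using t ab n by (auto simp: z_def field_simps)
    hence "nat \<lfloor>z n t\<rfloor> \<le> n" by linarith
    hence "real (m n t) = of_int \<lfloor>z n t\<rfloor>" using z by (simp add: m_def)
    hence iz: "real (m n t) \<le> z n t" "z n t < real (m n t) + 1" by linarith+
    have "a + real (m n t) * ((b - a) / n) - t = (real (m n t) - z n t) * ((b - a) / n)"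
      using ab n by (simp add: z_def field_simps)
    also have "\<bar>\<dots>\<bar> \<le> 1 * ((b - a) / n)" unfolding abs_mult using iz ab n by (intro mult_mono) auto
    finally show ?thesis by simp
  qed
  obtain F where F: "\<And>t. F t \<in> S" "\<And>s t k g. g > 0 \<Longrightarrow> \<exists>n\<ge>k.
      dist (f (Suc n) (m (Suc n) s)) (F s) < g \<and> dist (f (Suc n) (m (Suc n) t)) (F t) < g"
    by (rule pairwise_cluster[OF S, of "\<lambda>n t. f (Suc n) (m (Suc n) t)"]) (auto simp: m_def intro: f)
  show ?thesis
  proof (rule that[OF F(1)])
    fix s t assume st: "s \<in> {a..b}" "t \<in> {a..b}"
    have "\<forall>k. \<exists>n\<ge>k. dist (f (Suc n) (m (Suc n) s)) (F s) < inverse (real (Suc k)) \<and>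
      dist (f (Suc n) (m (Suc n) t)) (F t) < inverse (real (Suc k))" by (intro allI F(2)) simp
    from choice[OF this] obtain r where r: "\<And>k. k \<le> r k" "\<And>k. dist (f (Suc (r k)) (m (Suc (r k)) s)) (F s) < inverse (real (Suc k))"
      "\<And>k. dist (f (Suc (r k)) (m (Suc (r k)) t)) (F t) < inverse (real (Suc k))" by blast
    have lim: "u \<longlonglongrightarrow> l" if "\<And>k. dist (u k) l \<le> c * inverse (real (Suc k))" for u :: "nat \<Rightarrow> 'c::metric_space" and l c
      unfolding tendsto_dist_iff[of u] by (rule Lim_null_comparison[of _ "\<lambda>k. c * inverse (real (Suc k))"])
        (use that tendsto_mult[OF tendsto_const[of c] LIMSEQ_inverse_real_of_nat] in simp_all)
    have "(b - a) / Suc (r k) \<le> (b - a) * inverse (real (Suc k))" for k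
      using ab r(1)[of k] by (simp add: divide_inverse)
    hence "\<bar>a + real (m (Suc (r k)) u) * ((b - a) / Suc (r k)) - u\<bar> \<le> (b - a) * inverse (real (Suc k))"
      if "u \<in> {a..b}" for u k using order_trans[OF m[OF that, of "Suc (r k)"]] by blast
    hence "(\<lambda>k. a + real (m (Suc (r k)) u) * ((b - a) / Suc (r k))) \<longlonglongrightarrow> u" if "u \<in> {a..b}" for u
      using that by (intro lim[of _ _ "b - a"]) (simp only: dist_real_def)
    moreover have "(\<lambda>k. f (Suc (r k)) (m (Suc (r k)) u)) \<longlonglongrightarrow> F u" if "u = s \<or> u = t" for u
      by (rule lim[of _ _ 1]) (use that r(2,3)[THEN less_imp_le] in auto)
    ultimately show "\<exists>r i j. (\<forall>k. 0 < r k \<and> i k \<le> r k \<and> j k \<le> r k) \<and>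
      (\<lambda>k. a + real (i k) * ((b - a) / r k)) \<longlonglongrightarrow> s \<and> (\<lambda>k. a + real (j k) * ((b - a) / r k)) \<longlonglongrightarrow> t \<and>
      (\<lambda>k. f (r k) (i k)) \<longlonglongrightarrow> F s \<and> (\<lambda>k. f (r k) (j k)) \<longlonglongrightarrow> F t"
      using st by (intro exI[of _ "\<lambda>k. Suc (r k)"] exI[of _ "\<lambda>k. m (Suc (r k)) _"]) (auto simp: m_def)
  qed
qed

section \<open>Midpoint convexity\<close>

text \<open>Maximum principle: the difference \<open>h\<close> between g and its chord is midpoint
  convex and vanishes at both ends. At the leftmost point of a positive maximum the midpoint
  inequality would fail.\<close>

lemma midpoint_convex_imp_convex_on:
  fixes g :: "real \<Rightarrow> real"
  assumes "convex I" and cont: "continuous_on I g"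
    and mid: "\<And>x y. \<lbrakk>x \<in> I; y \<in> I\<rbrakk> \<Longrightarrow> g ((x + y) / 2) \<le> (g x + g y) / 2"
  shows "convex_on I g"
proof (rule convex_onI)
  fix t x y :: real assume t: "0 < t" "t < 1" and xy: "x \<in> I" "y \<in> I"
  define c where "c s = (1 - s) * x + s * y" for s
  define h where "h s = g (c s) - ((1 - s) * g x + s * g y)" for s
  have cI: "c s \<in> I" if "s \<in> {0..1}" for s
    using convexD_alt[OF \<open>convex I\<close> xy, of s] that by (simp add: c_def)
  have contc: "continuous_on {0..1} c" unfolding c_def by (intro continuous_intros)
  have "continuous_on {0..1} (\<lambda>s. g (c s))" by (rule continuous_on_compose2[OF cont contc]) (use cI in auto)
  hence conth: "continuous_on {0..1} h" unfolding h_def by (intro continuous_intros)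
  have hmid: "2 * h ((s + s') / 2) \<le> h s + h s'" if "s \<in> {0..1}" "s' \<in> {0..1}" for s s'
  proof -
    have aff: "2 * ((1 - (s + s') / 2) * p + (s + s') / 2 * q) = ((1 - s) * p + s * q) + ((1 - s') * p + s' * q)"
      for p q :: real by (simp add: algebra_simps add_divide_distrib)
    have "c ((s + s') / 2) = (c s + c s') / 2" using aff[of x y] by (simp add: c_def)
    hence "2 * g (c ((s + s') / 2)) \<le> g (c s) + g (c s')" using mid[OF cI cI, of s s'] that by (simp only:) simp
    thus ?thesis using aff[of "g x" "g y"] by (simp add: h_def)
  qed
  obtain m where m: "m \<in> {0..1}" "\<And>s. s \<in> {0..1} \<Longrightarrow> h s \<le> h m"
    using continuous_attains_sup[of "{0..1}" h] conth by auto
  have "h m \<le> 0"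
  proof (rule ccontr)
    assume "\<not> h m \<le> 0"
    define S where "S = {s \<in> {0..1}. h s = h m}"
    have "closed S" unfolding S_def using continuous_closed_preimage_constant[OF conth closed_atLeastAtMost] by simp
    moreover have "S \<subseteq> {0..1}" by (auto simp: S_def)
    ultimately have "compact S" using bounded_subset[OF bounded_closed_interval] compact_eq_bounded_closed by blast
    moreover have "m \<in> S" using m by (simp add: S_def)
    ultimately obtain s where s: "s \<in> S" "\<And>s'. s' \<in> S \<Longrightarrow> s \<le> s'"
      using compact_attains_inf[of S] by blast
    have "h 0 = 0" "h 1 = 0" by (auto simp: h_def c_def)
    hence "s \<noteq> 0" "s \<noteq> 1" using s(1) \<open>\<not> h m \<le> 0\<close> by (auto simp: S_def)
    hence s01: "0 < s" "s < 1" using s(1) by (auto simp: S_def)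
    define d where "d = min s (1 - s)"
    have d: "d > 0" "s - d \<in> {0..1}" "s + d \<in> {0..1}" using s01 by (auto simp: d_def)
    have "s - d \<notin> S" using s(2)[of "s - d"] d(1) by auto
    hence "h (s - d) < h m" using m(2)[OF d(2)] d(2) by (auto simp: S_def less_le)
    moreover have "2 * h s \<le> h (s - d) + h (s + d)" using hmid[OF d(2,3)] by simp
    moreover have "h (s + d) \<le> h m" using m(2) d(3) by blast
    moreover have "h s = h m" using s(1) by (simp add: S_def)
    ultimately show False by linarith
  qed
  hence "h t \<le> 0" using m(2)[of t] t by simp
  thus "g ((1 - t) *\<^sub>R x + t *\<^sub>R y) \<le> (1 - t) * g x + t * g y" by (simp add: h_def c_def)
qed (fact assms)

section \<open>Ribbons: extraction from the set and straightening by a C^{1,1} curve\<close>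

section \<open>The local structure near a point with one-dimensional tangent cone\<close>

text \<open>\<open>height\<close> and \<open>quad0\<close> confine \<open>K\<close> to a paraboloid around the axis \<open>e\<close>; the slices
  \<open>{x \<in> K. x \<bullet> e = t}\<close> depend on \<open>t\<close> in a Lipschitz way, and \<open>K\<close> is convex up to quadratic errors.\<close>

locale ribbon =
  fixes K :: "'a::euclidean_space set" and e :: 'a and lo hi C :: real
  assumes norm_e: "norm e = 1" and compact_K: "compact K" and zero_K: "0 \<in> K"
    and hi_pos: "0 < hi" and lo_cases: "lo = 0 \<or> lo = - hi" and C_ge_1: "1 \<le> C"
    and height: "x \<in> K \<Longrightarrow> x \<bullet> e \<in> {lo..hi}"
    and quad0: "x \<in> K \<Longrightarrow> norm (x - (x \<bullet> e) *\<^sub>R e) \<le> C * (x \<bullet> e)\<^sup>2"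
    and slice: "\<lbrakk>x \<in> K; t \<in> {lo..hi}\<rbrakk> \<Longrightarrow> \<exists>y\<in>K. y \<bullet> e = t \<and> norm (y - x) \<le> C * \<bar>t - x \<bullet> e\<bar>"
    and mid: "\<lbrakk>x \<in> K; y \<in> K\<rbrakk> \<Longrightarrow>
      \<exists>p\<in>K. p \<bullet> e = (x \<bullet> e + y \<bullet> e) / 2 \<and> norm (p - (1/2) *\<^sub>R (x + y)) \<le> C * (norm (x - y))\<^sup>2"
    and plane: "x \<in> K \<Longrightarrow> \<exists>S. subspace S \<and> dim S \<le> 2 \<and>
      (\<forall>y\<in>K. \<exists>v\<in>S. norm (y - x - v) \<le> C * (norm (y - x))\<^sup>2)"

lemma ribbon_restrict:
  assumes R: "ribbon K e lo hi C" and b: "0 < hi'" "hi' \<le> hi" and a: "lo' = (if lo = 0 then 0 else - hi')"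
  shows "ribbon (K \<inter> {x. x \<bullet> e \<in> {lo'..hi'}}) e lo' hi' C"
proof -
  interpret ribbon K e lo hi C by (fact R)
  have sub: "{lo'..hi'} \<subseteq> {lo..hi}" using lo_cases b a by auto
  have 0: "0 \<in> {lo'..hi'}" using b a by auto
  show ?thesis
  proof
    have "closed {x. x \<bullet> e \<in> {lo'..hi'}}"
      by (simp, intro closed_Collect_conj closed_Collect_le continuous_intros)
    thus "compact (K \<inter> {x. x \<bullet> e \<in> {lo'..hi'}})"
      using compact_K by (rule compact_Int_closed[rotated])
  next
    fix x t assume "x \<in> K \<inter> {x. x \<bullet> e \<in> {lo'..hi'}}" "t \<in> {lo'..hi'}"
    thus "\<exists>y\<in>K \<inter> {x. x \<bullet> e \<in> {lo'..hi'}}. y \<bullet> e = t \<and> norm (y - x) \<le> C * \<bar>t - x \<bullet> e\<bar>"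
      using slice[of x t] sub by blast
  next
    fix x y assume xy: "x \<in> K \<inter> {x. x \<bullet> e \<in> {lo'..hi'}}" "y \<in> K \<inter> {x. x \<bullet> e \<in> {lo'..hi'}}"
    hence "(x \<bullet> e + y \<bullet> e) / 2 \<in> {lo'..hi'}" by auto
    thus "\<exists>p\<in>K \<inter> {x. x \<bullet> e \<in> {lo'..hi'}}. p \<bullet> e = (x \<bullet> e + y \<bullet> e) / 2 \<and>
        norm (p - (1/2) *\<^sub>R (x + y)) \<le> C * (norm (x - y))\<^sup>2" using mid[of x y] xy by force
  next
    fix x assume "x \<in> K \<inter> {x. x \<bullet> e \<in> {lo'..hi'}}"
    thus "\<exists>S. subspace S \<and> dim S \<le> 2 \<and>
        (\<forall>y\<in>K \<inter> {x. x \<bullet> e \<in> {lo'..hi'}}. \<exists>v\<in>S. norm (y - x - v) \<le> C * (norm (y - x))\<^sup>2)"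
      using plane[of x] by blast
  qed (use norm_e zero_K b a 0 C_ge_1 quad0 in auto)
qed

lemma norm_diff_proj_le:
  fixes e :: "'a::real_inner"
  assumes "norm e = 1"
  shows "norm (x - (x \<bullet> e) *\<^sub>R e) \<le> norm (x - s *\<^sub>R e)"
proof -
  have ee: "e \<bullet> e = 1" using assms by (simp add: norm_eq_1)
  have "(norm (x - s *\<^sub>R e))\<^sup>2 = (norm (x - (x \<bullet> e) *\<^sub>R e))\<^sup>2 + (x \<bullet> e - s)\<^sup>2"
    unfolding power2_norm_eq_inner
    by (simp add: inner_diff_left inner_diff_right ee inner_commute power2_eq_square algebra_simps)
  hence "(norm (x - (x \<bullet> e) *\<^sub>R e))\<^sup>2 \<le> (norm (x - s *\<^sub>R e))\<^sup>2" by simp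
  thus ?thesis by (rule power2_le_imp_le) simp
qed

context ribbon
begin

abbreviation "J \<equiv> {lo..hi}"

lemma J0: "0 \<in> J" using lo_cases hi_pos by auto

lemma len_pos: "hi - lo > 0" using lo_cases hi_pos by auto

lemma abs_J: "t \<in> J \<Longrightarrow> \<bar>t\<bar> \<le> hi" "t \<in> J \<Longrightarrow> \<bar>t\<bar> \<le> hi - lo"
  using lo_cases hi_pos by auto

lemma ee: "e \<bullet> e = 1" using norm_e by (simp add: norm_eq_1)

lemma norm_le:
  assumes x: "x \<in> K" and C: "C * hi \<le> 1"
  shows "norm x \<le> 2 * \<bar>x \<bullet> e\<bar>"
proof -
  have "C * \<bar>x \<bullet> e\<bar> \<le> 1" using mult_left_mono[OF abs_J(1)[OF height[OF x]], of C] C C_ge_1 by linarith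
  hence "C * \<bar>x \<bullet> e\<bar> * \<bar>x \<bullet> e\<bar> \<le> 1 * \<bar>x \<bullet> e\<bar>" by (intro mult_right_mono) auto
  hence "norm (x - (x \<bullet> e) *\<^sub>R e) \<le> \<bar>x \<bullet> e\<bar>" using quad0[OF x] by (simp add: power2_eq_square mult.assoc)
  thus ?thesis using norm_triangle_sub[of x "(x \<bullet> e) *\<^sub>R e"] by (simp add: norm_e)
qed

text \<open>Each condition on a ribbon tolerates errors of its own order, so a map with a C^{1,1}
  jet that is bi-Lipschitz and preserves the height keeps them all: midpoints by
  \<open>jet_mid\<close>, the plane at x by applying \<open>D x\<close> to it, and the paraboloid by
  the hypothesis Q.\<close>

lemma jet_image:
  fixes f :: "'a \<Rightarrow> 'b::euclidean_space"
  assumes jet: "jet K f D M" and M: "M \<ge> 0" and e': "norm e' = 1" and fe: "\<And>x. x \<in> K \<Longrightarrow> f x \<bullet> e' = x \<bullet> e"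
    and f0: "f 0 = 0" and G: "\<And>x y. \<lbrakk>x \<in> K; y \<in> K\<rbrakk> \<Longrightarrow> norm (y - x) \<le> G * norm (f y - f x)"
    and Q: "\<And>x. x \<in> K \<Longrightarrow> norm (f x - (x \<bullet> e) *\<^sub>R e') \<le> Q * (x \<bullet> e)\<^sup>2"
  obtains C' where "ribbon (f ` K) e' lo hi C'"
proof -
  have bK: "bounded K" by (rule compact_imp_bounded[OF compact_K])
  have C0: "0 \<le> C" using C_ge_1 by simp
  obtain l where l: "l \<ge> 0" "\<And>x. x \<in> K \<Longrightarrow> norm (D x) \<le> l"
    "\<And>x y. \<lbrakk>x \<in> K; y \<in> K\<rbrakk> \<Longrightarrow> norm (f y - f x) \<le> l * norm (y - x)"
    by (rule jet_lipschitz[OF bK jet M]) (rule that)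
  obtain Cm where Cm: "Cm \<ge> 0" "\<And>x y p. \<lbrakk>x \<in> K; y \<in> K; p \<in> K; norm (p - (1/2) *\<^sub>R (x + y)) \<le> C * (norm (x - y))\<^sup>2\<rbrakk> \<Longrightarrow>
    norm (f p - (1/2) *\<^sub>R (f x + f y)) \<le> Cm * (norm (f x - f y))\<^sup>2"
    by (rule jet_mid[OF bK jet M C0 G]) (assumption, assumption, rule that)
  define C' where "C' = 1 + \<bar>Q\<bar> + l * C + Cm + (M + l * C) * G\<^sup>2"
  have lC: "0 \<le> l * C" and MG: "0 \<le> (M + l * C) * G\<^sup>2" using l(1) M C0 by simp_all
  have C': "1 \<le> C'" "Q \<le> C'" "l * C \<le> C'" "Cm \<le> C'" "(M + l * C) * G\<^sup>2 \<le> C'"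
    using lC MG Cm(1) abs_ge_self[of Q] unfolding C'_def by linarith+
  have "ribbon (f ` K) e' lo hi C'"
  proof
    have "l-lipschitz_on K f" using l by (intro lipschitz_onI) (auto simp: dist_norm norm_minus_commute)
    thus "compact (f ` K)" using compact_K lipschitz_on_continuous_on compact_continuous_image by blast
    show "0 \<in> f ` K" using zero_K f0 by force
    show "w \<bullet> e' \<in> J" if "w \<in> f ` K" for w using that fe height by auto
    show "norm (w - (w \<bullet> e') *\<^sub>R e') \<le> C' * (w \<bullet> e')\<^sup>2" if "w \<in> f ` K" for w
      using that Q fe mult_right_mono[OF C'(2) zero_le_power2] by (fastforce intro: order_trans)
    show "\<exists>z\<in>f ` K. z \<bullet> e' = t \<and> norm (z - w) \<le> C' * \<bar>t - w \<bullet> e'\<bar>" if w: "w \<in> f ` K" and t: "t \<in> J" for w t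
    proof -
      obtain x where x: "x \<in> K" "w = f x" using w by blast
      obtain y where y: "y \<in> K" "y \<bullet> e = t" "norm (y - x) \<le> C * \<bar>t - x \<bullet> e\<bar>" using slice[OF x(1) t] by blast
      have "norm (f y - w) \<le> l * (C * \<bar>t - x \<bullet> e\<bar>)" using l(3)[OF x(1) y(1)] mult_left_mono[OF y(3) l(1)] x(2) by simp
      also have "\<dots> \<le> C' * \<bar>t - w \<bullet> e'\<bar>" using mult_right_mono[OF C'(3), of "\<bar>t - x \<bullet> e\<bar>"] x fe by (simp add: mult.assoc)
      finally show ?thesis using y fe by (intro bexI[of _ "f y"]) auto
    qed
    show "\<exists>p\<in>f ` K. p \<bullet> e' = (w \<bullet> e' + z \<bullet> e') / 2 \<and> norm (p - (1/2) *\<^sub>R (w + z)) \<le> C' * (norm (w - z))\<^sup>2"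
      if w: "w \<in> f ` K" "z \<in> f ` K" for w z
    proof -
      obtain x y where x: "x \<in> K" "w = f x" and y: "y \<in> K" "z = f y" using w by blast
      obtain p where p: "p \<in> K" "p \<bullet> e = (x \<bullet> e + y \<bullet> e) / 2" "norm (p - (1/2) *\<^sub>R (x + y)) \<le> C * (norm (x - y))\<^sup>2"
        using mid[OF x(1) y(1)] by blast
      have "norm (f p - (1/2) *\<^sub>R (w + z)) \<le> C' * (norm (w - z))\<^sup>2"
        using Cm(2)[OF x(1) y(1) p(1,3)] mult_right_mono[OF C'(4), of "(norm (w - z))\<^sup>2"] x(2) y(2) by simp
      thus ?thesis using p fe x y by (intro bexI[of _ "f p"]) auto
    qed
    show "\<exists>S. subspace S \<and> dim S \<le> 2 \<and> (\<forall>z\<in>f ` K. \<exists>v\<in>S. norm (z - w - v) \<le> C' * (norm (z - w))\<^sup>2)" if w: "w \<in> f ` K" for w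
    proof -
      obtain x where x: "x \<in> K" "w = f x" using w by blast
      obtain S where S: "subspace S" "dim S \<le> 2" "\<And>y. y \<in> K \<Longrightarrow> \<exists>v\<in>S. norm (y - x - v) \<le> C * (norm (y - x))\<^sup>2"
        using plane[OF x(1)] by blast
      have lin: "linear (blinfun_apply (D x))" by (rule linear_blinfun)
      have "\<exists>v\<in>blinfun_apply (D x) ` S. norm (f y - w - v) \<le> C' * (norm (f y - w))\<^sup>2" if y: "y \<in> K" for y
      proof -
        obtain v where v: "v \<in> S" "norm (y - x - v) \<le> C * (norm (y - x))\<^sup>2" using S(3)[OF y] by blast
        have eq: "f y - w - D x v = (f y - f x - D x (y - x)) + D x (y - x - v)" by (simp add: x(2) blinfun.diff_right)
        have "norm (D x (y - x - v)) \<le> l * (C * (norm (y - x))\<^sup>2)"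
          by (rule order_trans[OF norm_blinfun_le[OF l(2)[OF x(1)]] mult_left_mono[OF v(2) l(1)]])
        hence "norm (f y - w - D x v) \<le> M * (norm (y - x))\<^sup>2 + l * (C * (norm (y - x))\<^sup>2)"
          unfolding eq by (rule order_trans[OF norm_triangle_ineq add_mono[OF jetD(1)[OF jet x(1) y]]])
        also have "\<dots> = (M + l * C) * (norm (y - x))\<^sup>2" by (simp add: algebra_simps)
        also have "\<dots> \<le> (M + l * C) * (G * norm (f y - w))\<^sup>2"
          unfolding x(2) using G[OF x(1) y] M lC by (intro mult_left_mono power_mono) auto
        also have "\<dots> \<le> C' * (norm (f y - w))\<^sup>2"
          using mult_right_mono[OF C'(5), of "(norm (f y - w))\<^sup>2"] by (simp add: power_mult_distrib mult.assoc)
        finally show ?thesis using v(1) by blast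
      qed
      moreover have "subspace (blinfun_apply (D x) ` S)" using lin S(1) by (rule linear_subspace_image)
      moreover have "dim (blinfun_apply (D x) ` S) \<le> 2" using dim_image_le[OF lin, of S] S(2) by simp
      ultimately show ?thesis by (intro exI[of _ "blinfun_apply (D x) ` S"]) blast
    qed
  qed (use hi_pos lo_cases e' C' in auto)
  thus ?thesis by (rule that)
qed

end

context unique_nearest
begin

lemma Tan_direction:
  assumes u: "u \<in> Tan A a" "u \<noteq> 0" and b: "b > 0"
  obtains q where "q \<in> A" "q \<noteq> a" "dist q a < b" "dist (sgn (q - a)) (sgn u) < 1/100"
proof -
  obtain ai ri where ai: "\<And>i::nat. ai i \<in> A \<and> ai i \<noteq> a \<and> ri i > (0::real)" "ai \<longlonglongrightarrow> a"
    and lim: "(\<lambda>i. ri i *\<^sub>R (ai i - a)) \<longlonglongrightarrow> u" using u unfolding Tan_def by auto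
  have "(\<lambda>i. sgn (ri i *\<^sub>R (ai i - a))) \<longlonglongrightarrow> sgn u" using lim u(2) by (rule tendsto_sgn)
  hence sg: "(\<lambda>i. sgn (ai i - a)) \<longlonglongrightarrow> sgn u" using ai(1) by (simp add: sgn_scaleR)
  have "\<forall>\<^sub>F i in sequentially. dist (ai i) a < b \<and> dist (sgn (ai i - a)) (sgn u) < 1/100"
    by (intro eventually_conj tendstoD[OF ai(2) b] tendstoD[OF sg]) simp
  then obtain i where "dist (ai i) a < b \<and> dist (sgn (ai i - a)) (sgn u) < 1/100"
    by (auto simp: eventually_sequentially)
  thus ?thesis using that[of "ai i"] ai(1)[of i] by blast
qed

text \<open>The nearest points of the points of the segment from x to q form a continuous path in A,
  so its height takes the value s. After a distance w along the segment the path is off by at most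
  w/8, while the height of the segment has changed by at least w/4; hence w \<le> 8 |s - x.e|, and
  the point found is within w + w/8 of x.\<close>

lemma slice_towards:
  assumes e: "norm e = 1" and x: "x \<in> A" and q: "q \<in> A" and D: "dist x q < r"
    and steep: "dist x q \<le> 4 * \<bar>q \<bullet> e - x \<bullet> e\<bar>" and small: "2 / r * dist x q \<le> 1/8"
    and s: "s \<in> closed_segment (x \<bullet> e) (q \<bullet> e)"
  obtains y where "y \<in> A" "y \<bullet> e = s" "norm (y - x) \<le> 9 * \<bar>s - x \<bullet> e\<bar>"
proof -
  define D where "D = dist x q"
  define m where "m a = x + a *\<^sub>R (q - x)" for a
  define p where "p a = P (m a)" for a
  have pm: "norm (p a - m a) \<le> a * D / 8" if a: "a \<in> {0..1}" for a
  proof -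
    have "norm (p a - m a) = infdist (m a) A" using dist_P[of "m a"] by (simp add: p_def dist_norm norm_minus_commute)
    also have "\<dots> \<le> 2 / r * (a * (1 - a) * D\<^sup>2)"
      unfolding m_def D_def using a by (intro chord x q D) auto
    also have "\<dots> \<le> 2 / r * (a * 1 * D\<^sup>2)" using a r_pos by (intro mult_left_mono mult_right_mono) auto
    also have "\<dots> = (a * D) * (2 / r * D)" by (simp add: power2_eq_square)
    also have "\<dots> \<le> (a * D) * (1/8)" using small a by (intro mult_left_mono) (auto simp: D_def)
    finally show ?thesis by simp
  qed
  have mr: "infdist (m a) A < r" if a: "a \<in> {0..1}" for a
  proof -
    have "infdist (m a) A \<le> norm (p a - m a)"
      using dist_P[of "m a"] by (simp add: p_def dist_norm norm_minus_commute)
    also have "\<dots> \<le> 1 * D / 8" using pm[OF a] a mult_right_mono[of a 1 "D / 8"] by (simp add: D_def)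
    also have "\<dots> < r" using D r_pos by (simp add: D_def)
    finally show ?thesis .
  qed
  have contp: "continuous_on {0..1} (\<lambda>a. p a \<bullet> e)"
  proof -
    have "continuous_on {0..1} m" unfolding m_def by (intro continuous_intros)
    hence "continuous_on {0..1} p" unfolding p_def by (rule continuous_on_compose2[OF continuous_P]) (use mr in auto)
    thus ?thesis by (intro continuous_intros)
  qed
  have p0: "p 0 = x" and p1: "p 1 = q" using x q by (simp_all add: p_def m_def closest_point_self)
  have "connected ((\<lambda>a. p a \<bullet> e) ` {0..1})" using contp by (intro connected_continuous_image) auto
  moreover have "x \<bullet> e \<in> (\<lambda>a. p a \<bullet> e) ` {0..1}" "q \<bullet> e \<in> (\<lambda>a. p a \<bullet> e) ` {0..1}"
    using p0 p1 by (force intro: image_eqI[of _ _ 0], force intro: image_eqI[of _ _ 1])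
  ultimately have "closed_segment (x \<bullet> e) (q \<bullet> e) \<subseteq> (\<lambda>a. p a \<bullet> e) ` {0..1}"
    by (intro closed_segment_subset connected_convex_1[THEN iffD1])
  hence "s \<in> (\<lambda>a. p a \<bullet> e) ` {0..1}" using s by (rule subsetD)
  then obtain a where a: "a \<in> {0..1}" "s = p a \<bullet> e" by blast
  define w where "w = a * D"
  have pw: "norm (p a - m a) \<le> w / 8" using pm[OF a(1)] by (simp add: w_def)
  have "s - x \<bullet> e = a * (q \<bullet> e - x \<bullet> e) + (p a - m a) \<bullet> e"
    by (simp add: a(2) m_def inner_add_left inner_diff_left algebra_simps)
  moreover have "\<bar>(p a - m a) \<bullet> e\<bar> \<le> w / 8"
    using Cauchy_Schwarz_ineq2[of "p a - m a" e] e pw by simp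
  moreover have "\<bar>a * (q \<bullet> e - x \<bullet> e)\<bar> \<ge> a * (D / 4)"
    unfolding abs_mult using a(1) steep by (intro mult_mono) (auto simp: D_def)
  hence "\<bar>a * (q \<bullet> e - x \<bullet> e)\<bar> \<ge> w / 4" by (simp add: w_def)
  moreover have "w \<le> 8 * \<bar>u\<bar>" if "u = X + Y" "\<bar>Y\<bar> \<le> w / 8" "w / 4 \<le> \<bar>X\<bar>" for u X Y
    using abs_triangle_ineq4[of u Y] that by simp
  ultimately have "w \<le> 8 * \<bar>s - x \<bullet> e\<bar>" by blast
  moreover have "norm (p a - x) \<le> norm (p a - m a) + norm (m a - x)"
    using norm_triangle_ineq[of "p a - m a" "m a - x"] by simp
  moreover have "norm (m a - x) = w" using a(1) by (simp add: m_def w_def D_def dist_norm norm_minus_commute)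
  ultimately have "norm (p a - x) \<le> 9 * \<bar>s - x \<bullet> e\<bar>" using pw by linarith
  thus ?thesis using that[of "p a"] a(2) by (simp add: p_def P_in)
qed

text \<open>\<open>chord_near_Tan\<close> at a confines A to a paraboloid around e. A slice is
  reached from x by walking, with \<open>slice_towards\<close>, towards points of A lying on the two
  sides of a, far away compared with the ribbon; if the cone is a half-line, the downward walk goes
  towards a itself. For a midpoint, project it to A and then walk to the right height.\<close>

theorem obtain_ribbon:
  assumes cd: "covering_dim_le A 2" and a: "a \<in> A" and dim1: "dim (Tan A a) = 1"
  obtains K e lo hi C f where "ribbon K e lo hi C" "f > 0" "(\<lambda>x. a + x) ` K \<subseteq> A"
    "\<And>y. \<lbrakk>y \<in> A; dist y a < f\<rbrakk> \<Longrightarrow> y - a \<in> K"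
proof -
  obtain B where B: "B \<subseteq> Tan A a" "independent B" "Tan A a \<subseteq> span B" "card B = dim (Tan A a)"
    by (rule basis_exists)
  obtain b where b: "B = {b}" using B(4) dim1 card_1_singletonE by metis
  have b0: "b \<noteq> 0" using B(2) b by (auto simp: dependent_zero)
  define e where "e = sgn b"
  have e: "norm e = 1" and ee: "e \<bullet> e = 1" using b0 by (auto simp: e_def norm_sgn norm_eq_1[symmetric])
  have TanE: "\<exists>z. u = z *\<^sub>R e" if uT: "u \<in> Tan A a" for u
  proof -
    have "u \<in> range (\<lambda>k. k *\<^sub>R b)" using B(3) uT unfolding b span_singleton by blast
    then obtain k where "u = k *\<^sub>R b" by blast
    hence "u = (k * norm b) *\<^sub>R e" using b0 by (simp add: e_def sgn_div_norm)
    thus ?thesis by blast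
  qed
  define c where "c = 2 / r"
  have c: "c > 0" using r_pos by (simp add: c_def)
  \<comment> \<open>Within distance g of a, the quadratic error c |y - a|^2 is at most |y - a| /
    32.\<close>
  define g where "g = min (r / 4) (1 / (32 * c))"
  have g: "g > 0" "4 * g \<le> r" "c * g \<le> 1 / 32" using r_pos c by (auto simp: g_def min_def field_simps)
  define t where "t y = (y - a) \<bullet> e" for y
  have near: "\<exists>z. z *\<^sub>R e \<in> Tan A a \<and> \<bar>t y - z\<bar> \<le> c * (dist y a)\<^sup>2 \<and>
      norm (y - a - t y *\<^sub>R e) \<le> c * (dist y a)\<^sup>2" if y: "y \<in> A" "dist y a \<le> g" for y
  proof -
    have "dist a y < r" using y(2) g r_pos by (simp add: dist_commute)
    then obtain u where u: "u \<in> Tan A a" "norm (y - a - u) \<le> c * (dist y a)\<^sup>2"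
      using chord_near_Tan[OF a y(1)] by (auto simp: c_def dist_commute)
    then obtain z where z: "u = z *\<^sub>R e" using TanE by blast
    have "t y - z = (y - a - u) \<bullet> e" by (simp add: t_def z inner_diff_left ee)
    hence "\<bar>t y - z\<bar> \<le> norm (y - a - u)" using Cauchy_Schwarz_ineq2[of "y - a - u" e] e by simp
    moreover have "norm (y - a - t y *\<^sub>R e) \<le> norm (y - a - u)"
      unfolding t_def z by (rule norm_diff_proj_le[OF e])
    ultimately show ?thesis using u z by (intro exI[of _ z]) auto
  qed
  have sq: "c * (dist y a)\<^sup>2 \<le> dist y a / 32" if "dist y a \<le> g" for y
  proof -
    have "c * dist y a \<le> 1/32" using that g(3) c mult_left_mono[of "dist y a" g c] by linarith
    hence "dist y a * (c * dist y a) \<le> dist y a * (1/32)" by (intro mult_left_mono) auto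
    thus ?thesis by (simp add: power2_eq_square mult_ac)
  qed
  have dt: "dist y a \<le> 2 * \<bar>t y\<bar>" if y: "y \<in> A" "dist y a \<le> g" for y
  proof -
    have "norm (y - a) \<le> norm (y - a - t y *\<^sub>R e) + norm (t y *\<^sub>R e)"
      using norm_triangle_ineq[of "y - a - t y *\<^sub>R e" "t y *\<^sub>R e"] by simp
    thus ?thesis using near[OF y] sq[OF y(2)] e by (auto simp: dist_norm)
  qed
  have t_le: "\<bar>t y\<bar> \<le> dist y a" for y
    using Cauchy_Schwarz_ineq2[of "y - a" e] e by (simp add: t_def dist_norm)
  have quad: "norm (y - a - t y *\<^sub>R e) \<le> 4 * c * (t y)\<^sup>2" if y: "y \<in> A" "dist y a \<le> g" for y
  proof -
    have "(dist y a)\<^sup>2 \<le> (2 * \<bar>t y\<bar>)\<^sup>2" using dt[OF y] by (intro power_mono) auto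
    hence "c * (dist y a)\<^sup>2 \<le> c * (4 * (t y)\<^sup>2)" using c by (simp add: power_mult_distrib)
    thus ?thesis using near[OF y] by auto
  qed
  \<comment> \<open>A half-line leads to lo = 0 and finally to a \<open>Bminus_set\<close>, a full
    line to lo = -hi and a \<open>Bplus_set\<close>.\<close>
  define ray where "ray \<longleftrightarrow> (\<forall>u\<in>Tan A a. u \<bullet> e \<ge> 0)"
  have ray_pos: "t y \<ge> 0" if ray and y: "y \<in> A" "dist y a \<le> g" for y
  proof (rule ccontr)
    assume "\<not> t y \<ge> 0"
    obtain z where z: "z *\<^sub>R e \<in> Tan A a" "\<bar>t y - z\<bar> \<le> c * (dist y a)\<^sup>2" using near[OF y] by blast
    have "z \<ge> 0" using \<open>ray\<close> z(1) ee by (force simp: ray_def)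
    thus False using z(2) sq[OF y(2)] dt[OF y] \<open>\<not> t y \<ge> 0\<close> by simp
  qed
  have dirE: "\<exists>q. q \<in> A \<and> q \<noteq> a \<and> dist q a < g / 2 \<and> w * t q \<ge> (99/100) * dist q a"
    if u: "u \<in> Tan A a" "u \<noteq> 0" "sgn u = w *\<^sub>R e" "\<bar>w\<bar> = 1" for u w
  proof -
    obtain q where q: "q \<in> A" "q \<noteq> a" "dist q a < g / 2" "dist (sgn (q - a)) (w *\<^sub>R e) < 1/100"
      using Tan_direction[OF u(1,2), of "g / 2"] g(1) u(3) by auto
    have qa: "q - a = dist q a *\<^sub>R sgn (q - a)" using q(2) by (simp add: dist_norm sgn_div_norm)
    have "1 - sgn (q - a) \<bullet> (w *\<^sub>R e) = (w *\<^sub>R e - sgn (q - a)) \<bullet> (w *\<^sub>R e)"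
      using u(4) ee by (cases "w \<ge> 0") (auto simp: inner_diff_left)
    also have "\<dots> \<le> norm (w *\<^sub>R e - sgn (q - a)) * norm (w *\<^sub>R e)" by (rule norm_cauchy_schwarz)
    also have "\<dots> \<le> 1/100" using q(4) e u(4) by (simp add: dist_norm norm_minus_commute)
    finally have 1: "99/100 \<le> w * (sgn (q - a) \<bullet> e)" by simp
    have "w * t q = dist q a * (w * (sgn (q - a) \<bullet> e))" unfolding t_def by (subst qa) simp
    hence "w * t q \<ge> 99/100 * dist q a" using mult_left_mono[OF 1 zero_le_dist[of q a]] by linarith
    thus ?thesis using q by (intro exI[of _ q]) auto
  qed
  obtain qp where qp: "qp \<in> A" "qp \<noteq> a" "dist qp a < g / 2" "t qp \<ge> (99/100) * dist qp a"
    using dirE[of b 1] B(1) b b0 by (auto simp: e_def)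
  have "\<exists>qm. qm \<in> A \<and> qm \<noteq> a \<and> dist qm a < g / 2 \<and> (\<not> ray \<longrightarrow> t qm \<le> - (99/100) * dist qm a)"
  proof (cases ray)
    case False
    then obtain u where u: "u \<in> Tan A a" "u \<bullet> e < 0" by (auto simp: ray_def not_le)
    obtain z where z: "u = z *\<^sub>R e" using TanE u by blast
    have "z < 0" using u(2) ee by (simp add: z)
    hence "u \<noteq> 0" "sgn u = (- 1) *\<^sub>R e" using e by (auto simp: z sgn_scaleR sgn_div_norm)
    then obtain q where "q \<in> A \<and> q \<noteq> a \<and> dist q a < g / 2 \<and> (- 1) * t q \<ge> (99/100) * dist q a"
      using dirE[of u "- 1"] u(1) by auto
    thus ?thesis by (intro exI[of _ q]) auto
  qed (use qp in blast)
  then obtain qm where qm: "qm \<in> A" "qm \<noteq> a" "dist qm a < g / 2"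
    "\<not> ray \<Longrightarrow> t qm \<le> - (99/100) * dist qm a" by blast
  \<comment> \<open>Separation of scales: the targets qp and qm are at least 10 h away from a,
    whereas the heights in the ribbon are at most hi = h/100. Points reached from the ribbon are at
    distance at most 20 hi from a, hence within h.\<close>
  define h where "h = min (dist qp a) (dist qm a) / 10"
  have h: "h > 0" "10 * h \<le> dist qp a" "10 * h \<le> dist qm a" "20 * h \<le> g" using qp qm by (auto simp: h_def)
  define hi where "hi = h / 100"
  define lo where "lo = (if ray then 0 else - hi)"
  have hi: "hi > 0" "100 * hi = h" using h by (auto simp: hi_def)
  have tdiff: "q \<bullet> e - x \<bullet> e = t q - t x" for x q by (simp add: t_def inner_diff_left)
  have go: "\<exists>y\<in>A. t y = s \<and> norm (y - x) \<le> 9 * \<bar>s - t x\<bar>"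
    if x: "x \<in> A" and q: "q \<in> A" "dist x q \<le> g" "dist x q \<le> 4 * \<bar>t q - t x\<bar>" and s: "s \<in> closed_segment (t x) (t q)"
    for x q s
  proof -
    have "s + a \<bullet> e \<in> closed_segment (x \<bullet> e) (q \<bullet> e)"
      using s unfolding closed_segment_eq_real_ivl t_def by (auto simp: inner_diff_left split: if_splits)
    moreover have "2 / r * dist x q \<le> 1/8"
      using q(2) g(3) c mult_left_mono[of "dist x q" g c] unfolding c_def by linarith
    ultimately obtain y where y: "y \<in> A" "y \<bullet> e = s + a \<bullet> e" "norm (y - x) \<le> 9 * \<bar>(s + a \<bullet> e) - x \<bullet> e\<bar>"
      using slice_towards[OF e x q(1)] q(2,3) g r_pos unfolding tdiff by (auto simp: dist_commute)
    thus ?thesis by (intro bexI[of _ y]) (auto simp: t_def inner_diff_left algebra_simps)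
  qed
  have sl: "\<exists>y\<in>A. t y = s \<and> norm (y - x) \<le> 9 * \<bar>s - t x\<bar>"
    if x: "x \<in> A" "dist x a \<le> h" and s: "s \<in> {lo..hi}" for x s
  proof -
    have tx: "\<bar>t x\<bar> \<le> h" using t_le[of x] x(2) by simp
    have xg: "dist x a \<le> g" using x(2) h by simp
    show ?thesis
    proof (cases "s \<ge> t x")
      case True
      have d: "dist x qp \<le> dist qp a + h" using dist_triangle[of x qp a] x(2) by (simp add: dist_commute)
      have "t x + (dist x qp) / 4 \<le> t qp" using d tx qp(4) h by linarith
      moreover have "s \<le> t qp" using s qp(4) h hi by simp
      moreover have "dist x qp \<le> g" using d qp(3) h by linarith
      ultimately show ?thesis using True qp(1) zero_le_dist[of x qp]
        by (intro go[OF x(1), of qp]) (auto simp: closed_segment_eq_real_ivl)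
    next
      case False
      show ?thesis
      proof (cases ray)
        case True
        have "0 \<le> t x" using ray_pos[OF True x(1) xg] .
        thus ?thesis using False s True dt[OF x(1) xg] xg a
          by (intro go[OF x(1), of a]) (auto simp: closed_segment_eq_real_ivl t_def[of a] lo_def)
      next
        case nray: False
        have d: "dist x qm \<le> dist qm a + h" using dist_triangle[of x qm a] x(2) by (simp add: dist_commute)
        have "t qm + (dist x qm) / 4 \<le> t x" using d tx qm(4)[OF nray] h by linarith
        moreover have "t qm \<le> s" using s qm(4)[OF nray] h hi nray by (simp add: lo_def)
        moreover have "dist x qm \<le> g" using d qm(3) h by linarith
        ultimately show ?thesis using False qm(1) zero_le_dist[of x qm]
          by (intro go[OF x(1), of qm]) (auto simp: closed_segment_eq_real_ivl)
      qed
    qed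
  qed
  define K where "K = {x. a + x \<in> A \<and> norm x \<le> h \<and> x \<bullet> e \<in> {lo..hi}}"
  define C where "C = 10 + 4 * c"
  have KD: "a + x \<in> A" "dist (a + x) a \<le> h" "dist (a + x) a \<le> g" "t (a + x) = x \<bullet> e" "\<bar>x \<bullet> e\<bar> \<le> hi"
    "norm x \<le> 2 * hi" if "x \<in> K" for x
  proof -
    show 1: "a + x \<in> A" "dist (a + x) a \<le> h" "t (a + x) = x \<bullet> e"
      using that by (auto simp: K_def dist_norm t_def)
    thus 2: "dist (a + x) a \<le> g" using h by simp
    show 3: "\<bar>x \<bullet> e\<bar> \<le> hi" using that hi by (auto simp: K_def lo_def abs_le_iff split: if_splits)
    show "norm x \<le> 2 * hi" using dt[OF 1(1) 2] 1(3) 3 by (simp add: dist_norm)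
  qed
  have KI: "y - a \<in> K" if "y \<in> A" "dist y a \<le> h" "t y \<in> {lo..hi}" for y
    using that by (simp add: K_def dist_norm t_def)
  have rib: "ribbon K e lo hi C"
  proof
    show "norm e = 1" "0 < hi" "lo = 0 \<or> lo = - hi" "1 \<le> C" using e hi c by (auto simp: lo_def C_def)
    have "closed ((\<lambda>x. a + x) -` A \<inter> cball 0 h \<inter> {x. x \<bullet> e \<in> {lo..hi}})"
      by (simp, intro closed_Int continuous_closed_vimage closed closed_cball closed_Collect_conj
          closed_Collect_le continuous_intros)
    moreover have "(\<lambda>x. a + x) -` A \<inter> cball 0 h \<inter> {x. x \<bullet> e \<in> {lo..hi}} = K"
      by (auto simp: K_def)
    moreover have "K \<subseteq> cball 0 h" by (auto simp: K_def)
    ultimately show "compact K" using bounded_cball bounded_subset by (metis compact_eq_bounded_closed)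
    show "0 \<in> K" using a h hi by (simp add: K_def lo_def)
    show "x \<bullet> e \<in> {lo..hi}" if "x \<in> K" for x using that by (simp add: K_def)
    show "norm (x - (x \<bullet> e) *\<^sub>R e) \<le> C * (x \<bullet> e)\<^sup>2" if x: "x \<in> K" for x
    proof -
      have "norm (x - (x \<bullet> e) *\<^sub>R e) \<le> 4 * c * (x \<bullet> e)\<^sup>2"
        using quad[of "a + x"] KD[OF x] by simp
      also have "\<dots> \<le> C * (x \<bullet> e)\<^sup>2" by (intro mult_right_mono) (auto simp: C_def)
      finally show ?thesis .
    qed
    show "\<exists>y\<in>K. y \<bullet> e = s \<and> norm (y - x) \<le> C * \<bar>s - x \<bullet> e\<bar>" if x: "x \<in> K" and s: "s \<in> {lo..hi}" for x s
    proof -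
      obtain y where y: "y \<in> A" "t y = s" "norm (y - (a + x)) \<le> 9 * \<bar>s - x \<bullet> e\<bar>"
        using sl[OF KD(1,2)[OF x] s] KD(4)[OF x] by auto
      have "\<bar>s\<bar> \<le> hi" using s hi by (auto simp: lo_def abs_le_iff split: if_splits)
      hence "\<bar>s - x \<bullet> e\<bar> \<le> 2 * hi" using KD(5)[OF x] by linarith
      moreover have "y - a = (y - (a + x)) + x" by simp
      ultimately have "norm (y - a) \<le> 2 * hi + 9 * (2 * hi)"
        using norm_triangle_ineq[of "y - (a + x)" x] y(3) KD(6)[OF x] by simp
      hence "y - a \<in> K" using KI[OF y(1)] y(2) s hi by (simp add: dist_norm)
      moreover have "(y - a) \<bullet> e = s" using y(2) by (simp add: t_def)
      moreover have "norm (y - a - x) \<le> C * \<bar>s - x \<bullet> e\<bar>"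
        using y(3) c mult_right_mono[of 9 C "\<bar>s - x \<bullet> e\<bar>"] by (simp add: C_def diff_diff_eq)
      ultimately show ?thesis by blast
    qed
    show "\<exists>p\<in>K. p \<bullet> e = (x \<bullet> e + y \<bullet> e) / 2 \<and> norm (p - (1/2) *\<^sub>R (x + y)) \<le> C * (norm (x - y))\<^sup>2"
      if x: "x \<in> K" and y: "y \<in> K" for x y
    proof -
      define m where "m = (1/2) *\<^sub>R (x + y)"
      define d where "d = c * (norm (x - y))\<^sup>2"
      have nm: "norm m \<le> 2 * hi" using norm_triangle_ineq[of x y] KD(6)[OF x] KD(6)[OF y] by (simp add: m_def)
      have xy4: "norm (x - y) \<le> 4 * hi" using norm_triangle_ineq4[of x y] KD(6)[OF x] KD(6)[OF y] by simp
      have "c * hi \<le> c * g" using h hi c by (intro mult_left_mono) auto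
      hence "c * hi \<le> 1/32" using g(3) by linarith
      have d: "0 \<le> d" "d \<le> hi"
      proof -
        have "norm (x - y) * norm (x - y) \<le> (4 * hi) * (4 * hi)" using xy4 hi by (intro mult_mono) auto
        hence "d \<le> c * ((4 * hi) * (4 * hi))" using c by (simp add: d_def power2_eq_square)
        also have "\<dots> = (c * hi) * (16 * hi)" by simp
        also have "\<dots> \<le> (1/32) * (16 * hi)" using \<open>c * hi \<le> 1/32\<close> hi by (intro mult_right_mono) auto
        finally show "d \<le> hi" using hi by simp
      qed (use c in \<open>simp add: d_def\<close>)
      define p where "p = P (a + m)"
      have E: "(a + x) + (1/2) *\<^sub>R ((a + y) - (a + x)) = a + m"
      proof -
        have "2 *\<^sub>R ((a + x) + (1/2) *\<^sub>R ((a + y) - (a + x))) = 2 *\<^sub>R (a + m)"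
          by (simp add: m_def algebra_simps scaleR_2)
        thus ?thesis by (simp only: scaleR_cancel_left) simp
      qed
      have "dist (a + x) (a + y) < r" using xy4 hi h g by (simp add: dist_norm)
      hence "infdist (a + m) A \<le> 2 / r * ((1/2) * (1 - 1/2) * (dist (a + x) (a + y))\<^sup>2)"
        using chord[OF KD(1)[OF x] KD(1)[OF y], of "1/2"] unfolding E by simp
      hence "infdist (a + m) A \<le> d / 4" by (simp add: d_def c_def dist_norm)
      hence "dist (a + m) p \<le> d / 4" by (simp only: p_def dist_P)
      hence pm: "norm (p - a - m) \<le> d / 4" by (simp add: dist_norm norm_minus_commute diff_diff_eq)
      have pa: "norm (p - a) \<le> 3 * hi" using norm_triangle_ineq[of "p - a - m" m] pm nm d by simp
      hence ph: "dist p a \<le> h" using hi by (simp add: dist_norm)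
      define s where "s = (x \<bullet> e + y \<bullet> e) / 2"
      have s: "s \<in> {lo..hi}" using x y by (auto simp: s_def K_def)
      have "\<bar>s - t p\<bar> \<le> d / 4"
      proof -
        have "s - t p = - ((p - a - m) \<bullet> e)" by (simp add: s_def t_def m_def inner_diff_left inner_add_left)
        thus ?thesis using Cauchy_Schwarz_ineq2[of "p - a - m" e] e pm by simp
      qed
      \<comment> \<open>The projection p of the midpoint misses the height s by at most d/4; the
        correction by \<open>sl\<close> moves it by at most 9 d/4.\<close>
      moreover obtain q where q: "q \<in> A" "t q = s" "norm (q - p) \<le> 9 * \<bar>s - t p\<bar>"
        using sl[of p s] ph s by (auto simp: p_def P_in)
      ultimately have qp: "norm (q - p) \<le> 9 * (d / 4)" by simp
      have "norm (q - a) \<le> 3 * hi + 9 * hi" using norm_triangle_ineq[of "q - p" "p - a"] qp pa d by simp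
      hence "q - a \<in> K" using KI[OF q(1)] q(2) s hi by (simp add: dist_norm)
      moreover have "norm (q - a - m) \<le> C * (norm (x - y))\<^sup>2"
      proof -
        have eq: "q - a - m = (q - p) + (p - a - m)" by simp
        have "norm (q - a - m) \<le> 10 / 4 * d"
          unfolding eq using norm_triangle_ineq[of "q - p" "p - a - m"] qp pm by linarith
        also have "\<dots> \<le> (4 * c) * (norm (x - y))\<^sup>2"
          using mult_right_mono[of "10/4" 4 d] d by (simp add: d_def)
        also have "\<dots> \<le> C * (norm (x - y))\<^sup>2" by (intro mult_right_mono) (auto simp: C_def)
        finally show ?thesis .
      qed
      moreover have "(q - a) \<bullet> e = s" using q(2) by (simp add: t_def)
      ultimately show ?thesis unfolding s_def m_def by blast
    qed
    show "\<exists>S. subspace S \<and> dim S \<le> 2 \<and> (\<forall>y\<in>K. \<exists>v\<in>S. norm (y - x - v) \<le> C * (norm (y - x))\<^sup>2)"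
      if x: "x \<in> K" for x
    proof (intro exI[of _ "span (Tan A (a + x))"] conjI ballI)
      show "dim (span (Tan A (a + x))) \<le> 2" using dim_Tan_le_2[OF cd KD(1)[OF x]] by simp
      fix y assume y: "y \<in> K"
      have "dist (a + x) (a + y) < r"
        using norm_triangle_ineq4[of x y] KD(6)[OF x] KD(6)[OF y] hi h g by (simp add: dist_norm)
      from chord_near_Tan[OF KD(1)[OF x] KD(1)[OF y] this]
      obtain v where v: "v \<in> Tan A (a + x)" "norm (y - x - v) \<le> c * (norm (y - x))\<^sup>2"
        by (auto simp: c_def dist_norm norm_minus_commute)
      moreover have "c * (norm (y - x))\<^sup>2 \<le> C * (norm (y - x))\<^sup>2"
        using c by (intro mult_right_mono) (auto simp: C_def)
      ultimately show "\<exists>v\<in>span (Tan A (a + x)). norm (y - x - v) \<le> C * (norm (y - x))\<^sup>2"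
        by (intro bexI[of _ v] span_base) auto
    qed simp
  qed
  show ?thesis
  proof (rule that[OF rib hi(1)])
    show "(\<lambda>x. a + x) ` K \<subseteq> A" by (auto simp: K_def)
    fix y assume y: "y \<in> A" "dist y a < hi"
    hence "dist y a \<le> h" "dist y a \<le> g" using hi h by simp_all
    moreover have "t y \<in> {lo..hi}"
      using t_le[of y] y ray_pos[OF _ y(1) \<open>dist y a \<le> g\<close>] by (auto simp: lo_def)
    ultimately show "y - a \<in> K" using KI y by blast
  qed
qed

end

section \<open>Minimal polygons and the section through all slices\<close>

section \<open>A curve of class \<open>C\<^sup>1\<^sup>,\<^sup>1\<close> through all slices\<close>

text \<open>A discrete Gronwall argument starting from the index k in both directions: as long as b
  \<le> 2 C h, one step adds at most q = 44 C^3 h^2, and n such steps add at most C h.\<close>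

lemma velocity_propagation:
  fixes b :: "nat \<Rightarrow> real"
  assumes C: "C \<ge> 1" and h: "h > 0" and n: "44 * C\<^sup>2 * (real n * h) \<le> 1"
    and b0: "\<And>i. b i \<ge> 0"
    and up: "\<And>i. Suc i < n \<Longrightarrow> b (Suc i) \<le> b i + 11 * C * (b i)\<^sup>2"
    and down: "\<And>i. Suc i < n \<Longrightarrow> b i \<le> b (Suc i) + 11 * C * (b (Suc i))\<^sup>2"
    and k: "k < n" "b k \<le> C * h" and i: "i < n"
  shows "b i \<le> 2 * (C * h)"
proof -
  define q where "q = 44 * C ^ 3 * h\<^sup>2"
  have q: "real n * q \<le> C * h"
  proof -
    have "real n * q = (44 * C\<^sup>2 * (real n * h)) * (C * h)" by (simp add: q_def power2_eq_square power3_eq_cube)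
    also have "\<dots> \<le> 1 * (C * h)" using n C h by (intro mult_right_mono) auto
    finally show ?thesis by simp
  qed
  have q0: "q \<ge> 0" using C h by (simp add: q_def)
  have le2: "x \<le> 2 * (C * h)" if "x \<le> C * h + real l * q" "l \<le> n" for x l
    using that q q0 mult_right_mono[of "real l" "real n" q] by simp
  have step: "y \<le> C * h + real (Suc l) * q"
    if "y \<le> x + 11 * C * x\<^sup>2" "x \<le> C * h + real l * q" "l \<le> n" "x \<ge> 0" for x y l
  proof -
    have "x \<le> 2 * (C * h)" using le2 that by blast
    hence "x\<^sup>2 \<le> (2 * (C * h))\<^sup>2" using that by (intro power_mono) auto
    hence "11 * C * x\<^sup>2 \<le> 11 * C * (2 * (C * h))\<^sup>2" using C by (intro mult_left_mono) auto
    also have "\<dots> = q" by (simp add: q_def power2_eq_square power3_eq_cube)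
    finally show ?thesis using that by (simp add: algebra_simps)
  qed
  have fw: "k + l < n \<Longrightarrow> b (k + l) \<le> C * h + real l * q" for l
  proof (induction l)
    case (Suc l)
    thus ?case using up[of "k + l"] step[of "b (k + Suc l)" "b (k + l)" l] b0[of "k + l"] by simp
  qed (use k in simp)
  have bw: "l \<le> k \<Longrightarrow> b (k - l) \<le> C * h + real l * q" for l
  proof (induction l)
    case (Suc l)
    hence "Suc (k - Suc l) = k - l" by simp
    thus ?case using down[of "k - Suc l"] step[of "b (k - Suc l)" "b (k - l)" l] Suc k(1) b0[of "k - l"] by simp
  qed (use k in simp)
  show ?thesis
  proof (cases "k \<le> i")
    case True
    thus ?thesis using fw[of "i - k"] le2[of "b i" "i - k"] i by simp
  next
    case False
    thus ?thesis using bw[of "k - i"] le2[of "b i" "k - i"] k by simp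
  qed
qed

lemma minimal_polygon:
  fixes S :: "nat \<Rightarrow> 'a::euclidean_space set"
  assumes "\<And>i. i \<le> n \<Longrightarrow> compact (S i)" "\<And>i. i \<le> n \<Longrightarrow> S i \<noteq> {}"
  obtains x where "\<And>i. i \<le> n \<Longrightarrow> x i \<in> S i"
    "\<And>y. (\<And>i. i \<le> n \<Longrightarrow> y i \<in> S i) \<Longrightarrow>
      (\<Sum>i<n. (norm (x (Suc i) - x i))\<^sup>2) \<le> (\<Sum>i<n. (norm (y (Suc i) - y i))\<^sup>2)"
proof -
  define S' where "S' i = (if i \<le> n then S i else {0})" for i
  define X where "X = PiE UNIV S'"
  have "compact X" unfolding X_def using assms by (intro compact_PiE_UNIV) (auto simp: S'_def)
  moreover have "X \<noteq> {}" using assms by (auto simp: X_def S'_def PiE_eq_empty_iff)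
  moreover have "continuous_on X (\<lambda>x. \<Sum>i<n. (norm (x (Suc i) - x i))\<^sup>2)"
    by (intro continuous_intros continuous_on_subset[OF continuous_on_product_coordinates]) auto
  ultimately have "\<exists>x\<in>X. \<forall>y\<in>X. (\<Sum>i<n. (norm (x (Suc i) - x i))\<^sup>2) \<le> (\<Sum>i<n. (norm (y (Suc i) - y i))\<^sup>2)"
    by (rule continuous_attains_inf)
  then obtain x where x: "x \<in> X" "\<And>y. y \<in> X \<Longrightarrow>
      (\<Sum>i<n. (norm (x (Suc i) - x i))\<^sup>2) \<le> (\<Sum>i<n. (norm (y (Suc i) - y i))\<^sup>2)" by blast
  show ?thesis
  proof (rule that)
    show "x i \<in> S i" if "i \<le> n" for i
    proof -
      have "x i \<in> S' i" using x(1) by (auto simp: X_def)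
      thus ?thesis using that by (simp add: S'_def)
    qed
    fix y assume y: "\<And>i. i \<le> n \<Longrightarrow> y i \<in> S i"
    define y' where "y' i = (if i \<le> n then y i else 0)" for i
    have "y' \<in> X" using y by (auto simp: X_def y'_def S'_def)
    hence "(\<Sum>i<n. (norm (x (Suc i) - x i))\<^sup>2) \<le> (\<Sum>i<n. (norm (y' (Suc i) - y' i))\<^sup>2)" by (rule x(2))
    also have "\<dots> = (\<Sum>i<n. (norm (y (Suc i) - y i))\<^sup>2)" by (intro sum.cong) (auto simp: y'_def)
    finally show "(\<Sum>i<n. (norm (x (Suc i) - x i))\<^sup>2) \<le> (\<Sum>i<n. (norm (y (Suc i) - y i))\<^sup>2)" .
  qed
qed

text \<open>Only two terms of the energy contain a given inner vertex. By the parallelogram law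
  their sum is, up to a constant, twice the squared distance of this vertex from the midpoint of its
  neighbours.\<close>

lemma minimal_polygon_midpoint:
  fixes x :: "nat \<Rightarrow> 'a::euclidean_space"
  assumes x: "\<And>i. i \<le> n \<Longrightarrow> x i \<in> S i"
    and min: "\<And>y. (\<And>i. i \<le> n \<Longrightarrow> y i \<in> S i) \<Longrightarrow>
      (\<Sum>i<n. (norm (x (Suc i) - x i))\<^sup>2) \<le> (\<Sum>i<n. (norm (y (Suc i) - y i))\<^sup>2)"
    and i: "Suc i < n" and z: "z \<in> S (Suc i)"
  shows "norm (x (Suc i) - (1/2) *\<^sub>R (x i + x (Suc (Suc i)))) \<le> norm (z - (1/2) *\<^sub>R (x i + x (Suc (Suc i))))"
proof -
  define y where "y = x(Suc i := z)"
  define d where "d j = (norm (y (Suc j) - y j))\<^sup>2 - (norm (x (Suc j) - x j))\<^sup>2" for j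
  have "(\<Sum>j<n. (norm (x (Suc j) - x j))\<^sup>2) \<le> (\<Sum>j<n. (norm (y (Suc j) - y j))\<^sup>2)"
    using x z by (intro min) (auto simp: y_def)
  hence "0 \<le> (\<Sum>j<n. d j)" by (simp add: d_def sum_subtractf)
  also have "(\<Sum>j<n. d j) = (\<Sum>j\<in>{i, Suc i}. d j)"
    using i by (intro sum.mono_neutral_right) (auto simp: d_def y_def)
  also have "\<dots> = d i + d (Suc i)" by simp
  finally have 1: "(norm (x (Suc i) - x i))\<^sup>2 + (norm (x (Suc (Suc i)) - x (Suc i)))\<^sup>2
      \<le> (norm (z - x i))\<^sup>2 + (norm (x (Suc (Suc i)) - z))\<^sup>2" by (simp add: d_def y_def)
  have par: "(norm (w - p))\<^sup>2 + (norm (q - w))\<^sup>2 = 2 * (norm (w - (1/2) *\<^sub>R (p + q)))\<^sup>2 + (norm (p - q))\<^sup>2 / 2"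
    for w p q :: 'a unfolding power2_norm_eq_inner
    by (simp add: inner_add_left inner_add_right inner_diff_left inner_diff_right inner_commute field_simps)
  have "(norm (x (Suc i) - (1/2) *\<^sub>R (x i + x (Suc (Suc i)))))\<^sup>2 \<le> (norm (z - (1/2) *\<^sub>R (x i + x (Suc (Suc i)))))\<^sup>2"
    using 1 unfolding par by simp
  thus ?thesis by (rule power2_le_imp_le) simp
qed

context ribbon
begin

lemma slice_ne: "t \<in> J \<Longrightarrow> \<exists>x\<in>K. x \<bullet> e = t" using slice[OF zero_K] by blast

lemma norm_K_diff:
  assumes x: "x \<in> K" and y: "y \<in> K" and small: "4 * C * (hi - lo) \<le> 1"
  shows "norm (x - y) \<le> 2 * (hi - lo)"
proof -
  define w where "w = hi - lo"
  have w0: "w \<ge> 0" using len_pos by (simp add: w_def)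
  have tr: "norm (z - (z \<bullet> e) *\<^sub>R e) \<le> w / 4" if z: "z \<in> K" for z
  proof -
    have "C * (z \<bullet> e)\<^sup>2 \<le> C * w\<^sup>2"
      using abs_J(2)[OF height[OF z]] w0 C_ge_1 by (intro mult_left_mono) (auto simp: w_def simp flip: abs_le_square_iff)
    also have "\<dots> = (4 * C * w) * w / 4" by (simp add: power2_eq_square)
    also have "\<dots> \<le> 1 * w / 4" using small w0 unfolding w_def[symmetric] by (intro divide_right_mono mult_right_mono) auto
    finally show ?thesis using quad0[OF z] by simp
  qed
  have "\<bar>x \<bullet> e - y \<bullet> e\<bar> \<le> w" using height[OF x] height[OF y] by (auto simp: w_def)
  hence "norm ((x \<bullet> e - y \<bullet> e) *\<^sub>R e) \<le> w" using norm_e by simp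
  moreover have eq: "x - y = ((x - (x \<bullet> e) *\<^sub>R e) - (y - (y \<bullet> e) *\<^sub>R e)) + (x \<bullet> e - y \<bullet> e) *\<^sub>R e" by (simp add: algebra_simps)
  ultimately have "norm (x - y) \<le> (w / 4 + w / 4) + w"
    by (subst eq) (intro order_trans[OF norm_triangle_ineq] order_trans[OF norm_triangle_ineq4] add_mono tr x y)
  also have "\<dots> \<le> 2 * w" using w0 by simp
  finally show ?thesis by (simp only: w_def)
qed

text \<open>In a polygon of least energy each inner vertex is the point of its slice nearest to the
  midpoint of its neighbours, and \<open>mid\<close> offers a point of that slice quadratically
  near. So the second differences are bounded by squares of step lengths. One step is no longer than
  C h, and \<open>velocity_propagation\<close> carries this bound to all steps.\<close>

lemma discrete_curve:
  assumes n: "n > 0" and small: "400 * C\<^sup>2 * (hi - lo) \<le> 1" and h: "h = (hi - lo) / n"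
  obtains x where "\<And>i. i \<le> n \<Longrightarrow> x i \<in> K" "\<And>i. i \<le> n \<Longrightarrow> x i \<bullet> e = lo + i * h"
    "\<And>i. i < n \<Longrightarrow> norm (x (Suc i) - x i) \<le> 2 * (C * h)"
    "\<And>i. Suc i < n \<Longrightarrow> norm (x (Suc (Suc i)) - 2 *\<^sub>R x (Suc i) + x i) \<le> 32 * C ^ 3 * h\<^sup>2"
proof -
  define w where "w = hi - lo"
  have w: "w > 0" using len_pos by (simp add: w_def)
  have Cw: "400 * (C * w) \<le> 1"
  proof -
    have "C * w \<le> C * C * w" using C_ge_1 w by simp
    thus ?thesis using small by (simp add: w_def power2_eq_square)
  qed
  have h0: "h > 0" "real n * h = w" using n w by (auto simp: h w_def)
  define S where "S i = {y \<in> K. y \<bullet> e = lo + real i * h}" for i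
  have ti: "lo + real i * h \<in> J" if "i \<le> n" for i
    using h0 mult_right_mono[of "real i" "real n" h] that by (auto simp: w_def)
  have "closed {y. y \<bullet> e = c}" for c by (intro closed_Collect_eq continuous_intros)
  hence "compact (K \<inter> {y. y \<bullet> e = c})" for c using compact_K by (intro compact_Int_closed)
  hence cS: "compact (S i)" for i unfolding S_def Int_def[symmetric] by (simp add: Collect_conj_eq)
  have neS: "S i \<noteq> {}" if "i \<le> n" for i using slice_ne[OF ti[OF that]] by (auto simp: S_def)
  obtain x where x: "\<And>i. i \<le> n \<Longrightarrow> x i \<in> S i"
    and min: "\<And>y. (\<And>i. i \<le> n \<Longrightarrow> y i \<in> S i) \<Longrightarrow>
      (\<Sum>i<n. (norm (x (Suc i) - x i))\<^sup>2) \<le> (\<Sum>i<n. (norm (y (Suc i) - y i))\<^sup>2)"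
  proof (rule minimal_polygon[of n S])
    show "compact (S i)" for i by (rule cS)
    show "S i \<noteq> {}" if "i \<le> n" for i by (rule neS[OF that])
  qed (rule that, assumption, blast)
  have xK: "x i \<in> K" "x i \<bullet> e = lo + real i * h" if "i \<le> n" for i using x[OF that] by (auto simp: S_def)
  define v where "v i = norm (x (Suc i) - x i)" for i
  have dd: "norm (x (Suc (Suc i)) - 2 *\<^sub>R x (Suc i) + x i) \<le> 2 * C * (v i + v (Suc i))\<^sup>2" if i: "Suc i < n" for i
  proof -
    obtain p where p: "p \<in> K" "p \<bullet> e = (x i \<bullet> e + x (Suc (Suc i)) \<bullet> e) / 2"
      "norm (p - (1/2) *\<^sub>R (x i + x (Suc (Suc i)))) \<le> C * (norm (x i - x (Suc (Suc i))))\<^sup>2"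
      using mid[of "x i" "x (Suc (Suc i))"] xK i by auto
    have "p \<in> S (Suc i)" using p(1,2) xK(2)[of i] xK(2)[of "Suc (Suc i)"] i by (simp add: S_def algebra_simps)
    from minimal_polygon_midpoint[OF x min i this]
    have "norm (x (Suc i) - (1/2) *\<^sub>R (x i + x (Suc (Suc i)))) \<le> C * (norm (x i - x (Suc (Suc i))))\<^sup>2"
      using p(3) by simp
    also have "\<dots> \<le> C * (v i + v (Suc i))\<^sup>2"
    proof -
      have "norm (x i - x (Suc (Suc i))) \<le> v i + v (Suc i)"
        using norm_triangle_ineq[of "x (Suc i) - x i" "x (Suc (Suc i)) - x (Suc i)"]
        by (simp add: v_def norm_minus_commute)
      thus ?thesis using C_ge_1 by (intro mult_left_mono power_mono) auto
    qed
    finally have "norm (x (Suc i) - (1/2) *\<^sub>R (x i + x (Suc (Suc i)))) \<le> C * (v i + v (Suc i))\<^sup>2" .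
    moreover have "x (Suc (Suc i)) - 2 *\<^sub>R x (Suc i) + x i = (-2) *\<^sub>R (x (Suc i) - (1/2) *\<^sub>R (x i + x (Suc (Suc i))))"
      by (simp add: algebra_simps)
    ultimately show ?thesis by simp
  qed
  have dv: "\<bar>v (Suc i) - v i\<bar> \<le> 2 * C * (v i + v (Suc i))\<^sup>2" if i: "Suc i < n" for i
  proof -
    have "\<bar>v (Suc i) - v i\<bar> \<le> norm ((x (Suc (Suc i)) - x (Suc i)) - (x (Suc i) - x i))"
      unfolding v_def by (rule norm_triangle_ineq3)
    also have "(x (Suc (Suc i)) - x (Suc i)) - (x (Suc i) - x i) = x (Suc (Suc i)) - 2 *\<^sub>R x (Suc i) + x i"
      by (simp add: algebra_simps scaleR_2)
    finally show ?thesis using dd[OF i] by simp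
  qed
  have v0: "v i \<ge> 0" for i by (simp add: v_def)
  have vw: "v i \<le> 2 * w" if "i < n" for i
    unfolding v_def w_def using xK that Cw by (intro norm_K_diff) (auto simp: w_def)
  \<comment> \<open>Since 400 C w \<le> 1, the two step lengths are comparable, a + b \<le> 9/4 a,
    so the bound 2 C (a + b)^2 can be expressed by a alone; 2 (9/4)^2 = 81/8 < 11.\<close>
  have growth: "b \<le> a + 11 * C * a\<^sup>2"
    if ab: "0 \<le> a" "0 \<le> b" "a + b \<le> 4 * w" "\<bar>b - a\<bar> \<le> 2 * C * (a + b)\<^sup>2" for a b
  proof -
    have "2 * C * (a + b)\<^sup>2 = (2 * C * (a + b)) * (a + b)" by (simp add: power2_eq_square)
    also have "\<dots> \<le> (2 * C * (4 * w)) * (a + b)"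
      using ab C_ge_1 by (intro mult_right_mono mult_left_mono) auto
    also have "\<dots> \<le> (1/10) * (a + b)" using Cw ab by (intro mult_right_mono) auto
    finally have "b - a \<le> (1/10) * (a + b)" using ab(4) by (simp add: abs_le_iff)
    hence "a + b \<le> 9/4 * a" using ab by simp
    hence "(a + b)\<^sup>2 \<le> (9/4 * a)\<^sup>2" using ab by (intro power_mono) auto
    hence "2 * C * (a + b)\<^sup>2 \<le> 2 * C * (9/4 * a)\<^sup>2" using C_ge_1 by (intro mult_left_mono) auto
    also have "\<dots> = 81/8 * (C * a\<^sup>2)" by (simp add: power2_eq_square)
    also have "\<dots> \<le> 11 * (C * a\<^sup>2)" using C_ge_1 by (intro mult_right_mono) auto
    finally show ?thesis using ab(4) by (simp add: abs_le_iff)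
  qed
  have "\<exists>k<n. v k \<le> C * h"
  proof -
    \<comment> \<open>\<open>slice\<close> builds a competitor all of whose steps are at most C h.
      If every step of the minimizer were longer, it would have larger energy.\<close>
    have chain: "m \<le> n \<Longrightarrow> \<exists>y. (\<forall>i\<le>m. y i \<in> S i) \<and> (\<forall>i<m. norm (y (Suc i) - y i) \<le> C * h)" for m
    proof (induction m)
      case 0
      obtain z where "z \<in> S 0" using neS[of 0] by blast
      thus ?case by (intro exI[of _ "\<lambda>_. z"]) simp
    next
      case (Suc m)
      then obtain y where y: "\<forall>i\<le>m. y i \<in> S i" "\<forall>i<m. norm (y (Suc i) - y i) \<le> C * h" by auto
      have ym: "y m \<in> K" "y m \<bullet> e = lo + real m * h" using y(1) by (auto simp: S_def)
      obtain z where "z \<in> K" "z \<bullet> e = lo + real (Suc m) * h"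
        "norm (z - y m) \<le> C * \<bar>lo + real (Suc m) * h - y m \<bullet> e\<bar>"
        using slice[OF ym(1) ti[OF Suc.prems]] by blast
      hence z: "z \<in> S (Suc m)" "norm (z - y m) \<le> C * h" using ym(2) h0 by (auto simp: S_def algebra_simps)
      show ?case by (intro exI[of _ "y(Suc m := z)"]) (use y z in \<open>auto simp: le_Suc_eq less_Suc_eq\<close>)
    qed
    then obtain y where y: "\<forall>i\<le>n. y i \<in> S i" "\<forall>i<n. norm (y (Suc i) - y i) \<le> C * h" by blast
    show ?thesis
    proof (rule ccontr)
      assume "\<not> (\<exists>k<n. v k \<le> C * h)"
      hence "(\<Sum>i<n. (norm (y (Suc i) - y i))\<^sup>2) < (\<Sum>i<n. (norm (x (Suc i) - x i))\<^sup>2)"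
        using y(2) n C_ge_1 h0 by (intro sum_strict_mono power_strict_mono) (force simp: v_def)+
      thus False using min[of y] y(1) by simp
    qed
  qed
  then obtain k where k: "k < n" "v k \<le> C * h" by blast
  have v2: "v i \<le> 2 * (C * h)" if "i < n" for i
  proof (rule velocity_propagation[where b = v and n = n and h = h and C = C and k = k])
    show "44 * C\<^sup>2 * (real n * h) \<le> 1" using small h0(2) w C_ge_1 unfolding w_def[symmetric]
      by (simp add: mult.assoc)
    show "v (Suc i) \<le> v i + 11 * C * (v i)\<^sup>2" if "Suc i < n" for i
      using vw[of i] vw[of "Suc i"] dv[OF that] v0[of i] v0[of "Suc i"] that by (intro growth) auto
    show "v i \<le> v (Suc i) + 11 * C * (v (Suc i))\<^sup>2" if "Suc i < n" for i
      using vw[of i] vw[of "Suc i"] dv[OF that] v0[of i] v0[of "Suc i"] that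
      by (intro growth) (auto simp: add.commute abs_minus_commute)
  qed (use C_ge_1 h0 v0 k that in auto)
  show ?thesis
  proof (rule that[of x])
    show "norm (x (Suc (Suc i)) - 2 *\<^sub>R x (Suc i) + x i) \<le> 32 * C ^ 3 * h\<^sup>2" if "Suc i < n" for i
    proof -
      have "v i + v (Suc i) \<le> 4 * (C * h)" using v2[of i] v2[of "Suc i"] that by simp
      hence "(v i + v (Suc i))\<^sup>2 \<le> (4 * (C * h))\<^sup>2" using v0 by (intro power_mono add_nonneg_nonneg) auto
      hence "2 * C * (v i + v (Suc i))\<^sup>2 \<le> 2 * C * (4 * (C * h))\<^sup>2" using C_ge_1 by (intro mult_left_mono) auto
      also have "\<dots> = 32 * C ^ 3 * h\<^sup>2" by (simp add: power2_eq_square power3_eq_cube)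
      finally show ?thesis using dd[OF that] by simp
    qed
  qed (use xK v2 in \<open>auto simp: v_def\<close>)
qed

text \<open>The difference quotients of the discrete curves satisfy the Lipschitz and the Taylor
  estimate with the same constant 32 C^3 for every grid. Both are closed conditions on two grid
  points, so they pass to the limit given by \<open>grid_cluster\<close>.\<close>

theorem C11_section:
  assumes small: "400 * C\<^sup>2 * (hi - lo) \<le> 1"
  obtains c V M where "M \<ge> 0"
    "\<And>t. t \<in> J \<Longrightarrow> c t \<in> K" "\<And>t. t \<in> J \<Longrightarrow> c t \<bullet> e = t"
    "\<And>s t. \<lbrakk>s \<in> J; t \<in> J\<rbrakk> \<Longrightarrow> norm (c t - c s - (t - s) *\<^sub>R V s) \<le> M * (t - s)\<^sup>2"
    "\<And>s t. \<lbrakk>s \<in> J; t \<in> J\<rbrakk> \<Longrightarrow> norm (V t - V s) \<le> M * \<bar>t - s\<bar>"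
proof -
  define h where "h n = (hi - lo) / real n" for n
  define M where "M = 32 * C ^ 3"
  have M: "M \<ge> 0" using C_ge_1 by (simp add: M_def)
  let ?x = "\<lambda>n x. (\<forall>i\<le>n. x i \<in> K \<and> x i \<bullet> e = lo + i * h n) \<and> (\<forall>i<n. norm (x (Suc i) - x i) \<le> 2 * (C * h n)) \<and>
    (\<forall>i. Suc i < n \<longrightarrow> norm (x (Suc (Suc i)) - 2 *\<^sub>R x (Suc i) + x i) \<le> M * (h n)\<^sup>2)"
  define x where "x n = (SOME x. ?x n x)" for n
  have "\<exists>x. ?x n x" if n: "n > 0" for n by (rule discrete_curve[OF n small h_def[of n]]) (auto simp: M_def)
  hence "?x n (x n)" if "n > 0" for n unfolding x_def by (rule someI_ex) (rule that)
  hence x: "\<And>n i. n > 0 \<Longrightarrow> i \<le> n \<Longrightarrow> x n i \<in> K"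
    "\<And>n i. n > 0 \<Longrightarrow> i \<le> n \<Longrightarrow> x n i \<bullet> e = lo + i * h n"
    "\<And>n i. n > 0 \<Longrightarrow> i < n \<Longrightarrow> norm (x n (Suc i) - x n i) \<le> 2 * (C * h n)"
    "\<And>n i. n > 0 \<Longrightarrow> Suc i < n \<Longrightarrow> norm (x n (Suc (Suc i)) - 2 *\<^sub>R x n (Suc i) + x n i) \<le> M * (h n)\<^sup>2"
    by blast+
  have hpos: "h n > 0" if "n > 0" for n using len_pos that by (simp add: h_def)
  \<comment> \<open>At the last grid point there is no forward difference, and the preceding one is
    repeated.\<close>
  define V where "V n i = (if i < n then (1 / h n) *\<^sub>R (x n (Suc i) - x n i) else (1 / h n) *\<^sub>R (x n i - x n (i - 1)))" for n i
  have xV: "x n (Suc i) = x n i + h n *\<^sub>R V n i" if "i < n" for n i using hpos[of n] that by (simp add: V_def)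
  have Vb: "norm (V n i) \<le> 2 * C" if n: "n > 0" "i \<le> n" for n i
  proof (cases "i < n")
    case True
    thus ?thesis using x(3)[OF n(1) True] hpos[OF n(1)] by (simp add: V_def pos_divide_le_eq mult_ac)
  next
    case False
    thus ?thesis using x(3)[OF n(1), of "n - 1"] hpos[OF n(1)] n by (simp add: V_def pos_divide_le_eq mult_ac)
  qed
  have V1: "norm (V n (Suc i) - V n i) \<le> M * h n" if n: "i < n" for n i
  proof (cases "Suc i < n")
    case True
    have "V n (Suc i) - V n i = (1 / h n) *\<^sub>R (x n (Suc (Suc i)) - 2 *\<^sub>R x n (Suc i) + x n i)"
      using True by (simp add: V_def algebra_simps scaleR_2)
    thus ?thesis using x(4)[OF _ True] hpos[of n] n by (simp add: power2_eq_square divide_le_eq mult.assoc)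
  next
    case False
    hence "V n (Suc i) = V n i" using n by (auto simp: V_def dest!: Suc_lessI)
    thus ?thesis using M hpos[of n] n by simp
  qed
  have V2: "norm (V n j - V n i) \<le> M * \<bar>real j * h n - real i * h n\<bar>" if n: "i \<le> n" "j \<le> n" "n > 0" for n i j
    by (rule grid_lipschitz[where n = n]) (use V1 M n hpos[OF n(3)] in auto)
  \<comment> \<open>Admitting the velocity at either end of the interval makes the estimate
    available for j < i too, by a change of sign.\<close>
  have X2: "norm (x n j - x n i - (real j * h n - real i * h n) *\<^sub>R V n k) \<le> M * (real j * h n - real i * h n)\<^sup>2"
    if ij: "i \<le> j" "j \<le> n" "n > 0" and k: "k = i \<or> k = j" for n i j k
  proof -
    have ik: "i \<le> k" "k \<le> j" using ij k by auto
    have "i \<le> l \<Longrightarrow> l \<le> j \<Longrightarrow> norm (x n l - x n i - (real l * h n - real i * h n) *\<^sub>R V n k)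
        \<le> M * (real j * h n - real i * h n) * (real l * h n - real i * h n)" for l
    proof (induction l rule: dec_induct)
      case (step l)
      have eq: "x n (Suc l) - x n i - (real (Suc l) * h n - real i * h n) *\<^sub>R V n k
          = (x n l - x n i - (real l * h n - real i * h n) *\<^sub>R V n k) + h n *\<^sub>R (V n l - V n k)"
        using xV[of l n] step ij by (simp add: algebra_simps)
      have "norm (x n (Suc l) - x n i - (real (Suc l) * h n - real i * h n) *\<^sub>R V n k)
          \<le> norm (x n l - x n i - (real l * h n - real i * h n) *\<^sub>R V n k) + norm (h n *\<^sub>R (V n l - V n k))"
        unfolding eq by (rule norm_triangle_ineq)
      also have "norm (h n *\<^sub>R (V n l - V n k)) \<le> h n * (M * (real j * h n - real i * h n))"
      proof -
        have "\<bar>real l * h n - real k * h n\<bar> \<le> real j * h n - real i * h n"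
        proof -
          have "real l * h n \<le> real j * h n" "real i * h n \<le> real l * h n"
            "real k * h n \<le> real j * h n" "real i * h n \<le> real k * h n"
            using step ik hpos[OF ij(3)] by (simp_all add: mult_right_mono)
          thus ?thesis by (simp add: abs_le_iff)
        qed
        hence "M * \<bar>real l * h n - real k * h n\<bar> \<le> M * (real j * h n - real i * h n)"
          using M by (rule mult_left_mono)
        hence "norm (V n l - V n k) \<le> M * (real j * h n - real i * h n)" using V2[of k n l] step ik ij by simp
        thus ?thesis using hpos[OF ij(3)] by simp
      qed
      finally show ?case using step by (simp add: algebra_simps)
    qed (simp)
    from this[of j] show ?thesis using ij by (simp add: power2_eq_square mult.assoc)
  qed
  have X2': "norm (x n j - x n i - (real j * h n - real i * h n) *\<^sub>R V n i) \<le> M * (real j * h n - real i * h n)\<^sup>2"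
    if "i \<le> n" "j \<le> n" "n > 0" for n i j
  proof (cases "i \<le> j")
    case False
    have eq: "x n j - x n i - (real j * h n - real i * h n) *\<^sub>R V n i
        = - (x n i - x n j - (real i * h n - real j * h n) *\<^sub>R V n i)" by (simp add: algebra_simps)
    show ?thesis unfolding eq norm_minus_cancel using X2[of j i n i] that False by (simp add: power2_commute)
  qed (use X2[of i j n i] that in simp)
  obtain F where FK: "\<And>t. F t \<in> K \<times> cball 0 (2 * C)" and F: "\<And>s t. \<lbrakk>s \<in> J; t \<in> J\<rbrakk> \<Longrightarrow> \<exists>r i j.
      (\<forall>k. 0 < r k \<and> i k \<le> r k \<and> j k \<le> r k) \<and>
      (\<lambda>k. lo + real (i k) * ((hi - lo) / r k)) \<longlonglongrightarrow> s \<and> (\<lambda>k. lo + real (j k) * ((hi - lo) / r k)) \<longlonglongrightarrow> t \<and>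
      (\<lambda>k. (x (r k) (i k), V (r k) (i k))) \<longlonglongrightarrow> F s \<and> (\<lambda>k. (x (r k) (j k), V (r k) (j k))) \<longlonglongrightarrow> F t"
    by (rule grid_cluster[of "K \<times> cball 0 (2 * C)" "\<lambda>n i. (x n i, V n i)" lo hi])
      (use compact_K x(1) Vb len_pos in \<open>auto intro: compact_Times\<close>)
  define g V' where "g t = fst (F t)" and "V' t = snd (F t)" for t
  have jet: "norm (V' t - V' s) \<le> M * \<bar>t - s\<bar>" "norm (g t - g s - (t - s) *\<^sub>R V' s) \<le> M * (t - s)\<^sup>2" "g s \<bullet> e = s"
    if st: "s \<in> J" "t \<in> J" for s t
  proof -
    obtain r i j where ij: "\<And>k. 0 < r k" "\<And>k. i k \<le> r k" "\<And>k. j k \<le> r k"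
      and i': "(\<lambda>k. lo + real (i k) * h (r k)) \<longlonglongrightarrow> s" and j': "(\<lambda>k. lo + real (j k) * h (r k)) \<longlonglongrightarrow> t"
      and lim: "(\<lambda>k. (x (r k) (i k), V (r k) (i k))) \<longlonglongrightarrow> F s" "(\<lambda>k. (x (r k) (j k), V (r k) (j k))) \<longlonglongrightarrow> F t"
      using F[OF st] unfolding h_def by blast
    note i = lim(1)[THEN tendsto_fst, folded g_def, simplified] lim(1)[THEN tendsto_snd, folded V'_def, simplified]
    note j = lim(2)[THEN tendsto_fst, folded g_def, simplified] lim(2)[THEN tendsto_snd, folded V'_def, simplified]
    have d: "(\<lambda>k. real (j k) * h (r k) - real (i k) * h (r k)) \<longlonglongrightarrow> t - s" using tendsto_diff[OF j' i'] by simp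
    show "norm (V' t - V' s) \<le> M * \<bar>t - s\<bar>"
      by (rule lim_mono[of 0, OF _ tendsto_norm[OF tendsto_diff[OF j(2) i(2)]] tendsto_mult[OF tendsto_const tendsto_rabs[OF d]]])
        (intro V2 ij)
    have xl: "(\<lambda>k. M * (real (j k) * h (r k) - real (i k) * h (r k))\<^sup>2) \<longlonglongrightarrow> M * (t - s)\<^sup>2"
      "(\<lambda>k. norm (x (r k) (j k) - x (r k) (i k) - (real (j k) * h (r k) - real (i k) * h (r k)) *\<^sub>R V (r k) (i k)))
        \<longlonglongrightarrow> norm (g t - g s - (t - s) *\<^sub>R V' s)" by (intro tendsto_intros i j d)+
    show "norm (g t - g s - (t - s) *\<^sub>R V' s) \<le> M * (t - s)\<^sup>2"
      by (rule lim_mono[of 0, OF X2'[OF ij(2,3,1)] xl(2,1)])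
    have "(\<lambda>k. x (r k) (i k) \<bullet> e) \<longlonglongrightarrow> g s \<bullet> e" by (intro tendsto_intros i)
    thus "g s \<bullet> e = s" using i' LIMSEQ_unique by (simp add: x(2)[OF ij(1,2)])
  qed
  have "g t \<in> K" for t using FK[of t] by (auto simp: g_def)
  thus ?thesis using that[of M g V'] M jet by blast
qed

end

text \<open>\<open>axis\<close> says that the section has been straightened; \<open>gap_quad\<close> says that \<open>K\<close> touches
  the axis to second order at each degenerate slice.\<close>

locale straight_ribbon = ribbon +
  assumes axis: "t \<in> {lo..hi} \<Longrightarrow> t *\<^sub>R e \<in> K"
    and gap_quad: "\<lbrakk>c \<in> {lo..hi}; \<And>y. y \<in> K \<Longrightarrow> y \<bullet> e = c \<Longrightarrow> y = c *\<^sub>R e; x \<in> K\<rbrakk> \<Longrightarrow>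
      norm (x - (x \<bullet> e) *\<^sub>R e) \<le> C * (x \<bullet> e - c)\<^sup>2"

lemma straight_ribbon_restrict:
  assumes "straight_ribbon K e lo hi C" and b: "0 < hi'" "hi' \<le> hi" and a: "lo' = (if lo = 0 then 0 else - hi')"
  shows "straight_ribbon (K \<inter> {x. x \<bullet> e \<in> {lo'..hi'}}) e lo' hi' C"
proof -
  interpret straight_ribbon K e lo hi C by (fact assms(1))
  have sub: "{lo'..hi'} \<subseteq> {lo..hi}" using lo_cases b a by auto
  have ee: "e \<bullet> e = 1" using norm_e by (simp add: norm_eq_1)
  interpret R: ribbon "K \<inter> {x. x \<bullet> e \<in> {lo'..hi'}}" e lo' hi' C
    by (rule ribbon_restrict[OF ribbon_axioms b a])
  show ?thesis
  proof
    show "t *\<^sub>R e \<in> K \<inter> {x. x \<bullet> e \<in> {lo'..hi'}}" if "t \<in> {lo'..hi'}" for t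
      using axis[of t] that sub ee by auto
    show "norm (x - (x \<bullet> e) *\<^sub>R e) \<le> C * (x \<bullet> e - c)\<^sup>2"
      if "c \<in> {lo'..hi'}" "\<And>y. y \<in> K \<inter> {x. x \<bullet> e \<in> {lo'..hi'}} \<Longrightarrow> y \<bullet> e = c \<Longrightarrow> y = c *\<^sub>R e"
        "x \<in> K \<inter> {x. x \<bullet> e \<in> {lo'..hi'}}" for c x using that sub by (intro gap_quad) auto
  qed
qed

lemma ribbon_mono:
  assumes "ribbon K e lo hi C" "C \<le> C'"
  shows "ribbon K e lo hi C'"
proof -
  interpret ribbon K e lo hi C by (fact assms(1))
  have up: "a \<le> C' * b" if "a \<le> C * b" "b \<ge> 0" for a b
    using that assms(2) mult_right_mono[of C C' b] by linarith
  show ?thesis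
  proof
    show "norm (x - (x \<bullet> e) *\<^sub>R e) \<le> C' * (x \<bullet> e)\<^sup>2" if "x \<in> K" for x
      using quad0[OF that] by (rule up) simp
    show "\<exists>y\<in>K. y \<bullet> e = t \<and> norm (y - x) \<le> C' * \<bar>t - x \<bullet> e\<bar>" if "x \<in> K" "t \<in> {lo..hi}" for x t
      using slice[OF that] up by (meson abs_ge_zero)
    show "\<exists>p\<in>K. p \<bullet> e = (x \<bullet> e + y \<bullet> e) / 2 \<and> norm (p - (1/2) *\<^sub>R (x + y)) \<le> C' * (norm (x - y))\<^sup>2"
      if "x \<in> K" "y \<in> K" for x y using mid[OF that] up by (meson zero_le_power2)
    show "\<exists>S. subspace S \<and> dim S \<le> 2 \<and> (\<forall>y\<in>K. \<exists>v\<in>S. norm (y - x - v) \<le> C' * (norm (y - x))\<^sup>2)"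
      if "x \<in> K" for x using plane[OF that] up by (meson zero_le_power2)
  qed (use norm_e compact_K zero_K hi_pos lo_cases C_ge_1 assms(2) height in auto)
qed

text \<open>Near a degenerate slice at \<open>c\<close>, the midpoint of \<open>x\<close> and the axis point of height
  \<open>2c - x \<bullet> e\<close> must be close to \<open>c e\<close>.\<close>

lemma ribbon_straightI:
  assumes R: "ribbon K e lo hi C" and axis: "\<And>t. t \<in> {lo..hi} \<Longrightarrow> t *\<^sub>R e \<in> K"
    and a: "lo' = (if lo = 0 then 0 else - (hi / 3))"
  shows "straight_ribbon (K \<inter> {x. x \<bullet> e \<in> {lo'..hi / 3}}) e lo' (hi / 3) (18 * C ^ 3)"
proof -
  interpret ribbon K e lo hi C by (fact R)
  have ee: "e \<bullet> e = 1" using norm_e by (simp add: norm_eq_1)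
  have C3: "C \<le> C ^ 3" "1 \<le> C ^ 3" using C_ge_1 power_increasing[of 1 3 C] one_le_power[of C 3] by auto
  interpret R': ribbon "K \<inter> {x. x \<bullet> e \<in> {lo'..hi / 3}}" e lo' "hi / 3" "18 * C ^ 3"
    by (rule ribbon_mono[OF ribbon_restrict[OF R _ _ a]]) (use hi_pos C3 in auto)
  have sub: "{lo'..hi / 3} \<subseteq> {lo..hi}" using lo_cases hi_pos a by auto
  show ?thesis
  proof
    show "t *\<^sub>R e \<in> K \<inter> {x. x \<bullet> e \<in> {lo'..hi / 3}}" if "t \<in> {lo'..hi / 3}" for t
      using axis[of t] that sub ee by auto
    fix c x assume c: "c \<in> {lo'..hi / 3}" and x': "x \<in> K \<inter> {x. x \<bullet> e \<in> {lo'..hi / 3}}"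
      and triv': "\<And>y. y \<in> K \<inter> {x. x \<bullet> e \<in> {lo'..hi / 3}} \<Longrightarrow> y \<bullet> e = c \<Longrightarrow> y = c *\<^sub>R e"
    have x: "x \<in> K" and triv: "y = c *\<^sub>R e" if "y \<in> K" "y \<bullet> e = c" for y using x' triv' that c by auto
    have xK: "x \<in> K" using x' by simp
    define t z where "t = x \<bullet> e" and "z = x - t *\<^sub>R e"
    have t: "t \<in> {lo'..hi / 3}" using x' by (simp add: t_def)
    show "norm (x - (x \<bullet> e) *\<^sub>R e) \<le> 18 * C ^ 3 * (x \<bullet> e - c)\<^sup>2"
    proof (cases "2 * c - t \<in> {lo..hi}")
      case True
      define y where "y = (2 * c - t) *\<^sub>R e"
      have yK: "y \<in> K" unfolding y_def by (rule axis[OF True])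
      obtain p where p: "p \<in> K" "p \<bullet> e = (x \<bullet> e + y \<bullet> e) / 2" "norm (p - (1/2) *\<^sub>R (x + y)) \<le> C * (norm (x - y))\<^sup>2"
        using mid[OF xK yK] by blast
      have "p = c *\<^sub>R e" using p by (intro triv) (auto simp: y_def ee t_def[symmetric])
      moreover have "2 *\<^sub>R (c *\<^sub>R e - (1/2) *\<^sub>R (x + y)) = - z"
        by (simp add: z_def y_def algebra_simps)
      ultimately have "norm z = 2 * norm (p - (1/2) *\<^sub>R (x + y))"
        by (metis norm_minus_cancel norm_scaleR abs_numeral)
      hence z1: "norm z \<le> 2 * (C * (norm (x - y))\<^sup>2)" using p(3) by simp
      obtain w where w: "w \<in> K" "w \<bullet> e = c" "norm (w - x) \<le> C * \<bar>c - t\<bar>"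
        using slice[OF xK, of c] c sub t_def by auto
      have "w = c *\<^sub>R e" using triv w by blast
      hence "norm z \<le> norm (x - w)" using norm_diff_proj_le[OF norm_e, of x c] by (simp add: z_def t_def)
      hence "norm z \<le> C * \<bar>t - c\<bar>" using w(3) by (simp add: norm_minus_commute abs_minus_commute)
      moreover have "norm (x - y) \<le> norm z + 2 * \<bar>t - c\<bar>"
      proof -
        have "2 * (t - c) = t - (2 * c - t)" by simp
        hence eq: "x - y = z + (2 * (t - c)) *\<^sub>R e" by (simp only: z_def y_def scaleR_left_diff_distrib) simp
        have "norm ((2 * (t - c)) *\<^sub>R e) = 2 * \<bar>t - c\<bar>"
          by (simp only: norm_scaleR norm_e abs_mult abs_numeral mult_1_right)
        thus ?thesis unfolding eq using norm_triangle_ineq[of z "(2 * (t - c)) *\<^sub>R e"] by linarith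
      qed
      moreover have "\<bar>t - c\<bar> \<le> C * \<bar>t - c\<bar>" using C_ge_1 mult_right_mono[of 1 C "\<bar>t - c\<bar>"] by simp
      ultimately have "norm (x - y) \<le> 3 * C * \<bar>t - c\<bar>" by simp
      hence "(norm (x - y))\<^sup>2 \<le> (3 * C * \<bar>t - c\<bar>)\<^sup>2" by (intro power_mono) auto
      hence "2 * (C * (norm (x - y))\<^sup>2) \<le> 2 * (C * (3 * C * \<bar>t - c\<bar>)\<^sup>2)"
        using C_ge_1 by (intro mult_left_mono) auto
      also have "\<dots> = 18 * C ^ 3 * (t - c)\<^sup>2" by (simp add: power_mult_distrib power2_eq_square power3_eq_cube)
      finally show ?thesis using z1 by (simp add: z_def t_def)
    next
      case False
      \<comment> \<open>As |c| and |t| are at most hi/3, the reflected height 2c - t leaves [lo, hi]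
        only if lo = 0 and 2c < t. Then |t| \<le> 2 |t - c|, and the paraboloid at 0 gives the
        claim.\<close>
      have lo0: "lo = 0" "lo' = 0"
      proof -
        show "lo = 0"
        proof (rule ccontr)
          assume "lo \<noteq> 0"
          hence "lo = - hi" "lo' = - (hi / 3)" using lo_cases a by auto
          thus False using False c t by auto
        qed
        thus "lo' = 0" using a by simp
      qed
      hence "2 * c < t" "c \<ge> 0" "t \<ge> 0" using False c t hi_pos by auto
      hence "\<bar>t\<bar> \<le> \<bar>2 * (t - c)\<bar>" by simp
      hence "t\<^sup>2 \<le> (2 * (t - c))\<^sup>2" by (simp only: abs_le_square_iff)
      hence "C * t\<^sup>2 \<le> C * (2 * (t - c))\<^sup>2" using C_ge_1 by (intro mult_left_mono) auto
      also have "(2 * (t - c))\<^sup>2 = 4 * (t - c)\<^sup>2" by (simp only: power_mult_distrib) simp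
      also have "C * (4 * (t - c)\<^sup>2) = 4 * C * (t - c)\<^sup>2" by simp
      also have "\<dots> \<le> 18 * C ^ 3 * (t - c)\<^sup>2" using C3 by (intro mult_right_mono) auto
      finally show ?thesis using quad0[OF xK] by (simp add: t_def)
    qed
  qed
qed

text \<open>With g the transversal part of the section, the shear x - g(x.e) moves the section to
  the axis and has the inverse x + g(x.e). Both have C^{1,1} jets on bounded sets, so the shear is
  bi-Lipschitz on K and \<open>jet_image\<close> applies. Its derivative at 0 is injective because
  g' is orthogonal to e.\<close>

theorem straighten:
  assumes R: "ribbon K e lo hi C" and small: "400 * C\<^sup>2 * (hi - lo) \<le> 1"
  obtains a S M C' where "M \<ge> 0" "jet K a S M" "a 0 = 0" "\<And>v. blinfun_apply (S 0) v = 0 \<Longrightarrow> v = 0"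
    "\<And>x. a x \<bullet> e = x \<bullet> e" "inj a" "ribbon (a ` K) e lo hi C'" "\<And>t. t \<in> {lo..hi} \<Longrightarrow> t *\<^sub>R e \<in> a ` K"
proof -
  interpret ribbon K e lo hi C by (fact R)
  obtain c V M where M: "M \<ge> 0"
    and cK: "\<And>t. t \<in> J \<Longrightarrow> c t \<in> K" "\<And>t. t \<in> J \<Longrightarrow> c t \<bullet> e = t"
    and cJ: "\<And>s t. \<lbrakk>s \<in> J; t \<in> J\<rbrakk> \<Longrightarrow> norm (c t - c s - (t - s) *\<^sub>R V s) \<le> M * (t - s)\<^sup>2"
    and VL: "\<And>s t. \<lbrakk>s \<in> J; t \<in> J\<rbrakk> \<Longrightarrow> norm (V t - V s) \<le> M * \<bar>t - s\<bar>"
    by (rule C11_section[OF small]) (rule that)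
  define pr where "pr v = v - (v \<bullet> e) *\<^sub>R e" for v
  have pr: "norm (pr v) \<le> norm v" "pr v \<bullet> e = 0" "pr (u - v) = pr u - pr v" "pr (k *\<^sub>R v) = k *\<^sub>R pr v" for u v k
    using norm_diff_proj_le[OF norm_e, of v 0] by (auto simp: pr_def inner_diff_left ee algebra_simps)
  define g g' where "g t = pr (c t)" and "g' t = pr (V t)" for t
  have gJ: "norm (g t - g s - (t - s) *\<^sub>R g' s) \<le> M * (t - s)\<^sup>2" if "s \<in> J" "t \<in> J" for s t
    using cJ[OF that] pr(1)[of "c t - c s - (t - s) *\<^sub>R V s"] by (simp add: g_def g'_def pr(3,4))
  have g'L: "norm (g' t - g' s) \<le> M * \<bar>t - s\<bar>" if "s \<in> J" "t \<in> J" for s t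
    using VL[OF that] pr(1)[of "V t - V s"] by (simp add: g'_def pr(3))
  have ge: "g t \<bullet> e = 0" "g' t \<bullet> e = 0" for t by (simp_all add: g_def g'_def pr)
  have gq: "norm (g t) \<le> C * t\<^sup>2" if "t \<in> J" for t
    using quad0[OF cK(1)[OF that]] cK(2)[OF that] by (simp add: g_def pr_def)
  define a S where "a x = x + - g (x \<bullet> e)" and "S x = id_blinfun + rank_one e (- g' (x \<bullet> e))" for x
  have ae: "a x \<bullet> e = x \<bullet> e" for x by (simp add: a_def inner_diff_left ge)
  have aa: "a x + g (a x \<bullet> e) = x" for x unfolding ae by (simp add: a_def)
  have jet: "jet K a S M" unfolding a_def[abs_def] S_def[abs_def]
  proof (rule shear_jet[OF norm_e M height, where g = "\<lambda>t. - g t" and g' = "\<lambda>t. - g' t"])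
    fix s t assume st: "s \<in> J" "t \<in> J"
    have eq: "- g t - - g s - (t - s) *\<^sub>R - g' s = - (g t - g s - (t - s) *\<^sub>R g' s)" by simp
    show "norm (- g t - - g s - (t - s) *\<^sub>R - g' s) \<le> M * (t - s)\<^sup>2" unfolding eq norm_minus_cancel by (rule gJ[OF st])
    show "norm (- g' t - - g' s) \<le> M * \<bar>t - s\<bar>" using g'L[OF st] by (simp add: norm_minus_commute)
  qed
  have bK: "bounded K" by (rule compact_imp_bounded[OF compact_K])
  obtain l where l: "\<And>x y. \<lbrakk>x \<in> K; y \<in> K\<rbrakk> \<Longrightarrow> norm (a y - a x) \<le> l * norm (y - x)" "l \<ge> 0"
    by (rule jet_lipschitz[OF bK jet M]) (rule that)
  have "l-lipschitz_on K a" using l by (intro lipschitz_onI) (auto simp: dist_norm norm_minus_commute)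
  hence ba: "bounded (a ` K)" using bK lipschitz_on_uniformly_continuous bounded_uniformly_continuous_image by blast
  have ha: "x \<in> a ` K \<Longrightarrow> x \<bullet> e \<in> J" for x using height ae by auto
  obtain G where G: "\<And>x y. \<lbrakk>x \<in> a ` K; y \<in> a ` K\<rbrakk> \<Longrightarrow> norm ((y + g (y \<bullet> e)) - (x + g (x \<bullet> e))) \<le> G * norm (y - x)"
    using jet_lipschitz[OF ba shear_jet[OF norm_e M ha gJ g'L] M] by metis
  have low: "norm (y - x) \<le> G * norm (a y - a x)" if "x \<in> K" "y \<in> K" for x y
    using G[OF imageI[OF that(1), of a] imageI[OF that(2)]] unfolding aa .
  have g0: "g 0 = 0" using gq[OF J0] by simp
  hence a0: "a 0 = 0" by (simp add: a_def)
  have "norm (a x - (x \<bullet> e) *\<^sub>R e) \<le> 2 * C * (x \<bullet> e)\<^sup>2" if "x \<in> K" for x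
    using norm_triangle_ineq4[of "x - (x \<bullet> e) *\<^sub>R e" "g (x \<bullet> e)"] quad0[OF that] gq[OF height[OF that]]
    by (simp add: a_def algebra_simps)
  from jet_image[OF jet M norm_e ae a0 low this] obtain C' where "ribbon (a ` K) e lo hi C'" by blast
  moreover have "v = 0" if "S 0 v = 0" for v
  proof -
    have v: "v = (v \<bullet> e) *\<^sub>R g' 0" using that by (simp add: S_def blinfun.add_left)
    have "v \<bullet> e = 0" by (subst v) (simp add: ge)
    thus ?thesis using v by simp
  qed
  moreover have "t *\<^sub>R e \<in> a ` K" if t: "t \<in> J" for t
    using cK[OF t] by (intro image_eqI[of _ _ "c t"]) (auto simp: a_def g_def pr_def)
  moreover have "inj a" by (rule inj_on_inverseI[of _ "\<lambda>x. x + g (x \<bullet> e)"]) (rule aa)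
  ultimately show ?thesis using that M jet a0 ae by blast
qed

section \<open>The planes along a ribbon and their parallel transport\<close>

section \<open>Orthogonal projections\<close>

text \<open>Packaged as a bounded linear map, so that planes can be compared by the operator norm of
  their projections.\<close>

definition orth_proj :: "'a::euclidean_space set \<Rightarrow> 'a \<Rightarrow>\<^sub>L 'a" where
  "orth_proj S = (SOME P. (\<forall>v. blinfun_apply P v \<in> S) \<and> (\<forall>v\<in>S. blinfun_apply P v = v) \<and>
    (\<forall>u v. blinfun_apply P u \<bullet> v = u \<bullet> blinfun_apply P v))"

lemma orth_proj:
  fixes S :: "'a::euclidean_space set"
  assumes "subspace S"
  shows orth_proj_in: "orth_proj S v \<in> S" and orth_proj_id: "v \<in> S \<Longrightarrow> orth_proj S v = v"
    and orth_proj_sym: "orth_proj S u \<bullet> v = u \<bullet> orth_proj S v"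
proof -
  obtain B where B: "B \<subseteq> S" "pairwise orthogonal B" "\<And>x. x \<in> B \<Longrightarrow> norm x = 1" "independent B" "span B = S"
    using orthonormal_basis_subspace[OF assms] by metis
  have fB: "finite B" using B(4) independent_bound by blast
  define P where "P = Blinfun (\<lambda>v. \<Sum>b\<in>B. (v \<bullet> b) *\<^sub>R b)"
  have P: "P v = (\<Sum>b\<in>B. (v \<bullet> b) *\<^sub>R b)" for v
    unfolding P_def by (subst bounded_linear_Blinfun_apply) (auto intro!: bounded_linear_intros)
  have 1: "P v \<in> S" for v unfolding P using B(1) assms by (intro subspace_sum subspace_scale) auto
  have Pb: "P b = b" if b: "b \<in> B" for b
  proof -
    have "P b = (\<Sum>c\<in>B. if c = b then b else 0)" unfolding P
    proof (rule sum.cong[OF refl])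
      fix c assume c: "c \<in> B"
      show "(b \<bullet> c) *\<^sub>R c = (if c = b then b else 0)"
        using B(2,3) b c by (auto simp: pairwise_def orthogonal_def norm_eq_1)
    qed
    thus ?thesis using fB b by simp
  qed
  have 2: "P v = v" if "v \<in> S" for v
  proof -
    have "v \<in> span B" using that B(5) by simp
    thus ?thesis by (induction rule: span_induct_alt) (simp_all add: blinfun.add_right blinfun.scaleR_right Pb)
  qed
  have 3: "P u \<bullet> v = u \<bullet> P v" for u v
    unfolding P by (simp add: inner_sum_left inner_sum_right inner_commute mult.commute)
  have "(\<forall>v. orth_proj S v \<in> S) \<and> (\<forall>v\<in>S. orth_proj S v = v) \<and> (\<forall>u v. orth_proj S u \<bullet> v = u \<bullet> orth_proj S v)"
    unfolding orth_proj_def by (rule someI[of _ P]) (intro conjI allI ballI 1 2 3)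
  thus "orth_proj S v \<in> S" "v \<in> S \<Longrightarrow> orth_proj S v = v" "orth_proj S u \<bullet> v = u \<bullet> orth_proj S v" by blast+
qed

lemma norm_orth_proj_compl:
  fixes S :: "'a::euclidean_space set"
  assumes S: "subspace S"
  shows "norm (v - orth_proj S v) \<le> norm v" "norm (orth_proj S v) \<le> norm v"
    "w \<in> S \<Longrightarrow> norm (v - orth_proj S v) \<le> norm (v - w)"
proof -
  have pyth: "(norm v)\<^sup>2 = (norm (v - orth_proj S v))\<^sup>2 + (norm (orth_proj S v))\<^sup>2" for v
  proof -
    have "(v - orth_proj S v) \<bullet> orth_proj S v = 0"
      using orth_proj_sym[OF S, of v "orth_proj S v"] orth_proj_id[OF S orth_proj_in[OF S, of v]]
      by (simp add: inner_diff_left)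
    hence "(norm ((v - orth_proj S v) + orth_proj S v))\<^sup>2 = (norm (v - orth_proj S v))\<^sup>2 + (norm (orth_proj S v))\<^sup>2"
      by (intro norm_add_Pythagorean) (simp add: orthogonal_def)
    thus ?thesis by simp
  qed
  have 1: "norm (v - orth_proj S v) \<le> norm v" for v by (rule power2_le_imp_le) (use pyth[of v] in simp_all)
  thus "norm (v - orth_proj S v) \<le> norm v" .
  show "norm (orth_proj S v) \<le> norm v" by (rule power2_le_imp_le) (use pyth[of v] in simp_all)
  show "norm (v - orth_proj S v) \<le> norm (v - w)" if "w \<in> S"
    using 1[of "v - w"] orth_proj_id[OF S that] by (simp add: blinfun.diff_right)
qed

lemma norm_orth_proj: "subspace S \<Longrightarrow> norm (orth_proj S) \<le> 1"
  by (rule norm_blinfun_bound) (simp_all add: norm_orth_proj_compl(2))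

text \<open>Split v into p in S and w orthogonal to S; the difference of the projections sends v to
  (p - P' p) - P' w. The first term is small by one hypothesis. For q = P' w one has |q|^2 = q . w =
  (q - P q) . w, and the other hypothesis bounds it.\<close>

lemma orth_proj_close:
  fixes S S' :: "'a::euclidean_space set"
  assumes S: "subspace S" "subspace S'" and b: "b \<ge> 0"
    and 1: "\<And>v. v \<in> S \<Longrightarrow> norm (v - orth_proj S' v) \<le> b * norm v"
    and 2: "\<And>v. v \<in> S' \<Longrightarrow> norm (v - orth_proj S v) \<le> b * norm v"
  shows "norm (orth_proj S - orth_proj S') \<le> 2 * b"
proof (rule norm_blinfun_bound)
  fix v
  define p w q where "p = orth_proj S v" and "w = v - p" and "q = orth_proj S' w"
  have "norm (p - orth_proj S' p) \<le> b * norm p" unfolding p_def by (intro 1 orth_proj_in S)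
  also have "\<dots> \<le> b * norm v" unfolding p_def using norm_orth_proj_compl(2)[OF S(1)] b by (intro mult_left_mono)
  finally have A: "norm (p - orth_proj S' p) \<le> b * norm v" .
  have "(norm q)\<^sup>2 = q \<bullet> w"
    unfolding q_def power2_norm_eq_inner orth_proj_sym[OF S(2)] orth_proj_id[OF S(2) orth_proj_in[OF S(2)]]
    by (simp add: orth_proj_sym[OF S(2)])
  also have "\<dots> = (q - orth_proj S q) \<bullet> w"
  proof -
    have "orth_proj S q \<bullet> w = q \<bullet> orth_proj S w" by (rule orth_proj_sym[OF S(1)])
    also have "orth_proj S w = 0"
      using orth_proj_id[OF S(1) orth_proj_in[OF S(1), of v]] by (simp add: w_def p_def blinfun.diff_right)
    finally show ?thesis by (simp add: inner_diff_left)
  qed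
  also have "\<dots> \<le> norm (q - orth_proj S q) * norm w" by (rule norm_cauchy_schwarz)
  also have "\<dots> \<le> (b * norm q) * norm w" unfolding q_def by (intro mult_right_mono 2 orth_proj_in S) auto
  finally have "norm q * norm q \<le> norm q * (b * norm w)" by (simp add: power2_eq_square mult_ac)
  hence "norm q \<le> b * norm w" using b by (cases "q = 0") simp_all
  also have "\<dots> \<le> b * norm v" unfolding w_def p_def using norm_orth_proj_compl(1)[OF S(1)] b by (intro mult_left_mono)
  finally have B: "norm q \<le> b * norm v" .
  have "(orth_proj S - orth_proj S') v = (p - orth_proj S' p) - q"
    by (simp add: p_def q_def w_def blinfun.diff_left blinfun.diff_right)
  thus "norm ((orth_proj S - orth_proj S') v) \<le> 2 * b * norm v"
    using A B norm_triangle_ineq4[of "p - orth_proj S' p" q] by simp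
qed (use b in simp)

text \<open>Continuity method: consider the supremum of the points up to which the global estimate
  from s holds. The local radius may depend on the point, yet the constant L is kept.\<close>

lemma locally_lipschitz_interval:
  fixes f :: "real \<Rightarrow> 'b::metric_space"
  assumes st: "s \<le> t"
    and loc: "\<And>u. u \<in> {s..t} \<Longrightarrow> \<exists>h>0. \<forall>v\<in>{s..t}. \<bar>v - u\<bar> < h \<longrightarrow> dist (f u) (f v) \<le> L * \<bar>v - u\<bar>"
  shows "dist (f s) (f t) \<le> L * (t - s)"
proof -
  define S where "S = {u \<in> {s..t}. dist (f s) (f u) \<le> L * (u - s)}"
  have sS: "s \<in> S" using st by (simp add: S_def)
  have bdd: "bdd_above S" by (auto simp: S_def intro: bdd_aboveI[of _ t])
  define c where "c = Sup S"
  have cst: "c \<in> {s..t}"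
  proof -
    have "s \<le> c" unfolding c_def using sS bdd by (rule cSup_upper)
    moreover have "c \<le> t" unfolding c_def using sS by (intro cSup_least) (auto simp: S_def)
    ultimately show ?thesis by simp
  qed
  obtain h where h: "h > 0" "\<And>v. v \<in> {s..t} \<Longrightarrow> \<bar>v - c\<bar> < h \<Longrightarrow> dist (f c) (f v) \<le> L * \<bar>v - c\<bar>"
    using loc[OF cst] by blast
  obtain u where u: "u \<in> S" "c - h < u" using less_cSupD[of S "c - h"] sS h(1) by (auto simp: c_def)
  have uc: "u \<le> c" using cSup_upper[OF u(1) bdd] by (simp add: c_def)
  have "dist (f u) (f c) \<le> L * (c - u)" using h(2)[of u] u uc by (auto simp: S_def dist_commute)
  hence "dist (f s) (f c) \<le> L * (u - s) + L * (c - u)"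
    using u(1) dist_triangle[of "f s" "f c" "f u"] by (simp add: S_def)
  hence cS: "dist (f s) (f c) \<le> L * (c - s)" by (simp add: algebra_simps)
  show ?thesis
  proof (cases "c = t")
    case False
    define v where "v = min t (c + h / 2)"
    have v: "v \<in> {s..t}" "c < v" "\<bar>v - c\<bar> < h" using cst False h(1) by (auto simp: v_def)
    have "dist (f s) (f v) \<le> L * (c - s) + L * (v - c)"
      using h(2)[OF v(1,3)] v(2) cS dist_triangle[of "f s" "f v" "f c"] by simp
    hence "v \<in> S" using v(1) by (simp add: S_def algebra_simps)
    hence "v \<le> c" using cSup_upper[OF _ bdd] by (simp add: c_def)
    thus ?thesis using v(2) by simp
  qed (use cS in simp)
qed

section \<open>The planes along a ribbon\<close>

locale thin_ribbon = straight_ribbon +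
  assumes thin: "4000 * C ^ 4 * (hi - lo) \<le> 1"
begin

text \<open>The degenerate heights. The axis points over \<open>Z\<close> become T_1(B), and the
  intervals between them carry the rotations.\<close>

definition Z where "Z = {c \<in> J. \<forall>y\<in>K. y \<bullet> e = c \<longrightarrow> y = c *\<^sub>R e}"

abbreviation "in_gap s t \<equiv> closed_segment s t \<inter> Z = {}"

text \<open>A choice of plane. It has dimension 2 outside \<open>Z\<close> (\<open>dim_pl\<close>),
  whereas over \<open>Z\<close> the ribbon need not determine it, which is why planes are compared
  only within a gap.\<close>

definition pl where "pl x = (SOME S. subspace S \<and> dim S \<le> 2 \<and>
  (\<forall>y\<in>K. \<exists>v\<in>S. norm (y - x - v) \<le> C * (norm (y - x))\<^sup>2))"

abbreviation "Pr x \<equiv> orth_proj (pl x)"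

text \<open>Four times the constant 84 C^4 for points in wide slices; the factor is explained by
  \<open>Pr_lipschitz\<close>.\<close>

definition "lip = 336 * C ^ 4"

lemma C_powers: "1 \<le> C ^ 4" "C \<le> C ^ 4" "C\<^sup>2 \<le> C ^ 4" "C ^ 3 \<le> C ^ 4"
  using C_ge_1 power_increasing[of 1 4 C] power_increasing[of 2 4 C] power_increasing[of 3 4 C] one_le_power[of C 4] by auto

lemma small_len: "4000 * (c * (hi - lo)) \<le> 1" if "c \<le> C ^ 4"
proof -
  have "c * (hi - lo) \<le> C ^ 4 * (hi - lo)" using that len_pos by (intro mult_right_mono) auto
  thus ?thesis using thin by linarith
qed

lemma lip_pos: "lip > 0" "lip * (hi - lo) \<le> 1/10" using C_powers(1) thin by (auto simp: lip_def)

lemma pl: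
  assumes "x \<in> K"
  shows "subspace (pl x)" "dim (pl x) \<le> 2" "y \<in> K \<Longrightarrow> norm (y - x - Pr x (y - x)) \<le> C * (norm (y - x))\<^sup>2"
proof -
  have *: "subspace (pl x) \<and> dim (pl x) \<le> 2 \<and> (\<forall>y\<in>K. \<exists>v\<in>pl x. norm (y - x - v) \<le> C * (norm (y - x))\<^sup>2)"
    unfolding pl_def using plane[OF assms] by (rule someI_ex)
  thus 1: "subspace (pl x)" "dim (pl x) \<le> 2" by auto
  assume "y \<in> K"
  then obtain v where "v \<in> pl x" "norm (y - x - v) \<le> C * (norm (y - x))\<^sup>2" using * by blast
  thus "norm (y - x - Pr x (y - x)) \<le> C * (norm (y - x))\<^sup>2"
    using norm_orth_proj_compl(3)[OF 1(1), of v "y - x"] by simp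
qed

lemma diam_K: "x \<in> K \<Longrightarrow> y \<in> K \<Longrightarrow> norm (x - y) \<le> 2 * (hi - lo)"
  using small_len[of C] C_powers by (intro norm_K_diff) auto

lemma transversal_le: "x \<in> K \<Longrightarrow> y \<in> K \<Longrightarrow>
  norm ((x - (x \<bullet> e) *\<^sub>R e) - (y - (y \<bullet> e) *\<^sub>R e)) \<le> norm (x - y)"
  using norm_diff_proj_le[OF norm_e, of "x - y" 0] by (simp add: inner_diff_left algebra_simps)

text \<open>Two clusters of a slice at minimal distance would have a point of \<open>K\<close> near the midpoint of a
  closest pair.\<close>

lemma connected_slice: "connected {y \<in> K. y \<bullet> e = t}"
proof (rule ccontr)
  let ?S = "{y \<in> K. y \<bullet> e = t}"
  have "closed {y. y \<bullet> e = t}" by (intro closed_Collect_eq continuous_intros)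
  hence cS: "compact ?S" using compact_Int_closed[OF compact_K, of "{y. y \<bullet> e = t}"] by (simp add: Collect_conj_eq)
  assume "\<not> connected ?S"
  then obtain A B where AB: "closed A" "closed B" "A \<noteq> {}" "B \<noteq> {}" "A \<union> B = ?S" "A \<inter> B = {}"
    using connected_closed_set[OF compact_imp_closed[OF cS]] by blast
  have "compact A" "compact B" using cS AB compact_Int_closed[of ?S A] compact_Int_closed[of ?S B]
    by (metis Int_absorb1 Un_upper1, metis Int_absorb1 Un_upper2)
  hence "compact (A \<times> B)" by (rule compact_Times)
  moreover have "A \<times> B \<noteq> {}" using AB by auto
  moreover have "continuous_on (A \<times> B) (\<lambda>p. dist (fst p) (snd p))" by (intro continuous_intros)
  ultimately have "\<exists>p\<in>A \<times> B. \<forall>q\<in>A \<times> B. dist (fst p) (snd p) \<le> dist (fst q) (snd q)"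
    by (rule continuous_attains_inf)
  then obtain a b where ab: "a \<in> A" "b \<in> B" and min: "\<And>a' b'. a' \<in> A \<Longrightarrow> b' \<in> B \<Longrightarrow> dist a b \<le> dist a' b'"
    by auto
  have K: "a \<in> K" "b \<in> K" "a \<bullet> e = t" "b \<bullet> e = t" using ab AB(5) by auto
  define d where "d = norm (a - b)"
  have d: "d > 0" using ab AB(6) by (auto simp: d_def)
  obtain p where p: "p \<in> K" "p \<bullet> e = t" "norm (p - (1/2) *\<^sub>R (a + b)) \<le> C * d\<^sup>2"
    using mid[OF K(1,2)] K(3,4) by (auto simp: d_def)
  have "C * d \<le> C * (2 * (hi - lo))" unfolding d_def using diam_K[OF K(1,2)] C_ge_1 by (intro mult_left_mono) auto
  also have "\<dots> = 2 * (C * (hi - lo))" by simp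
  finally have "C * d < 1/2" using small_len[OF C_powers(2)] by linarith
  hence "C * d\<^sup>2 < d / 2" using d mult_strict_right_mono[of "C * d" "1/2" d] by (simp add: power2_eq_square mult.assoc)
  hence 1: "norm (p - (1/2) *\<^sub>R (a + b)) < d / 2" using p(3) by simp
  have half: "norm ((1/2) *\<^sub>R (a - b)) = d / 2" "norm ((1/2) *\<^sub>R (b - a)) = d / 2" by (simp_all add: d_def norm_minus_commute)
  have "norm (p - a) < d" "norm (p - b) < d"
    using 1 half norm_triangle_ineq4[of "p - (1/2) *\<^sub>R (a + b)" "(1/2) *\<^sub>R (a - b)"]
      norm_triangle_ineq4[of "p - (1/2) *\<^sub>R (a + b)" "(1/2) *\<^sub>R (b - a)"]
    unfolding half_split[of p a b, symmetric] half_split[of p b a, unfolded add.commute[of b a], symmetric] by linarith+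
  moreover have "p \<in> A \<or> p \<in> B" using p AB(5) by blast
  moreover have "d \<le> norm (p - b)" if "p \<in> A" using min[OF that ab(2)] by (simp add: d_def dist_norm)
  moreover have "d \<le> norm (p - a)" if "p \<in> B" using min[OF ab(1) that] by (simp add: d_def dist_norm norm_minus_commute)
  ultimately show False by linarith
qed

definition wide where "wide t \<rho> \<longleftrightarrow> (\<exists>y\<in>K. y \<bullet> e = t \<and> norm (y - t *\<^sub>R e) \<ge> \<rho>)"

lemma wide_near:
  assumes "wide c p" "u \<in> J"
  shows "wide u (p - C * \<bar>u - c\<bar>)"
proof -
  obtain y where y: "y \<in> K" "y \<bullet> e = c" "norm (y - c *\<^sub>R e) \<ge> p" using assms by (auto simp: wide_def)
  obtain y' where y': "y' \<in> K" "y' \<bullet> e = u" "norm (y' - y) \<le> C * \<bar>u - c\<bar>" using slice[OF y(1) assms(2)] y(2) by auto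
  have "norm (y - c *\<^sub>R e) - norm (y' - u *\<^sub>R e) \<le> norm (y - y')"
    using transversal_le[OF y(1) y'(1)] norm_triangle_ineq2[of "y - c *\<^sub>R e" "y' - u *\<^sub>R e"] y(2) y'(2) by simp
  thus ?thesis using y y' unfolding wide_def by (intro bexI[of _ y']) (auto simp: norm_minus_commute)
qed

lemma not_Z_wide: "t \<in> J \<Longrightarrow> t \<notin> Z \<Longrightarrow> \<exists>p>0. wide t p"
proof -
  assume "t \<in> J" "t \<notin> Z"
  then obtain y where "y \<in> K" "y \<bullet> e = t" "y \<noteq> t *\<^sub>R e" unfolding Z_def by blast
  thus ?thesis unfolding wide_def by (intro exI[of _ "norm (y - t *\<^sub>R e)"]) auto
qed

lemma wide_not_Z: "wide t p \<Longrightarrow> p > 0 \<Longrightarrow> t \<notin> Z" unfolding Z_def wide_def by force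

text \<open>The axis point and the far point of the slice cannot both be closer than a to x, and the
  slice is connected, so the distance from x takes the value a on it.\<close>

lemma slice_point_at_distance:
  assumes x: "x \<in> K" and w: "wide (x \<bullet> e) (2 * a)" and a: "a \<ge> 0"
  obtains y where "y \<in> K" "y \<bullet> e = x \<bullet> e" "norm (y - x) = a"
proof -
  let ?S = "{y \<in> K. y \<bullet> e = x \<bullet> e}"
  have t: "x \<bullet> e \<in> J" using height x by blast
  obtain y where y: "y \<in> K" "y \<bullet> e = x \<bullet> e" "norm (y - (x \<bullet> e) *\<^sub>R e) \<ge> 2 * a" using w by (auto simp: wide_def)
  have "2 * a \<le> norm (y - x) + norm ((x \<bullet> e) *\<^sub>R e - x)"
    using y(3) norm_triangle_ineq[of "y - x" "x - (x \<bullet> e) *\<^sub>R e"] by (simp add: norm_minus_commute)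
  hence "a \<le> norm (y - x) \<or> a \<le> norm ((x \<bullet> e) *\<^sub>R e - x)" by linarith
  moreover have "(x \<bullet> e) *\<^sub>R e \<in> ?S" using axis[OF t] ee by simp
  ultimately obtain q where q: "q \<in> ?S" "a \<le> norm (q - x)" using y by blast
  have "connected ((\<lambda>y. norm (y - x)) ` ?S)"
    by (intro connected_continuous_image connected_slice continuous_intros)
  moreover have "0 \<in> (\<lambda>y. norm (y - x)) ` ?S" using x by (intro image_eqI[of _ _ x]) auto
  ultimately have "a \<in> (\<lambda>y. norm (y - x)) ` ?S"
    using q a connected_contains_Icc[of _ 0 "norm (q - x)"] by fastforce
  thus ?thesis using that by auto
qed

text \<open>At scale \<open>c\<close>, the plane at \<open>x\<close> is determined up to an angle of order \<open>c\<close> by one chord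
  along \<open>e\<close> and one chord inside the slice, and both are also seen from \<open>x'\<close>.\<close>

lemma plane_compare:
  assumes x: "x \<in> K" and x': "x' \<in> K" and d: "norm (x' - x) = 2 * c" "c > 0" and w: "wide (x \<bullet> e) (2 * c)"
  shows "dim (pl x) = 2" "v \<in> pl x \<Longrightarrow> norm (v - Pr x' v) \<le> 84 * C ^ 4 * c * norm v"
proof -
  define t where "t = x \<bullet> e"
  have t: "t \<in> J" using height x by (simp add: t_def)
  have cw: "c \<le> hi - lo" using diam_K[OF x' x] d by simp
  have C4c: "6 * (C ^ 4 * c) \<le> 1"
  proof -
    have "C ^ 4 * c \<le> C ^ 4 * (hi - lo)" using cw C_ge_1 by (intro mult_left_mono) auto
    thus ?thesis using thin by simp
  qed
  have C0: "C > 0" using C_ge_1 by simp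
  note sub = pl(1)[OF x] and sub' = pl(1)[OF x']
  have "2 * c \<le> hi - lo"
  proof -
    obtain y where y: "y \<in> K" "y \<bullet> e = t" "norm (y - t *\<^sub>R e) \<ge> 2 * c" using w by (auto simp: wide_def t_def)
    have "norm (y - t *\<^sub>R e) \<le> C * t\<^sup>2" using quad0[OF y(1)] y(2) by simp
    also have "\<dots> \<le> C * (hi - lo)\<^sup>2"
      using abs_J(2)[OF t] len_pos C_ge_1 by (intro mult_left_mono) (auto simp flip: abs_le_square_iff)
    also have "\<dots> = (C * (hi - lo)) * (hi - lo)" by (simp add: power2_eq_square)
    also have "\<dots> \<le> 1 * (hi - lo)" using small_len[of C] C_powers len_pos by (intro mult_right_mono) auto
    finally show ?thesis using y(3) by simp
  qed
  hence "t + c \<in> J \<or> t - c \<in> J" using t d(2) by auto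
  then obtain s where s: "s \<in> J" "\<bar>s - t\<bar> = c" using d(2) by (metis abs_of_pos add_diff_cancel_left' abs_minus_cancel minus_diff_eq diff_diff_eq2 diff_self diff_add_eq diff_0)
  obtain y1 where y1: "y1 \<in> K" "y1 \<bullet> e = s" "norm (y1 - x) \<le> C * c" using slice[OF x s(1)] s(2) by (auto simp: t_def)
  obtain y2 where y2: "y2 \<in> K" "y2 \<bullet> e = t" "norm (y2 - x) = c"
    using slice_point_at_distance[OF x w] d(2) by (auto simp: t_def)
  define u1 u2 where "u1 = y1 - x" and "u2 = y2 - x"
  \<comment> \<open>The quadratic error of \<open>pl\<close> for a chord of length at most C
    c.\<close>
  define f where "f = C ^ 3 * c\<^sup>2"
  have f: "f > 0" using C0 d(2) by (simp add: f_def)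
  have ineq: "C * r\<^sup>2 \<le> m\<^sup>2 * f" if "0 \<le> r" "r \<le> m * (C * c)" for r m
  proof -
    have "C * r\<^sup>2 \<le> C * (m * (C * c))\<^sup>2" using that C0 by (intro mult_left_mono power_mono) auto
    thus ?thesis by (simp add: f_def power_mult_distrib power2_eq_square power3_eq_cube mult_ac)
  qed
  have Cc: "c \<le> C * c" using C_ge_1 d(2) by simp
  define p1 p2 p1' p2' where "p1 = Pr x u1" and "p2 = Pr x u2" and "p1' = Pr x' u1" and "p2' = Pr x' u2"
  have p: "norm (u1 - p1) \<le> f" "norm (u2 - p2) \<le> f"
    using pl(3)[OF x y1(1)] pl(3)[OF x y2(1)] ineq[of "norm (y1 - x)" 1] ineq[of "norm (y2 - x)" 1] y1(3) y2(3) Cc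
    by (auto simp: u1_def u2_def p1_def p2_def)
  have p': "norm (u - Pr x' u) \<le> 13 * f" if u: "u = y - x" "y \<in> K" "norm u \<le> C * c" for u y
  proof -
    have "y - x' = u - (x' - x)" by (simp add: u)
    hence "norm (y - x') \<le> norm u + norm (x' - x)" by (simp only: norm_triangle_ineq4)
    hence "norm (y - x') \<le> 3 * (C * c)" using u(3) d(1) Cc by linarith
    hence 1: "norm (y - x' - Pr x' (y - x')) \<le> 9 * f" using pl(3)[OF x' u(2)] ineq[of "norm (y - x')" 3] by simp
    have 2: "norm (x - x' - Pr x' (x - x')) \<le> 4 * f"
      using pl(3)[OF x' x] ineq[of "norm (x - x')" 2] d(1) Cc by (simp add: norm_minus_commute)
    have "u - Pr x' u = (y - x' - Pr x' (y - x')) - (x - x' - Pr x' (x - x'))" by (simp add: u blinfun.diff_right)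
    thus ?thesis using 1 2 norm_triangle_ineq4[of "y - x' - Pr x' (y - x')" "x - x' - Pr x' (x - x')"] by simp
  qed
  have q': "norm (p1 - p1') \<le> 14 * f" "norm (p2 - p2') \<le> 14 * f"
  proof -
    have eq: "p1 - p1' = (u1 - p1') - (u1 - p1)" "p2 - p2' = (u2 - p2') - (u2 - p2)" by simp_all
    show "norm (p1 - p1') \<le> 14 * f" "norm (p2 - p2') \<le> 14 * f"
      unfolding eq using p p'[OF u1_def y1(1)] p'[OF u2_def y2(1)] y1(3) y2(3) Cc
        norm_triangle_ineq4[of "u1 - p1'" "u1 - p1"] norm_triangle_ineq4[of "u2 - p2'" "u2 - p2"]
      by (auto simp: u1_def u2_def p1'_def p2'_def)
  qed
  \<comment> \<open>The chords are well conditioned: u1 has component c or -c along e, while u2 is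
    orthogonal to e and has length c. Passing to the projections p1, p2 costs a fraction of m that
    is absorbed because C^4 c is small.\<close>
  have coef: "\<bar>a\<bar> + \<bar>b\<bar> \<le> 6 * C / c * norm (a *\<^sub>R p1 + b *\<^sub>R p2)" for a b
  proof -
    define m where "m = norm (a *\<^sub>R u1 + b *\<^sub>R u2)"
    have "(a *\<^sub>R u1 + b *\<^sub>R u2) \<bullet> e = a * (s - t)"
      using y1(2) y2(2) by (simp add: u1_def u2_def inner_add_left inner_diff_left t_def)
    hence a: "\<bar>a\<bar> * c \<le> m"
      using Cauchy_Schwarz_ineq2[of "a *\<^sub>R u1 + b *\<^sub>R u2" e] norm_e s(2) by (simp add: m_def abs_mult)
    have m0: "m \<ge> 0" by (simp add: m_def)
    have "norm (b *\<^sub>R u2) \<le> m + norm (a *\<^sub>R u1)"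
      using norm_triangle_ineq4[of "a *\<^sub>R u1 + b *\<^sub>R u2" "a *\<^sub>R u1"] by (simp add: m_def)
    also have "norm (a *\<^sub>R u1) \<le> C * (\<bar>a\<bar> * c)"
      using y1(3) mult_left_mono[of "norm u1" "C * c" "\<bar>a\<bar>"] by (simp add: u1_def mult_ac)
    also have "C * (\<bar>a\<bar> * c) \<le> C * m" using a C0 by simp
    finally have b: "\<bar>b\<bar> * c \<le> m + C * m" using y2(3) by (simp add: u2_def)
    have "m \<le> C * m" using C_ge_1 m0 mult_right_mono[of 1 C m] by simp
    hence ab: "(\<bar>a\<bar> + \<bar>b\<bar>) * c \<le> 3 * (C * m)" using a b by (simp add: distrib_right)
    have "a *\<^sub>R u1 + b *\<^sub>R u2 = (a *\<^sub>R p1 + b *\<^sub>R p2) + a *\<^sub>R (u1 - p1) + b *\<^sub>R (u2 - p2)" by (simp add: algebra_simps)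
    hence "m \<le> norm (a *\<^sub>R p1 + b *\<^sub>R p2) + norm (a *\<^sub>R (u1 - p1)) + norm (b *\<^sub>R (u2 - p2))"
      unfolding m_def
      using norm_triangle_ineq[of "(a *\<^sub>R p1 + b *\<^sub>R p2) + a *\<^sub>R (u1 - p1)" "b *\<^sub>R (u2 - p2)"]
        norm_triangle_ineq[of "a *\<^sub>R p1 + b *\<^sub>R p2" "a *\<^sub>R (u1 - p1)"] by simp
    also have "norm (a *\<^sub>R (u1 - p1)) \<le> \<bar>a\<bar> * f" using p(1) by (simp add: mult_left_mono)
    also have "norm (b *\<^sub>R (u2 - p2)) \<le> \<bar>b\<bar> * f" using p(2) by (simp add: mult_left_mono)
    finally have "m \<le> norm (a *\<^sub>R p1 + b *\<^sub>R p2) + (\<bar>a\<bar> + \<bar>b\<bar>) * f" by (simp add: algebra_simps)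
    also have "(\<bar>a\<bar> + \<bar>b\<bar>) * f = ((\<bar>a\<bar> + \<bar>b\<bar>) * c) * (C ^ 3 * c)" by (simp add: f_def power2_eq_square)
    also have "\<dots> \<le> (3 * (C * m)) * (C ^ 3 * c)" using ab C0 d(2) by (intro mult_right_mono) auto
    also have "\<dots> = (6 * (C ^ 4 * c)) * m / 2" by (simp add: power3_eq_cube power4_eq_xxxx)
    also have "\<dots> \<le> 1 * m / 2" using C4c m0 by (intro divide_right_mono mult_right_mono) auto
    finally have "m \<le> 2 * norm (a *\<^sub>R p1 + b *\<^sub>R p2)" by simp
    hence "C * m \<le> C * (2 * norm (a *\<^sub>R p1 + b *\<^sub>R p2))" using C0 by simp
    hence "(\<bar>a\<bar> + \<bar>b\<bar>) * c \<le> 6 * C * norm (a *\<^sub>R p1 + b *\<^sub>R p2)" using ab by simp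
    thus ?thesis using d(2) by (simp add: field_simps)
  qed
  have pS: "p1 \<in> pl x" "p2 \<in> pl x" by (simp_all add: p1_def p2_def orth_proj_in[OF sub])
  have p2nz: "p2 \<noteq> 0" using coef[of 0 1] by auto
  have nots: "p1 \<notin> span {p2}"
  proof
    assume "p1 \<in> span {p2}"
    then obtain k where "p1 = k *\<^sub>R p2" by (auto simp: span_singleton)
    thus False using coef[of 1 "- k"] by simp
  qed
  have ind: "independent {p1, p2}" using p2nz nots by (simp add: independent_insert dependent_single)
  have "p1 \<noteq> p2" using nots span_base by auto
  hence dim2: "dim (span {p1, p2}) = 2" using dim_eq_card_independent[OF ind] by simp
  have sp: "span {p1, p2} = pl x" using pS sub pl(2)[OF x] dim2 by (intro subspace_dim_equal span_minimal) auto
  thus "dim (pl x) = 2" using dim2 by simp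
  assume "v \<in> pl x"
  hence "v \<in> span {p1, p2}" using sp by simp
  then obtain a b where v: "v = a *\<^sub>R p1 + b *\<^sub>R p2"
    unfolding span_insert[of p1] span_singleton by auto (metis add.commute diff_add_cancel)
  define v' where "v' = a *\<^sub>R p1' + b *\<^sub>R p2'"
  have v'S: "v' \<in> pl x'" unfolding v'_def p1'_def p2'_def by (intro subspace_add subspace_scale sub' orth_proj_in)
  have "v - v' = a *\<^sub>R (p1 - p1') + b *\<^sub>R (p2 - p2')" by (simp add: v v'_def algebra_simps)
  hence "norm (v - v') \<le> norm (a *\<^sub>R (p1 - p1')) + norm (b *\<^sub>R (p2 - p2'))" by (simp only: norm_triangle_ineq)
  also have "\<dots> \<le> \<bar>a\<bar> * (14 * f) + \<bar>b\<bar> * (14 * f)"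
    unfolding norm_scaleR using q' by (intro add_mono mult_left_mono) auto
  also have "\<dots> = (\<bar>a\<bar> + \<bar>b\<bar>) * (14 * f)" by (simp add: distrib_right)
  also have "\<dots> \<le> (6 * C / c * norm v) * (14 * f)" unfolding v using coef f by (intro mult_right_mono) auto
  also have "\<dots> = 84 * C ^ 4 * c * norm v"
    using d(2) by (simp add: f_def power2_eq_square power3_eq_cube power4_eq_xxxx)
  finally show "norm (v - Pr x' v) \<le> 84 * C ^ 4 * c * norm v"
    using norm_orth_proj_compl(3)[OF sub' v'S, of v] by simp
qed

lemma Pr_close_wide:
  assumes x: "x \<in> K" and x': "x' \<in> K" and w: "wide (x \<bullet> e) (norm (x' - x))" "wide (x' \<bullet> e) (norm (x' - x))"
  shows "norm (Pr x - Pr x') \<le> 84 * C ^ 4 * norm (x' - x)"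
proof (cases "x' = x")
  case False
  define a where "a = norm (x' - x) / 2"
  have d: "norm (x' - x) = 2 * a" "a > 0" using False by (auto simp: a_def)
  have d': "norm (x - x') = 2 * a" using d(1) by (simp add: norm_minus_commute)
  have "norm (Pr x - Pr x') \<le> 2 * (84 * C ^ 4 * a)"
  proof (rule orth_proj_close[OF pl(1)[OF x] pl(1)[OF x']])
    show "0 \<le> 84 * C ^ 4 * a" using C_ge_1 d by simp
    show "norm (v - Pr x' v) \<le> 84 * C ^ 4 * a * norm v" if "v \<in> pl x" for v
      using plane_compare(2)[OF x x' d _ that] w(1) d(1) by simp
    show "norm (v - Pr x v) \<le> 84 * C ^ 4 * a * norm v" if "v \<in> pl x'" for v
      using plane_compare(2)[OF x' x d' d(2) _ that] w(2) d(1) by simp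
  qed
  thus ?thesis using d(1) by simp
qed simp

lemma dim_pl:
  assumes x: "x \<in> K" and nZ: "x \<bullet> e \<notin> Z"
  shows "dim (pl x) = 2"
proof -
  obtain p where p: "p > 0" "wide (x \<bullet> e) p" using not_Z_wide[OF height[OF x] nZ] by blast
  have w: "wide (x \<bullet> e) (2 * (p / 2))" using p by simp
  obtain y where y: "y \<in> K" "y \<bullet> e = x \<bullet> e" "norm (y - x) = p / 2"
    using slice_point_at_distance[OF x w] p(1) by auto
  show ?thesis
  proof (rule plane_compare(1)[OF x y(1)])
    show "norm (y - x) = 2 * (p / 4)" "p / 4 > 0" using y p by auto
    show "wide (x \<bullet> e) (2 * (p / 4))" using p unfolding wide_def by force
  qed
qed

lemma axis_props: assumes "t \<in> J" shows "t *\<^sub>R e \<in> K" "(t *\<^sub>R e) \<bullet> e = t"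
  using axis[OF assms] ee by auto

text \<open>Near u in a gap, the slices at u and v are wide at the scale |v - u|, so
  \<open>Pr_close_wide\<close> gives the estimate locally. The width enters only the local radius,
  hence \<open>locally_lipschitz_interval\<close> yields a constant common to all gaps.\<close>

lemma Pr_axis_lipschitz:
  assumes s: "s \<in> J" and t: "t \<in> J" and gap: "in_gap s t"
  shows "norm (Pr (s *\<^sub>R e) - Pr (t *\<^sub>R e)) \<le> 84 * C ^ 4 * \<bar>t - s\<bar>"
proof -
  have main: "norm (Pr (s *\<^sub>R e) - Pr (t *\<^sub>R e)) \<le> 84 * C ^ 4 * (t - s)"
    if st: "s \<le> t" and s: "s \<in> J" and t: "t \<in> J" and gap: "{s..t} \<inter> Z = {}" for s t
  proof -
    have "dist (Pr (s *\<^sub>R e)) (Pr (t *\<^sub>R e)) \<le> 84 * C ^ 4 * (t - s)"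
    proof (rule locally_lipschitz_interval[OF st])
      fix u assume u: "u \<in> {s..t}"
      hence uJ: "u \<in> J" using s t by auto
      obtain b where b: "b > 0" "wide u b" using not_Z_wide[OF uJ] gap u by blast
      show "\<exists>h>0. \<forall>v\<in>{s..t}. \<bar>v - u\<bar> < h \<longrightarrow> dist (Pr (u *\<^sub>R e)) (Pr (v *\<^sub>R e)) \<le> 84 * C ^ 4 * \<bar>v - u\<bar>"
      proof (intro exI[of _ "b / (C + 1)"] conjI ballI impI)
        show "b / (C + 1) > 0" using b(1) C_ge_1 by simp
        fix v assume v: "v \<in> {s..t}" "\<bar>v - u\<bar> < b / (C + 1)"
        have vJ: "v \<in> J" using v s t by auto
        have *: "C * \<bar>v - u\<bar> + \<bar>v - u\<bar> < b" using v(2) C_ge_1 by (simp add: pos_less_divide_eq algebra_simps)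
        have 0: "0 \<le> C * \<bar>v - u\<bar>" using C_ge_1 by simp
        have mono: "wide a q" if "wide a p" "q \<le> p" for a p q using that unfolding wide_def by force
        have "wide u \<bar>v - u\<bar>" "wide v \<bar>v - u\<bar>"
          using mono[OF b(2)] mono[OF wide_near[OF b(2) vJ]] * 0 by auto
        thus "dist (Pr (u *\<^sub>R e)) (Pr (v *\<^sub>R e)) \<le> 84 * C ^ 4 * \<bar>v - u\<bar>"
          using Pr_close_wide[OF axis_props(1)[OF uJ] axis_props(1)[OF vJ]] norm_e
          by (simp add: ee dist_norm flip: scaleR_left_diff_distrib)
      qed
    qed
    thus ?thesis by (simp add: dist_norm)
  qed
  show ?thesis
  proof (cases "s \<le> t")
    case True
    thus ?thesis using main[OF True s t] gap by (simp add: closed_segment_eq_real_ivl)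
  next
    case False
    thus ?thesis using main[of t s] s t gap by (simp add: closed_segment_eq_real_ivl norm_minus_commute)
  qed
qed

lemma Pr_slice_lipschitz:
  assumes x: "x \<in> K"
  shows "norm (Pr x - Pr ((x \<bullet> e) *\<^sub>R e)) \<le> 84 * C ^ 4 * norm (x - (x \<bullet> e) *\<^sub>R e)"
proof -
  have w: "wide (x \<bullet> e) (norm (x - (x \<bullet> e) *\<^sub>R e))" using x unfolding wide_def by blast
  show ?thesis using Pr_close_wide[OF x axis_props(1)[OF height[OF x]]] w by (simp add: ee norm_minus_commute)
qed

text \<open>Let d be the distance of the points. If both slices are wide at scale d, compare
  directly. Otherwise the distances of the two points from the axis add up to at most 3d, and the
  detour through the axis costs 3d + d.\<close>

lemma Pr_lipschitz:
  assumes x: "x \<in> K" and x': "x' \<in> K" and gap: "in_gap (x \<bullet> e) (x' \<bullet> e)"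
  shows "norm (Pr x - Pr x') \<le> lip * norm (x' - x)"
proof -
  define c where "c = 84 * C ^ 4"
  have c: "c \<ge> 0" using C_ge_1 by (simp add: c_def)
  define d where "d = norm (x' - x)"
  have d0: "d \<ge> 0" by (simp add: d_def)
  have "norm (Pr x - Pr x') \<le> c * (4 * d)"
  proof (cases "wide (x \<bullet> e) d \<and> wide (x' \<bullet> e) d")
    case True
    hence "norm (Pr x - Pr x') \<le> c * d" using Pr_close_wide[OF x x'] by (simp add: c_def d_def)
    also have "\<dots> \<le> c * (4 * d)" using c d0 by (intro mult_left_mono) auto
    finally show ?thesis .
  next
    case False
    define z z' where "z = norm (x - (x \<bullet> e) *\<^sub>R e)" and "z' = norm (x' - (x' \<bullet> e) *\<^sub>R e)"
    have "wide (x \<bullet> e) d" if "d \<le> z" using x that unfolding wide_def z_def by blast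
    moreover have "wide (x' \<bullet> e) d" if "d \<le> z'" using x' that unfolding wide_def z'_def by blast
    ultimately have "z < d \<or> z' < d" using False by (auto simp: not_less[symmetric])
    moreover have "\<bar>z - z'\<bar> \<le> d"
      using transversal_le[OF x x'] norm_triangle_ineq3[of "x - (x \<bullet> e) *\<^sub>R e" "x' - (x' \<bullet> e) *\<^sub>R e"]
      by (simp add: z_def z'_def d_def norm_minus_commute)
    ultimately have zz: "z + z' \<le> 3 * d" by linarith
    have "\<bar>x' \<bullet> e - x \<bullet> e\<bar> \<le> d"
      using Cauchy_Schwarz_ineq2[of "x' - x" e] norm_e by (simp add: d_def inner_diff_left)
    hence tt: "c * \<bar>x' \<bullet> e - x \<bullet> e\<bar> \<le> c * d" using c by (rule mult_left_mono)
    define P1 P2 where "P1 = Pr ((x \<bullet> e) *\<^sub>R e)" and "P2 = Pr ((x' \<bullet> e) *\<^sub>R e)"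
    have "Pr x - Pr x' = (Pr x - P1) + (P1 - P2) - (Pr x' - P2)" by simp
    hence "norm (Pr x - Pr x') \<le> norm (Pr x - P1) + norm (P1 - P2) + norm (Pr x' - P2)"
      using norm_triangle_ineq4[of "(Pr x - P1) + (P1 - P2)" "Pr x' - P2"] norm_triangle_ineq[of "Pr x - P1" "P1 - P2"] by simp
    also have "\<dots> \<le> c * z + c * \<bar>x' \<bullet> e - x \<bullet> e\<bar> + c * z'"
      using Pr_slice_lipschitz[OF x] Pr_slice_lipschitz[OF x'] Pr_axis_lipschitz[OF height[OF x] height[OF x'] gap]
      by (intro add_mono) (auto simp: P1_def P2_def c_def z_def z'_def)
    also have "\<dots> \<le> c * (z + z') + c * d" using tt by (simp add: algebra_simps)
    also have "\<dots> \<le> c * (3 * d) + c * d" using zz c by (intro add_mono mult_left_mono) auto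
    finally show ?thesis by (simp add: algebra_simps)
  qed
  thus ?thesis by (simp add: c_def lip_def d_def)
qed

text \<open>The chords (s - t) e lie in the plane at the axis point t e up to a quadratic error;
  divide by |s - t| and let s tend to t.\<close>

lemma Pr_axis_e:
  assumes t: "t \<in> J"
  shows "Pr (t *\<^sub>R e) e = e"
proof -
  define q where "q = norm (e - Pr (t *\<^sub>R e) e)"
  have q: "q \<le> C * \<bar>s - t\<bar>" if s: "s \<in> J" "s \<noteq> t" for s
  proof -
    have "norm (s *\<^sub>R e - t *\<^sub>R e - Pr (t *\<^sub>R e) (s *\<^sub>R e - t *\<^sub>R e)) \<le> C * (norm (s *\<^sub>R e - t *\<^sub>R e))\<^sup>2"
      using pl(3)[OF axis_props(1)[OF t] axis_props(1)[OF s(1)]] .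
    moreover have "s *\<^sub>R e - t *\<^sub>R e - Pr (t *\<^sub>R e) (s *\<^sub>R e - t *\<^sub>R e) = (s - t) *\<^sub>R (e - Pr (t *\<^sub>R e) e)"
      by (simp add: blinfun.diff_right blinfun.scaleR_right algebra_simps)
    ultimately have "\<bar>s - t\<bar> * q \<le> C * \<bar>s - t\<bar>\<^sup>2"
      using norm_e by (simp add: q_def flip: scaleR_left_diff_distrib)
    hence "\<bar>s - t\<bar> * q \<le> \<bar>s - t\<bar> * (C * \<bar>s - t\<bar>)" by (simp add: power2_eq_square mult_ac)
    thus ?thesis using s(2) by simp
  qed
  have "q \<le> 0"
  proof (rule field_le_epsilon)
    fix a :: real assume a: "a > 0"
    define h where "h = min (a / C) ((hi - lo) / 2)"
    have h: "h > 0" "C * h \<le> a" "2 * h \<le> hi - lo"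
      using a C_ge_1 len_pos by (auto simp: h_def min_def field_simps)
    have "t + h \<in> J \<or> t - h \<in> J" using t h by auto
    hence "q \<le> C * h" using q[of "t + h"] q[of "t - h"] h(1) by auto
    thus "q \<le> 0 + a" using h by simp
  qed
  thus ?thesis by (simp add: q_def)
qed

lemma closed_Z: "closed Z"
proof -
  have "\<exists>a>0. \<forall>u. dist u c < a \<longrightarrow> u \<notin> Z" if c: "c \<notin> Z" for c
  proof (cases "c \<in> J")
    case True
    obtain p where p: "p > 0" "wide c p" using not_Z_wide[OF True c] by blast
    have "u \<notin> Z" if "dist u c < p / C" for u
    proof
      assume "u \<in> Z"
      hence uJ: "u \<in> J" by (simp add: Z_def)
      have "C * \<bar>u - c\<bar> < p" using that C_ge_1 by (simp add: dist_real_def pos_less_divide_eq mult.commute)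
      thus False using wide_not_Z[OF wide_near[OF p(2) uJ]] \<open>u \<in> Z\<close> by simp
    qed
    thus ?thesis using p C_ge_1 by (intro exI[of _ "p / C"]) auto
  next
    case False
    hence "c \<in> - J" by simp
    then obtain a where "a > 0" "ball c a \<subseteq> - J" using openE[of "- J" c] by (auto simp: open_Compl)
    thus ?thesis by (intro exI[of _ a]) (auto simp: Z_def dist_commute subset_iff)
  qed
  hence "open (- Z)" unfolding open_dist by blast
  thus ?thesis by (simp add: closed_def)
qed

lemma zero_Z: "0 \<in> Z"
proof -
  have "y = 0" if "y \<in> K" "y \<bullet> e = 0" for y using quad0[OF that(1)] that(2) by simp
  thus ?thesis using J0 by (auto simp: Z_def)
qed

end

section \<open>Parallel transport of the planes\<close>

context thin_ribbon
begin

text \<open>On the plane at t this is the orthogonal projection to the plane at s, and on the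
  orthogonal complement it is the identity. Across a degenerate height, where the planes on the two
  sides are unrelated, nothing is moved.\<close>

definition transport :: "real \<Rightarrow> real \<Rightarrow> 'a \<Rightarrow>\<^sub>L 'a" where
  "transport s t = (if in_gap s t
    then id_blinfun - ((id_blinfun - Pr (s *\<^sub>R e)) o\<^sub>L Pr (t *\<^sub>R e)) else id_blinfun)"

lemma sub_axis: "t \<in> J \<Longrightarrow> subspace (pl (t *\<^sub>R e))" using pl(1) axis_props(1) by blast

lemma transport_near_id:
  assumes s: "s \<in> J" and t: "t \<in> J"
  shows "norm (transport s t - id_blinfun) \<le> lip * \<bar>t - s\<bar>"
proof (cases "in_gap s t")
  case True
  have "(id_blinfun - Pr (s *\<^sub>R e)) o\<^sub>L Pr (t *\<^sub>R e) = (Pr (t *\<^sub>R e) - Pr (s *\<^sub>R e)) o\<^sub>L Pr (t *\<^sub>R e)"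
    using orth_proj_id[OF sub_axis[OF t] orth_proj_in[OF sub_axis[OF t]]]
    by (intro blinfun_eqI) (simp add: blinfun.diff_left)
  hence "norm (transport s t - id_blinfun) = norm ((Pr (t *\<^sub>R e) - Pr (s *\<^sub>R e)) o\<^sub>L Pr (t *\<^sub>R e))"
    using True by (simp add: transport_def)
  also have "\<dots> \<le> norm (Pr (t *\<^sub>R e) - Pr (s *\<^sub>R e)) * norm (Pr (t *\<^sub>R e))" by (rule norm_blinfun_compose)
  also have "\<dots> \<le> norm (Pr (s *\<^sub>R e) - Pr (t *\<^sub>R e)) * 1"
    using norm_orth_proj[OF sub_axis[OF t]] by (intro mult_mono) (auto simp: norm_minus_commute)
  also have "\<dots> \<le> lip * \<bar>t - s\<bar>"
  proof -
    have "84 * C ^ 4 \<le> lip" using C_powers(1) by (simp add: lip_def)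
    hence "84 * C ^ 4 * \<bar>t - s\<bar> \<le> lip * \<bar>t - s\<bar>" by (intro mult_right_mono) auto
    thus ?thesis using Pr_axis_lipschitz[OF s t True] by simp
  qed
  finally show ?thesis .
qed (use lip_pos in \<open>simp add: transport_def\<close>)

lemma transport_e:
  assumes s: "s \<in> J" and t: "t \<in> J"
  shows "transport s t e = e" "transport s t v \<bullet> e = v \<bullet> e"
proof -
  show "transport s t e = e" using Pr_axis_e[OF s] Pr_axis_e[OF t] by (simp add: transport_def blinfun.diff_left)
  have "(w - Pr (s *\<^sub>R e) w) \<bullet> e = 0" for w
    using orth_proj_sym[OF sub_axis[OF s], of w e] Pr_axis_e[OF s] by (simp add: inner_diff_left)
  thus "transport s t v \<bullet> e = v \<bullet> e" by (simp add: transport_def blinfun.diff_left inner_diff_left)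
qed

lemma transport_plane:
  assumes s: "s \<in> J" and t: "t \<in> J" and gap: "in_gap s t"
    and v: "v \<in> pl (t *\<^sub>R e)"
  shows "transport s t v = Pr (s *\<^sub>R e) v"
  using orth_proj_id[OF sub_axis[OF t] v] gap by (simp add: transport_def blinfun.diff_left)

primrec frame_grid :: "('a \<Rightarrow>\<^sub>L 'a) \<Rightarrow> nat \<Rightarrow> nat \<Rightarrow> 'a \<Rightarrow>\<^sub>L 'a" where
  "frame_grid O' n 0 = O'"
| "frame_grid O' n (Suc i) = frame_grid O' n i o\<^sub>L
    transport (lo + real i * ((hi - lo) / n)) (lo + real (Suc i) * ((hi - lo) / n))"

lemma grid_in_J: "i \<le> n \<Longrightarrow> lo + real i * ((hi - lo) / n) \<in> J"
proof -
  assume i: "i \<le> n"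
  have "real i * ((hi - lo) / n) \<le> real n * ((hi - lo) / n)" using i len_pos by (intro mult_right_mono) auto
  also have "\<dots> \<le> hi - lo" using len_pos by (cases "n = 0") auto
  finally show ?thesis using len_pos by auto
qed

lemma transport_grid:
  assumes "i < n"
  shows "norm (transport (lo + real i * ((hi - lo) / n)) (lo + real (Suc i) * ((hi - lo) / n)) - id_blinfun)
    \<le> lip * ((hi - lo) / n)"
proof -
  define h where "h = (hi - lo) / n"
  have "(lo + real (Suc i) * h) - (lo + real i * h) = h" by (simp add: distrib_right)
  moreover have "h \<ge> 0" using len_pos by (simp add: h_def)
  ultimately have "\<bar>(lo + real (Suc i) * h) - (lo + real i * h)\<bar> = h" by simp
  thus ?thesis
    using transport_near_id[OF grid_in_J[of i n] grid_in_J[of "Suc i" n]] assms unfolding h_def[symmetric] by simp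
qed

text \<open>A product of near-identities: the factors deviate by \<open>lip\<close> times the mesh,
  and lip (hi - lo) \<le> 1/10 keeps the whole product within 1/5 of its start.\<close>

lemma frame_grid_near:
  assumes O': "norm O' \<le> 1" and i: "i \<le> n"
  shows "norm (frame_grid O' n i - O') \<le> 2 * lip * (real i * ((hi - lo) / n))" "norm (frame_grid O' n i - O') \<le> 1/5"
    "norm (frame_grid O' n i) \<le> 6/5"
proof -
  have small: "2 * lip * (real i * ((hi - lo) / n)) \<le> 1/5" if "i \<le> n" for i
  proof -
    have "real i * ((hi - lo) / n) \<le> hi - lo" using grid_in_J[OF that] by simp
    hence "2 * lip * (real i * ((hi - lo) / n)) \<le> 2 * lip * (hi - lo)" using lip_pos by (intro mult_left_mono) auto
    thus ?thesis using lip_pos(2) by simp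
  qed
  have bound: "norm N \<le> 6/5" if "norm (N - O') \<le> 1/5" for N
    using that norm_triangle_ineq[of "N - O'" O'] O' by simp
  show 1: "norm (frame_grid O' n i - O') \<le> 2 * lip * (real i * ((hi - lo) / n))" using i
  proof (induction i)
    case (Suc i)
    define h where "h = (hi - lo) / n"
    define N T where "N = frame_grid O' n i" and "T = transport (lo + real i * h) (lo + real (Suc i) * h)"
    have IH: "norm (N - O') \<le> 2 * lip * (real i * h)" using Suc by (simp add: N_def h_def)
    have "norm N \<le> 6/5" by (rule bound[OF order_trans[OF IH[unfolded h_def] small[of i]]]) (use Suc.prems in simp)
    have "norm (T - id_blinfun) \<le> lip * h" unfolding T_def h_def using Suc.prems by (intro transport_grid) simp
    have h0: "h \<ge> 0" using len_pos by (simp add: h_def)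
    have "(N o\<^sub>L T) - O' = (N o\<^sub>L (T - id_blinfun)) + (N - O')"
      by (intro blinfun_eqI) (simp add: blinfun.diff_left blinfun.diff_right blinfun.add_left)
    hence "norm ((N o\<^sub>L T) - O') \<le> norm (N o\<^sub>L (T - id_blinfun)) + norm (N - O')" by (simp only: norm_triangle_ineq)
    also have "norm (N o\<^sub>L (T - id_blinfun)) \<le> 6/5 * (lip * h)"
      using \<open>norm N \<le> 6/5\<close> \<open>norm (T - id_blinfun) \<le> lip * h\<close>
      by (intro order_trans[OF norm_blinfun_compose] mult_mono) auto
    also have "\<dots> \<le> 2 * (lip * h)" using lip_pos h0 by (intro mult_right_mono) auto
    finally have "norm ((N o\<^sub>L T) - O') \<le> 2 * lip * (real (Suc i) * h)" using IH by (simp add: algebra_simps)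
    thus ?case by (simp add: N_def T_def h_def)
  qed simp
  show 2: "norm (frame_grid O' n i - O') \<le> 1/5" by (rule order_trans[OF 1 small[OF i]])
  show "norm (frame_grid O' n i) \<le> 6/5" by (rule bound[OF 2])
qed

lemma frame_grid_step:
  assumes O': "norm O' \<le> 1" and i: "i < n"
  shows "norm (frame_grid O' n (Suc i) - frame_grid O' n i) \<le> 2 * lip * ((hi - lo) / n)"
proof -
  define h where "h = (hi - lo) / n"
  define N T where "N = frame_grid O' n i" and "T = transport (lo + real i * h) (lo + real (Suc i) * h)"
  have h0: "h \<ge> 0" using len_pos by (simp add: h_def)
  have T: "norm (T - id_blinfun) \<le> lip * h" unfolding T_def h_def by (rule transport_grid[OF i])
  have "(N o\<^sub>L T) - N = N o\<^sub>L (T - id_blinfun)"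
    by (intro blinfun_eqI) (simp add: blinfun.diff_left blinfun.diff_right)
  hence "norm ((N o\<^sub>L T) - N) \<le> norm N * norm (T - id_blinfun)" by (simp only: norm_blinfun_compose)
  also have "\<dots> \<le> 6/5 * (lip * h)"
    using frame_grid_near(3)[OF O', of i n] i T by (intro mult_mono) (auto simp: N_def)
  also have "\<dots> \<le> 2 * (lip * h)" using lip_pos h0 by (intro mult_right_mono) auto
  finally show ?thesis by (simp add: N_def T_def h_def mult.assoc)
qed

lemma frame_grid_plane:
  assumes ij: "i \<le> j" "j \<le> n" and gap: "closed_segment (lo + real i * ((hi - lo) / n)) (lo + real j * ((hi - lo) / n)) \<inter> Z = {}"
    and v: "v \<in> pl ((lo + real j * ((hi - lo) / n)) *\<^sub>R e)"
  shows "\<exists>u\<in>pl ((lo + real i * ((hi - lo) / n)) *\<^sub>R e). frame_grid O' n i u = frame_grid O' n j v"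
  using ij gap v
proof (induction j arbitrary: v rule: dec_induct)
  case (step j)
  define h where "h = (hi - lo) / n"
  have h0: "h \<ge> 0" using len_pos by (simp add: h_def)
  have sub: "closed_segment (lo + real i * h) (lo + real j * h) \<subseteq> closed_segment (lo + real i * h) (lo + real (Suc j) * h)"
    "closed_segment (lo + real j * h) (lo + real (Suc j) * h) \<subseteq> closed_segment (lo + real i * h) (lo + real (Suc j) * h)"
  proof -
    have "real i * h \<le> real j * h" using step(1) h0 by (intro mult_right_mono) auto
    thus "closed_segment (lo + real i * h) (lo + real j * h) \<subseteq> closed_segment (lo + real i * h) (lo + real (Suc j) * h)"
      "closed_segment (lo + real j * h) (lo + real (Suc j) * h) \<subseteq> closed_segment (lo + real i * h) (lo + real (Suc j) * h)"
      using h0 by (auto simp: closed_segment_eq_real_ivl distrib_right)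
  qed
  have J: "lo + real j * h \<in> J" "lo + real (Suc j) * h \<in> J"
    using grid_in_J[of j n] grid_in_J[of "Suc j" n] step by (auto simp: h_def)
  have tv: "transport (lo + real j * h) (lo + real (Suc j) * h) v = Pr ((lo + real j * h) *\<^sub>R e) v"
    using step.prems sub(2) by (intro transport_plane J) (auto simp: h_def)
  have "\<exists>u\<in>pl ((lo + real i * h) *\<^sub>R e). frame_grid O' n i u = frame_grid O' n j (Pr ((lo + real j * h) *\<^sub>R e) v)"
    using step.prems sub(1) orth_proj_in[OF sub_axis[OF J(1)]] unfolding h_def by (intro step.IH) auto
  thus ?case using tv by (simp add: h_def)
qed auto

lemma frame_grid_e:
  assumes "i \<le> n" and O': "\<And>v w. blinfun_apply O' v \<bullet> O' w = v \<bullet> w"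
  shows "frame_grid O' n i e = O' e" "frame_grid O' n i v \<bullet> O' e = v \<bullet> e"
proof -
  have "frame_grid O' n i e = O' e \<and> (\<forall>v. frame_grid O' n i v \<bullet> O' e = v \<bullet> e)"
    using assms(1)
  proof (induction i)
    case (Suc i)
    thus ?case using transport_e[OF grid_in_J[of i n] grid_in_J[of "Suc i" n]] by auto
  qed (simp add: O')
  thus "frame_grid O' n i e = O' e" "frame_grid O' n i v \<bullet> O' e = v \<bullet> e" by auto
qed

text \<open>Limits of products of transports over finer and finer grids. Within a gap such a product
  carries the plane at a later grid point into the image of the plane at an earlier one
  (\<open>frame_grid_plane\<close>). The inclusion survives in the limit and is an equality, as both
  sides have dimension 2. Thus N unrolls the varying planes of a gap into a single one.\<close>

theorem frame:
  fixes O' :: "'a \<Rightarrow>\<^sub>L 'a"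
  assumes O': "\<And>v w. blinfun_apply O' v \<bullet> O' w = v \<bullet> w"
  obtains N where "\<And>t. t \<in> J \<Longrightarrow> norm (N t - O') \<le> 1/5"
    "\<And>t. t \<in> J \<Longrightarrow> blinfun_apply (N t) e = O' e"
    "\<And>t v. t \<in> J \<Longrightarrow> blinfun_apply (N t) v \<bullet> O' e = v \<bullet> e"
    "\<And>s t. \<lbrakk>s \<in> J; t \<in> J\<rbrakk> \<Longrightarrow> norm (N t - N s) \<le> 2 * lip * \<bar>t - s\<bar>"
    "\<And>s t. \<lbrakk>s \<in> J; t \<in> J; in_gap s t\<rbrakk> \<Longrightarrow>
      blinfun_apply (N s) ` pl (s *\<^sub>R e) = blinfun_apply (N t) ` pl (t *\<^sub>R e)"
proof -
  have O'n: "norm (O' v) = norm v" for v using O'[of v v] by (simp add: norm_eq_sqrt_inner)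
  hence O1: "norm O' \<le> 1" by (intro norm_blinfun_bound) auto
  let ?h = "\<lambda>n::nat. (hi - lo) / real n"
  obtain N where near': "\<And>t. N t \<in> cball O' (1/5)" and N: "\<And>s t. \<lbrakk>s \<in> J; t \<in> J\<rbrakk> \<Longrightarrow> \<exists>r i j.
      (\<forall>k. 0 < r k \<and> i k \<le> r k \<and> j k \<le> r k) \<and>
      (\<lambda>k. lo + real (i k) * ?h (r k)) \<longlonglongrightarrow> s \<and> (\<lambda>k. lo + real (j k) * ?h (r k)) \<longlonglongrightarrow> t \<and>
      (\<lambda>k. frame_grid O' (r k) (i k)) \<longlonglongrightarrow> N s \<and> (\<lambda>k. frame_grid O' (r k) (j k)) \<longlonglongrightarrow> N t"
    by (rule grid_cluster[of "cball O' (1/5)" "frame_grid O'" lo hi])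
      (use frame_grid_near(2)[OF O1] len_pos in \<open>auto simp: dist_norm norm_minus_commute\<close>)
  have near: "norm (N t - O') \<le> 1/5" for t using near'[of t] by (simp add: dist_norm norm_minus_commute)
  have Ne: "blinfun_apply (N t) e = O' e" "blinfun_apply (N t) v \<bullet> O' e = v \<bullet> e" if t: "t \<in> J" for t v
  proof -
    obtain r i where i: "\<And>k. i k \<le> r k" "(\<lambda>k. frame_grid O' (r k) (i k)) \<longlonglongrightarrow> N t" using N[OF t t] by blast
    have "(\<lambda>k. frame_grid O' (r k) (i k) e) \<longlonglongrightarrow> N t e"
      "(\<lambda>k. frame_grid O' (r k) (i k) v \<bullet> O' e) \<longlonglongrightarrow> N t v \<bullet> O' e"
      by (intro tendsto_intros blinfun.tendsto i)+
    from this[unfolded frame_grid_e[OF i(1) O'] LIMSEQ_const_iff]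
    show "N t e = O' e" "N t v \<bullet> O' e = v \<bullet> e" by simp_all
  qed
  have NL: "norm (N t - N s) \<le> 2 * lip * \<bar>t - s\<bar>" if st: "s \<in> J" "t \<in> J" for s t
  proof -
    obtain r i j where ij: "\<And>k. i k \<le> r k" "\<And>k. j k \<le> r k"
      and i: "(\<lambda>k. lo + real (i k) * ?h (r k)) \<longlonglongrightarrow> s" "(\<lambda>k. frame_grid O' (r k) (i k)) \<longlonglongrightarrow> N s"
      and j: "(\<lambda>k. lo + real (j k) * ?h (r k)) \<longlonglongrightarrow> t" "(\<lambda>k. frame_grid O' (r k) (j k)) \<longlonglongrightarrow> N t"
      using N[OF st] by blast
    have "(\<lambda>k. real (j k) * ?h (r k) - real (i k) * ?h (r k)) \<longlonglongrightarrow> t - s" using tendsto_diff[OF j(1) i(1)] by simp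
    note lim = tendsto_norm[OF tendsto_diff[OF j(2) i(2)]] tendsto_mult[OF tendsto_const tendsto_rabs[OF this], of "2 * lip"]
    show ?thesis by (rule lim_mono[of 0, OF _ lim], rule grid_lipschitz[where n = "r _"], rule frame_grid_step[OF O1])
        (use len_pos lip_pos ij in auto)
  qed
  have expand: "4/5 * norm v \<le> norm (M v)" if "norm (M - O') \<le> 1/5" for M v
    using norm_blinfun_le[OF that, of v] norm_triangle_ineq2[of "O' v" "- ((M - O') v)"] O'n[of v]
    by (simp add: blinfun.diff_left norm_minus_commute)
  have lin: "linear (blinfun_apply (N t))" for t by (rule linear_blinfun)
  have inj: "inj (blinfun_apply (N t))" for t
  proof (rule linear_injective_0[OF lin, THEN iffD2], intro allI impI)
    fix v assume "N t v = 0"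
    thus "v = 0" using expand[OF near, of v t] by simp
  qed
  have sub: "N t v \<in> blinfun_apply (N s) ` pl (s *\<^sub>R e)"
    if st: "s < t" and s: "s \<in> J" and t: "t \<in> J" and gap: "{s..t} \<inter> Z = {}" and v: "v \<in> pl (t *\<^sub>R e)" for s t v
  proof -
    obtain r i j where ij: "\<And>k. i k \<le> r k" "\<And>k. j k \<le> r k"
      and i: "(\<lambda>k. lo + real (i k) * ?h (r k)) \<longlonglongrightarrow> s" "(\<lambda>k. frame_grid O' (r k) (i k)) \<longlonglongrightarrow> N s"
      and j: "(\<lambda>k. lo + real (j k) * ?h (r k)) \<longlonglongrightarrow> t" "(\<lambda>k. frame_grid O' (r k) (j k)) \<longlonglongrightarrow> N t"
      using N[OF s t] by blast
    define f m where "f k = lo + real (i k) * ?h (r k)" and "m k = lo + real (j k) * ?h (r k)" for k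
    have J: "f k \<in> J" "m k \<in> J" for k using grid_in_J ij by (auto simp: f_def m_def)
    obtain c where c: "c > 0" "\<And>u z. u \<in> {s..t} \<Longrightarrow> z \<in> Z \<Longrightarrow> c \<le> dist u z"
      using separate_compact_closed[OF compact_Icc closed_Z gap] by blast
    \<comment> \<open>The grid points approximating s and t may lie outside [s, t]; a neighbourhood
      free of \<open>Z\<close> keeps them in the same gap.\<close>
    have far: "u \<notin> Z" if "s - c < u" "u < t + c" for u
    proof
      assume "u \<in> Z"
      define u' where "u' = max s (min t u)"
      have "u' \<in> {s..t}" "dist u' u < c" using that st c(1) by (auto simp: u'_def dist_real_def)
      thus False using c(2)[of u' u] \<open>u \<in> Z\<close> by simp
    qed
    have ev: "\<forall>\<^sub>F k in sequentially. \<bar>f k - s\<bar> < min c ((t - s) / 2) \<and> \<bar>m k - t\<bar> < min c ((t - s) / 2)"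
      using tendstoD[OF i(1), of "min c ((t - s) / 2)"] tendstoD[OF j(1), of "min c ((t - s) / 2)"] c(1) st
      by (simp add: f_def m_def dist_real_def eventually_conj_iff)
    then obtain n0 where n0: "\<And>k. k \<ge> n0 \<Longrightarrow> \<bar>f k - s\<bar> < min c ((t - s) / 2) \<and> \<bar>m k - t\<bar> < min c ((t - s) / 2)"
      by (auto simp: eventually_sequentially)
    have gaps: "in_gap (f k) (m k)" "in_gap s (f k)" "in_gap t (m k)"
      "i k \<le> j k" if "k \<ge> n0" for k
    proof -
      have b: "s - c < f k" "f k < s + c" "t - c < m k" "m k < t + c" "f k < m k"
      proof -
        have "\<bar>f k - s\<bar> < (t - s) / 2" "\<bar>m k - t\<bar> < (t - s) / 2" using n0[OF that] by simp_all
        hence "f k - s < (t - s) / 2" "t - m k < (t - s) / 2"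
          using abs_ge_self[of "f k - s"] abs_ge_minus_self[of "m k - t"] by linarith+
        thus "f k < m k" by (simp add: field_simps)
      qed (use n0[OF that] in \<open>auto simp: abs_less_iff\<close>)
      have b': "f k < t + c" "s - c < m k" using b st by auto
      have segs: "in_gap a b" if "s - c < a" "a < t + c" "s - c < b" "b < t + c" for a b
        using far that by (fastforce simp: closed_segment_eq_real_ivl split: if_splits)
      show "in_gap (f k) (m k)" "in_gap s (f k)" "in_gap t (m k)" using b b' st c(1) by (intro segs; simp)+
      have "real (i k) * ?h (r k) < real (j k) * ?h (r k)" using b(5) by (simp add: f_def m_def)
      moreover have "0 \<le> ?h (r k)" using len_pos by simp
      ultimately show "i k \<le> j k" by (meson mult_right_mono not_le of_nat_less_iff less_imp_le not_less)
    qed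
    \<comment> \<open>The vector v belongs to the plane at t and not to that at m k; its projection
      does and converges to v.\<close>
    define w where "w k = Pr (m k *\<^sub>R e) v" for k
    have conv: "(\<lambda>k. Pr (p k *\<^sub>R e)) \<longlonglongrightarrow> Pr (q *\<^sub>R e)"
      if q: "q \<in> J" and p: "\<And>k. p k \<in> J" "p \<longlonglongrightarrow> q" and g: "\<And>k. k \<ge> n0 \<Longrightarrow> in_gap q (p k)" for q p
    proof -
      have "(\<lambda>k. Pr (q *\<^sub>R e) - Pr (p k *\<^sub>R e)) \<longlonglongrightarrow> 0"
      proof (rule Lim_null_comparison)
        show "\<forall>\<^sub>F k in sequentially. norm (Pr (q *\<^sub>R e) - Pr (p k *\<^sub>R e)) \<le> 84 * C ^ 4 * \<bar>p k - q\<bar>"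
          using Pr_axis_lipschitz[OF q p(1) g] by (auto simp: eventually_sequentially)
        have "(\<lambda>k. 84 * C ^ 4 * \<bar>p k - q\<bar>) \<longlonglongrightarrow> 84 * C ^ 4 * \<bar>q - q\<bar>" by (intro tendsto_intros p)
        thus "(\<lambda>k. 84 * C ^ 4 * \<bar>p k - q\<bar>) \<longlonglongrightarrow> 0" by simp
      qed
      from tendsto_diff[OF tendsto_const[of "Pr (q *\<^sub>R e)"] this] show ?thesis by simp
    qed
    have Pm: "(\<lambda>k. Pr (m k *\<^sub>R e)) \<longlonglongrightarrow> Pr (t *\<^sub>R e)"
      using conv[OF t J(2)] j(1) gaps(3) by (simp add: m_def)
    have Pf: "(\<lambda>k. Pr (f k *\<^sub>R e)) \<longlonglongrightarrow> Pr (s *\<^sub>R e)"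
      using conv[OF s J(1)] i(1) gaps(2) by (simp add: f_def)
    have wlim: "w \<longlonglongrightarrow> v"
      using blinfun.tendsto[OF Pm tendsto_const[of v]] orth_proj_id[OF sub_axis[OF t] v] by (simp add: w_def[abs_def])
    have "\<exists>u. u \<in> pl (f k *\<^sub>R e) \<and> frame_grid O' (r k) (i k) u = frame_grid O' (r k) (j k) (w k)" if "k \<ge> n0" for k
      using frame_grid_plane[of "i k" "j k" "r k" "w k" O'] gaps[OF that] ij(2) orth_proj_in[OF sub_axis[OF J(2)]]
      unfolding w_def f_def m_def by blast
    then obtain u where u: "\<And>k. k \<ge> n0 \<Longrightarrow> u k \<in> pl (f k *\<^sub>R e)"
      "\<And>k. k \<ge> n0 \<Longrightarrow> frame_grid O' (r k) (i k) (u k) = frame_grid O' (r k) (j k) (w k)" by metis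
    obtain u0 where u0: "N s u0 = N t v" using linear_injective_imp_surjective[OF lin inj, of s] by (metis surjD)
    have "(\<lambda>k. u k - u0) \<longlonglongrightarrow> 0"
    proof (rule Lim_null_comparison)
      let ?d = "\<lambda>k. frame_grid O' (r k) (j k) (w k) - frame_grid O' (r k) (i k) u0"
      have "norm (u k - u0) \<le> 5/4 * norm (?d k)" if "k \<ge> n0" for k
        using expand[OF frame_grid_near(2)[OF O1 ij(1)], of "u k - u0" k] u(2)[OF that] by (simp add: blinfun.diff_right)
      thus "\<forall>\<^sub>F k in sequentially. norm (u k - u0) \<le> 5/4 * norm (?d k)" by (rule eventually_sequentiallyI)
      have "(\<lambda>k. 5/4 * norm (?d k)) \<longlonglongrightarrow> 5/4 * norm (N t v - N s u0)"
        by (intro tendsto_intros blinfun.tendsto i j wlim)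
      thus "(\<lambda>k. 5/4 * norm (?d k)) \<longlonglongrightarrow> 0" by (simp add: u0)
    qed
    hence ul: "u \<longlonglongrightarrow> u0" by (rule LIM_zero_cancel)
    have "(\<lambda>k. Pr (f k *\<^sub>R e) (u k)) \<longlonglongrightarrow> u0"
      by (rule Lim_transform_eventually[OF ul], rule eventually_sequentiallyI[of n0])
        (use u(1) orth_proj_id[OF sub_axis[OF J(1)]] in simp)
    hence "Pr (s *\<^sub>R e) u0 = u0" by (rule LIMSEQ_unique[OF blinfun.tendsto[OF Pf ul]])
    hence "u0 \<in> pl (s *\<^sub>R e)" using orth_proj_in[OF sub_axis[OF s], of u0] by simp
    thus ?thesis using u0 by (metis imageI)
  qed
  have dimN: "dim (blinfun_apply (N t) ` pl (t *\<^sub>R e)) = 2" "subspace (blinfun_apply (N t) ` pl (t *\<^sub>R e))"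
    if t: "t \<in> J" "t \<notin> Z" for t
  proof -
    have "dim (blinfun_apply (N t) ` pl (t *\<^sub>R e)) = dim (pl (t *\<^sub>R e))"
      by (intro dim_image_eq lin inj_on_subset[OF inj]) auto
    thus "dim (blinfun_apply (N t) ` pl (t *\<^sub>R e)) = 2"
      using dim_pl[OF axis_props(1)[OF t(1)]] t(2) by (simp add: ee)
    show "subspace (blinfun_apply (N t) ` pl (t *\<^sub>R e))" by (intro linear_subspace_image lin sub_axis t)
  qed
  have eq: "blinfun_apply (N s) ` pl (s *\<^sub>R e) = blinfun_apply (N t) ` pl (t *\<^sub>R e)"
    if st: "s < t" and s: "s \<in> J" and t: "t \<in> J" and gap: "{s..t} \<inter> Z = {}" for s t
  proof -
    have "s \<in> {s..t}" "t \<in> {s..t}" using st by auto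
    hence "s \<notin> Z" "t \<notin> Z" using gap by blast+
    hence "blinfun_apply (N t) ` pl (t *\<^sub>R e) = blinfun_apply (N s) ` pl (s *\<^sub>R e)"
      using sub[OF st s t gap] dimN[OF s] dimN[OF t] by (intro subspace_dim_equal) auto
    thus ?thesis by simp
  qed
  have "blinfun_apply (N s) ` pl (s *\<^sub>R e) = blinfun_apply (N t) ` pl (t *\<^sub>R e)"
    if s: "s \<in> J" and t: "t \<in> J" and gap: "in_gap s t" for s t
  proof (cases s t rule: linorder_cases)
    case less
    thus ?thesis using eq[OF less s t] gap by (simp add: closed_segment_eq_real_ivl)
  next
    case greater
    thus ?thesis using eq[OF greater t s] gap by (simp add: closed_segment_eq_real_ivl)
  qed simp
  thus ?thesis using that near Ne NL by blast
qed

end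

section \<open>Flattening each gap into one plane\<close>

section \<open>Flattening a ribbon\<close>

text \<open>N is merely Lipschitz, whereas the flattening map must be of class C^{1,1}. So N is
  replaced in each gap by the affine function with the same values at the ends of the gap. The error
  is at most linear in the distance to any point of Z, with slope bounded by L.\<close>

lemma gap_interpolation:
  fixes N :: "real \<Rightarrow> 'b::real_normed_vector"
  assumes Z: "closed Z" "Z \<subseteq> {lo..hi}" and ab: "lo < hi"
    and L: "\<And>s t. \<lbrakk>s \<in> {lo..hi}; t \<in> {lo..hi}\<rbrakk> \<Longrightarrow> norm (N t - N s) \<le> L * \<bar>t - s\<bar>"
  obtains G B where
    "\<And>t. \<lbrakk>t \<in> {lo..hi}; t \<notin> Z\<rbrakk> \<Longrightarrow> \<exists>a\<in>{lo..hi}. \<exists>b\<in>{lo..hi}. a < b \<and> a \<le> t \<and> t \<le> b \<and>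
      G t = N a + (t - a) *\<^sub>R B t \<and> B t = (1 / (b - a)) *\<^sub>R (N b - N a)"
    "\<And>s t. \<lbrakk>s \<in> {lo..hi}; t \<in> {lo..hi}; closed_segment s t \<inter> Z = {}\<rbrakk> \<Longrightarrow> B s = B t \<and> G s - G t = (s - t) *\<^sub>R B t"
    "\<And>t c. \<lbrakk>t \<in> {lo..hi}; t \<notin> Z; c \<in> Z\<rbrakk> \<Longrightarrow> norm (G t - N t) \<le> 2 * L * \<bar>t - c\<bar>"
    "\<And>t. \<lbrakk>t \<in> {lo..hi}; t \<notin> Z\<rbrakk> \<Longrightarrow> norm (B t) \<le> L"
proof -
  \<comment> \<open>The ends lo and hi serve as artificial gap ends when no point of Z lies on that
    side.\<close>
  define S1 S2 where "S1 t = insert lo (Z \<inter> {..t})" and "S2 t = insert hi (Z \<inter> {t..})" for t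
  define a b where "a t = Sup (S1 t)" and "b t = Inf (S2 t)" for t
  define B where "B t = (1 / (b t - a t)) *\<^sub>R (N (b t) - N (a t))" for t
  define G where "G t = N (a t) + (t - a t) *\<^sub>R B t" for t
  have bdd: "bdd_above (S1 t)" "bdd_below (S2 t)" for t
    unfolding S1_def S2_def by (auto intro!: bdd_aboveI[of _ t] bdd_belowI[of _ t])
  have cl: "closed (S1 t)" "closed (S2 t)" for t
    unfolding S1_def S2_def by (intro closed_insert closed_Int Z closed_atMost closed_atLeast)+
  have mem: "a t \<in> S1 t" "b t \<in> S2 t" for t unfolding a_def b_def using bdd cl
    by (intro closed_contains_Sup closed_contains_Inf; simp add: S1_def S2_def)+
  have ord: "a t \<in> {lo..hi}" "b t \<in> {lo..hi}" "a t \<le> t" "t \<le> b t" "a t < b t" if t: "t \<in> {lo..hi}" "t \<notin> Z" for t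
  proof -
    show 1: "a t \<in> {lo..hi}" "b t \<in> {lo..hi}" "a t \<le> t" "t \<le> b t"
      using mem[of t] t Z(2) ab by (auto simp: S1_def S2_def)
    have "a t \<noteq> t \<or> b t \<noteq> t" using mem[of t] t ab by (auto simp: S1_def S2_def)
    thus "a t < b t" using 1 by linarith
  qed
  have away: "c \<le> a t \<or> b t \<le> c" if "c \<in> Z" for c t
    using cSup_upper[OF _ bdd(1)[of t], of c] cInf_lower[OF _ bdd(2)[of t], of c] that
    unfolding a_def b_def S1_def S2_def by (metis Int_iff atLeast_iff atMost_iff insertCI linorder_linear)
  have Bn: "norm (B t) \<le> L" if t: "t \<in> {lo..hi}" "t \<notin> Z" for t
  proof -
    have "norm (N (b t) - N (a t)) \<le> L * (b t - a t)" using L[of "a t" "b t"] ord[OF t] by simp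
    thus ?thesis using ord[OF t] by (simp add: B_def pos_divide_le_eq del: scaleR_diff_right)
  qed
  have Gb: "G t = N (b t) - (b t - t) *\<^sub>R B t" if t: "t \<in> {lo..hi}" "t \<notin> Z" for t
  proof -
    have "(b t - a t) *\<^sub>R B t = N (b t) - N (a t)" using ord[OF t] by (simp add: B_def)
    thus ?thesis by (simp add: G_def algebra_simps)
  qed
  have same: "a s = a t" "b s = b t" if "closed_segment s t \<inter> Z = {}" for s t
  proof -
    have "x \<le> s \<longleftrightarrow> x \<le> t" "s \<le> x \<longleftrightarrow> t \<le> x" if "x \<in> Z" for x
      using that \<open>closed_segment s t \<inter> Z = {}\<close> linorder_linear[of x s] linorder_linear[of x t]
      by (auto simp: closed_segment_eq_real_ivl disjoint_iff split: if_splits)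
    hence "S1 s = S1 t" "S2 s = S2 t" by (auto simp: S1_def S2_def)
    thus "a s = a t" "b s = b t" by (simp_all add: a_def b_def)
  qed
  show ?thesis
  proof (rule that[of G B])
    show "\<exists>a\<in>{lo..hi}. \<exists>b\<in>{lo..hi}. a < b \<and> a \<le> t \<and> t \<le> b \<and>
      G t = N a + (t - a) *\<^sub>R B t \<and> B t = (1 / (b - a)) *\<^sub>R (N b - N a)" if "t \<in> {lo..hi}" "t \<notin> Z" for t
      using ord[OF that] by (intro bexI[of _ "a t"] bexI[of _ "b t"]) (auto simp: G_def B_def)
    show "B s = B t \<and> G s - G t = (s - t) *\<^sub>R B t" if "closed_segment s t \<inter> Z = {}" for s t
      using same[OF that] by (simp add: G_def B_def flip: scaleR_diff_left diff_divide_distrib)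
    show "norm (G t - N t) \<le> 2 * L * \<bar>t - c\<bar>" if t: "t \<in> {lo..hi}" "t \<notin> Z" and c: "c \<in> Z" for t c
    proof -
      have L0: "L \<ge> 0" using Bn[OF t] norm_ge_zero order_trans by blast
      have *: "norm (G t - N t) \<le> 2 * L * \<bar>t - d\<bar>" if "G t = N d + (t - d) *\<^sub>R B t" "d \<in> {lo..hi}" for d
      proof -
        have "norm ((t - d) *\<^sub>R B t) \<le> L * \<bar>t - d\<bar>" using mult_right_mono[OF Bn[OF t], of "\<bar>t - d\<bar>"] by (simp add: mult.commute)
        moreover have "norm (N d - N t) \<le> L * \<bar>t - d\<bar>" using L[OF t(1) that(2)] by (simp add: abs_minus_commute)
        moreover have eq: "G t - N t = (N d - N t) + (t - d) *\<^sub>R B t" by (simp add: that(1))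
        ultimately show ?thesis unfolding eq using norm_triangle_ineq[of "N d - N t" "(t - d) *\<^sub>R B t"] by linarith
      qed
      have 1: "norm (G t - N t) \<le> 2 * L * \<bar>t - a t\<bar>" by (rule *) (use ord[OF t] in \<open>simp_all add: G_def\<close>)
      have 2: "norm (G t - N t) \<le> 2 * L * \<bar>t - b t\<bar>"
        by (rule *) (use ord[OF t] in \<open>simp_all add: Gb[OF t] algebra_simps\<close>)
      from away[OF c, of t] show ?thesis
      proof
        assume "c \<le> a t"
        hence "\<bar>t - a t\<bar> \<le> \<bar>t - c\<bar>" using ord[OF t] by simp
        thus ?thesis using 1 L0 by (meson mult_left_mono mult_nonneg_nonneg order_trans zero_le_numeral)
      next
        assume "b t \<le> c"
        hence "\<bar>t - b t\<bar> \<le> \<bar>t - c\<bar>" using ord[OF t] by simp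
        thus ?thesis using 2 L0 by (meson mult_left_mono mult_nonneg_nonneg order_trans zero_le_numeral)
      qed
    qed
  qed (use Bn in blast)
qed

lemma plane_basis:
  fixes S :: "'a::euclidean_space set"
  assumes S: "subspace S" "dim S = 2" and e: "e \<in> S" "norm e = 1"
  obtains u where "norm u = 1" "u \<bullet> e = 0" "\<And>v. v \<in> S \<Longrightarrow> v = (v \<bullet> e) *\<^sub>R e + (v \<bullet> u) *\<^sub>R u"
proof -
  have ee: "e \<bullet> e = 1" using e(2) by (simp add: norm_eq_1)
  have "\<not> S \<subseteq> span {e}"
  proof
    assume "S \<subseteq> span {e}"
    hence "dim S \<le> card {e}" by (intro dim_le_card) auto
    thus False using S(2) by simp
  qed
  then obtain w where w: "w \<in> S" "w \<notin> span {e}" by blast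
  define w' where "w' = w - (w \<bullet> e) *\<^sub>R e"
  have w': "w' \<noteq> 0" "w' \<bullet> e = 0"
    using w(2) span_breakdown_eq[of w e "{}"] by (auto simp: w'_def inner_diff_left ee)
  define u where "u = (1 / norm w') *\<^sub>R w'"
  have u: "norm u = 1" "u \<bullet> e = 0" "u \<in> S"
    using w' w(1) e(1) S(1) by (auto simp: u_def w'_def subspace_diff subspace_scale)
  have uu: "u \<bullet> u = 1" using u(1) by (simp add: norm_eq_1)
  have "v = (v \<bullet> e) *\<^sub>R e + (v \<bullet> u) *\<^sub>R u" if v: "v \<in> S" for v
  proof (rule ccontr)
    define z where "z = v - ((v \<bullet> e) *\<^sub>R e + (v \<bullet> u) *\<^sub>R u)"
    assume "v \<noteq> (v \<bullet> e) *\<^sub>R e + (v \<bullet> u) *\<^sub>R u"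
    hence z: "z \<noteq> 0" by (simp add: z_def)
    have zo: "z \<bullet> e = 0" "z \<bullet> u = 0"
      using u(2) by (simp_all add: z_def inner_diff_left inner_add_left ee uu inner_commute[of e u])
    have zS: "z \<in> S" unfolding z_def using v e(1) u(3) S(1) by (intro subspace_diff subspace_add subspace_scale) auto
    have ne: "e \<noteq> u" "e \<noteq> z" "u \<noteq> z" using ee u(2) zo uu by auto
    have "pairwise orthogonal {e, u, z}" using u(2) zo by (auto simp: pairwise_insert orthogonal_def inner_commute)
    hence "independent {e, u, z}" by (rule pairwise_orthogonal_independent) (use z ee uu in auto)
    hence "card {e, u, z} \<le> dim S" by (intro independent_card_le_dim) (use e(1) u(3) zS in auto)
    thus False using ne S(2) by simp
  qed
  thus ?thesis using that u by blast
qed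

context thin_ribbon
begin

text \<open>Over a gap, x is mapped by the interpolated frame G and then projected onto the plane Q
  of the gap; over \<open>Z\<close> only the axis is left. The prescribed derivative is the true one
  on the plane at x and N on its complement: chords of K see only the former up to quadratic error,
  and the latter lets the jet tend to N at \<open>Z\<close>. For two points in one gap, G is affine
  and Q fixed, so the remainder is explicit. For points separated by c in \<open>Z\<close>, both
  jets are compared with the one at the axis point c, where K has quadratic contact with the
  axis.\<close>

theorem flatten:
  fixes O' :: "'a \<Rightarrow>\<^sub>L 'a"
  assumes O': "\<And>v w. blinfun_apply O' v \<bullet> O' w = v \<bullet> w"
  obtains P D u M where "jet K P D M" "M \<ge> 0" "norm (D 0 - O') \<le> 1/5"
    "\<And>x. x \<in> K \<Longrightarrow> P x \<bullet> O' e = x \<bullet> e" "\<And>t. t \<in> J \<Longrightarrow> P (t *\<^sub>R e) = t *\<^sub>R O' e"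
    "\<And>t. \<lbrakk>t \<in> J; t \<notin> Z\<rbrakk> \<Longrightarrow> norm (u t) = 1 \<and> u t \<bullet> O' e = 0"
    "\<And>x. \<lbrakk>x \<in> K; x \<bullet> e \<notin> Z\<rbrakk> \<Longrightarrow> P x = (x \<bullet> e) *\<^sub>R O' e + (P x \<bullet> u (x \<bullet> e)) *\<^sub>R u (x \<bullet> e)"
    "\<And>s t. \<lbrakk>s \<in> J; t \<in> J; in_gap s t\<rbrakk> \<Longrightarrow> u s = u t"
proof -
  obtain N where near: "\<And>t. t \<in> J \<Longrightarrow> norm (N t - O') \<le> 1/5"
    and Ne: "\<And>t. t \<in> J \<Longrightarrow> N t e = O' e" "\<And>t v. t \<in> J \<Longrightarrow> N t v \<bullet> O' e = v \<bullet> e"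
    and NL: "\<And>s t. \<lbrakk>s \<in> J; t \<in> J\<rbrakk> \<Longrightarrow> norm (N t - N s) \<le> 2 * lip * \<bar>t - s\<bar>"
    and Npl: "\<And>s t. \<lbrakk>s \<in> J; t \<in> J; in_gap s t\<rbrakk> \<Longrightarrow>
      blinfun_apply (N s) ` pl (s *\<^sub>R e) = blinfun_apply (N t) ` pl (t *\<^sub>R e)"
    by (rule frame[OF O']) (rule that)
  have ZJ: "Z \<subseteq> J" by (auto simp: Z_def)
  have lohi: "lo < hi" using len_pos by linarith
  obtain G B where G1: "\<And>t. \<lbrakk>t \<in> J; t \<notin> Z\<rbrakk> \<Longrightarrow> \<exists>a\<in>J. \<exists>b\<in>J. a < b \<and> a \<le> t \<and> t \<le> b \<and>
      G t = N a + (t - a) *\<^sub>R B t \<and> B t = (1 / (b - a)) *\<^sub>R (N b - N a)"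
    and G2: "\<And>s t. \<lbrakk>s \<in> J; t \<in> J; in_gap s t\<rbrakk> \<Longrightarrow> B s = B t \<and> G s - G t = (s - t) *\<^sub>R B t"
    and G3: "\<And>t c. \<lbrakk>t \<in> J; t \<notin> Z; c \<in> Z\<rbrakk> \<Longrightarrow> norm (G t - N t) \<le> 2 * (2 * lip) * \<bar>t - c\<bar>"
    and B1: "\<And>t. \<lbrakk>t \<in> J; t \<notin> Z\<rbrakk> \<Longrightarrow> norm (B t) \<le> 2 * lip"
    by (rule gap_interpolation[of Z lo hi N "2 * lip"])
      (rule closed_Z, rule ZJ, rule lohi, rule NL, assumption, assumption, rule that)
  have O'n: "norm (O' v) = norm v" for v by (simp add: norm_eq_sqrt_inner O')
  have O'1: "norm O' \<le> 1" by (rule norm_blinfun_bound) (simp_all add: O'n)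
  have Nn: "norm (N t) \<le> 6/5" if "t \<in> J" for t
    using norm_triangle_ineq[of "N t - O'" O'] near[OF that] O'1 by simp
  have Be: "B t e = 0" "B t v \<bullet> O' e = 0" if t: "t \<in> J" "t \<notin> Z" for t v
    using G1[OF t] Ne by (auto simp: blinfun.scaleR_left blinfun.diff_left inner_diff_left)
  have Ge: "G t e = O' e" "G t v \<bullet> O' e = v \<bullet> e" if t: "t \<in> J" "t \<notin> Z" for t v
    using G1[OF t] Ne Be[OF t] by (auto simp: blinfun.scaleR_left blinfun.add_left inner_add_left)
  have Gn: "norm (G t) \<le> 6/5" if t: "t \<in> J" "t \<notin> Z" for t
  proof -
    obtain a b where ab: "a \<in> J" "b \<in> J" "a < b" "a \<le> t" "t \<le> b"
      "G t = N a + (t - a) *\<^sub>R B t" "B t = (1 / (b - a)) *\<^sub>R (N b - N a)" using G1[OF t] by blast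
    define l where "l = (t - a) / (b - a)"
    have l: "0 \<le> l" "l \<le> 1" using ab by (auto simp: l_def)
    have "G t = (1 - l) *\<^sub>R N a + l *\<^sub>R N b" unfolding ab(6) ab(7) by (simp add: l_def algebra_simps)
    moreover have "(1 - l) *\<^sub>R N a + l *\<^sub>R N b \<in> cball 0 (6/5)"
      by (rule convexD[OF convex_cball]) (use l Nn ab in auto)
    ultimately show ?thesis by simp
  qed
  \<comment> \<open>By \<open>frame\<close>, Q and everything chosen from it (the projection q and
    the unit vector u) is constant along each gap.\<close>
  define Q where "Q t = blinfun_apply (N t) ` pl (t *\<^sub>R e)" for t
  define q where "q t = orth_proj (Q t)" for t
  have lin: "linear (blinfun_apply (N t))" for t by (rule linear_blinfun)
  have subQ: "subspace (Q t)" if "t \<in> J" for t unfolding Q_def by (intro linear_subspace_image lin sub_axis that)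
  have dimQ: "dim (Q t) = 2" if t: "t \<in> J" "t \<notin> Z" for t
  proof -
    have "inj (blinfun_apply (N t))"
    proof (rule linear_injective_0[OF lin, THEN iffD2], intro allI impI)
      fix v assume v: "N t v = 0"
      have "norm ((N t - O') v) \<le> 1/5 * norm v" by (rule norm_blinfun_le[OF near[OF t(1)]])
      thus "v = 0" using v by (simp add: blinfun.diff_left O'n)
    qed
    hence "dim (Q t) = dim (pl (t *\<^sub>R e))"
      unfolding Q_def by (intro dim_image_eq lin) (auto intro: inj_on_subset)
    thus ?thesis using dim_pl[OF axis_props(1)[OF t(1)]] t(2) by (simp add: ee)
  qed
  have qN: "q t (N t (Pr (t *\<^sub>R e) v)) = N t (Pr (t *\<^sub>R e) v)" if t: "t \<in> J" for t v
    unfolding q_def by (rule orth_proj_id[OF subQ[OF t]]) (simp add: Q_def orth_proj_in[OF sub_axis[OF t]])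
  have eQ: "O' e \<in> Q t" if t: "t \<in> J" for t
    unfolding Q_def using Ne(1)[OF t] orth_proj_in[OF sub_axis[OF t], of e] Pr_axis_e[OF t] by (metis imageI)
  have qe: "q t (O' e) = O' e" if t: "t \<in> J" for t unfolding q_def by (rule orth_proj_id[OF subQ[OF t] eQ[OF t]])
  have q1: "norm (q t v) \<le> norm v" "norm (v - q t v) \<le> norm v" if t: "t \<in> J" for t v
    unfolding q_def by (rule norm_orth_proj_compl(2)[OF subQ[OF t]], rule norm_orth_proj_compl(1)[OF subQ[OF t]])
  define u where "u t = (SOME u. norm u = 1 \<and> u \<bullet> O' e = 0 \<and> (\<forall>v\<in>Q t. v = (v \<bullet> O' e) *\<^sub>R O' e + (v \<bullet> u) *\<^sub>R u))" for t
  have u: "norm (u t) = 1 \<and> u t \<bullet> O' e = 0 \<and> (\<forall>v\<in>Q t. v = (v \<bullet> O' e) *\<^sub>R O' e + (v \<bullet> u t) *\<^sub>R u t)"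
    if t: "t \<in> J" "t \<notin> Z" for t
  proof -
    obtain u' where u': "norm u' = 1" "u' \<bullet> O' e = 0" "\<And>v. v \<in> Q t \<Longrightarrow> v = (v \<bullet> O' e) *\<^sub>R O' e + (v \<bullet> u') *\<^sub>R u'"
      by (rule plane_basis[OF subQ[OF t(1)] dimQ[OF t] eQ[OF t(1)]]) (use O'n norm_e in auto)
    show ?thesis unfolding u_def by (rule someI[of _ u']) (intro conjI ballI u')
  qed
  have Qgap: "Q s = Q t" "q s = q t" "u s = u t" if "s \<in> J" "t \<in> J" "in_gap s t" for s t
    using Npl[OF that] by (simp_all add: Q_def q_def u_def)
  define p where "p x = x - (x \<bullet> e) *\<^sub>R e" for x
  \<comment> \<open>Over a gap this is the derivative of x -> q (G (x.e) x) by the product rule, B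
    being the slope of G.\<close>
  define E where "E x = (q (x \<bullet> e) o\<^sub>L G (x \<bullet> e)) + rank_one e (q (x \<bullet> e) (B (x \<bullet> e) x))" for x
  define D where "D x = (if x \<bullet> e \<in> Z then N (x \<bullet> e) else N (x \<bullet> e) + ((E x - N (x \<bullet> e)) o\<^sub>L Pr x))" for x
  define P where "P x = (if x \<bullet> e \<in> Z then (x \<bullet> e) *\<^sub>R O' e else q (x \<bullet> e) (G (x \<bullet> e) x))" for x
  have Eapp: "E x v = q (x \<bullet> e) (G (x \<bullet> e) v) + (v \<bullet> e) *\<^sub>R q (x \<bullet> e) (B (x \<bullet> e) x)" for x v
    by (simp add: E_def blinfun.add_left)
  have pc: "norm (p x) \<le> norm (x - c *\<^sub>R e)" for x c unfolding p_def by (rule norm_diff_proj_le[OF norm_e])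
  have Bp: "B t x = B t (p x)" if t: "t \<in> J" "t \<notin> Z" for t x
    by (simp add: p_def blinfun.diff_right blinfun.scaleR_right Be[OF t])
  have Bx: "norm (B t x) \<le> 2 * lip * norm (p x)" if t: "t \<in> J" "t \<notin> Z" for t x
    unfolding Bp[OF t, of x] by (rule order_trans[OF norm_blinfun]) (rule mult_right_mono[OF B1[OF t]], simp)
  note ve = abs_inner_le_norm[OF norm_e]
  have psmall: "2 * lip * norm (p x) \<le> 2/5" if x: "x \<in> K" for x
  proof -
    have "norm (p x) \<le> 2 * (hi - lo)" using pc[of x 0] diam_K[OF x zero_K] by simp
    hence "lip * norm (p x) \<le> lip * (2 * (hi - lo))" using lip_pos by (intro mult_left_mono) auto
    thus ?thesis using lip_pos(2) by linarith
  qed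
  have qG: "norm (q t (G t v)) \<le> 6/5 * norm v" if t: "t \<in> J" "t \<notin> Z" for t v
    using q1(1)[OF t(1), of "G t v"] norm_blinfun[of "G t" v] Gn[OF t] by (meson mult_right_mono norm_ge_zero order_trans)
  have Nv: "norm (N t v) \<le> 6/5 * norm v" if t: "t \<in> J" for t v by (rule norm_blinfun_le[OF Nn[OF t]])
  have En: "norm (E x) \<le> 2" if x: "x \<in> K" "x \<bullet> e \<notin> Z" for x
  proof (rule norm_blinfun_bound)
    fix v
    have "norm (q (x \<bullet> e) (B (x \<bullet> e) x)) \<le> 2/5"
      using q1(1)[OF height[OF x(1)], of "B (x \<bullet> e) x"] Bx[OF height[OF x(1)] x(2), of x] psmall[OF x(1)] by linarith
    hence "norm ((v \<bullet> e) *\<^sub>R q (x \<bullet> e) (B (x \<bullet> e) x)) \<le> norm v * (2/5)"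
      using ve[of v] by (simp only: norm_scaleR) (intro mult_mono, auto)
    thus "norm (E x v) \<le> 2 * norm v" unfolding Eapp using qG[OF height[OF x(1)] x(2), of v]
        norm_triangle_ineq[of "q (x \<bullet> e) (G (x \<bullet> e) v)" "(v \<bullet> e) *\<^sub>R q (x \<bullet> e) (B (x \<bullet> e) x)"] norm_ge_zero[of v] by linarith
  qed simp
  have ENn: "norm (E x - N (x \<bullet> e)) \<le> 4" if x: "x \<in> K" "x \<bullet> e \<notin> Z" for x
    using norm_triangle_ineq4[of "E x" "N (x \<bullet> e)"] En[OF x] Nn[OF height[OF x(1)]] by linarith

  have DZ: "norm (D x - N c) \<le> 9 * lip * norm (x - c *\<^sub>R e)" if x: "x \<in> K" and c: "c \<in> Z" for x c
  proof -
    define t where "t = x \<bullet> e"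
    have t: "t \<in> J" using height[OF x] by (simp add: t_def)
    define f where "f = norm (x - c *\<^sub>R e)"
    have tc: "\<bar>t - c\<bar> \<le> f" using ve[of "x - c *\<^sub>R e"] by (simp add: f_def t_def inner_diff_left ee)
    have cJ: "c \<in> J" using c ZJ by blast
    have NN: "norm (N t - N c) \<le> 2 * lip * f"
      using NL[OF cJ t] mult_left_mono[OF tc, of "2 * lip"] lip_pos by linarith
    show ?thesis
    proof (cases "t \<in> Z")
      case True
      have "2 * lip * f \<le> 9 * lip * f" using lip_pos by (intro mult_right_mono) (auto simp: f_def)
      thus ?thesis using True NN by (simp add: D_def t_def f_def)
    next
      case False
      have "norm ((E x - N t) o\<^sub>L Pr x) \<le> 7 * lip * f"
      proof (rule norm_blinfun_bound)
        fix v
        define w where "w = Pr x v"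
        have wv: "norm w \<le> norm v" unfolding w_def by (rule norm_orth_proj_compl(2)[OF pl(1)[OF x]])
        define y where "y = N t (w - Pr (t *\<^sub>R e) v)"
        \<comment> \<open>N t maps the plane at t e into Q t, where \<open>q t\<close> is the
          identity (\<open>qN\<close>); so y measures only how far the plane at x differs from that
          at the axis. Each of the three terms is bounded by a multiple of the distance from x to
          the axis point c.\<close>
        have eq: "((E x - N t) o\<^sub>L Pr x) v = q t ((G t - N t) w) - (y - q t y) + (w \<bullet> e) *\<^sub>R q t (B t x)"
          using qN[OF t, of v] by (simp add: y_def w_def Eapp blinfun.diff_left blinfun.diff_right flip: t_def)
        have 1: "norm (q t ((G t - N t) w)) \<le> 4 * lip * f * norm v"
        proof -
          have "norm (G t - N t) \<le> 4 * lip * f"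
            using G3[OF t False c] mult_left_mono[OF tc, of "4 * lip"] lip_pos(1) by linarith
          hence "norm (G t - N t) * norm w \<le> 4 * lip * f * norm v"
            using wv lip_pos by (intro mult_mono) (auto simp: f_def)
          thus ?thesis using q1(1)[OF t, of "(G t - N t) w"] norm_blinfun[of "G t - N t" w] by linarith
        qed
        have 2: "norm (y - q t y) \<le> lip * f * norm v"
        proof -
          have "norm (w - Pr (t *\<^sub>R e) v) \<le> norm (Pr x - Pr (t *\<^sub>R e)) * norm v"
            unfolding w_def using norm_blinfun[of "Pr x - Pr (t *\<^sub>R e)" v] by (simp add: blinfun.diff_left)
          also have "\<dots> \<le> (84 * C ^ 4 * f) * norm v"
          proof (intro mult_right_mono)
            have "84 * C ^ 4 * norm (p x) \<le> 84 * C ^ 4 * f"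
              using pc[of x c] C_powers by (intro mult_left_mono) (auto simp: f_def)
            thus "norm (Pr x - Pr (t *\<^sub>R e)) \<le> 84 * C ^ 4 * f"
              using Pr_slice_lipschitz[OF x] by (simp add: t_def p_def)
          qed simp
          finally have a: "norm (w - Pr (t *\<^sub>R e) v) \<le> (84 * C ^ 4 * f) * norm v" .
          have b: "norm (y - q t y) \<le> 6/5 * norm (w - Pr (t *\<^sub>R e) v)"
            using q1(2)[OF t, of y] Nv[OF t, of "w - Pr (t *\<^sub>R e) v"] unfolding y_def by linarith
          have "6/5 * ((84 * C ^ 4 * f) * norm v) \<le> 336 * C ^ 4 * f * norm v"
          proof -
            have "0 \<le> C ^ 4 * f * norm v" using C_powers by (simp add: f_def)
            thus ?thesis by (simp add: mult_ac)
          qed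
          thus ?thesis using a b unfolding lip_def by linarith
        qed
        have 3: "norm ((w \<bullet> e) *\<^sub>R q t (B t x)) \<le> 2 * lip * f * norm v"
        proof -
          have "2 * lip * norm (p x) \<le> 2 * lip * f" using pc[of x c] lip_pos by (intro mult_left_mono) (auto simp: f_def)
          hence "norm (q t (B t x)) \<le> 2 * lip * f" using q1(1)[OF t, of "B t x"] Bx[OF t False, of x] by linarith
          hence "\<bar>w \<bullet> e\<bar> * norm (q t (B t x)) \<le> norm v * (2 * lip * f)"
            using ve[of w] wv by (intro mult_mono) auto
          thus ?thesis by (simp add: mult_ac)
        qed
        show "norm (((E x - N t) o\<^sub>L Pr x) v) \<le> 7 * lip * f * norm v"
          unfolding eq using 1 2 3 norm_triangle_ineq[of "q t ((G t - N t) w) - (y - q t y)" "(w \<bullet> e) *\<^sub>R q t (B t x)"]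
            norm_triangle_ineq4[of "q t ((G t - N t) w)" "y - q t y"] by linarith
      qed (use lip_pos in \<open>simp add: f_def\<close>)
      moreover have eq: "D x - N c = (N t - N c) + ((E x - N t) o\<^sub>L Pr x)" using False by (simp add: D_def t_def)
      ultimately show ?thesis unfolding eq using NN norm_triangle_ineq[of "N t - N c" "(E x - N t) o\<^sub>L Pr x"]
        unfolding f_def by linarith
    qed
  qed
  have ptc: "norm (p x) \<le> C * (x \<bullet> e - c)\<^sup>2" if "x \<in> K" "c \<in> Z" for x c
    unfolding p_def by (rule gap_quad) (use that in \<open>auto simp: Z_def\<close>)
  have px0: "p x = 0" if "x \<in> K" "x \<bullet> e \<in> Z" for x using ptc[OF that] by simp
  have PZ: "norm (P x - c *\<^sub>R O' e - N c (x - c *\<^sub>R e)) \<le> 3 * C * (norm (x - c *\<^sub>R e))\<^sup>2" if x: "x \<in> K" and c: "c \<in> Z" for x c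
  proof -
    define t where "t = x \<bullet> e"
    have t: "t \<in> J" using height[OF x] by (simp add: t_def)
    have cJ: "c \<in> J" using c ZJ by blast
    have xe: "x = t *\<^sub>R e + p x" by (simp add: p_def t_def)
    have "x - c *\<^sub>R e = (t - c) *\<^sub>R e + p x" by (simp add: p_def t_def algebra_simps)
    hence Nc: "N c (x - c *\<^sub>R e) = (t - c) *\<^sub>R O' e + N c (p x)"
      using Ne(1)[OF cJ] by (simp add: blinfun.add_right blinfun.scaleR_right)
    have "norm (p x) \<le> C * (t - c)\<^sup>2" using ptc[OF x c] by (simp add: t_def)
    also have "\<dots> \<le> C * (norm (x - c *\<^sub>R e))\<^sup>2"
    proof (intro mult_left_mono)
      have "\<bar>t - c\<bar> \<le> norm (x - c *\<^sub>R e)" using ve[of "x - c *\<^sub>R e"] by (simp add: t_def inner_diff_left ee)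
      thus "(t - c)\<^sup>2 \<le> (norm (x - c *\<^sub>R e))\<^sup>2" by (simp add: power2_le_iff_abs_le)
    qed (use C_ge_1 in simp)
    finally have pz: "norm (p x) \<le> C * (norm (x - c *\<^sub>R e))\<^sup>2" .
    obtain y where y: "P x = t *\<^sub>R O' e + y" "norm y \<le> 6/5 * norm (p x)"
    proof (cases "t \<in> Z")
      case True
      thus ?thesis using that[of 0] by (simp add: P_def t_def)
    next
      case False
      have "P x = q t (G t (t *\<^sub>R e + p x))" using False xe by (simp add: P_def t_def)
      also have "\<dots> = t *\<^sub>R O' e + q t (G t (p x))"
        using Ge(1)[OF t False] qe[OF t] by (simp add: blinfun.add_right blinfun.scaleR_right)
      finally show ?thesis by (rule that) (rule qG[OF t False])
    qed
    have "P x - c *\<^sub>R O' e - N c (x - c *\<^sub>R e) = y - N c (p x)"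
      unfolding Nc y(1) by (simp add: algebra_simps)
    hence "norm (P x - c *\<^sub>R O' e - N c (x - c *\<^sub>R e)) \<le> 12/5 * norm (p x)"
      using norm_triangle_ineq4[of y "N c (p x)"] y(2) Nv[OF cJ, of "p x"] by simp
    also have "\<dots> \<le> 3 * (C * (norm (x - c *\<^sub>R e))\<^sup>2)" using pz norm_ge_zero[of "p x"] by linarith
    finally show ?thesis by (simp add: mult.assoc)
  qed

  define M where "M = 100 * (C + lip)"
  have M: "100 * C \<le> M" "100 * lip \<le> M" "0 \<le> M" "24 * C + 36 * lip \<le> M" "24 * C + 18 * lip \<le> M" "2 * lip + 4 * C \<le> M" "12 * lip \<le> M"
    using lip_pos C_ge_1 by (auto simp: M_def)
  have jet: "norm (P y - P x - D x (y - x)) \<le> M * (norm (y - x))\<^sup>2 \<and> norm (D y - D x) \<le> M * norm (y - x)"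
    if x: "x \<in> K" and y: "y \<in> K" for x y
  proof -
    define t s d where "t = x \<bullet> e" and "s = y \<bullet> e" and "d = norm (y - x)"
    have t: "t \<in> J" and s: "s \<in> J" using height x y by (auto simp: t_def s_def)
    have d0: "d \<ge> 0" by (simp add: d_def)
    have std: "\<bar>s - t\<bar> \<le> d" using ve[of "y - x"] by (simp add: s_def t_def d_def inner_diff_left)
    show ?thesis
    proof (cases "in_gap t s")
      case True
      have tZ: "t \<notin> Z" and sZ: "s \<notin> Z" using True by (auto simp: disjoint_iff)
      have eqs: "B s = B t" "G s = G t + (s - t) *\<^sub>R B t" "q s = q t"
        using G2[OF t s True] Qgap(2)[OF t s True] by (auto simp: algebra_simps)
      define w where "w = y - x - Pr x (y - x)"
      have wn: "norm w \<le> C * d\<^sup>2" unfolding w_def d_def using pl(3)[OF x y] .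
      have Bd: "norm (B t (y - x)) \<le> 2 * lip * d" unfolding d_def by (rule norm_blinfun_le[OF B1[OF t tZ]])
      have Prw: "Pr x (y - x) = (y - x) - w" by (simp add: w_def)
      have eq: "P y - P x - D x (y - x) = (s - t) *\<^sub>R q t (B t (y - x)) + (E x - N t) w"
      proof -
        have "D x (y - x) = N t (y - x) + (E x - N t) ((y - x) - w)"
          using tZ by (simp add: D_def blinfun.add_left Prw flip: t_def)
        also have "\<dots> = E x (y - x) - (E x - N t) w" by (simp add: blinfun.diff_left blinfun.diff_right)
        finally have 1: "D x (y - x) = E x (y - x) - (E x - N t) w" .
        have 2: "E x (y - x) = q t (G t (y - x)) + (s - t) *\<^sub>R q t (B t x)"
          by (simp add: Eapp inner_diff_left flip: t_def s_def)
        have 3: "P y = q t (G t y) + (s - t) *\<^sub>R q t (B t y)" "P x = q t (G t x)"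
          using sZ tZ eqs by (simp_all add: P_def blinfun.add_left blinfun.add_right blinfun.scaleR_left blinfun.scaleR_right flip: t_def s_def)
        show ?thesis unfolding 1 2 3 by (simp add: blinfun.diff_right scaleR_diff_right)
      qed
      have "norm ((s - t) *\<^sub>R q t (B t (y - x))) \<le> d * (2 * lip * d)"
        unfolding norm_scaleR using std Bd q1(1)[OF t, of "B t (y - x)"] by (intro mult_mono) auto
      moreover have "norm ((E x - N t) w) \<le> 4 * (C * d\<^sup>2)"
        using norm_blinfun[of "E x - N t" w] mult_mono[OF ENn[OF x] wn] tZ by (simp add: t_def)
      ultimately have "norm (P y - P x - D x (y - x)) \<le> d * (2 * lip * d) + 4 * (C * d\<^sup>2)"
        unfolding eq using norm_triangle_ineq[of "(s - t) *\<^sub>R q t (B t (y - x))" "(E x - N t) w"] by linarith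
      also have "\<dots> = (2 * lip + 4 * C) * d\<^sup>2" by (simp add: power2_eq_square algebra_simps)
      also have "\<dots> \<le> M * d\<^sup>2" using M by (intro mult_right_mono) auto
      finally have A: "norm (P y - P x - D x (y - x)) \<le> M * d\<^sup>2" .
      have NN: "norm (N s - N t) \<le> 2 * lip * d"
        using NL[OF t s] mult_left_mono[OF std, of "2 * lip"] lip_pos by linarith
      have EE: "norm (E y - E x) \<le> 4 * lip * d"
      proof (rule norm_blinfun_bound)
        fix v
        have "(E y - E x) v = (s - t) *\<^sub>R q t (B t v) + (v \<bullet> e) *\<^sub>R q t (B t (y - x))"
          by (simp add: Eapp eqs blinfun.diff_left blinfun.diff_right blinfun.add_left blinfun.add_right blinfun.scaleR_left blinfun.scaleR_right algebra_simps flip: t_def s_def)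
        moreover have "norm ((s - t) *\<^sub>R q t (B t v)) \<le> d * (2 * lip * norm v)"
        proof -
          have "norm (B t v) \<le> 2 * lip * norm v" by (rule norm_blinfun_le[OF B1[OF t tZ]])
          thus ?thesis unfolding norm_scaleR using std q1(1)[OF t, of "B t v"] by (intro mult_mono) auto
        qed
        moreover have "norm ((v \<bullet> e) *\<^sub>R q t (B t (y - x))) \<le> norm v * (2 * lip * d)"
          unfolding norm_scaleR using ve[of v] Bd q1(1)[OF t, of "B t (y - x)"] by (intro mult_mono) auto
        ultimately show "norm ((E y - E x) v) \<le> 4 * lip * d * norm v"
          using norm_triangle_ineq[of "(s - t) *\<^sub>R q t (B t v)" "(v \<bullet> e) *\<^sub>R q t (B t (y - x))"] by (simp add: mult_ac)
      qed (use lip_pos d0 in simp)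
      have PP: "norm (Pr y - Pr x) \<le> lip * d"
        using Pr_lipschitz[OF x y] True by (simp add: t_def s_def d_def norm_minus_commute)
      have Py: "norm (Pr y) \<le> 1" by (rule norm_orth_proj[OF pl(1)[OF y]])
      have eqD: "D y - D x = (N s - N t) + ((((E y - E x) - (N s - N t)) o\<^sub>L Pr y) + ((E x - N t) o\<^sub>L (Pr y - Pr x)))"
        using sZ tZ by (simp add: D_def blinfun_compose_diff_left blinfun_compose_diff_right flip: t_def s_def)
      have "norm (((E y - E x) - (N s - N t)) o\<^sub>L Pr y) \<le> (6 * lip * d) * 1"
        by (rule order_trans[OF norm_blinfun_compose])
          (use EE NN Py norm_triangle_ineq4[of "E y - E x" "N s - N t"] d0 lip_pos in \<open>intro mult_mono, auto\<close>)
      moreover have "norm ((E x - N t) o\<^sub>L (Pr y - Pr x)) \<le> 4 * (lip * d)"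
        by (rule order_trans[OF norm_blinfun_compose]) (use ENn[OF x] PP tZ in \<open>intro mult_mono, auto simp: t_def\<close>)
      ultimately have "norm (D y - D x) \<le> 2 * lip * d + (6 * lip * d + 4 * (lip * d))"
        unfolding eqD using NN by (intro order_trans[OF norm_triangle_ineq] add_mono) auto
      also have "\<dots> = (12 * lip) * d" by (simp add: algebra_simps)
      also have "\<dots> \<le> M * d" using M d0 by (intro mult_right_mono) auto
      finally show ?thesis using A by (simp add: d_def)
    next
      case False
      \<comment> \<open>A degenerate height in between: both points are within 2d of the axis point
        at c, so comparing each with the jet there costs only O(d^2) in the values and O(d) in the
        derivatives.\<close>
      then obtain c where c: "c \<in> closed_segment t s" "c \<in> Z" by blast
      have tsc: "\<bar>t - c\<bar> \<le> d" "\<bar>s - c\<bar> \<le> d"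
        using c(1) std by (auto simp: closed_segment_eq_real_ivl split: if_splits)
      have z: "norm (z - c *\<^sub>R e) \<le> 2 * d" if zK: "z \<in> K" and zd: "\<bar>z \<bullet> e - c\<bar> \<le> d" for z
      proof -
        have cJ: "c \<in> J" using c(2) ZJ by blast
        have "\<bar>z \<bullet> e - c\<bar> \<le> hi - lo" using height[OF zK] cJ by auto
        hence "C * \<bar>z \<bullet> e - c\<bar> \<le> C * (hi - lo)" using C_ge_1 by (intro mult_left_mono) auto
        hence "C * \<bar>z \<bullet> e - c\<bar> \<le> 1" using small_len[OF C_powers(2)] by linarith
        hence "C * \<bar>z \<bullet> e - c\<bar> * \<bar>z \<bullet> e - c\<bar> \<le> 1 * \<bar>z \<bullet> e - c\<bar>" by (intro mult_right_mono) auto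
        hence "norm (p z) \<le> \<bar>z \<bullet> e - c\<bar>" using ptc[OF zK c(2)] by (simp add: power2_eq_square mult.assoc)
        moreover have eq: "z - c *\<^sub>R e = p z + (z \<bullet> e - c) *\<^sub>R e" by (simp add: p_def algebra_simps)
        moreover have "norm ((z \<bullet> e - c) *\<^sub>R e) = \<bar>z \<bullet> e - c\<bar>" by (simp add: norm_e)
        ultimately show ?thesis unfolding eq using norm_triangle_ineq[of "p z" "(z \<bullet> e - c) *\<^sub>R e"] zd by linarith
      qed
      note zx = z[OF x tsc(1)[unfolded t_def]] and zy = z[OF y tsc(2)[unfolded s_def]]
      have sq: "3 * C * (norm (z - c *\<^sub>R e))\<^sup>2 \<le> 12 * C * d\<^sup>2" if "norm (z - c *\<^sub>R e) \<le> 2 * d" for z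
      proof -
        have "(norm (z - c *\<^sub>R e))\<^sup>2 \<le> (2 * d)\<^sup>2" using that by (intro power_mono) auto
        hence "3 * C * (norm (z - c *\<^sub>R e))\<^sup>2 \<le> 3 * C * (2 * d)\<^sup>2" using C_ge_1 by (intro mult_left_mono) auto
        thus ?thesis by (simp add: power_mult_distrib)
      qed
      have li: "9 * lip * norm (z - c *\<^sub>R e) \<le> 18 * lip * d" if "norm (z - c *\<^sub>R e) \<le> 2 * d" for z
        using mult_left_mono[OF that, of "9 * lip"] lip_pos by simp
      note X = order_trans[OF PZ[OF x c(2)] sq[OF zx]] and Y = order_trans[OF PZ[OF y c(2)] sq[OF zy]]
      note DX = order_trans[OF DZ[OF x c(2)] li[OF zx]] and DY = order_trans[OF DZ[OF y c(2)] li[OF zy]]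
      have W: "norm ((D x - N c) (y - x)) \<le> 18 * lip * d * d"
        using norm_blinfun[of "D x - N c" "y - x"] mult_right_mono[OF DX, of d] d0 by (simp add: d_def)
      have eq: "P y - P x - D x (y - x) = ((P y - c *\<^sub>R O' e - N c (y - c *\<^sub>R e)) - (P x - c *\<^sub>R O' e - N c (x - c *\<^sub>R e))) - (D x - N c) (y - x)"
        by (simp add: blinfun.diff_left blinfun.diff_right)
      have "norm (P y - P x - D x (y - x)) \<le> (12 * C * d\<^sup>2 + 12 * C * d\<^sup>2) + 18 * lip * d * d"
        unfolding eq by (rule order_trans[OF norm_triangle_ineq4 add_mono[OF order_trans[OF norm_triangle_ineq4 add_mono[OF Y X]] W]])
      also have "\<dots> = (24 * C + 18 * lip) * d\<^sup>2" by (simp add: power2_eq_square algebra_simps)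
      also have "\<dots> \<le> M * d\<^sup>2" using M by (intro mult_right_mono) auto
      finally have A: "norm (P y - P x - D x (y - x)) \<le> M * d\<^sup>2" .
      have eqD: "D y - D x = (D y - N c) - (D x - N c)" by simp
      have "norm (D y - D x) \<le> 18 * lip * d + 18 * lip * d"
        unfolding eqD by (rule order_trans[OF norm_triangle_ineq4 add_mono[OF DY DX]])
      also have "\<dots> = (36 * lip) * d" by simp
      also have "\<dots> \<le> M * d" using M d0 C_ge_1 by (intro mult_right_mono) auto
      finally show ?thesis using A by (simp add: d_def)
    qed
  qed
  have qsym: "q t v \<bullet> O' e = v \<bullet> O' e" if t: "t \<in> J" for t v
    using orth_proj_sym[OF subQ[OF t], of v "O' e"] qe[OF t] by (simp add: q_def)
  have O'ee: "O' e \<bullet> O' e = 1" by (simp add: O' ee)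
  show ?thesis
  proof (rule that[of P D M u])
    show "jet K P D M" unfolding jet_def using jet by blast
    show "norm (D 0 - O') \<le> 1/5" using zero_Z near[of 0] J0 by (simp add: D_def)
    show "P x \<bullet> O' e = x \<bullet> e" if x: "x \<in> K" for x
      using height[OF x] Ge qsym by (auto simp: P_def O'ee)
    show "P (t *\<^sub>R e) = t *\<^sub>R O' e" if t: "t \<in> J" for t
      using t Ge(1)[OF t] qe[OF t] by (auto simp: P_def ee blinfun.scaleR_right)
    show "P x = (x \<bullet> e) *\<^sub>R O' e + (P x \<bullet> u (x \<bullet> e)) *\<^sub>R u (x \<bullet> e)" if x: "x \<in> K" "x \<bullet> e \<notin> Z" for x
    proof -
      have h: "x \<bullet> e \<in> J" using height[OF x(1)] .
      have "P x \<in> Q (x \<bullet> e)" using x(2) orth_proj_in[OF subQ[OF h]] by (simp add: P_def q_def)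
      moreover have "P x \<bullet> O' e = x \<bullet> e" using x(2) Ge(2)[OF h x(2)] qsym[OF h] by (simp add: P_def)
      ultimately show ?thesis using u[OF h x(2)] by auto
    qed
    show "norm (u t) = 1 \<and> u t \<bullet> O' e = 0" if "t \<in> J" "t \<notin> Z" for t using u[OF that] by blast
  qed (rule M Qgap(3); assumption)+
qed

end

section \<open>Rotations, points of T_1, and recognition of rotated B-sets\<close>

section \<open>Rotations in a plane\<close>

definition plane_rot :: "'a::real_inner \<Rightarrow> 'a \<Rightarrow> real \<Rightarrow> 'a \<Rightarrow> 'a" where
  "plane_rot f g \<theta> x = x + ((cos \<theta> - 1) * (x \<bullet> f) - sin \<theta> * (x \<bullet> g)) *\<^sub>R f
     + (sin \<theta> * (x \<bullet> f) + (cos \<theta> - 1) * (x \<bullet> g)) *\<^sub>R g"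

lemma plane_rot:
  fixes f g :: "'a::euclidean_space"
  assumes fg: "norm f = 1" "norm g = 1" "f \<bullet> g = 0"
  shows orthogonal_plane_rot: "orthogonal_transformation (plane_rot f g k)"
    and plane_rot_add: "plane_rot f g k (plane_rot f g h x) = plane_rot f g (k + h) x"
    and plane_rot_f: "plane_rot f g k f = cos k *\<^sub>R f + sin k *\<^sub>R g"
    and plane_rot_fix: "x \<bullet> f = 0 \<Longrightarrow> x \<bullet> g = 0 \<Longrightarrow> plane_rot f g k x = x"
proof -
  have ip: "f \<bullet> f = 1" "g \<bullet> g = 1" "g \<bullet> f = 0" using fg by (simp_all add: norm_eq_1 inner_commute)
  have f': "plane_rot f g k x \<bullet> f = cos k * (x \<bullet> f) - sin k * (x \<bullet> g)"
    and g': "plane_rot f g k x \<bullet> g = sin k * (x \<bullet> f) + cos k * (x \<bullet> g)" for x k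
    by (simp_all add: plane_rot_def inner_add_left ip fg algebra_simps)
  show "plane_rot f g k f = cos k *\<^sub>R f + sin k *\<^sub>R g" by (simp add: plane_rot_def ip fg algebra_simps)
  show "x \<bullet> f = 0 \<Longrightarrow> x \<bullet> g = 0 \<Longrightarrow> plane_rot f g k x = x" by (simp add: plane_rot_def)
  define c where "c x = x - (x \<bullet> f) *\<^sub>R f - (x \<bullet> g) *\<^sub>R g" for x
  have split: "plane_rot f g k x = c x + (cos k * (x \<bullet> f) - sin k * (x \<bullet> g)) *\<^sub>R f + (sin k * (x \<bullet> f) + cos k * (x \<bullet> g)) *\<^sub>R g"
    for k x by (simp add: plane_rot_def c_def algebra_simps)
  have "c (plane_rot f g h x) = c x" unfolding c_def[of "plane_rot f g h x"] f' g' by (simp add: split)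
  moreover have "cos k * (cos h * (x \<bullet> f) - sin h * (x \<bullet> g)) - sin k * (sin h * (x \<bullet> f) + cos h * (x \<bullet> g))
      = cos (k + h) * (x \<bullet> f) - sin (k + h) * (x \<bullet> g)"
    "sin k * (cos h * (x \<bullet> f) - sin h * (x \<bullet> g)) + cos k * (sin h * (x \<bullet> f) + cos h * (x \<bullet> g))
      = sin (k + h) * (x \<bullet> f) + cos (k + h) * (x \<bullet> g)"
    by (simp_all add: cos_add sin_add algebra_simps)
  ultimately show "plane_rot f g k (plane_rot f g h x) = plane_rot f g (k + h) x"
    unfolding split[of k "plane_rot f g h x"] split[of "k + h"] f' g' by simp
  show "orthogonal_transformation (plane_rot f g k)" unfolding orthogonal_transformation
  proof (intro conjI allI)
    show "linear (plane_rot f g k)" by (rule linearI) (simp_all add: plane_rot_def inner_add_left algebra_simps)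
    fix x
    define p q a b where "p = x \<bullet> f" and "q = x \<bullet> g" and "a = (cos k - 1) * p - sin k * q" and "b = sin k * p + (cos k - 1) * q"
    have "(norm (plane_rot f g k x))\<^sup>2 = x \<bullet> x + 2 * (a * p + b * q) + (a\<^sup>2 + b\<^sup>2)"
    proof -
      have "plane_rot f g k x = x + (a *\<^sub>R f + b *\<^sub>R g)" by (simp add: plane_rot_def a_def b_def p_def q_def)
      moreover have "x \<bullet> (a *\<^sub>R f + b *\<^sub>R g) = a * p + b * q"
        by (simp add: inner_add_right p_def q_def)
      moreover have "(a *\<^sub>R f + b *\<^sub>R g) \<bullet> (a *\<^sub>R f + b *\<^sub>R g) = a\<^sup>2 + b\<^sup>2"
        by (simp add: inner_add_right inner_add_left ip fg power2_eq_square)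
      moreover have "(x + y) \<bullet> (x + y) = x \<bullet> x + 2 * (x \<bullet> y) + y \<bullet> y" for y :: 'a
        by (simp add: inner_add_left inner_add_right inner_commute)
      ultimately show ?thesis unfolding power2_norm_eq_inner by simp
    qed
    moreover have "2 * (a * p + b * q) + (a\<^sup>2 + b\<^sup>2) = ((sin k)\<^sup>2 + (cos k)\<^sup>2 - 1) * (p\<^sup>2 + q\<^sup>2)"
      unfolding a_def b_def by algebra
    ultimately have "(norm (plane_rot f g k x))\<^sup>2 = (norm x)\<^sup>2" by (simp add: power2_norm_eq_inner)
    thus "norm (plane_rot f g k x) = norm x" by (rule power2_eq_imp_eq) simp_all
  qed
qed

text \<open>The rotation is the square of the one by half the angle, so its determinant is the
  square of 1 or -1.\<close>

lemma rotation_plane_rot: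
  fixes f g :: "real^'n"
  assumes fg: "norm f = 1" "norm g = 1" "f \<bullet> g = 0"
  shows "rotation (plane_rot f g q)"
proof -
  let ?S = "plane_rot f g (q / 2)"
  have S: "orthogonal_transformation ?S" by (rule orthogonal_plane_rot[OF fg])
  have "plane_rot f g q = ?S \<circ> ?S" by (rule ext) (simp add: plane_rot_add[OF fg])
  hence "matrix (plane_rot f g q) = matrix ?S ** matrix ?S"
    using S by (simp add: matrix_compose orthogonal_transformation_linear)
  moreover have "det (matrix ?S) = 1 \<or> det (matrix ?S) = - 1"
    using S by (intro det_orthogonal_matrix) (simp add: orthogonal_transformation_matrix)
  ultimately have "det (matrix (plane_rot f g q)) = 1" by (auto simp: det_mul)
  thus ?thesis unfolding rotation_def using orthogonal_plane_rot[OF fg] by blast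
qed

text \<open>Rotate in a plane orthogonal to the axis that contains both \<open>std_e i2\<close> and
  v. If v is a multiple of \<open>std_e i2\<close>, a third basis vector completes the plane, and
  this is where dimension at least 3 enters.\<close>

lemma two_rotation_exists:
  fixes i1 i2 :: "'n::finite" and v :: "real^'n"
  assumes n: "CARD('n) \<ge> 3" and i: "i1 \<noteq> i2" and v: "norm v = 1" "v \<bullet> std_e i1 = 0"
  obtains R where "two_rotation i1 R" "R (std_e i2) = v"
proof -
  let ?e = "std_e i1 :: real^'n" and ?f = "std_e i2 :: real^'n"
  have nf: "norm ?f = 1" by (simp add: std_e_def)
  have ff: "?f \<bullet> ?f = 1" using nf by (simp add: norm_eq_1)
  have fe: "?f \<bullet> ?e = 0" using i by (simp add: std_e_def inner_axis_axis)
  obtain g where g: "norm g = 1" "g \<bullet> ?e = 0" "g \<bullet> ?f = 0" "v = (v \<bullet> ?f) *\<^sub>R ?f + (v \<bullet> g) *\<^sub>R g"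
  proof (cases "v = (v \<bullet> ?f) *\<^sub>R ?f")
    case True
    have "card {i1, i2} < card (UNIV :: 'n set)" using n i by simp
    then obtain i3 where "i3 \<notin> {i1, i2}" by (metis UNIV_eq_I less_irrefl)
    hence 3: "norm (std_e i3 :: real^'n) = 1" "(std_e i3 :: real^'n) \<bullet> ?e = 0" "(std_e i3 :: real^'n) \<bullet> ?f = 0"
      by (auto simp: std_e_def inner_axis_axis)
    have "v \<bullet> std_e i3 = 0" by (subst True) (use 3 in \<open>simp add: inner_commute\<close>)
    thus ?thesis using that[of "std_e i3"] 3 True by simp
  next
    case False
    define w where "w = v - (v \<bullet> ?f) *\<^sub>R ?f"
    have w: "w \<noteq> 0" "w \<bullet> ?f = 0" "w \<bullet> ?e = 0" using False v fe ff by (simp_all add: w_def inner_diff_left)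
    have "v \<bullet> w = w \<bullet> w" using w(2) by (simp add: w_def inner_diff_left inner_diff_right inner_commute)
    hence "(v \<bullet> ((1 / norm w) *\<^sub>R w)) *\<^sub>R ((1 / norm w) *\<^sub>R w) = w"
      using w(1) by (simp add: dot_square_norm power2_eq_square)
    hence "v = (v \<bullet> ?f) *\<^sub>R ?f + (v \<bullet> ((1 / norm w) *\<^sub>R w)) *\<^sub>R ((1 / norm w) *\<^sub>R w)"
      by (simp add: w_def)
    thus ?thesis using that[of "(1 / norm w) *\<^sub>R w"] w by simp
  qed
  have gg: "g \<bullet> g = 1" using g(1) by (simp add: norm_eq_1)
  have "v \<bullet> v = (v \<bullet> ?f)\<^sup>2 + (v \<bullet> g)\<^sup>2"
    by (subst g(4)) (simp add: inner_add_right power2_eq_square inner_commute)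
  hence "(v \<bullet> ?f)\<^sup>2 + (v \<bullet> g)\<^sup>2 = 1" using v(1) by (simp add: norm_eq_1)
  then obtain q where q: "v \<bullet> ?f = cos q" "v \<bullet> g = sin q" using sincos_total_2pi by metis
  have fg: "norm ?f = 1" "norm g = 1" "?f \<bullet> g = 0" using nf g by (simp_all add: inner_commute)
  let ?R = "plane_rot ?f g q"
  have "two_rotation i1 ?R" unfolding two_rotation_def
  proof (intro conjI exI[of _ "span {?f, g}"] ballI allI impI)
    show "rotation ?R" by (rule rotation_plane_rot[OF fg])
    have ne: "?f \<noteq> g" using fg(3) ff by auto
    have "independent {?f, g}" by (rule pairwise_orthogonal_independent)
        (use fg g gg ff in \<open>auto simp: pairwise_insert orthogonal_def inner_commute\<close>)
    thus "dim (span {?f, g}) = 2" using ne by (simp add: dim_eq_card_independent)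
    show "x \<bullet> ?e = 0" if "x \<in> span {?f, g}" for x
    proof -
      have "span {?f, g} \<subseteq> {x. x \<bullet> ?e = 0}"
        by (rule span_minimal) (use fe g(2) subspace_hyperplane2[of ?e] in \<open>auto simp: inner_commute subspace_def inner_add_left inner_add_right\<close>)
      thus ?thesis using that by blast
    qed
    show "?R x = x" if "\<forall>t\<in>span {?f, g}. x \<bullet> t = 0" for x
      by (rule plane_rot_fix[OF fg]) (use that span_base[of _ "{?f, g}"] in auto)
  qed simp
  moreover have "?R ?f = v" unfolding plane_rot_f[OF fg] using g(4) q by simp
  ultimately show ?thesis using that by blast
qed

lemma two_rotation_inner_axis:
  assumes "two_rotation i1 R"
  shows "R (std_e i1) = std_e i1" "linear R" "R x \<bullet> R y = x \<bullet> y" "R x \<bullet> std_e i1 = x \<bullet> std_e i1"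
proof -
  have o: "orthogonal_transformation R" using assms by (simp add: two_rotation_def rotation_def)
  thus "linear R" "R x \<bullet> R y = x \<bullet> y" by (auto simp: orthogonal_transformation_def)
  obtain T where "\<forall>v\<in>T. v \<bullet> std_e i1 = 0" "\<forall>v. (\<forall>t\<in>T. v \<bullet> t = 0) \<longrightarrow> R v = v"
    using assms by (auto simp: two_rotation_def)
  thus 1: "R (std_e i1) = std_e i1" by (simp add: inner_commute)
  show "R x \<bullet> std_e i1 = x \<bullet> std_e i1" using o 1 unfolding orthogonal_transformation_def by metis
qed

section \<open>Points of B-sets with one-dimensional tangent cone\<close>

text \<open>Common form of the two kinds of B-sets, with J equal to [0, r] or to [-r, r].\<close>

definition lens :: "'n::finite \<Rightarrow> 'n \<Rightarrow> real set \<Rightarrow> (real \<Rightarrow> real) \<Rightarrow> (real \<Rightarrow> real) \<Rightarrow> (real^'n) set" where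
  "lens i1 i2 J \<phi> \<psi> = {x *\<^sub>R std_e i1 + y *\<^sub>R std_e i2 | x y. x \<in> J \<and> \<psi> x \<le> y \<and> y \<le> \<phi> x}"

lemma std_e_inner: "std_e i \<bullet> (std_e j :: real^'n) = (if i = j then 1 else 0)"
  by (simp add: std_e_def inner_axis_axis)

lemma norm_std_e [simp]: "norm (std_e i :: real^'n) = 1" by (simp add: std_e_def)

lemma Tan_curveI:
  assumes "\<And>n. f n \<in> A" "\<And>n. f n \<noteq> a" and h: "\<And>n::nat. h n > 0" "h \<longlonglongrightarrow> 0" and u: "(\<lambda>n. (1 / h n) *\<^sub>R (f n - a)) \<longlonglongrightarrow> u"
  shows "u \<in> Tan A a"
proof -
  have "(\<lambda>n. a + h n *\<^sub>R ((1 / h n) *\<^sub>R (f n - a))) \<longlonglongrightarrow> a + 0 *\<^sub>R u" by (intro tendsto_intros h u)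
  moreover have "a + h n *\<^sub>R ((1 / h n) *\<^sub>R (f n - a)) = f n" for n using h(1)[of n] by simp
  ultimately have "f \<longlonglongrightarrow> a" by simp
  thus ?thesis unfolding Tan_def using assms by (intro CollectI disjI2 exI[of _ f] exI[of _ "\<lambda>n. 1 / h n"]) auto
qed

text \<open>The quadratic error disappears under rescaling, because r |d|^2 = |d| |r d| tends to
  0.\<close>

lemma Tan_subset:
  fixes A :: "'a::euclidean_space set"
  assumes S: "subspace S" and w: "\<And>x. x \<in> A \<Longrightarrow> \<exists>w\<in>S. norm (x - a - w) \<le> C * (norm (x - a))\<^sup>2"
  shows "Tan A a \<subseteq> S"
proof
  fix u assume "u \<in> Tan A a"
  then consider "u = 0" | x r where "\<And>i. x i \<in> A" "\<And>i. r i > 0" "x \<longlonglongrightarrow> a" "(\<lambda>i. r i *\<^sub>R (x i - a)) \<longlonglongrightarrow> u"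
    unfolding Tan_def by blast
  thus "u \<in> S"
  proof cases
    case 2
    define d where "d i = x i - a" for i
    have d: "(\<lambda>i. norm (d i)) \<longlonglongrightarrow> 0" "(\<lambda>i. r i *\<^sub>R d i) \<longlonglongrightarrow> u"
      using tendsto_norm[OF LIM_zero[OF 2(3)]] 2(4) by (simp_all add: d_def)
    have "\<forall>i. \<exists>v\<in>S. norm (d i - v) \<le> C * (norm (d i))\<^sup>2" using w 2(1) by (simp add: d_def)
    then obtain v where v: "\<And>i. v i \<in> S" "\<And>i. norm (d i - v i) \<le> C * (norm (d i))\<^sup>2" by metis
    have 1: "norm (r i *\<^sub>R d i - r i *\<^sub>R v i) \<le> C * norm (d i) * norm (r i *\<^sub>R d i)" for i
    proof -
      have "norm (r i *\<^sub>R (d i - v i)) = r i * norm (d i - v i)" using 2(2)[of i] by simp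
      also have "\<dots> \<le> r i * (C * (norm (d i))\<^sup>2)" using v(2)[of i] 2(2)[of i] by (intro mult_left_mono) auto
      also have "\<dots> = C * norm (d i) * norm (r i *\<^sub>R d i)" using 2(2)[of i] by (simp add: power2_eq_square)
      finally show ?thesis by (simp only: scaleR_diff_right)
    qed
    have "(\<lambda>i. C * norm (d i) * norm (r i *\<^sub>R d i)) \<longlonglongrightarrow> C * 0 * norm u" by (intro tendsto_intros d)
    hence "(\<lambda>i. C * norm (d i) * norm (r i *\<^sub>R d i)) \<longlonglongrightarrow> 0" by (simp only: mult_zero_left mult_zero_right)
    hence "(\<lambda>i. r i *\<^sub>R d i - r i *\<^sub>R v i) \<longlonglongrightarrow> 0"
      by (rule Lim_null_comparison[rotated]) (rule always_eventually, rule allI, rule 1)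
    from tendsto_diff[OF d(2) this] have "(\<lambda>i. r i *\<^sub>R v i) \<longlonglongrightarrow> u" by simp
    moreover have "r i *\<^sub>R v i \<in> S" for i using S v(1) by (rule subspace_scale)
    ultimately show ?thesis by (rule closed_sequentially[OF closed_subspace[OF S], rotated])
  qed (use S subspace_0 in blast)
qed

lemma interval_sequence:
  fixes a b c :: real
  assumes "a < b" "c \<in> {a..b}"
  obtains s h where "s = 1 \<or> s = -1" "\<And>n. c + s * h n \<in> {a..b}" "h \<longlonglongrightarrow> 0" "\<And>n::nat. h n > 0"
proof -
  define h where "h n = (b - a) / 2 / real (Suc n)" for n
  have h: "h n > 0" "h n \<le> (b - a) / 2" for n
  proof -
    show "h n > 0" using assms by (simp add: h_def)
    have "h n \<le> (b - a) / 2 / 1" unfolding h_def by (intro divide_left_mono) (use assms in auto)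
    thus "h n \<le> (b - a) / 2" by simp
  qed
  have lim: "h \<longlonglongrightarrow> 0" unfolding h_def[abs_def]
    using tendsto_mult[OF tendsto_const[of "(b - a) / 2"] LIMSEQ_inverse_real_of_nat]
    by (simp only: divide_inverse mult_zero_right)
  show ?thesis
  proof (cases "c \<le> (a + b) / 2")
    case True
    have "c + 1 * h n \<in> {a..b}" for n using h[of n] True assms by (auto simp: field_simps)
    thus ?thesis using h lim by (intro that[of 1 h]) simp_all
  next
    case False
    have "c + (- 1) * h n \<in> {a..b}" for n using h[of n] False assms by (auto simp: field_simps)
    thus ?thesis using h lim by (intro that[of "- 1" h]) simp_all
  qed
qed

text \<open>Quadratic contact of both boundary functions with the axis at c confines the tangent
  cone to the span of the axis direction, and the axis segment inside the lens provides a nonzero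
  tangent vector.\<close>

lemma lens_Tk1I:
  fixes i1 i2 :: "'n::finite"
  assumes i: "i1 \<noteq> i2" and ab: "a < b" and c: "c \<in> {a..b}" and C: "C \<ge> 0"
    and sgn: "\<And>t. t \<in> {a..b} \<Longrightarrow> g t \<le> 0 \<and> 0 \<le> p t"
    and q: "\<And>t. t \<in> {a..b} \<Longrightarrow> p t \<le> C * (t - c)\<^sup>2 \<and> - g t \<le> C * (t - c)\<^sup>2"
  shows "c *\<^sub>R std_e i1 \<in> Tk 1 (lens i1 i2 {a..b} p g)"
proof -
  let ?e = "std_e i1 :: real^'n" and ?f = "std_e i2 :: real^'n" and ?B = "lens i1 i2 {a..b} p g"
  have axB: "t *\<^sub>R ?e \<in> ?B" if "t \<in> {a..b}" for t
    unfolding lens_def using that sgn[OF that] by (intro CollectI exI[of _ t] exI[of _ 0]) auto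
  have sub: "Tan ?B (c *\<^sub>R ?e) \<subseteq> span {?e}"
  proof (rule Tan_subset)
    fix x assume "x \<in> ?B"
    then obtain t y where t: "x = t *\<^sub>R ?e + y *\<^sub>R ?f" "t \<in> {a..b}" "g t \<le> y" "y \<le> p t" by (auto simp: lens_def)
    have xc: "x - c *\<^sub>R ?e - (t - c) *\<^sub>R ?e = y *\<^sub>R ?f" by (simp add: t(1) algebra_simps)
    have "(x - c *\<^sub>R ?e) \<bullet> ?e = t - c" using i by (simp add: t(1) inner_add_left inner_diff_left std_e_inner)
    hence "(t - c)\<^sup>2 \<le> (norm (x - c *\<^sub>R ?e))\<^sup>2"
      using Cauchy_Schwarz_ineq2[of "x - c *\<^sub>R ?e" ?e] by (simp add: power2_le_iff_abs_le)
    hence "C * (t - c)\<^sup>2 \<le> C * (norm (x - c *\<^sub>R ?e))\<^sup>2" using C by (rule mult_left_mono)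
    moreover have "\<bar>y\<bar> \<le> C * (t - c)\<^sup>2" using t(3,4) q[OF t(2)] by (auto simp: abs_le_iff)
    ultimately show "\<exists>w\<in>span {?e}. norm (x - c *\<^sub>R ?e - w) \<le> C * (norm (x - c *\<^sub>R ?e))\<^sup>2"
      by (intro bexI[of _ "(t - c) *\<^sub>R ?e"]) (simp_all add: xc span_scale span_base)
  qed simp
  obtain s h where s: "s = 1 \<or> s = -1" and h: "\<And>n. c + s * h n \<in> {a..b}" "h \<longlonglongrightarrow> 0" "\<And>n::nat. h n > 0"
    by (rule interval_sequence[OF ab c]) (rule that)
  have e0: "?e \<noteq> 0" using norm_std_e[of i1] by (metis norm_zero zero_neq_one)
  have T: "s *\<^sub>R ?e \<in> Tan ?B (c *\<^sub>R ?e)"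
  proof (rule Tan_curveI[where f = "\<lambda>n. (c + s * h n) *\<^sub>R ?e" and h = h])
    have "(1 / h n) *\<^sub>R ((c + s * h n) *\<^sub>R ?e - c *\<^sub>R ?e) = s *\<^sub>R ?e" for n
      using h(3)[of n] by (simp add: algebra_simps)
    thus "(\<lambda>n. (1 / h n) *\<^sub>R ((c + s * h n) *\<^sub>R ?e - c *\<^sub>R ?e)) \<longlonglongrightarrow> s *\<^sub>R ?e" by simp
    show "(c + s * h n) *\<^sub>R ?e \<noteq> c *\<^sub>R ?e" for n using h(3)[of n] s e0 by auto
  qed (use h axB in auto)
  have "dim (Tan ?B (c *\<^sub>R ?e)) \<le> 1" using dim_le_card[OF sub] by simp
  moreover have "dim {s *\<^sub>R ?e} \<le> dim (Tan ?B (c *\<^sub>R ?e))" using T by (intro dim_subset) simp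
  moreover have "dim {s *\<^sub>R ?e} = 1" using s e0 by (auto simp: dim_eq_card_independent)
  ultimately show ?thesis using axB[OF c] by (simp add: Tk_def)
qed

text \<open>If the slice at t were a proper segment, it would give a vertical tangent vector. The
  Lipschitz boundary functions permit following the lens to neighbouring slices, which gives a
  second tangent vector with nonzero component along the axis, so the dimension would be at least
  2.\<close>

lemma lens_Tk1D:
  fixes i1 i2 :: "'n::finite"
  assumes i: "i1 \<noteq> i2" and ab: "a < b" and t: "t \<in> {a..b}" and L: "L-lipschitz_on {a..b} p" "L'-lipschitz_on {a..b} g"
    and le: "\<And>t. t \<in> {a..b} \<Longrightarrow> g t \<le> p t"
    and T: "t *\<^sub>R std_e i1 + y *\<^sub>R std_e i2 \<in> Tk 1 (lens i1 i2 {a..b} p g)"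
  shows "g t = p t"
proof (rule ccontr)
  let ?e = "std_e i1 :: real^'n" and ?f = "std_e i2 :: real^'n" and ?B = "lens i1 i2 {a..b} p g"
  define z where "z = t *\<^sub>R ?e + y *\<^sub>R ?f"
  assume "g t \<noteq> p t"
  hence lt: "g t < p t" using le[OF t] by simp
  have coord: "(s *\<^sub>R ?e + w *\<^sub>R ?f) \<bullet> ?e = s" "(s *\<^sub>R ?e + w *\<^sub>R ?f) \<bullet> ?f = w" for s w
    using i by (auto simp: inner_add_left std_e_inner)
  have y: "g t \<le> y" "y \<le> p t"
  proof -
    obtain s w where "z = s *\<^sub>R ?e + w *\<^sub>R ?f" "g s \<le> w" "w \<le> p s" using T by (auto simp: Tk_def lens_def z_def)
    thus "g t \<le> y" "y \<le> p t" using coord[of t y] coord[of s w] by (auto simp: z_def)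
  qed
  have f0: "?f \<noteq> 0" using norm_std_e[of i2] by (metis norm_zero zero_neq_one)
  have L0: "L \<ge> 0" "L' \<ge> 0" using L lipschitz_on_nonneg by blast+
  have yi: "y \<in> {g t..p t}" using y by simp
  obtain q k where q: "q = 1 \<or> q = -1" and k: "\<And>n. y + q * k n \<in> {g t..p t}" "k \<longlonglongrightarrow> 0" "\<And>n::nat. k n > 0"
    by (rule interval_sequence[OF lt yi]) (rule that)
  have T2: "q *\<^sub>R ?f \<in> Tan ?B z"
  proof (rule Tan_curveI[where f = "\<lambda>n. t *\<^sub>R ?e + (y + q * k n) *\<^sub>R ?f" and h = k])
    show "t *\<^sub>R ?e + (y + q * k n) *\<^sub>R ?f \<in> ?B" for n
      unfolding lens_def using t k(1)[of n] by (intro CollectI exI[of _ t] exI[of _ "y + q * k n"]) auto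
    have "(1 / k n) *\<^sub>R (t *\<^sub>R ?e + (y + q * k n) *\<^sub>R ?f - z) = q *\<^sub>R ?f" for n
      using k(3)[of n] by (simp add: z_def algebra_simps)
    thus "(\<lambda>n. (1 / k n) *\<^sub>R (t *\<^sub>R ?e + (y + q * k n) *\<^sub>R ?f - z)) \<longlonglongrightarrow> q *\<^sub>R ?f" by simp
    show "t *\<^sub>R ?e + (y + q * k n) *\<^sub>R ?f \<noteq> z" for n using k(3)[of n] q f0 by (auto simp: z_def)
  qed (use k in auto)
  obtain c h where c: "c = 1 \<or> c = -1" and h': "\<And>n. t + c * h n \<in> {a..b}" "h \<longlonglongrightarrow> 0" "\<And>n::nat. h n > 0"
    by (rule interval_sequence[OF ab t]) (rule that)
  define s where "s n = t + c * h n" for n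
  have h: "s n \<in> {a..b}" "h \<longlonglongrightarrow> 0" "h n > 0" for n using h' by (simp_all add: s_def)
  \<comment> \<open>The height y moved into the slice at s n; the displacement is bounded by the
    Lipschitz constants times h n.\<close>
  define w where "w n = max (g (s n)) (min (p (s n)) y)" for n
  have w: "g (s n) \<le> w n" "w n \<le> p (s n)" for n using le[OF h(1)[of n]] by (auto simp: w_def)
  have wy: "\<bar>w n - y\<bar> \<le> (L + L') * h n" for n
  proof -
    have d: "\<bar>s n - t\<bar> = h n" using c h(3)[of n] by (auto simp: s_def)
    have "\<bar>p (s n) - p t\<bar> \<le> L * h n" "\<bar>g (s n) - g t\<bar> \<le> L' * h n"
      using lipschitz_onD[OF L(1) h(1)[of n] t] lipschitz_onD[OF L(2) h(1)[of n] t] by (simp_all add: dist_real_def d)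
    moreover have "0 \<le> L * h n" "0 \<le> L' * h n" using L0 h(3)[of n] by auto
    ultimately show ?thesis unfolding w_def distrib_right using y by linarith
  qed
  define v where "v n = (1 / h n) *\<^sub>R (s n *\<^sub>R ?e + w n *\<^sub>R ?f - z)" for n
  have veq: "v n = c *\<^sub>R ?e + ((w n - y) / h n) *\<^sub>R ?f" for n
    using h(3)[of n] by (simp add: v_def z_def s_def algebra_simps diff_divide_distrib)
  have bv: "v n \<in> cball 0 (1 + (L + L'))" for n
  proof -
    have "\<bar>(w n - y) / h n\<bar> \<le> L + L'" using wy[of n] h(3)[of n] by (simp add: abs_divide pos_divide_le_eq)
    moreover have "\<bar>c\<bar> = 1" using c by auto
    ultimately show ?thesis unfolding veq using norm_triangle_ineq[of "c *\<^sub>R ?e" "((w n - y) / h n) *\<^sub>R ?f"] by simp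
  qed
  then obtain v0 m where m: "strict_mono m" "(v \<circ> m) \<longlonglongrightarrow> v0"
    using seq_compactE[OF compact_imp_seq_compact[OF compact_cball[of 0 "1 + (L + L')"]], of v] by blast
  have hm: "(\<lambda>n. h (m n)) \<longlonglongrightarrow> 0" using LIMSEQ_subseq_LIMSEQ[OF h(2) m(1)] by (simp add: o_def)
  have T1: "v0 \<in> Tan ?B z"
  proof (rule Tan_curveI[where f = "\<lambda>n. s (m n) *\<^sub>R ?e + w (m n) *\<^sub>R ?f" and h = "\<lambda>n. h (m n)"])
    show "s (m n) *\<^sub>R ?e + w (m n) *\<^sub>R ?f \<in> ?B" for n unfolding lens_def using h(1) w by blast
    show "s (m n) *\<^sub>R ?e + w (m n) *\<^sub>R ?f \<noteq> z" for n
      using coord[of "s (m n)" "w (m n)"] coord[of t y] h(3)[of "m n"] c by (auto simp: z_def s_def)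
    show "(\<lambda>n. (1 / h (m n)) *\<^sub>R (s (m n) *\<^sub>R ?e + w (m n) *\<^sub>R ?f - z)) \<longlonglongrightarrow> v0" using m(2) by (simp add: o_def v_def)
  qed (use h(3) hm in auto)
  have "(\<lambda>n. (v \<circ> m) n \<bullet> ?e) \<longlonglongrightarrow> v0 \<bullet> ?e" by (intro tendsto_intros m(2))
  moreover have "(v \<circ> m) n \<bullet> ?e = c" for n unfolding o_def veq by (rule coord)
  ultimately have v0e: "v0 \<bullet> ?e = c" by (simp add: LIMSEQ_const_iff)
  have "independent {v0, q *\<^sub>R ?f}"
  proof (rule independent_insertI)
    show "v0 \<notin> span {q *\<^sub>R ?f}"
    proof
      assume "v0 \<in> span {q *\<^sub>R ?f}"
      then obtain k where "v0 = k *\<^sub>R (q *\<^sub>R ?f)" by (auto simp: span_singleton)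
      hence "v0 \<bullet> ?e = 0" using i by (simp add: std_e_inner)
      thus False using v0e c by auto
    qed
    show "independent {q *\<^sub>R ?f}" using q f0 by auto
  qed
  moreover have "v0 \<noteq> q *\<^sub>R ?f" using v0e i c by (auto simp: std_e_inner)
  ultimately have "card {v0, q *\<^sub>R ?f} \<le> dim (Tan ?B z)" using T1 T2 by (intro independent_card_le_dim) auto
  thus False using \<open>v0 \<noteq> q *\<^sub>R ?f\<close> T by (simp add: Tk_def z_def)
qed

section \<open>Ribbons that are planar over each gap\<close>

text \<open>The outcome of flattening: over each gap of \<open>Z\<close> the set lies in the plane
  spanned by the axis and a constant vector \<open>u\<close>, and slices over heights outside
  \<open>Z\<close> are nontrivial. The B-set and the multirotation are read off from these
  data.\<close>

locale planar_ribbon = ribbon W "std_e i1" lo hi C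
  for W :: "(real^'n::finite) set" and i1 :: 'n and lo hi C :: real +
  fixes Z :: "real set" and u :: "real \<Rightarrow> real^'n"
  assumes Z_sub: "Z \<subseteq> J" and zero_Z: "0 \<in> Z" and axis: "t \<in> J \<Longrightarrow> t *\<^sub>R std_e i1 \<in> W"
    and connected_slice: "connected {w \<in> W. w \<bullet> std_e i1 = t}"
    and gap_quad: "\<lbrakk>w \<in> W; c \<in> Z\<rbrakk> \<Longrightarrow> norm (w - (w \<bullet> std_e i1) *\<^sub>R std_e i1) \<le> C * (w \<bullet> std_e i1 - c)\<^sup>2"
    and wide: "\<lbrakk>t \<in> J; t \<notin> Z\<rbrakk> \<Longrightarrow> \<exists>w\<in>W. w \<bullet> std_e i1 = t \<and> w \<noteq> t *\<^sub>R std_e i1"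
    and u: "t \<in> J \<Longrightarrow> norm (u t) = 1" "t \<in> J \<Longrightarrow> u t \<bullet> std_e i1 = 0"
    and planar: "w \<in> W \<Longrightarrow> w = (w \<bullet> std_e i1) *\<^sub>R std_e i1 + (w \<bullet> u (w \<bullet> std_e i1)) *\<^sub>R u (w \<bullet> std_e i1)"
    and u_gap: "\<lbrakk>s \<in> J; t \<in> J; closed_segment s t \<inter> Z = {}\<rbrakk> \<Longrightarrow> u s = u t"
begin

abbreviation "e \<equiv> std_e i1"

lemma C_nonneg: "0 \<le> C" using C_ge_1 by simp

definition top where "top t = Sup ((\<lambda>w. w \<bullet> u t) ` {w \<in> W. w \<bullet> e = t})"

text \<open>Reversing \<open>u\<close> exchanges the upper and the lower boundary, so every fact on
  \<open>top\<close> serves for the lower boundary too.\<close>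

lemma planar_ribbon_uminus: "planar_ribbon W i1 lo hi C Z (\<lambda>t. - u t)"
proof unfold_locales
  show "w = (w \<bullet> e) *\<^sub>R e + (w \<bullet> - u (w \<bullet> e)) *\<^sub>R (- u (w \<bullet> e))" if "w \<in> W" for w
    using planar[OF that] by simp
  show "- u s = - u t" if "s \<in> J" "t \<in> J" "closed_segment s t \<inter> Z = {}" for s t
    using u_gap[OF that] by simp
qed (use Z_sub zero_Z axis connected_slice gap_quad wide u in auto)

lemma top_props:
  assumes t: "t \<in> J"
  shows top_attained: "\<exists>w\<in>W. w \<bullet> e = t \<and> w \<bullet> u t = top t"
    and top_ge: "\<And>w. w \<in> W \<Longrightarrow> w \<bullet> e = t \<Longrightarrow> w \<bullet> u t \<le> top t"
    and top_nonneg: "0 \<le> top t"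
proof -
  let ?S = "{w \<in> W. w \<bullet> e = t}"
  have "closed {w. w \<bullet> e = t}" by (intro closed_Collect_eq continuous_intros)
  hence "compact ?S" using compact_Int_closed[OF compact_K, of "{w. w \<bullet> e = t}"] by (simp add: Collect_conj_eq)
  moreover have ax: "t *\<^sub>R e \<in> ?S" using axis[OF t] by (simp add: std_e_inner)
  moreover have "continuous_on ?S (\<lambda>w. w \<bullet> u t)" by (intro continuous_intros)
  ultimately obtain w where w: "w \<in> ?S" "\<And>w'. w' \<in> ?S \<Longrightarrow> w' \<bullet> u t \<le> w \<bullet> u t"
    using continuous_attains_sup[of ?S "\<lambda>w. w \<bullet> u t"] by blast
  have top: "top t = w \<bullet> u t" unfolding top_def by (rule cSup_eq_maximum) (use w in auto)
  thus "\<exists>w\<in>W. w \<bullet> e = t \<and> w \<bullet> u t = top t" using w(1) by auto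
  show "w' \<bullet> u t \<le> top t" if "w' \<in> W" "w' \<bullet> e = t" for w' unfolding top using w(2)[of w'] that by simp
  from this[of "t *\<^sub>R e"] ax u(2)[OF t] show "0 \<le> top t" by (simp add: inner_commute)
qed

lemma top_gap:
  assumes t: "t \<in> J" and c: "c \<in> Z"
  shows "top t \<le> C * (t - c)\<^sup>2"
proof -
  obtain w where w: "w \<in> W" "w \<bullet> e = t" "w \<bullet> u t = top t" using top_attained[OF t] by blast
  have "top t = (w - t *\<^sub>R e) \<bullet> u t" using w(3) u(2)[OF t] by (simp add: inner_diff_left inner_commute[of e])
  also have "\<dots> \<le> norm (w - t *\<^sub>R e)" using norm_cauchy_schwarz[of "w - t *\<^sub>R e" "u t"] u(1)[OF t] by simp
  also have "\<dots> \<le> C * (t - c)\<^sup>2" using gap_quad[OF w(1) c] w(2) by simp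
  finally show ?thesis .
qed

lemma top_Z: "c \<in> Z \<Longrightarrow> top c = 0" using top_gap[of c c] top_nonneg[of c] Z_sub by auto

lemma top_step:
  assumes s: "s \<in> J" and t: "t \<in> J" and gap: "closed_segment s t \<inter> Z = {}"
  shows "top s - top t \<le> C * \<bar>t - s\<bar>"
proof -
  obtain w where w: "w \<in> W" "w \<bullet> e = s" "w \<bullet> u s = top s" using top_attained[OF s] by blast
  obtain w' where w': "w' \<in> W" "w' \<bullet> e = t" "norm (w' - w) \<le> C * \<bar>t - s\<bar>" using slice[OF w(1) t] w(2) by auto
  have "(w - w') \<bullet> u t \<le> norm (w' - w)"
    using norm_cauchy_schwarz[of "w - w'" "u t"] u(1)[OF t] by (simp add: norm_minus_commute)
  moreover have "w \<bullet> u t = top s" using w(3) u_gap[OF s t gap] by simp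
  ultimately show ?thesis using top_ge[OF t w'(1,2)] w'(3) by (simp add: inner_diff_left)
qed

lemma top_lipschitz: "(C * (2 * hi + 1))-lipschitz_on J top"
proof (rule lipschitz_onI)
  have *: "top s - top t \<le> C * (2 * hi + 1) * \<bar>t - s\<bar>" if s: "s \<in> J" and t: "t \<in> J" for s t
  proof (cases "closed_segment s t \<inter> Z = {}")
    case True
    have "C * \<bar>t - s\<bar> \<le> C * (2 * hi + 1) * \<bar>t - s\<bar>" using C_nonneg hi_pos by (intro mult_right_mono) (auto simp: algebra_simps)
    thus ?thesis using top_step[OF s t True] by linarith
  next
    case False
    then obtain c where c: "c \<in> closed_segment s t" "c \<in> Z" by blast
    have 1: "\<bar>s - c\<bar> \<le> \<bar>t - s\<bar>" using c(1) by (auto simp: closed_segment_eq_real_ivl split: if_splits)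
    have "c \<in> J" using c(2) Z_sub by blast
    hence 2: "\<bar>s - c\<bar> \<le> 2 * hi" using s lo_cases hi_pos by (auto simp: abs_le_iff)
    have "C * (s - c)\<^sup>2 = C * (\<bar>s - c\<bar> * \<bar>s - c\<bar>)" by (simp add: power2_eq_square)
    also have "\<dots> \<le> C * ((2 * hi + 1) * \<bar>t - s\<bar>)"
      using 1 2 C_nonneg hi_pos by (intro mult_left_mono mult_mono) auto
    finally show ?thesis using top_gap[OF s c(2)] top_nonneg[OF t] by (simp add: mult.assoc)
  qed
  show "dist (top s) (top t) \<le> C * (2 * hi + 1) * dist s t" if "s \<in> J" "t \<in> J" for s t
    using *[OF that] *[OF that(2,1)] by (simp add: dist_real_def abs_le_iff abs_minus_commute)
  show "0 \<le> C * (2 * hi + 1)" using C_nonneg hi_pos by simp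
qed

text \<open>Within a gap, apply \<open>mid\<close> to the two highest points; they lie in one plane,
  so the near-midpoint bounds \<open>top\<close> from below. If c in \<open>Z\<close> lies between s
  and t, both values of \<open>top\<close> are O((s - t)^2) and nonnegativity at the midpoint is
  enough.\<close>

lemma top_mid:
  assumes s: "s \<in> J" and t: "t \<in> J"
  shows "(top s + top t) / 2 - C * (1 + C)\<^sup>2 * (s - t)\<^sup>2 \<le> top ((s + t) / 2)"
proof (cases "closed_segment s t \<inter> Z = {}")
  case True
  define m where "m = (s + t) / 2"
  have m: "m \<in> J" using s t by (auto simp: m_def)
  obtain w where w: "w \<in> W" "w \<bullet> e = s" "w \<bullet> u s = top s" using top_attained[OF s] by blast
  obtain w' where w': "w' \<in> W" "w' \<bullet> e = t" "w' \<bullet> u t = top t" using top_attained[OF t] by blast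
  have us: "u t = u s" "u m = u s"
  proof -
    show "u t = u s" using u_gap[OF s t True] by simp
    have "closed_segment s m \<subseteq> closed_segment s t"
      by (simp add: subset_closed_segment m_def closed_segment_eq_real_ivl)
    hence "closed_segment s m \<inter> Z = {}" using True by blast
    from u_gap[OF s m this] show "u m = u s" by (rule sym)
  qed
  have dw: "norm (w - w') \<le> (1 + C) * \<bar>s - t\<bar>"
  proof -
    have "w = s *\<^sub>R e + top s *\<^sub>R u s" by (rule planar[OF w(1), unfolded w(2), unfolded w(3)])
    moreover have "w' = t *\<^sub>R e + top t *\<^sub>R u s"
      by (rule planar[OF w'(1), unfolded w'(2), unfolded w'(3), unfolded us(1)])
    ultimately have "w - w' = (s - t) *\<^sub>R e + (top s - top t) *\<^sub>R u s" by (simp add: algebra_simps)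
    hence "norm (w - w') \<le> \<bar>s - t\<bar> + \<bar>top s - top t\<bar>"
      using norm_triangle_ineq[of "(s - t) *\<^sub>R e" "(top s - top t) *\<^sub>R u s"] u(1)[OF s] by simp
    moreover have "closed_segment t s \<inter> Z = {}" using True by (simp add: closed_segment_commute)
    hence "\<bar>top s - top t\<bar> \<le> C * \<bar>s - t\<bar>"
      using top_step[OF s t True] top_step[OF t s] by (simp add: abs_le_iff abs_minus_commute)
    ultimately show ?thesis by (simp add: distrib_right)
  qed
  obtain p where p: "p \<in> W" "p \<bullet> e = m" "norm (p - (1/2) *\<^sub>R (w + w')) \<le> C * (norm (w - w'))\<^sup>2"
    using mid[OF w(1) w'(1)] w w' by (auto simp: m_def)
  have "((1/2) *\<^sub>R (w + w') - p) \<bullet> u s \<le> norm (p - (1/2) *\<^sub>R (w + w'))"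
    using norm_cauchy_schwarz[of "(1/2) *\<^sub>R (w + w') - p" "u s"] u(1)[OF s] by (simp add: norm_minus_commute)
  moreover have "((1/2) *\<^sub>R (w + w') - p) \<bullet> u s = (top s + top t) / 2 - p \<bullet> u m"
    using w w' us by (simp add: inner_diff_left inner_add_left)
  moreover have "C * (norm (w - w'))\<^sup>2 \<le> C * ((1 + C) * \<bar>s - t\<bar>)\<^sup>2"
    using dw C_nonneg by (intro mult_left_mono power_mono) auto
  moreover have "C * ((1 + C) * \<bar>s - t\<bar>)\<^sup>2 = C * (1 + C)\<^sup>2 * (s - t)\<^sup>2" by (simp add: power_mult_distrib)
  ultimately show ?thesis using p(3) top_ge[OF m p(1,2)] unfolding m_def by linarith
next
  case False
  then obtain c where c: "c \<in> closed_segment s t" "c \<in> Z" by blast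
  have d: "\<bar>s - c\<bar> \<le> \<bar>s - t\<bar>" "\<bar>t - c\<bar> \<le> \<bar>s - t\<bar>"
    using c(1) by (auto simp: closed_segment_eq_real_ivl split: if_splits)
  have *: "C * (x - c)\<^sup>2 \<le> C * (1 + C)\<^sup>2 * (s - t)\<^sup>2" if "\<bar>x - c\<bar> \<le> \<bar>s - t\<bar>" for x
  proof -
    have "(x - c)\<^sup>2 \<le> (s - t)\<^sup>2" using that by (simp add: abs_le_square_iff)
    also have "\<dots> \<le> (1 + C)\<^sup>2 * (s - t)\<^sup>2"
    proof -
      have "1\<^sup>2 \<le> (1 + C)\<^sup>2" using C_nonneg by (intro power_mono) auto
      from mult_right_mono[OF this, of "(s - t)\<^sup>2"] show ?thesis by simp
    qed
    finally show ?thesis using C_nonneg by (simp add: mult.assoc mult_left_mono)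
  qed
  have "(s + t) / 2 \<in> J" using s t by auto
  hence "0 \<le> top ((s + t) / 2)" by (rule top_nonneg)
  thus ?thesis using top_gap[OF s c(2)] top_gap[OF t c(2)] *[OF d(1)] *[OF d(2)] by (simp add: field_simps)
qed

text \<open>The midpoint defect of k x^2 is k/4 (x - y)^2, so k = 4 C (1 + C)^2 compensates the
  defect in \<open>top_mid\<close>; continuity upgrades midpoint concavity to concavity.\<close>

lemma top_semiconcave:
  assumes I: "convex I" "I \<subseteq> J"
  shows "semiconcave_on I top"
proof -
  define k where "k = 4 * (C * (1 + C)\<^sup>2)"
  have k: "k \<ge> 0" using C_nonneg by (simp add: k_def)
  have "convex_on I (\<lambda>x. - (top x - k * x\<^sup>2))"
  proof (rule midpoint_convex_imp_convex_on[OF I(1)])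
    have "continuous_on I top" using top_lipschitz I(2) lipschitz_on_continuous_on continuous_on_subset by blast
    thus "continuous_on I (\<lambda>x. - (top x - k * x\<^sup>2))" by (intro continuous_intros)
    fix x y assume "x \<in> I" "y \<in> I"
    hence xy: "x \<in> J" "y \<in> J" using I(2) by auto
    have "k * ((x + y) / 2)\<^sup>2 = (k * x\<^sup>2 + k * y\<^sup>2) / 2 - k / 4 * (x - y)\<^sup>2"
      by (simp add: power2_eq_square field_simps)
    moreover have "k / 4 * (x - y)\<^sup>2 = C * (1 + C)\<^sup>2 * (x - y)\<^sup>2" by (simp add: k_def)
    ultimately show "- (top ((x + y) / 2) - k * ((x + y) / 2)\<^sup>2) \<le>
        (- (top x - k * x\<^sup>2) + - (top y - k * y\<^sup>2)) / 2" using top_mid[OF xy] by argo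
  qed
  thus ?thesis unfolding semiconcave_on_def concave_on_def by (intro exI[of _ "2 * k"]) (use k in simp)
qed

lemma top_derivative: "(top has_real_derivative 0) (at 0 within J)" unfolding has_field_derivative_iff
proof (rule Lim_null_comparison)
  have "norm ((top y - top 0) / (y - 0) - 0) \<le> C * \<bar>y\<bar>" if y: "y \<in> J" "y \<noteq> 0" for y
    using top_gap[OF y(1) zero_Z] top_nonneg[OF y(1)] y(2)
    by (simp add: top_Z[OF zero_Z] abs_divide pos_divide_le_eq power2_eq_square mult.assoc)
  thus "\<forall>\<^sub>F y in at 0 within J. norm ((top y - top 0) / (y - 0)) \<le> C * \<bar>y\<bar>"
    by (simp add: eventually_at_filter)
  show "((\<lambda>y. C * \<bar>y\<bar>) \<longlongrightarrow> 0) (at 0 within J)" by (rule tendsto_eq_intros | simp)+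
qed

text \<open>B is the lens between the extreme values of w . u over the slices.
  \<open>lens_Tk1I\<close> and \<open>lens_Tk1D\<close> identify T_1(B) with the axis points over
  \<open>Z\<close>, and over a gap the rotation takes \<open>std_e i2\<close> to the vector u of
  that gap. Connected slices ensure that the image fills W.\<close>

theorem B_set_rotated:
  assumes n: "CARD('n) \<ge> 3" and i: "i1 \<noteq> i2"
  obtains B a where "B_set i1 i2 B" "multirotation i1 (Tk 1 B) a" "a ` B = W"
proof -
  interpret m: planar_ribbon W i1 lo hi C Z "\<lambda>t. - u t" by (rule planar_ribbon_uminus)
  define bot where "bot t = - m.top t" for t
  define B where "B = lens i1 i2 J top bot"
  have ab: "lo < hi" using lo_cases hi_pos by auto
  have J0: "0 \<in> J" using zero_Z Z_sub by blast
  have sgn: "bot t \<le> 0 \<and> 0 \<le> top t" if "t \<in> J" for t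
    using top_nonneg[OF that] m.top_nonneg[OF that] by (simp add: bot_def)
  have lipb: "(C * (2 * hi + 1))-lipschitz_on J bot"
    using m.top_lipschitz by (simp add: lipschitz_on_def bot_def dist_real_def abs_minus_commute)
  have bz: "bot c = 0" "top c = 0" if "c \<in> Z" for c using top_Z[OF that] m.top_Z[OF that] by (simp_all add: bot_def)
  have derb: "(bot has_real_derivative 0) (at 0 within J)"
    unfolding bot_def using DERIV_minus[OF m.top_derivative] by simp
  have scb: "semiconvex_on I bot" if "convex I" "I \<subseteq> J" for I
    unfolding semiconvex_on_def bot_def using m.top_semiconcave[OF that] by simp
  have sub: "{lo<..<hi} \<subseteq> J" by auto
  have B: "B_set i1 i2 B"
  proof (cases "lo = 0")
    case True
    have "Bminus_set i1 i2 B" unfolding Bminus_set_def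
      by (rule exI[of _ hi], rule exI[of _ top], rule exI[of _ bot], intro conjI)
        (use hi_pos top_lipschitz lipb sgn sub[THEN top_semiconcave[rotated]] sub[THEN scb[rotated]] bz[OF zero_Z] top_derivative derb True
          in \<open>auto simp: B_def lens_def\<close>)
    thus ?thesis by (simp add: B_set_def)
  next
    case False
    hence lo: "lo = - hi" using lo_cases by simp
    have at: "at 0 within {-hi..hi} = at 0" using hi_pos by (intro at_within_interior) simp
    have "Bplus_set i1 i2 B" unfolding Bplus_set_def
      by (rule exI[of _ hi], rule exI[of _ top], rule exI[of _ bot], intro conjI)
        (use hi_pos top_lipschitz lipb sgn sub[THEN top_semiconcave[rotated]] sub[THEN scb[rotated]] bz[OF zero_Z] top_derivative derb at lo
          in \<open>auto simp: B_def lens_def\<close>)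
    thus ?thesis by (simp add: B_set_def)
  qed
  have wid: "t \<in> Z" if t: "t \<in> J" and eq: "bot t = top t" for t
  proof (rule ccontr)
    assume "t \<notin> Z"
    then obtain w where w: "w \<in> W" "w \<bullet> e = t" "w \<noteq> t *\<^sub>R e" using wide[OF t] by blast
    have "w \<bullet> u t \<noteq> 0"
    proof
      assume 0: "w \<bullet> u t = 0"
      have "w = t *\<^sub>R e + 0 *\<^sub>R u t" by (rule planar[OF w(1), unfolded w(2), unfolded 0])
      thus False using w(3) by simp
    qed
    moreover have "w \<bullet> u t \<le> top t" "bot t \<le> w \<bullet> u t"
      using top_ge[OF t w(1,2)] m.top_ge[OF t w(1,2)] by (simp_all add: bot_def)
    ultimately show False using sgn[OF t] eq by linarith
  qed
  have coord: "(s *\<^sub>R e + y *\<^sub>R std_e i2) \<bullet> e = s" "(s *\<^sub>R e + y *\<^sub>R std_e i2) \<bullet> std_e i2 = y" for s y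
    using i by (auto simp: inner_add_left std_e_inner)
  have Tk: "t *\<^sub>R e \<in> Tk 1 B \<longleftrightarrow> t \<in> Z" for t
  proof
    assume T: "t *\<^sub>R e \<in> Tk 1 B"
    then obtain s y where sy: "t *\<^sub>R e = s *\<^sub>R e + y *\<^sub>R std_e i2" "s \<in> J" by (auto simp: Tk_def B_def lens_def)
    have st: "s = t" using coord(1)[of s y] unfolding sy(1)[symmetric] by (simp add: std_e_inner)
    have le: "bot t \<le> top t" if "t \<in> J" for t using sgn[OF that] by linarith
    have "bot t = top t" using lens_Tk1D[OF i ab _ top_lipschitz lipb le, of t 0] T sy(2) st by (simp add: B_def)
    thus "t \<in> Z" using wid sy(2) st by blast
  next
    assume t: "t \<in> Z"
    have "top s \<le> C * (s - t)\<^sup>2 \<and> - bot s \<le> C * (s - t)\<^sup>2" if "s \<in> J" for s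
      using top_gap[OF that t] m.top_gap[OF that t] by (simp add: bot_def)
    thus "t *\<^sub>R e \<in> Tk 1 B" unfolding B_def using t Z_sub by (intro lens_Tk1I[OF i ab _ C_nonneg sgn]) auto
  qed
  \<comment> \<open>Components of the complement of T_1(B) reach beyond the interval J; heights
    outside J get the rotation of the nearest end.\<close>
  define clamp where "clamp t = max lo (min hi t)" for t
  have clJ: "clamp t \<in> J" for t using ab by (auto simp: clamp_def)
  define R where "R v = (SOME R. two_rotation i1 R \<and> R (std_e i2) = v)" for v
  have R: "two_rotation i1 (R (u (clamp t)))" "R (u (clamp t)) (std_e i2) = u (clamp t)" for t
  proof -
    obtain R' where R': "two_rotation i1 R'" "R' (std_e i2) = u (clamp t)"
      by (rule two_rotation_exists[OF n i u[OF clJ]])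
    have "two_rotation i1 (R (u (clamp t))) \<and> R (u (clamp t)) (std_e i2) = u (clamp t)"
      unfolding R_def by (rule someI[of _ R']) (use R' in blast)
    thus "two_rotation i1 (R (u (clamp t)))" "R (u (clamp t)) (std_e i2) = u (clamp t)" by auto
  qed
  define a where "a x = (if x \<bullet> e \<in> Z then x else R (u (clamp (x \<bullet> e))) x)" for x
  have cgap: "u (clamp s) = u (clamp t)" if "closed_segment s t \<inter> Z = {}" for s t
  proof (cases "clamp s = clamp t")
    case False
    hence "closed_segment (clamp s) (clamp t) \<subseteq> closed_segment s t"
      using ab by (auto simp: clamp_def closed_segment_eq_real_ivl split: if_splits)
    hence "closed_segment (clamp s) (clamp t) \<inter> Z = {}" using that by blast
    thus ?thesis by (rule u_gap[OF clJ clJ])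
  qed simp
  have "multirotation i1 (Tk 1 B) a" unfolding multirotation_def
  proof (intro conjI allI impI ballI)
    show "a x = x" if "proj1 i1 x \<in> Tk 1 B" for x using that Tk by (simp add: proj1_def a_def)
    fix I assume I: "I \<in> components (span {e} - Tk 1 B)"
    obtain x0 where x0: "x0 \<in> I" using in_components_nonempty[OF I] by blast
    have Isub: "I \<subseteq> span {e} - Tk 1 B" by (rule in_components_subset[OF I])
    have sp: "p = (p \<bullet> e) *\<^sub>R e" if "p \<in> I" for p
      using that Isub by (auto simp: span_singleton std_e_inner)
    have "a x = R (u (clamp (x0 \<bullet> e))) x" if x: "proj1 i1 x \<in> I" for x
    proof -
      have xe: "proj1 i1 x \<bullet> e = x \<bullet> e" by (simp add: proj1_def std_e_inner)
      have "connected ((\<lambda>p. p \<bullet> e) ` I)"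
        by (intro connected_continuous_image continuous_intros in_components_connected[OF I])
      hence cv: "convex ((\<lambda>p. p \<bullet> e) ` I)" using connected_convex_1 by blast
      have seg: "closed_segment (x \<bullet> e) (x0 \<bullet> e) \<subseteq> (\<lambda>p. p \<bullet> e) ` I"
        by (rule closed_segment_subset[OF imageI[OF x, of "\<lambda>p. p \<bullet> e", unfolded xe] imageI[OF x0] cv])
      have "(\<lambda>p. p \<bullet> e) ` I \<inter> Z = {}"
      proof -
        have "p \<bullet> e \<notin> Z" if "p \<in> I" for p
          using Tk[of "p \<bullet> e"] sp[OF that] that Isub by auto
        thus ?thesis by blast
      qed
      hence "closed_segment (x \<bullet> e) (x0 \<bullet> e) \<inter> Z = {}" using seg by blast
      hence "u (clamp (x \<bullet> e)) = u (clamp (x0 \<bullet> e))" "x \<bullet> e \<notin> Z" by (auto intro: cgap simp: disjoint_iff)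
      thus ?thesis by (simp add: a_def)
    qed
    thus "\<exists>R. two_rotation i1 R \<and> (\<forall>x. proj1 i1 x \<in> I \<longrightarrow> a x = R x)" using R(1) by blast
  qed
  moreover have aapp: "a (t *\<^sub>R e + y *\<^sub>R std_e i2) = t *\<^sub>R e + y *\<^sub>R u t"
    if t: "t \<in> J" and y: "bot t \<le> y" "y \<le> top t" for t y
  proof (cases "t \<in> Z")
    case True
    hence y0: "y = 0" using bz[OF True] y by simp
    have "(t *\<^sub>R e) \<bullet> e = t" by (simp add: std_e_inner)
    hence "a (t *\<^sub>R e) = t *\<^sub>R e" unfolding a_def using True by presburger
    thus ?thesis by (simp add: y0)
  next
    case False
    have cl: "clamp t = t" using t by (auto simp: clamp_def)
    note lin = two_rotation_inner_axis(2)[OF R(1)[of t]]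
    show ?thesis using False two_rotation_inner_axis(1)[OF R(1)[of t]] R(2)[of t]
      by (simp add: a_def coord(1) linear_add[OF lin] linear_scale[OF lin] cl)
        (simp add: cl linear_add[OF lin[unfolded cl]] linear_scale[OF lin[unfolded cl]])
  qed
  have "a ` B = W"
  proof
    show "a ` B \<subseteq> W"
    proof
      fix z assume "z \<in> a ` B"
      then obtain t y where z: "z = a (t *\<^sub>R e + y *\<^sub>R std_e i2)" and t: "t \<in> J" and y: "bot t \<le> y" "y \<le> top t"
        by (auto simp: B_def lens_def)
      obtain w1 w2 where w: "w1 \<in> W" "w1 \<bullet> e = t" "w1 \<bullet> u t = top t" "w2 \<in> W" "w2 \<bullet> e = t" "w2 \<bullet> - u t = m.top t"
        using top_attained[OF t] m.top_attained[OF t] by blast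
      have "connected ((\<lambda>w. w \<bullet> u t) ` {w \<in> W. w \<bullet> e = t})"
        by (intro connected_continuous_image continuous_intros connected_slice)
      hence "{w2 \<bullet> u t..w1 \<bullet> u t} \<subseteq> (\<lambda>w. w \<bullet> u t) ` {w \<in> W. w \<bullet> e = t}"
        by (rule connected_contains_Icc) (rule imageI, use w in simp)+
      moreover have "y \<in> {w2 \<bullet> u t..w1 \<bullet> u t}" using w y by (simp add: bot_def)
      ultimately obtain w where v: "w \<in> W" "w \<bullet> e = t" "w \<bullet> u t = y" by blast
      have "w = t *\<^sub>R e + y *\<^sub>R u t" by (rule planar[OF v(1), unfolded v(2), unfolded v(3)])
      thus "z \<in> W" using v(1) aapp[OF t y] z by simp
    qed
    show "W \<subseteq> a ` B"
    proof
      fix w assume w: "w \<in> W"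
      define t y where "t = w \<bullet> e" and "y = w \<bullet> u t"
      have t: "t \<in> J" using height[OF w] by (simp add: t_def)
      have y: "bot t \<le> y" "y \<le> top t"
        using top_ge[OF t w] m.top_ge[OF t w] by (simp_all add: bot_def t_def y_def)
      have "w = a (t *\<^sub>R e + y *\<^sub>R std_e i2)" unfolding aapp[OF t y] unfolding y_def t_def by (rule planar[OF w])
      moreover have "t *\<^sub>R e + y *\<^sub>R std_e i2 \<in> B" unfolding B_def lens_def using t y by blast
      ultimately show "w \<in> a ` B" by blast
    qed
  qed
  ultimately show ?thesis using that B by blast
qed

end

section \<open>Assembly of the chart\<close>

section \<open>From a set of positive reach to a rotated B-set\<close>

text \<open>The ribbon is shortened three times: to make the section available, to a third for the
  quadratic contact at degenerate slices, and for thinness. Restriction leaves constants unchanged,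
  so each cut may depend on the constants found before. L is the remaining piece in the original
  coordinates and \<open>s\<close> the straightening shear.\<close>

theorem local_structure:
  fixes A :: "'a::euclidean_space set"
  assumes pr: "positive_reach A" and cd: "covering_dim_le A 2" and a: "a \<in> A" and dim1: "dim (Tan A a) = 1"
  obtains L e lo hi C C' s S M c where "ribbon L e lo hi C'" "C' * hi \<le> 1" "thin_ribbon (s ` L) e lo hi C"
    "M \<ge> 0" "jet L s S M" "s 0 = 0" "\<And>v. blinfun_apply (S 0) v = 0 \<Longrightarrow> v = 0" "\<And>x. s x \<bullet> e = x \<bullet> e" "inj s"
    "c > 0" "(\<lambda>x. a + x) ` L \<subseteq> A" "\<And>y. \<lbrakk>y \<in> A; dist y a < c\<rbrakk> \<Longrightarrow> y - a \<in> L"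
proof -
  have "A \<noteq> {}" using a by blast
  then obtain r where "unique_nearest A r" by (rule positive_reach_unique_nearest[OF pr])
  then interpret unique_nearest A r .
  obtain K0 e lo0 hi0 C0 c0 where R0: "ribbon K0 e lo0 hi0 C0" and c0: "c0 > 0" and sub0: "(\<lambda>x. a + x) ` K0 \<subseteq> A"
    and near0: "\<And>y. \<lbrakk>y \<in> A; dist y a < c0\<rbrakk> \<Longrightarrow> y - a \<in> K0"
    by (rule obtain_ribbon[OF cd a dim1]) (rule that)
  interpret R0: ribbon K0 e lo0 hi0 C0 by (rule R0)
  have short: "k * (min b (1 / (2 * k)) - (if P then 0 else - min b (1 / (2 * k)))) \<le> 1" if "k > 0" "b > 0" for k b :: real and P
  proof -
    have "k * (2 * min b (1 / (2 * k))) \<le> k * (2 * (1 / (2 * k)))" using that by (intro mult_left_mono) auto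
    moreover have "0 \<le> k * min b (1 / (2 * k))" using that by simp
    ultimately show ?thesis using that by (auto simp: algebra_simps)
  qed
  define hi1 where "hi1 = min hi0 (1 / (2 * (400 * C0\<^sup>2)))"
  define lo1 where "lo1 = (if lo0 = 0 then 0 else - hi1)"
  define K1 where "K1 = K0 \<inter> {x. x \<bullet> e \<in> {lo1..hi1}}"
  have C02: "C0\<^sup>2 > 0" using R0.C_ge_1 by simp
  have b1: "0 < hi1" "hi1 \<le> hi0" using R0.hi_pos C02 by (auto simp: hi1_def)
  have R1: "ribbon K1 e lo1 hi1 C0" unfolding K1_def by (rule ribbon_restrict[OF R0 b1 lo1_def])
  have small1: "400 * C0\<^sup>2 * (hi1 - lo1) \<le> 1" unfolding lo1_def hi1_def using C02 R0.hi_pos by (intro short) auto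
  obtain s S M C2 where M: "M \<ge> 0" and jet: "jet K1 s S M" and s0: "s 0 = 0" and S0: "\<And>v. blinfun_apply (S 0) v = 0 \<Longrightarrow> v = 0"
    and se: "\<And>x. s x \<bullet> e = x \<bullet> e" and inj: "inj s"
    and R2: "ribbon (s ` K1) e lo1 hi1 C2" and ax: "\<And>t. t \<in> {lo1..hi1} \<Longrightarrow> t *\<^sub>R e \<in> s ` K1"
    by (rule straighten[OF R1 small1]) (rule that)
  define lo3 C3 K3 where "lo3 = (if lo1 = 0 then 0 else - (hi1 / 3))" and "C3 = 18 * C2 ^ 3"
    and "K3 = s ` K1 \<inter> {x. x \<bullet> e \<in> {lo3..hi1 / 3}}"
  have S3: "straight_ribbon K3 e lo3 (hi1 / 3) C3" unfolding K3_def C3_def by (rule ribbon_straightI[OF R2 ax lo3_def])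
  interpret S3: straight_ribbon K3 e lo3 "hi1 / 3" C3 by (rule S3)
  define hi where "hi = min (hi1 / 3) (1 / (2 * (4000 * C3 ^ 4)))"
  define lo where "lo = (if lo3 = 0 then 0 else - hi)"
  define L where "L = K0 \<inter> {x. x \<bullet> e \<in> {lo..hi}}"
  have C34: "C3 ^ 4 > 0" using S3.C_ge_1 by simp
  have b: "0 < hi" "hi \<le> hi1 / 3" "hi \<le> hi0" using b1 C34 by (auto simp: hi_def)
  have J: "{lo..hi} \<subseteq> {lo3..hi1 / 3}" "{lo..hi} \<subseteq> {lo1..hi1}" "lo = (if lo0 = 0 then 0 else - hi)"
    using b b1 by (auto simp: lo_def lo3_def lo1_def split: if_splits)
  have LK1: "L \<subseteq> K1" using J by (auto simp: L_def K1_def)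
  have sL: "s ` L = K3 \<inter> {x. x \<bullet> e \<in> {lo..hi}}" using J by (auto simp: K3_def L_def K1_def se)
  have "straight_ribbon (s ` L) e lo hi C3" unfolding sL by (rule straight_ribbon_restrict[OF S3 b(1,2) lo_def])
  moreover have "4000 * C3 ^ 4 * (hi - lo) \<le> 1" unfolding lo_def hi_def using C34 b1 by (intro short) auto
  ultimately have T: "thin_ribbon (s ` L) e lo hi C3" by (simp add: thin_ribbon_def thin_ribbon_axioms_def)
  have RL: "ribbon L e lo hi C0" unfolding L_def by (rule ribbon_restrict[OF R0 b(1,3) J(3)])
  have "C0 * hi \<le> C0\<^sup>2 * (hi1 - lo1)"
    using R0.C_ge_1 b b1 by (intro mult_mono) (auto simp: power2_eq_square lo1_def)
  hence C0hi: "C0 * hi \<le> 1" using small1 by linarith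
  have near: "y - a \<in> L" if y: "y \<in> A" "dist y a < min c0 hi" for y
  proof -
    have z: "y - a \<in> K0" using near0 y by simp
    have "\<bar>(y - a) \<bullet> e\<bar> < hi" using abs_inner_le_norm[OF R0.norm_e, of "y - a"] y(2) by (simp add: dist_norm)
    thus ?thesis using R0.height[OF z] z by (auto simp: L_def J(3))
  qed
  have sub: "0 < min c0 hi" "(\<lambda>x. a + x) ` L \<subseteq> A" using c0 b(1) sub0 by (auto simp: L_def)
  show ?thesis by (rule that[OF RL C0hi T M jet_subset[OF jet LK1] s0 S0 se inj sub near])
qed

text \<open>Over heights up to r the prescribed derivative stays within 3/10 of the isometry O', so
  increments of Q differ from those of O' by at most half their length. Hence Q is bi-Lipschitz with
  constant 2; \<open>jet_image\<close> transfers the ribbon, and connected and degenerate slices go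
  over to the image.\<close>

lemma planar_image:
  fixes K :: "(real^'n::finite) set" and i1 i2 :: 'n
  assumes T: "thin_ribbon K e lo hi C" and i: "i1 \<noteq> i2"
    and O': "\<And>v w. blinfun_apply O' v \<bullet> O' w = v \<bullet> w" "O' e = std_e i1"
    and jet: "jet K Q D M" and M: "M \<ge> 0" and D0: "norm (D 0 - O') \<le> 1/5"
    and Qe: "\<And>x. x \<in> K \<Longrightarrow> Q x \<bullet> std_e i1 = x \<bullet> e"
    and Qax: "\<And>t. t \<in> {lo..hi} \<Longrightarrow> Q (t *\<^sub>R e) = t *\<^sub>R std_e i1"
    and u: "\<And>t. \<lbrakk>t \<in> {lo..hi}; t \<notin> thin_ribbon.Z K e lo hi\<rbrakk> \<Longrightarrow> norm (u t) = 1 \<and> u t \<bullet> std_e i1 = 0"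
    and plan: "\<And>x. \<lbrakk>x \<in> K; x \<bullet> e \<notin> thin_ribbon.Z K e lo hi\<rbrakk> \<Longrightarrow> Q x = (x \<bullet> e) *\<^sub>R std_e i1 + (Q x \<bullet> u (x \<bullet> e)) *\<^sub>R u (x \<bullet> e)"
    and ugap: "\<And>s t. \<lbrakk>s \<in> {lo..hi}; t \<in> {lo..hi}; closed_segment s t \<inter> thin_ribbon.Z K e lo hi = {}\<rbrakk> \<Longrightarrow> u s = u t"
    and r: "0 < r" "r \<le> hi" "20 * (M + 1) * r \<le> 1" and lo': "lo' = (if lo = 0 then 0 else - r)"
  shows "\<exists>C' Z' u'. planar_ribbon (Q ` (K \<inter> {x. x \<bullet> e \<in> {lo'..r}})) i1 lo' r C' Z' u'"
proof -
  interpret thin_ribbon K e lo hi C by (rule T)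
  let ?e = "std_e i1 :: real^'n"
  define K' where "K' = K \<inter> {x. x \<bullet> e \<in> {lo'..r}}"
  interpret R: straight_ribbon K' e lo' r C
    unfolding K'_def by (rule straight_ribbon_restrict[OF straight_ribbon_axioms r(1,2) lo'])
  have J': "{lo'..r} \<subseteq> J" using r lo' lo_cases by auto
  have K': "x \<in> K" "x \<bullet> e \<in> {lo'..r}" if "x \<in> K'" for x using that by (auto simp: K'_def)
  have "C * r \<le> C * (hi - lo)" using r C_ge_1 lo_cases by (intro mult_left_mono) auto
  hence "C * r \<le> 1" using small_len[OF C_powers(2)] by linarith
  hence nx: "norm x \<le> 2 * r" if x: "x \<in> K'" for x using R.norm_le[OF x] R.abs_J(1)[OF R.height[OF x]] by linarith
  have Mr: "M * r \<le> 1/20" using r(1,3) by (simp add: algebra_simps)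
  have jet': "jet K' Q D M" using jet by (rule jet_subset) (auto simp: K'_def)
  have O'n: "norm (O' v) = norm v" for v by (simp add: norm_eq_sqrt_inner O')
  have close: "norm (Q y - Q x - O' (y - x)) \<le> 1/2 * norm (y - x)" if x: "x \<in> K'" and y: "y \<in> K'" for x y
  proof -
    have "M * norm x \<le> M * (2 * r)" using nx[OF x] M by (intro mult_left_mono)
    hence "norm (D x - D 0) \<le> 1/10" using jetD(2)[OF jet' R.zero_K x] Mr by simp
    hence "norm (D x - O') \<le> 3/10" using D0 norm_triangle_ineq[of "D x - D 0" "D 0 - O'"] by simp
    hence 1: "norm ((D x - O') (y - x)) \<le> 3/10 * norm (y - x)" by (rule norm_blinfun_le)
    have "norm (y - x) \<le> 4 * r" using nx[OF x] nx[OF y] norm_triangle_ineq4[of y x] by linarith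
    hence "M * norm (y - x) \<le> M * (4 * r)" using M by (intro mult_left_mono)
    hence "M * norm (y - x) \<le> 1/5" using Mr by simp
    hence "(M * norm (y - x)) * norm (y - x) \<le> 1/5 * norm (y - x)" by (intro mult_right_mono) auto
    hence "norm (Q y - Q x - D x (y - x)) \<le> 1/5 * norm (y - x)"
      using jetD(1)[OF jet' x y] by (simp add: power2_eq_square mult.assoc)
    moreover have eq: "Q y - Q x - O' (y - x) = (Q y - Q x - D x (y - x)) + (D x - O') (y - x)"
      by (simp add: blinfun.diff_left)
    ultimately show ?thesis unfolding eq
      using 1 norm_triangle_ineq[of "Q y - Q x - D x (y - x)" "(D x - O') (y - x)"] by linarith
  qed
  have up: "norm (Q y - Q x) \<le> 2 * norm (y - x)" and low: "norm (y - x) \<le> 2 * norm (Q y - Q x)"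
    if x: "x \<in> K'" and y: "y \<in> K'" for x y
    using close[OF x y] norm_triangle_sub[of "Q y - Q x" "O' (y - x)"] norm_triangle_sub[of "O' (y - x)" "Q y - Q x"]
      O'n[of "y - x"] norm_ge_zero[of "y - x"] by (simp_all add: norm_minus_commute)
  define Z' where "Z' = Z \<inter> {lo'..r}"
  \<comment> \<open>Over \<open>Z\<close> any unit vector orthogonal to the axis will do, since the
    slice is the axis point.\<close>
  define u' where "u' t = (if t \<in> Z then std_e i2 else u t)" for t
  have Qe': "Q x \<bullet> ?e = x \<bullet> e" if "x \<in> K'" for x using Qe K'(1)[OF that] by blast
  have axK: "t *\<^sub>R e \<in> K'" if "t \<in> {lo'..r}" for t using R.axis[OF that] .
  have gq: "norm (Q x - (x \<bullet> e) *\<^sub>R ?e) \<le> 2 * C * (x \<bullet> e - c)\<^sup>2" if x: "x \<in> K'" and c: "c \<in> Z" for x c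
  proof -
    have t: "x \<bullet> e \<in> {lo'..r}" by (rule K'(2)[OF x])
    have "norm (Q x - (x \<bullet> e) *\<^sub>R ?e) = norm (Q x - Q ((x \<bullet> e) *\<^sub>R e))" using Qax[of "x \<bullet> e"] t J' by (simp add: subset_eq)
    also have "\<dots> \<le> 2 * norm (x - (x \<bullet> e) *\<^sub>R e)" by (rule up[OF axK[OF t] x])
    also have "norm (x - (x \<bullet> e) *\<^sub>R e) \<le> C * (x \<bullet> e - c)\<^sup>2"
      by (rule gap_quad) (use K'(1)[OF x] c in \<open>auto simp: Z_def\<close>)
    finally show ?thesis by simp
  qed
  have q0: "norm (Q x - (x \<bullet> e) *\<^sub>R ?e) \<le> 2 * C * (x \<bullet> e)\<^sup>2" if "x \<in> K'" for x using gq[OF that zero_Z] by simp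
  have Q0: "Q 0 = 0" using Qax[OF J0] by simp
  obtain C1 where "ribbon (Q ` K') ?e lo' r C1" by (rule R.jet_image[OF jet' M norm_std_e Qe' Q0 low q0])
  then interpret P: ribbon "Q ` K'" ?e lo' r "max C1 (2 * C)" by (rule ribbon_mono) simp
  have "planar_ribbon (Q ` K') i1 lo' r (max C1 (2 * C)) Z' u'"
  proof unfold_locales
    show "Z' \<subseteq> {lo'..r}" by (simp add: Z'_def)
    show "0 \<in> Z'" using zero_Z r(1) lo' by (simp add: Z'_def)
    show "t *\<^sub>R ?e \<in> Q ` K'" if t: "t \<in> {lo'..r}" for t
      using Qax[of t] axK[OF t] t J' by (metis imageI subsetD)
    show "connected {w \<in> Q ` K'. w \<bullet> ?e = t}" for t
    proof (cases "t \<in> {lo'..r}")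
      case True
      have "2-lipschitz_on K' Q" using up by (intro lipschitz_onI) (auto simp: dist_norm norm_minus_commute)
      hence "continuous_on {y \<in> K. y \<bullet> e = t} Q"
        using True by (intro continuous_on_subset[OF lipschitz_on_continuous_on]) (auto simp: K'_def)
      moreover have "{w \<in> Q ` K'. w \<bullet> ?e = t} = Q ` {y \<in> K. y \<bullet> e = t}" using Qe' True by (auto simp: K'_def)
      ultimately show ?thesis using connected_continuous_image[OF _ connected_slice] by simp
    next
      case False
      hence empty: "{w \<in> Q ` K'. w \<bullet> ?e = t} = {}" using Qe' K'(2) by auto
      show ?thesis unfolding empty by simp
    qed
    show "norm (w - (w \<bullet> ?e) *\<^sub>R ?e) \<le> max C1 (2 * C) * (w \<bullet> ?e - c)\<^sup>2" if w: "w \<in> Q ` K'" and c: "c \<in> Z'" for w c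
    proof -
      obtain x where x: "x \<in> K'" "w = Q x" using w by blast
      have "2 * C * (x \<bullet> e - c)\<^sup>2 \<le> max C1 (2 * C) * (x \<bullet> e - c)\<^sup>2" by (intro mult_right_mono) auto
      thus ?thesis using gq[OF x(1), of c] c Qe'[OF x(1)] x(2) by (simp add: Z'_def)
    qed
    show "\<exists>w\<in>Q ` K'. w \<bullet> ?e = t \<and> w \<noteq> t *\<^sub>R ?e" if t: "t \<in> {lo'..r}" "t \<notin> Z'" for t
    proof -
      have tJ: "t \<in> J" "t \<notin> Z" using t J' by (auto simp: Z'_def)
      then obtain y where y: "y \<in> K" "y \<bullet> e = t" "y \<noteq> t *\<^sub>R e" unfolding Z_def by blast
      have yK: "y \<in> K'" using y t by (simp add: K'_def)
      have "Q y \<noteq> Q (t *\<^sub>R e)" using low[OF axK[OF t(1)] yK] y(3) by auto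
      thus ?thesis using yK y(2) Qe'[OF yK] Qax[OF tJ(1)] by (intro bexI[of _ "Q y"]) auto
    qed
    show "norm (u' t) = 1" "u' t \<bullet> ?e = 0" if t: "t \<in> {lo'..r}" for t
      using u[of t] t J' i by (auto simp: u'_def std_e_inner subset_eq)
    show "w = (w \<bullet> ?e) *\<^sub>R ?e + (w \<bullet> u' (w \<bullet> ?e)) *\<^sub>R u' (w \<bullet> ?e)" if w: "w \<in> Q ` K'" for w
    proof -
      obtain x where x: "x \<in> K'" "w = Q x" using w by blast
      have we: "w \<bullet> ?e = x \<bullet> e" using Qe'[OF x(1)] x(2) by simp
      show ?thesis
      proof (cases "x \<bullet> e \<in> Z")
        case True
        have "w = (x \<bullet> e) *\<^sub>R ?e" using gq[OF x(1) True] x(2) by simp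
        hence "w = (x \<bullet> e) *\<^sub>R ?e" "w \<bullet> std_e i2 = 0" using i by (simp_all add: std_e_inner)
        thus ?thesis unfolding we u'_def using True by simp
      next
        case False
        thus ?thesis unfolding we u'_def using plan[OF K'(1)[OF x(1)] False] x(2) by simp
      qed
    qed
    show "u' s = u' t" if st: "s \<in> {lo'..r}" "t \<in> {lo'..r}" "closed_segment s t \<inter> Z' = {}" for s t
    proof -
      have "closed_segment s t \<subseteq> {lo'..r}" using st(1,2) by (auto simp: closed_segment_eq_real_ivl split: if_splits)
      hence g: "closed_segment s t \<inter> Z = {}" using st(3) unfolding Z'_def by blast
      hence "s \<notin> Z" "t \<notin> Z" by (auto simp: disjoint_iff)
      thus ?thesis using ugap[OF _ _ g] st(1,2) J' unfolding u'_def by (simp add: subset_eq)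
    qed
  qed
  thus ?thesis unfolding K'_def by blast
qed

lemma C11_on_cong:
  assumes "open U" "C11_on U f" "\<And>x. x \<in> U \<Longrightarrow> f x = g x"
  shows "C11_on U g"
proof -
  obtain D L where D: "\<And>x. x \<in> U \<Longrightarrow> (f has_derivative blinfun_apply (D x)) (at x)" "L-lipschitz_on U D"
    using assms(2) by (auto simp: C11_on_def)
  have "(g has_derivative blinfun_apply (D x)) (at x)" if x: "x \<in> U" for x
    by (rule has_derivative_transform_within_open[OF D(1)[OF x] assms(1) x assms(3)])
  thus ?thesis unfolding C11_on_def using D(2) by blast
qed

lemma C11_diffeo_inverse:
  fixes F :: "'a::euclidean_space \<Rightarrow> 'a"
  assumes "C11_diffeo V F"
  shows "C11_diffeo (F ` V) (\<lambda>z. a + inv_into V F z)"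
proof -
  let ?P = "\<lambda>z. a + inv_into V F z"
  have V: "open V" "inj_on F V" "open (F ` V)" "C11_on V F" "C11_on (F ` V) (inv_into V F)"
    using assms by (auto simp: C11_diffeo_def)
  have PF: "?P (F v) = a + v" if "v \<in> V" for v using that V(2) by simp
  have im: "?P ` F ` V = (\<lambda>v. a + v) ` V" using PF by (force simp: image_iff)
  have op: "open ((\<lambda>v. a + v) ` V)" by (rule open_translation[OF V(1)])
  have inj: "inj_on ?P (F ` V)" by (auto intro!: inj_onI simp: V(2))
  obtain D L where D: "\<And>x. x \<in> F ` V \<Longrightarrow> (inv_into V F has_derivative blinfun_apply (D x)) (at x)" "L-lipschitz_on (F ` V) D"
    using V(5) by (auto simp: C11_on_def)
  have "(?P has_derivative blinfun_apply (D x)) (at x)" if x: "x \<in> F ` V" for x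
    using has_derivative_add[OF has_derivative_const D(1)[OF x]] by simp
  hence 1: "C11_on (F ` V) ?P" unfolding C11_on_def using D(2) by blast
  obtain D' L' where D': "\<And>x. x \<in> V \<Longrightarrow> (F has_derivative blinfun_apply (D' x)) (at x)" "L'-lipschitz_on V D'"
    using V(4) by (auto simp: C11_on_def)
  have "C11_on ((\<lambda>v. a + v) ` V) (\<lambda>y. F (y - a))" unfolding C11_on_def
  proof (intro exI[of _ "\<lambda>y. D' (y - a)"] exI[of _ L'] conjI ballI)
    fix y assume "y \<in> (\<lambda>v. a + v) ` V"
    hence y: "y - a \<in> V" by auto
    have "((\<lambda>y. y - a) has_derivative (\<lambda>h. h)) (at y)" by (auto intro!: derivative_eq_intros)
    from has_derivative_compose[OF this D'(1)[OF y]]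
    show "((\<lambda>y. F (y - a)) has_derivative blinfun_apply (D' (y - a))) (at y)" by simp
  next
    show "L'-lipschitz_on ((\<lambda>v. a + v) ` V) (\<lambda>y. D' (y - a))"
      using D'(2) by (auto simp: lipschitz_on_def dist_norm)
  qed
  moreover have "F (y - a) = inv_into (F ` V) ?P y" if y: "y \<in> (\<lambda>v. a + v) ` V" for y
  proof -
    obtain v where v: "v \<in> V" "y = a + v" using y by blast
    have "inv_into (F ` V) ?P (?P (F v)) = F v" by (rule inv_into_f_f[OF inj]) (use v in simp)
    thus ?thesis using v PF[OF v(1)] by simp
  qed
  ultimately have "C11_on ((\<lambda>v. a + v) ` V) (inv_into (F ` V) ?P)" by (rule C11_on_cong[OF op])
  thus ?thesis unfolding C11_diffeo_def im using V(3) op inj 1 by blast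
qed

text \<open>The composition of shear and flattening extends by \<open>whitney_C11\<close> to a map F
  of the whole space. Its derivative at 0 is injective, because the shear's is and D 0 is within 1/5
  of an isometry. So F is a diffeomorphism near 0, and its inverse followed by the translation to a
  is the chart.\<close>

theorem B_set_chart:
  fixes A :: "(real^'n::finite) set" and i1 i2 :: 'n
  assumes n: "CARD('n) \<ge> 3" and i: "i1 \<noteq> i2"
    and A: "positive_reach A" "covering_dim_le A 2" "a \<in> A" "dim (Tan A a) = 1"
  shows "\<exists>B p U P. B_set i1 i2 B \<and> multirotation i1 (Tk 1 B) p \<and> open U \<and>
          C11_diffeo U P \<and> 0 \<in> U \<and> a = P 0 \<and> p ` B \<subseteq> U \<and> nbhd_in A a (P ` p ` B)"
proof -
  obtain L e lo hi C C' f S M c where RL: "ribbon L e lo hi C'" and C': "C' * hi \<le> 1" and T: "thin_ribbon (f ` L) e lo hi C"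
    and M: "M \<ge> 0" and jetf: "jet L f S M" and f0: "f 0 = 0" and S0: "\<And>v. blinfun_apply (S 0) v = 0 \<Longrightarrow> v = 0"
    and fe: "\<And>x. f x \<bullet> e = x \<bullet> e" and injf: "inj f" and c: "c > 0" and inA: "(\<lambda>x. a + x) ` L \<subseteq> A"
    and nearA: "\<And>y. \<lbrakk>y \<in> A; dist y a < c\<rbrakk> \<Longrightarrow> y - a \<in> L"
    by (rule local_structure[OF A]) (rule that)
  interpret R: ribbon L e lo hi C' by (rule RL)
  interpret thin_ribbon "f ` L" e lo hi C by (rule T)
  obtain O0 where O0: "orthogonal_transformation O0" "O0 e = (std_e i1 :: real^'n)"
    using orthogonal_transformation_exists[of e "std_e i1 :: real^'n"] norm_e by auto
  define O' where "O' = Blinfun O0"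
  have O'app: "blinfun_apply O' = O0"
    using O0(1) by (auto simp: O'_def bounded_linear_Blinfun_apply orthogonal_transformation_linear linear_conv_bounded_linear[symmetric])
  have O': "blinfun_apply O' v \<bullet> O' w = v \<bullet> w" for v w using O0(1) by (simp add: O'app orthogonal_transformation_def)
  have O'e: "blinfun_apply O' e = std_e i1" by (simp add: O'app O0(2))
  obtain Q D u M1 where flat: "jet (f ` L) Q D M1" "M1 \<ge> 0" "norm (D 0 - O') \<le> 1/5"
    "\<And>x. x \<in> f ` L \<Longrightarrow> Q x \<bullet> O' e = x \<bullet> e" "\<And>t. t \<in> J \<Longrightarrow> Q (t *\<^sub>R e) = t *\<^sub>R O' e"
    "\<And>t. \<lbrakk>t \<in> J; t \<notin> Z\<rbrakk> \<Longrightarrow> norm (u t) = 1 \<and> u t \<bullet> O' e = 0"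
    "\<And>x. \<lbrakk>x \<in> f ` L; x \<bullet> e \<notin> Z\<rbrakk> \<Longrightarrow> Q x = (x \<bullet> e) *\<^sub>R O' e + (Q x \<bullet> u (x \<bullet> e)) *\<^sub>R u (x \<bullet> e)"
    "\<And>s t. \<lbrakk>s \<in> J; t \<in> J; in_gap s t\<rbrakk> \<Longrightarrow> u s = u t"
    by (rule flatten[OF O']) (rule that)
  obtain M2 where "jet L (Q \<circ> f) (\<lambda>y. D (f y) o\<^sub>L S y) M2"
    by (rule jet_compose[OF compact_imp_bounded[OF R.compact_K] jetf flat(1) M flat(2)])
  moreover have "L \<noteq> {}" using R.zero_K by blast
  ultimately obtain F D' l where F: "\<And>x. (F has_derivative blinfun_apply (D' x)) (at x)" "l-lipschitz_on UNIV D'"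
    "\<And>y. y \<in> L \<Longrightarrow> F y = (Q \<circ> f) y" "\<And>y. y \<in> L \<Longrightarrow> D' y = D (f y) o\<^sub>L S y"
    by (rule whitney_C11) (rule that)
  have lin: "linear (blinfun_apply (D' 0))" by (rule linear_blinfun)
  have "inj (blinfun_apply (D' 0))"
  proof (rule linear_injective_0[OF lin, THEN iffD2], intro allI impI)
    fix v assume "D' 0 v = 0"
    hence v: "D 0 (S 0 v) = 0" using F(4)[OF R.zero_K] by (simp add: f0)
    have "norm ((D 0 - O') (S 0 v)) \<le> 1/5 * norm (S 0 v)" by (rule norm_blinfun_le[OF flat(3)])
    moreover have "norm (O' (S 0 v)) = norm (S 0 v)" by (simp add: norm_eq_sqrt_inner O')
    ultimately have "S 0 v = 0" using v by (simp add: blinfun.diff_left)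
    thus "v = 0" by (rule S0)
  qed
  then obtain E0 where E0: "linear E0" "E0 \<circ> blinfun_apply (D' 0) = id"
    using linear_injective_left_inverse[OF lin] by blast
  have "Blinfun E0 o\<^sub>L D' 0 = id_blinfun"
    using E0 by (intro blinfun_eqI) (simp add: bounded_linear_Blinfun_apply linear_conv_bounded_linear[symmetric] fun_eq_iff)
  then obtain b where b: "b > 0" "C11_diffeo (ball 0 b) F" by (rule C11_local_diffeo[OF F(1,2)])
  \<comment> \<open>The second bound is required by \<open>planar_image\<close>. The third gives |x|
    \<le> 2r < b on the remaining piece, which therefore lies in the ball where F is a
    diffeomorphism.\<close>
  define r where "r = min hi (min (1 / (20 * (M1 + 1))) (b / 3))"
  have r: "0 < r" "r \<le> hi" "20 * (M1 + 1) * r \<le> 1" "2 * r < b"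
  proof -
    show r0: "0 < r" "r \<le> hi" using hi_pos flat(2) b(1) by (auto simp: r_def)
    have "r \<le> 1 / (20 * (M1 + 1))" "r \<le> b / 3" by (auto simp: r_def)
    thus "20 * (M1 + 1) * r \<le> 1" "2 * r < b" using flat(2) r0 b(1) by (simp_all add: pos_le_divide_eq mult.commute)
  qed
  define lo' where "lo' = (if lo = 0 then 0 else - r)"
  define L' where "L' = L \<inter> {x. x \<bullet> e \<in> {lo'..r}}"
  have fL': "f ` L \<inter> {x. x \<bullet> e \<in> {lo'..r}} = f ` L'" by (auto simp: L'_def fe)
  obtain C2 Z' u' where "planar_ribbon (Q ` f ` L') i1 lo' r C2 Z' u'"
    using planar_image[OF T i O' O'e flat(1-3) flat(4-8)[unfolded O'e] r(1-3) lo'_def] unfolding fL' by blast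
  then obtain B p where B: "B_set i1 i2 B" "multirotation i1 (Tk 1 B) p" "p ` B = Q ` f ` L'"
    by (rule planar_ribbon.B_set_rotated[OF _ n i])
  have FL': "p ` B = F ` L'" unfolding B(3) image_image by (rule image_cong) (simp_all add: F(3) L'_def)
  define V where "V = ball (0 :: real^'n) b"
  have L'V: "L' \<subseteq> V"
  proof
    fix x assume x: "x \<in> L'"
    have "\<bar>x \<bullet> e\<bar> \<le> r" using x r(1) by (auto simp: L'_def lo'_def abs_le_iff split: if_splits)
    thus "x \<in> V" using R.norm_le[OF _ C', of x] x r(4) by (auto simp: V_def L'_def)
  qed
  define P where "P z = a + inv_into V F z" for z
  have dV: "C11_diffeo V F" using b(2) by (simp add: V_def)
  hence inj: "inj_on F V" and op: "open (F ` V)" by (auto simp: C11_diffeo_def)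
  have "P (F x) = a + x" if "x \<in> L'" for x using inv_into_f_f[OF inj] L'V that by (simp add: P_def subset_eq)
  hence PL': "P ` p ` B = (\<lambda>x. a + x) ` L'" unfolding FL' image_image by (rule image_cong[OF refl])
  show ?thesis
  proof (intro exI conjI)
    show "B_set i1 i2 B" "multirotation i1 (Tk 1 B) p" by (rule B)+
    show "open (F ` V)" by (rule op)
    show "C11_diffeo (F ` V) P" unfolding P_def[abs_def] by (rule C11_diffeo_inverse[OF dV])
    have F0: "F 0 = 0" using F(3)[OF R.zero_K] flat(5)[OF J0] by (simp add: f0)
    have 0: "0 \<in> V" using b(1) by (simp add: V_def)
    show "0 \<in> F ` V" using imageI[OF 0, of F] by (simp add: F0)
    show "a = P 0" using inv_into_f_f[OF inj 0] by (simp add: P_def F0)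
    show "p ` B \<subseteq> F ` V" unfolding FL' by (rule image_mono[OF L'V])
    show "nbhd_in A a (P ` p ` B)" unfolding nbhd_in_def PL'
    proof (intro conjI exI[of _ "min c r"] subsetI)
      show "z \<in> A" if "z \<in> (\<lambda>x. a + x) ` L'" for z using that inA by (auto simp: L'_def)
      show "0 < min c r" using c r by simp
      fix y assume y: "y \<in> A \<inter> ball a (min c r)"
      hence yL: "y - a \<in> L" using nearA[of y] by (simp add: dist_commute)
      have "\<bar>(y - a) \<bullet> e\<bar> < r" using abs_inner_le_norm[OF norm_e, of "y - a"] y by (simp add: dist_norm norm_minus_commute)
      hence "y - a \<in> L'" using R.height[OF yL] yL by (auto simp: L'_def lo'_def abs_less_iff)
      thus "y \<in> (\<lambda>x. a + x) ` L'" by (intro image_eqI[of _ _ "y - a"]) auto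
    qed
  qed
qed

section \<open>The converse\<close>

section \<open>From a rotated B-set to a set of positive reach\<close>

lemma convex_on_closure:
  fixes f :: "'a::real_normed_vector \<Rightarrow> real"
  assumes f: "convex_on S f" and cont: "continuous_on (closure S) f"
  shows "convex_on (closure S) f"
proof (rule convex_onI)
  show "convex (closure S)" using f convex_on_imp_convex convex_closure by blast
  fix t :: real and x y assume t: "0 < t" "t < 1" and x: "x \<in> closure S" and y: "y \<in> closure S"
  obtain p q where p: "\<And>n. p n \<in> S" "p \<longlonglongrightarrow> x" and q: "\<And>n. q n \<in> S" "q \<longlonglongrightarrow> y"
    using x y unfolding closure_sequential by blast
  have S: "convex S" using f convex_on_imp_convex by blast
  have lim: "(\<lambda>n. f (s n)) \<longlonglongrightarrow> f z" if "s \<longlonglongrightarrow> z" "\<And>n. s n \<in> S" for s z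
  proof (rule continuous_on_tendsto_compose[OF cont that(1)])
    show "z \<in> closure S" using that unfolding closure_sequential by blast
    show "\<forall>\<^sub>F n in sequentially. s n \<in> closure S" using that(2) closure_subset by (intro always_eventually) blast
  qed
  show "f ((1 - t) *\<^sub>R x + t *\<^sub>R y) \<le> (1 - t) * f x + t * f y"
  proof (rule tendsto_le[OF trivial_limit_sequentially])
    show "(\<lambda>n. (1 - t) * f (p n) + t * f (q n)) \<longlonglongrightarrow> (1 - t) * f x + t * f y"
      by (intro tendsto_intros lim p q)
    show "(\<lambda>n. f ((1 - t) *\<^sub>R p n + t *\<^sub>R q n)) \<longlonglongrightarrow> f ((1 - t) *\<^sub>R x + t *\<^sub>R y)"
      by (intro lim tendsto_intros p q convexD[OF S]) (use t in auto)
    show "\<forall>\<^sub>F n in sequentially. f ((1 - t) *\<^sub>R p n + t *\<^sub>R q n) \<le> (1 - t) * f (p n) + t * f (q n)"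
      using convex_onD[OF f _ _ p(1) q(1), of t] t by (intro always_eventually) auto
  qed
qed

text \<open>At a zero c, semiconcavity between c - h and c + h together with f \<ge> 0 rules out
  linear growth; at c = 0 = lo, where one side is missing, the derivative hypothesis does.
  Semiconcavity along the segment from c to t then bounds l f(t) by f(c + l (t - c)) plus a
  quadratic term; divide by l and let it be small.\<close>

lemma semiconcave_zero_quadratic:
  fixes f :: "real \<Rightarrow> real"
  assumes r: "0 < r" and lo: "lo = 0 \<or> lo = - r" and m: "0 \<le> m"
    and conc: "concave_on {lo..r} (\<lambda>x. f x - m / 2 * x\<^sup>2)" and nn: "\<And>x. x \<in> {lo..r} \<Longrightarrow> 0 \<le> f x"
    and f0: "f 0 = 0" and der: "(f has_real_derivative 0) (at 0 within {lo..r})"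
    and c: "c \<in> {lo / 2..r / 2}" "f c = 0" and t: "t \<in> {lo..r}"
  shows "f t \<le> m * (t - c)\<^sup>2"
proof -
  have cJ: "c \<in> {lo..r}" using c(1) r lo by auto
  have cD: "(1 - l) * f x + l * f y \<le> f (x + l * (y - x)) + m / 2 * (l * (1 - l)) * (y - x)\<^sup>2"
    if "0 \<le> l" "l \<le> 1" "x \<in> {lo..r}" "y \<in> {lo..r}" for l x y
  proof -
    have "(1 - l) *\<^sub>R x + l *\<^sub>R y = x + l * (y - x)" by (simp add: algebra_simps)
    hence "(1 - l) * (f x - m / 2 * x\<^sup>2) + l * (f y - m / 2 * y\<^sup>2) \<le> f (x + l * (y - x)) - m / 2 * (x + l * (y - x))\<^sup>2"
      using concave_onD[OF conc that] by simp
    moreover have "m / 2 * (l * (1 - l)) * (y - x)\<^sup>2 = (1 - l) * (m / 2 * x\<^sup>2) + l * (m / 2 * y\<^sup>2) - m / 2 * (x + l * (y - x))\<^sup>2"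
      by (simp add: power2_eq_square field_simps)
    ultimately show ?thesis unfolding right_diff_distrib by linarith
  qed
  have small: "\<exists>a>0. \<forall>h. \<bar>h\<bar> < a \<longrightarrow> c + h \<in> {lo..r} \<longrightarrow> f (c + h) \<le> k * \<bar>h\<bar>" if k: "k > 0" for k
  proof (cases "lo = 0 \<and> c = 0")
    case True
    obtain a where "a > 0" "\<And>y. \<lbrakk>y \<in> {lo..r}; \<bar>y\<bar> < a\<rbrakk> \<Longrightarrow> \<bar>f y\<bar> \<le> k * \<bar>y\<bar>"
      using der k unfolding has_field_derivative_def has_derivative_within_alt by (auto simp: f0)
    thus ?thesis using True by (intro exI[of _ a]) (auto simp: abs_le_iff)
  next
    case False
    \<comment> \<open>Since c lies in [lo/2, r/2], there is room of size b on both sides of c in all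
      remaining cases.\<close>
    define b where "b = (if lo = 0 then min c (r / 2) else r / 2)"
    have b: "b > 0" using False r c lo by (auto simp: b_def)
    have "f (c + h) \<le> k * \<bar>h\<bar>" if h: "\<bar>h\<bar> < min b (k / (m + 1))" for h
    proof -
      have J: "c + h \<in> {lo..r}" "c - h \<in> {lo..r}" using h c(1) r lo by (auto simp: b_def abs_less_iff split: if_splits)
      have "f (c + h) / 2 \<le> (m / 2) * h\<^sup>2"
        using cD[of "1/2" "c - h" "c + h"] J nn[OF J(2)] c(2) by (simp add: power2_eq_square mult_ac)
      moreover have "m * h\<^sup>2 \<le> k * \<bar>h\<bar>"
      proof -
        have "(m + 1) * \<bar>h\<bar> \<le> k" using h m by (simp add: pos_less_divide_eq mult.commute)
        hence "m * \<bar>h\<bar> \<le> k" by (simp add: distrib_right)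
        thus ?thesis using mult_right_mono[of "m * \<bar>h\<bar>" k "\<bar>h\<bar>"] by (simp add: power2_eq_square mult.assoc)
      qed
      ultimately show ?thesis by simp
    qed
    thus ?thesis using b k m by (intro exI[of _ "min b (k / (m + 1))"]) simp
  qed
  define d where "d = t - c"
  have "f t \<le> m * d\<^sup>2 + g" if g: "g > 0" for g
  proof -
    have d1: "\<bar>d\<bar> + 1 > 0" by simp
    obtain a where a: "a > 0" "\<And>h. \<bar>h\<bar> < a \<Longrightarrow> c + h \<in> {lo..r} \<Longrightarrow> f (c + h) \<le> g / (\<bar>d\<bar> + 1) * \<bar>h\<bar>"
      using small[of "g / (\<bar>d\<bar> + 1)"] g d1 by (metis divide_pos_pos)
    define l where "l = min (1/2) (a / (\<bar>d\<bar> + 1))"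
    have l: "0 < l" "l \<le> 1" using a(1) d1 by (auto simp: l_def)
    have "l \<le> a / (\<bar>d\<bar> + 1)" by (simp add: l_def)
    hence "l * (\<bar>d\<bar> + 1) \<le> a" using d1 by (simp only: pos_le_divide_eq)
    hence "\<bar>l * d\<bar> < a" using l(1) by (simp add: abs_mult distrib_left)
    moreover have "c + l * d \<in> {lo..r}"
      using convexD_alt[OF convex_real_interval(5) cJ t, of l] l by (simp add: d_def algebra_simps)
    ultimately have "f (c + l * d) \<le> g / (\<bar>d\<bar> + 1) * \<bar>l * d\<bar>" by (rule a(2))
    also have "\<dots> = l * g * (\<bar>d\<bar> / (\<bar>d\<bar> + 1))" using l(1) by (simp add: abs_mult)
    also have "\<dots> \<le> l * g * 1" using l(1) g by (intro mult_left_mono) auto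
    finally have "f (c + l * d) \<le> l * g" by simp
    moreover have "m * d\<^sup>2 * ((1 - l) / 2) \<le> m * d\<^sup>2 * 1" using m l by (intro mult_left_mono) auto
    hence "l * (m * d\<^sup>2 * ((1 - l) / 2)) \<le> l * (m * d\<^sup>2)" using l by simp
    moreover have "l * f t \<le> f (c + l * d) + m / 2 * (l * (1 - l)) * d\<^sup>2"
      using cD[of l c t] l cJ t c(2) by (simp add: d_def)
    moreover have "m / 2 * (l * (1 - l)) * d\<^sup>2 = l * (m * d\<^sup>2 * ((1 - l) / 2))" by simp
    ultimately have "l * f t \<le> l * (m * d\<^sup>2 + g)" unfolding distrib_left by linarith
    thus ?thesis using l(1) by simp
  qed
  thus ?thesis unfolding d_def by (rule field_le_epsilon)
qed

text \<open>Lipschitz continuity carries semiconcavity from the open to the closed interval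
  (\<open>convex_on_closure\<close>), and maxima provide one constant for both boundary functions;
  two-sided derivatives are weakened to derivatives within the interval.\<close>

lemma B_set_lens:
  fixes i1 i2 :: "'n::finite" and B :: "(real^'n) set"
  assumes "B_set i1 i2 B"
  obtains r lo p g a L where "0 < r" "lo = 0 \<or> lo = - r" "0 \<le> a" "B = lens i1 i2 {lo..r} p g"
    "L-lipschitz_on {lo..r} p" "L-lipschitz_on {lo..r} g"
    "\<And>x. x \<in> {lo..r} \<Longrightarrow> g x \<le> 0 \<and> 0 \<le> p x" "p 0 = 0" "g 0 = 0"
    "concave_on {lo..r} (\<lambda>x. p x - a / 2 * x\<^sup>2)" "concave_on {lo..r} (\<lambda>x. - g x - a / 2 * x\<^sup>2)"
    "(p has_real_derivative 0) (at 0 within {lo..r})" "(g has_real_derivative 0) (at 0 within {lo..r})"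
proof -
  have "\<exists>r lo p g L1 L2. 0 < r \<and> (lo = 0 \<or> lo = - r) \<and> B = lens i1 i2 {lo..r} p g \<and>
    L1-lipschitz_on {lo..r} p \<and> L2-lipschitz_on {lo..r} g \<and> (\<forall>x\<in>{lo..r}. g x \<le> 0 \<and> 0 \<le> p x) \<and> p 0 = 0 \<and> g 0 = 0 \<and>
    semiconcave_on {lo<..<r} p \<and> semiconvex_on {lo<..<r} g \<and>
    (p has_real_derivative 0) (at 0 within {lo..r}) \<and> (g has_real_derivative 0) (at 0 within {lo..r})"
    using assms unfolding B_set_def
  proof
    assume "Bminus_set i1 i2 B"
    then obtain r p g where "r > 0" "\<exists>L. L-lipschitz_on {0..r} p" "\<exists>L. L-lipschitz_on {0..r} g"
      "\<forall>x\<in>{0..r}. g x \<le> 0 \<and> 0 \<le> p x" "semiconcave_on {0<..<r} p" "semiconvex_on {0<..<r} g"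
      "p 0 = 0" "g 0 = 0" "(p has_real_derivative 0) (at 0 within {0..r})" "(g has_real_derivative 0) (at 0 within {0..r})"
      "B = lens i1 i2 {0..r} p g" unfolding Bminus_set_def lens_def[symmetric] by blast
    thus ?thesis by - (rule exI[of _ r], rule exI[of _ "0::real"], rule exI[of _ p], rule exI[of _ g], blast)
  next
    assume "Bplus_set i1 i2 B"
    then obtain r p g where "r > 0" "\<exists>L. L-lipschitz_on {-r..r} p" "\<exists>L. L-lipschitz_on {-r..r} g"
      "\<forall>x\<in>{-r..r}. g x \<le> 0 \<and> 0 \<le> p x" "semiconcave_on {-r<..<r} p" "semiconvex_on {-r<..<r} g"
      "p 0 = 0" "g 0 = 0" "(p has_real_derivative 0) (at 0 within {-r..r})" "(g has_real_derivative 0) (at 0 within {-r..r})"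
      "B = lens i1 i2 {-r..r} p g"
      unfolding Bplus_set_def lens_def[symmetric] using has_field_derivative_at_within by blast
    thus ?thesis by - (rule exI[of _ r], rule exI[of _ "-r"], rule exI[of _ p], rule exI[of _ g], blast)
  qed
  then obtain r lo p g L1 L2 where *: "0 < r" "lo = 0 \<or> lo = - r" "B = lens i1 i2 {lo..r} p g"
    "L1-lipschitz_on {lo..r} p" "L2-lipschitz_on {lo..r} g" "\<forall>x\<in>{lo..r}. g x \<le> 0 \<and> 0 \<le> p x" "p 0 = 0" "g 0 = 0"
    "semiconcave_on {lo<..<r} p" "semiconvex_on {lo<..<r} g"
    "(p has_real_derivative 0) (at 0 within {lo..r})" "(g has_real_derivative 0) (at 0 within {lo..r})" by blast
  obtain k1 k2 where k: "k1 \<ge> 0" "concave_on {lo<..<r} (\<lambda>x. p x - k1 / 2 * x\<^sup>2)"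
    "k2 \<ge> 0" "concave_on {lo<..<r} (\<lambda>x. - g x - k2 / 2 * x\<^sup>2)"
    using *(9,10) by (auto simp: semiconcave_on_def semiconvex_on_def)
  define a where "a = max k1 k2"
  have sq: "convex_on UNIV (\<lambda>x::real. x\<^sup>2)" by (rule convex_power2)
  have up: "concave_on {lo..r} (\<lambda>x. f x - a / 2 * x\<^sup>2)"
    if f: "concave_on {lo<..<r} (\<lambda>x. f x - k / 2 * x\<^sup>2)" "k \<le> a" "L-lipschitz_on {lo..r} f" for f k L
  proof -
    have "convex_on {lo<..<r} (\<lambda>x. (a - k) / 2 * x\<^sup>2)"
      using f(2) convex_on_subset[OF sq] by (intro convex_on_cmul) auto
    hence "convex_on {lo<..<r} (\<lambda>x. - (f x - k / 2 * x\<^sup>2) + (a - k) / 2 * x\<^sup>2)"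
      using f(1) unfolding concave_on_def by (rule convex_on_add[rotated])
    moreover have "(\<lambda>x. - (f x - k / 2 * x\<^sup>2) + (a - k) / 2 * x\<^sup>2) = (\<lambda>x. - (f x - a / 2 * x\<^sup>2))"
      by (rule ext) (simp add: diff_divide_distrib left_diff_distrib)
    ultimately have c: "convex_on {lo<..<r} (\<lambda>x. - (f x - a / 2 * x\<^sup>2))" by simp
    have cl: "closure {lo<..<r} = {lo..r}" using *(1,2) by (intro closure_greaterThanLessThan) auto
    have "continuous_on {lo..r} f" using f(3) lipschitz_on_continuous_on by blast
    hence "continuous_on (closure {lo<..<r}) (\<lambda>x. - (f x - a / 2 * x\<^sup>2))"
      unfolding cl by (intro continuous_intros)
    from convex_on_closure[OF c this] show ?thesis unfolding cl concave_on_def .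
  qed
  have gL: "L2-lipschitz_on {lo..r} (\<lambda>x. - g x)" using *(5) by (simp add: lipschitz_on_def dist_real_def abs_minus_commute)
  show ?thesis
  proof (rule that[of r lo a p g "max L1 L2"])
    show "(max L1 L2)-lipschitz_on {lo..r} p" "(max L1 L2)-lipschitz_on {lo..r} g"
      using *(4,5) by (auto intro: lipschitz_on_le)
    show "concave_on {lo..r} (\<lambda>x. p x - a / 2 * x\<^sup>2)" by (rule up[OF k(2) _ *(4)]) (simp add: a_def)
    show "concave_on {lo..r} (\<lambda>x. - g x - a / 2 * x\<^sup>2)" by (rule up[OF k(4) _ gL]) (simp add: a_def)
  qed (use * k in \<open>auto simp: a_def\<close>)
qed

text \<open>On the coordinate plane a multirotation is determined by the image v(t) of
  \<open>std_e i2\<close> at each height t. A segment of the axis that avoids T lies in one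
  component, so v is constant along it.\<close>

lemma multirotation_lens:
  fixes i1 i2 :: "'n::finite" and p :: "real^'n \<Rightarrow> real^'n"
  assumes i: "i1 \<noteq> i2" and p: "multirotation i1 T p"
  obtains v where "\<And>t. norm (v t) = 1" "\<And>t. v t \<bullet> std_e i1 = 0"
    "\<And>t y. p (t *\<^sub>R std_e i1 + y *\<^sub>R std_e i2) = t *\<^sub>R std_e i1 + y *\<^sub>R v t"
    "\<And>s t. \<forall>c\<in>closed_segment s t. c *\<^sub>R std_e i1 \<notin> T \<Longrightarrow> v s = v t"
proof -
  let ?e = "std_e i1 :: real^'n" and ?f = "std_e i2 :: real^'n"
  define v where "v t = p (t *\<^sub>R ?e + ?f) - t *\<^sub>R ?e" for t
  have pr: "proj1 i1 (t *\<^sub>R ?e + y *\<^sub>R ?f) = t *\<^sub>R ?e" for t y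
    using i by (simp add: proj1_def inner_add_left std_e_inner)
  have pr1: "proj1 i1 (t *\<^sub>R ?e + ?f) = t *\<^sub>R ?e" for t using pr[of t 1] by simp
  have fe: "?f \<bullet> ?e = 0" using i by (simp add: std_e_inner)
  have comp: "\<exists>R. two_rotation i1 R \<and> (\<forall>t\<in>S. \<forall>y. p (t *\<^sub>R ?e + y *\<^sub>R ?f) = t *\<^sub>R ?e + y *\<^sub>R R ?f)"
    if S: "connected S" "S \<noteq> {}" "\<And>t. t \<in> S \<Longrightarrow> t *\<^sub>R ?e \<notin> T" for S
  proof -
    have "connected ((\<lambda>t. t *\<^sub>R ?e) ` S)" by (intro connected_continuous_image continuous_intros S)
    moreover have "(\<lambda>t. t *\<^sub>R ?e) ` S \<subseteq> span {?e} - T" using S(3) by (auto intro: span_scale span_base)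
    moreover have "(\<lambda>t. t *\<^sub>R ?e) ` S \<noteq> {}" using S(2) by simp
    ultimately obtain I where I: "I \<in> components (span {?e} - T)" "(\<lambda>t. t *\<^sub>R ?e) ` S \<subseteq> I"
      using exists_component_superset[of "(\<lambda>t. t *\<^sub>R ?e) ` S" "span {?e} - T"] by blast
    obtain R where R: "two_rotation i1 R" "\<And>x. proj1 i1 x \<in> I \<Longrightarrow> p x = R x"
      using p I(1) unfolding multirotation_def by blast
    note lin = two_rotation_inner_axis(2)[OF R(1)]
    have "p (t *\<^sub>R ?e + y *\<^sub>R ?f) = t *\<^sub>R ?e + y *\<^sub>R R ?f" if "t \<in> S" for t y
      using R(2)[of "t *\<^sub>R ?e + y *\<^sub>R ?f"] that I(2) two_rotation_inner_axis(1)[OF R(1)]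
      by (auto simp: pr linear_add[OF lin] linear_scale[OF lin])
    thus ?thesis using R(1) by blast
  qed
  have Rf: "norm (R ?f) = 1" "R ?f \<bullet> ?e = 0" if R: "two_rotation i1 R" for R
    using two_rotation_inner_axis(3,4)[OF R, of ?f] fe norm_std_e[of i2] by (simp_all add: norm_eq_sqrt_inner)
  have single: "norm (v t) = 1 \<and> v t \<bullet> ?e = 0 \<and> (\<forall>y. p (t *\<^sub>R ?e + y *\<^sub>R ?f) = t *\<^sub>R ?e + y *\<^sub>R v t)" for t
  proof (cases "t *\<^sub>R ?e \<in> T")
    case True
    hence id: "p x = x" if "proj1 i1 x = t *\<^sub>R ?e" for x using p that by (simp add: multirotation_def)
    have vf: "v t = ?f" using id[OF pr1] by (simp add: v_def)
    have "p (t *\<^sub>R ?e + y *\<^sub>R ?f) = t *\<^sub>R ?e + y *\<^sub>R ?f" for y by (rule id[OF pr])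
    thus ?thesis unfolding vf using fe by simp
  next
    case False
    obtain R where R: "two_rotation i1 R" "\<And>y. p (t *\<^sub>R ?e + y *\<^sub>R ?f) = t *\<^sub>R ?e + y *\<^sub>R R ?f"
      using comp[of "{t}"] False by auto
    have "v t = R ?f" using R(2)[of 1] by (simp add: v_def)
    thus ?thesis using R Rf[OF R(1)] by simp
  qed
  have "v s = v t" if "\<forall>c\<in>closed_segment s t. c *\<^sub>R ?e \<notin> T" for s t
  proof -
    have "closed_segment s t \<noteq> {}" by simp
    from comp[OF connected_segment(1) this that[rule_format]]
    obtain R where R: "\<forall>c\<in>closed_segment s t. \<forall>y. p (c *\<^sub>R ?e + y *\<^sub>R ?f) = c *\<^sub>R ?e + y *\<^sub>R R ?f" by blast
    have "v c = R ?f" if "c \<in> closed_segment s t" for c using bspec[OF R that, THEN spec, of 1] by (simp add: v_def)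
    thus ?thesis by simp
  qed
  thus ?thesis using that single by blast
qed

lemma C11_diffeo_jet:
  assumes F: "C11_diffeo U F" and W: "compact W" "W \<subseteq> U"
  obtains D M G where "M \<ge> 0" "jet W F D M" "G \<ge> 0" "continuous_on W F"
    "\<And>x y. \<lbrakk>x \<in> W; y \<in> W\<rbrakk> \<Longrightarrow> norm (y - x) \<le> G * norm (F y - F x)"
proof -
  have U: "open U" "inj_on F U" "open (F ` U)" "C11_on U F" "C11_on (F ` U) (inv_into U F)"
    using F by (auto simp: C11_diffeo_def)
  obtain D M where D: "M \<ge> 0" "jet W F D M" by (rule C11_on_jet[OF U(4,1) W])
  obtain l where "l \<ge> 0" "\<And>x y. \<lbrakk>x \<in> W; y \<in> W\<rbrakk> \<Longrightarrow> norm (F y - F x) \<le> l * norm (y - x)"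
    by (rule jet_lipschitz[OF compact_imp_bounded[OF W(1)] D(2,1)]) (rule that)
  hence "l-lipschitz_on W F" by (intro lipschitz_onI) (auto simp: dist_norm norm_minus_commute)
  hence c: "continuous_on W F" by (rule lipschitz_on_continuous_on)
  hence cA: "compact (F ` W)" using W(1) compact_continuous_image by blast
  obtain D' M' where D': "M' \<ge> 0" "jet (F ` W) (inv_into U F) D' M'"
    by (rule C11_on_jet[OF U(5,3) cA image_mono[OF W(2)]])
  obtain G where G: "G \<ge> 0"
    "\<And>x y. \<lbrakk>x \<in> F ` W; y \<in> F ` W\<rbrakk> \<Longrightarrow> norm (inv_into U F y - inv_into U F x) \<le> G * norm (y - x)"
    by (rule jet_lipschitz[OF compact_imp_bounded[OF cA] D'(2,1)]) (rule that)
  have inv: "inv_into U F (F w) = w" if "w \<in> W" for w using inv_into_f_f[OF U(2)] that W(2) by blast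
  have "norm (y - x) \<le> G * norm (F y - F x)" if "x \<in> W" "y \<in> W" for x y
    using G(2)[OF imageI[OF that(1)] imageI[OF that(2)]] by (simp add: inv that)
  thus ?thesis using that D G(1) c by blast
qed

lemma positive_reach_C11_image:
  fixes W :: "'a::euclidean_space set"
  assumes F: "C11_diffeo U F" and W: "compact W" "W \<subseteq> U" and k: "k \<ge> 0"
    and mid: "\<And>p q. \<lbrakk>p \<in> W; q \<in> W\<rbrakk> \<Longrightarrow> \<exists>m\<in>W. norm (m - (1/2) *\<^sub>R (p + q)) \<le> k * (norm (p - q))\<^sup>2"
  shows "positive_reach (F ` W)"
proof -
  obtain D M G where D: "M \<ge> 0" "jet W F D M" and c: "continuous_on W F"
    and G: "\<And>x y. \<lbrakk>x \<in> W; y \<in> W\<rbrakk> \<Longrightarrow> norm (y - x) \<le> G * norm (F y - F x)"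
    by (rule C11_diffeo_jet[OF F W]) (rule that)
  obtain C where C: "C \<ge> 0" "\<And>x y p. \<lbrakk>x \<in> W; y \<in> W; p \<in> W; norm (p - (1/2) *\<^sub>R (x + y)) \<le> k * (norm (x - y))\<^sup>2\<rbrakk> \<Longrightarrow>
    norm (F p - (1/2) *\<^sub>R (F x + F y)) \<le> C * (norm (F x - F y))\<^sup>2"
    by (rule jet_mid[OF compact_imp_bounded[OF W(1)] D(2,1) k G]) (assumption, assumption, rule that)
  show ?thesis
  proof (rule positive_reach_midpointI[of _ 1 C])
    show "closed (F ` W)" using c W(1) compact_continuous_image compact_imp_closed by blast
    show "\<exists>p\<in>F ` W. dist p (midpoint x y) \<le> C * (dist x y)\<^sup>2" if xy: "x \<in> F ` W" "y \<in> F ` W" for x y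
    proof -
      obtain p q where pq: "p \<in> W" "x = F p" "q \<in> W" "y = F q" using xy by blast
      obtain m where m: "m \<in> W" "norm (m - (1/2) *\<^sub>R (p + q)) \<le> k * (norm (p - q))\<^sup>2" using mid[OF pq(1,3)] by blast
      thus ?thesis using C(2)[OF pq(1,3) m] pq
        by (intro bexI[of _ "F m"]) (auto simp: midpoint_def dist_norm inverse_eq_divide)
    qed
  qed (use C(1) in auto)
qed

text \<open>W is quadratically close to the axis, so the image is quadratically close to the line F
  0 + R E e, with E = D 0, and \<open>Tan_subset\<close> applies. Axis points of W give the tangent
  vector E e or its negative, which is nonzero by the lower Lipschitz bound G.\<close>

lemma dim_Tan_C11_image:
  fixes W :: "'a::euclidean_space set" and h :: "nat \<Rightarrow> real"
  assumes F: "C11_diffeo U F" and W: "compact W" "W \<subseteq> U" "0 \<in> W" and e: "norm e = 1" and k: "k \<ge> 0"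
    and ax: "\<And>p. p \<in> W \<Longrightarrow> norm (p - (p \<bullet> e) *\<^sub>R e) \<le> k * (norm p)\<^sup>2"
    and s: "s = 1 \<or> s = -1" and hW: "\<And>n. (s * h n) *\<^sub>R e \<in> W" and h: "h \<longlonglongrightarrow> 0" "\<And>n. h n > 0"
  shows "dim (Tan (F ` W) (F 0)) = 1"
proof -
  obtain D M G where D: "M \<ge> 0" "jet W F D M" and G: "G \<ge> 0" "\<And>x y. \<lbrakk>x \<in> W; y \<in> W\<rbrakk> \<Longrightarrow> norm (y - x) \<le> G * norm (F y - F x)"
    by (rule C11_diffeo_jet[OF F W(1,2)]) (rule that)
  define E where "E = D 0"
  have lin: "norm (F p - F 0 - E p) \<le> M * (norm p)\<^sup>2" if "p \<in> W" for p using jetD(1)[OF D(2) W(3) that] by (simp add: E_def)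
  have low: "norm p \<le> G * norm (F p - F 0)" if "p \<in> W" for p using G(2)[OF W(3) that] by simp
  have sub: "Tan (F ` W) (F 0) \<subseteq> span {E e}"
  proof (rule Tan_subset)
    fix x assume "x \<in> F ` W"
    then obtain p where p: "p \<in> W" "x = F p" by blast
    have eq: "x - F 0 - (p \<bullet> e) *\<^sub>R E e = (F p - F 0 - E p) + E (p - (p \<bullet> e) *\<^sub>R e)"
      by (simp add: p(2) blinfun.diff_right blinfun.scaleR_right)
    have "norm (E (p - (p \<bullet> e) *\<^sub>R e)) \<le> norm E * (k * (norm p)\<^sup>2)"
      by (rule order_trans[OF norm_blinfun]) (use ax[OF p(1)] in \<open>simp add: mult_left_mono\<close>)
    hence "norm (x - F 0 - (p \<bullet> e) *\<^sub>R E e) \<le> M * (norm p)\<^sup>2 + norm E * (k * (norm p)\<^sup>2)"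
      unfolding eq by (rule order_trans[OF norm_triangle_ineq add_mono[OF lin[OF p(1)]]])
    also have "\<dots> = (M + norm E * k) * (norm p)\<^sup>2" by (simp add: algebra_simps)
    also have "\<dots> \<le> (M + norm E * k) * (G * norm (x - F 0))\<^sup>2"
      unfolding p(2) using low[OF p(1)] D(1) k by (intro mult_left_mono power_mono) auto
    finally show "\<exists>w\<in>span {E e}. norm (x - F 0 - w) \<le> (M + norm E * k) * G\<^sup>2 * (norm (x - F 0))\<^sup>2"
      by (intro bexI[of _ "(p \<bullet> e) *\<^sub>R E e"]) (simp_all add: power_mult_distrib mult.assoc span_scale span_base)
  qed simp
  define f where "f n = F ((s * h n) *\<^sub>R e)" for n
  have nh: "norm ((s * h n) *\<^sub>R e) = h n" for n using h(2)[of n] s e by auto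
  have near: "norm ((1 / h n) *\<^sub>R (f n - F 0) - s *\<^sub>R E e) \<le> M * h n" for n
  proof -
    have "(1 / h n) *\<^sub>R (f n - F 0) - s *\<^sub>R E e = (1 / h n) *\<^sub>R (f n - F 0 - E ((s * h n) *\<^sub>R e))"
      using h(2)[of n] by (simp add: scaleR_diff_right blinfun.scaleR_right)
    hence "norm ((1 / h n) *\<^sub>R (f n - F 0) - s *\<^sub>R E e) = (1 / h n) * norm (f n - F 0 - E ((s * h n) *\<^sub>R e))"
      using h(2)[of n] by simp
    also have "\<dots> \<le> (1 / h n) * (M * (h n)\<^sup>2)"
      using lin[OF hW[of n]] h(2)[of n] unfolding nh f_def by (intro mult_left_mono) auto
    also have "\<dots> = M * h n" using h(2)[of n] by (simp add: power2_eq_square)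
    finally show ?thesis .
  qed
  have lim1: "(\<lambda>n. (1 / h n) *\<^sub>R (f n - F 0)) \<longlonglongrightarrow> s *\<^sub>R E e"
  proof (rule LIM_zero_cancel, rule Lim_null_comparison)
    show "(\<lambda>n. M * h n) \<longlonglongrightarrow> 0" using tendsto_mult[OF tendsto_const[of M] h(1)] by simp
  qed (rule always_eventually, rule allI, rule near)
  have lowf: "h n \<le> G * norm (f n - F 0)" for n using low[OF hW[of n]] nh[of n] by (simp add: f_def)
  have T: "s *\<^sub>R E e \<in> Tan (F ` W) (F 0)"
  proof (rule Tan_curveI[where f = f and h = h])
    show "f n \<in> F ` W" for n unfolding f_def using hW by blast
    show "f n \<noteq> F 0" for n using lowf[of n] h(2)[of n] by auto
  qed (use h lim1 in auto)
  have "1 \<le> G * norm ((1 / h n) *\<^sub>R (f n - F 0))" for n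
  proof -
    have "norm ((1 / h n) *\<^sub>R (f n - F 0)) = norm (f n - F 0) / h n" using h(2)[of n] by simp
    thus ?thesis using lowf[of n] h(2)[of n] by (simp add: pos_le_divide_eq del: scaleR_diff_right)
  qed
  moreover have "(\<lambda>n. G * norm ((1 / h n) *\<^sub>R (f n - F 0))) \<longlonglongrightarrow> G * norm (s *\<^sub>R E e)" by (intro tendsto_intros lim1)
  ultimately have "1 \<le> G * norm (s *\<^sub>R E e)" by (intro tendsto_lowerbound[OF _ _ trivial_limit_sequentially]) auto
  hence "s *\<^sub>R E e \<noteq> 0" by auto
  hence "dim {s *\<^sub>R E e} = 1" by (simp add: dim_eq_card_independent)
  moreover have "dim {s *\<^sub>R E e} \<le> dim (Tan (F ` W) (F 0))" using T by (intro dim_subset) simp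
  moreover have "dim (Tan (F ` W) (F 0)) \<le> 1" using dim_le_card[OF sub] by simp
  ultimately show ?thesis by simp
qed

text \<open>A is the image of the rotated lens cut to half its length. Two of its points either see
  the same rotated vector v or are separated by a point of T_1(B) and hence quadratically close to
  the axis (\<open>alt\<close>). The dichotomy yields at once the continuity of the rotated
  parametrization and the midpoint condition.\<close>

theorem rotated_B_set_image:
  fixes i1 i2 :: "'n::finite" and a :: "real^'n"
  assumes i: "i1 \<noteq> i2" and B: "B_set i1 i2 B" and M: "multirotation i1 (Tk 1 B) M" and U: "open U" "C11_diffeo U F" "0 \<in> U"
    and MU: "M ` B \<subseteq> U" and a: "a = F 0"
  shows "\<exists>A k. positive_reach A \<and> covering_dim_le A 2 \<and> dim (Tan A a) = 1 \<and> k > 0 \<and>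
    F ` M ` B \<inter> ball a k = A \<inter> ball a k"
proof -
  let ?e = "std_e i1 :: real^'n" and ?f = "std_e i2 :: real^'n"
  obtain r lo G H E L where r: "0 < r" and lo: "lo = 0 \<or> lo = - r" and E: "0 \<le> E" and Beq: "B = lens i1 i2 {lo..r} G H"
    and L: "L-lipschitz_on {lo..r} G" "L-lipschitz_on {lo..r} H"
    and sgn: "\<And>x. x \<in> {lo..r} \<Longrightarrow> H x \<le> 0 \<and> 0 \<le> G x" and z0: "G 0 = 0" "H 0 = 0"
    and conc: "concave_on {lo..r} (\<lambda>x. G x - E / 2 * x\<^sup>2)" "concave_on {lo..r} (\<lambda>x. - H x - E / 2 * x\<^sup>2)"
    and der: "(G has_real_derivative 0) (at 0 within {lo..r})" "(H has_real_derivative 0) (at 0 within {lo..r})"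
    by (rule B_set_lens[OF B]) (rule that)
  obtain v where v: "\<And>t. norm (v t) = 1" "\<And>t. v t \<bullet> ?e = 0"
    and Mv: "\<And>t y. M (t *\<^sub>R ?e + y *\<^sub>R ?f) = t *\<^sub>R ?e + y *\<^sub>R v t"
    and vgap: "\<And>s t. \<forall>c\<in>closed_segment s t. c *\<^sub>R ?e \<notin> Tk 1 B \<Longrightarrow> v s = v t"
    by (rule multirotation_lens[OF i M]) (rule that)
  define D where "D t y = t *\<^sub>R ?e + y *\<^sub>R v t" for t y
  have ee: "?e \<bullet> ?e = 1" by (simp add: std_e_inner)
  have De: "D t y \<bullet> ?e = t" for t y by (simp add: D_def inner_add_left ee v(2))
  have ne: "\<bar>w \<bullet> ?e\<bar> \<le> norm w" for w using Cauchy_Schwarz_ineq2[of w ?e] by simp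
  have tn: "\<bar>t\<bar> \<le> norm (D t y)" for t y using ne[of "D t y"] by (simp add: De)
  have tsn: "\<bar>s - t\<bar> \<le> norm (D s z - D t y)" for s t y z
    using ne[of "D s z - D t y"] by (simp add: inner_diff_left De)
  have J': "{lo / 2..r / 2} \<subseteq> {lo..r}" using r lo by auto
  have ab: "lo < r" using r lo by auto
  have deg: "G c = 0 \<and> H c = 0" if c: "c \<in> {lo..r}" "c *\<^sub>R ?e \<in> Tk 1 B" for c
  proof -
    have le: "H t \<le> G t" if "t \<in> {lo..r}" for t using sgn[OF that] by linarith
    have "H c = G c" using lens_Tk1D[OF i ab c(1) L le, of 0] c(2) by (simp add: Beq)
    thus ?thesis using sgn[OF c(1)] by linarith
  qed
  have dern: "((\<lambda>x. - H x) has_real_derivative 0) (at 0 within {lo..r})" using DERIV_minus[OF der(2)] by simp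
  have sz: "\<bar>y\<bar> \<le> E * (t - c)\<^sup>2"
    if c: "c \<in> {lo / 2..r / 2}" "G c = 0" "H c = 0" and t: "t \<in> {lo..r}" and y: "H t \<le> y" "y \<le> G t" for t c y
  proof -
    have "G t \<le> E * (t - c)\<^sup>2"
      by (rule semiconcave_zero_quadratic[OF r lo E conc(1) _ z0(1) der(1) c(1,2) t]) (use sgn in blast)
    moreover have "- H t \<le> E * (t - c)\<^sup>2"
      by (rule semiconcave_zero_quadratic[OF r lo E conc(2) _ _ dern c(1) _ t]) (use sgn z0 c in auto)
    ultimately show ?thesis using y by linarith
  qed
  have sqm: "E * (x - c)\<^sup>2 \<le> E * (s - t)\<^sup>2" if "\<bar>x - c\<bar> \<le> \<bar>s - t\<bar>" for x c s t :: real
    using that E by (intro mult_left_mono) (simp_all add: abs_le_square_iff)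
  \<comment> \<open>At the ends of the full interval the boundary functions may reach zero with
    nonzero slope, where the quadratic bound \<open>sz\<close> would fail. Half the interval
    suffices for a small ball around a.\<close>
  define S where "S = {(t, y). t \<in> {lo / 2..r / 2} \<and> H t \<le> y \<and> y \<le> G t}"
  define W where "W = (\<lambda>(t, y). D t y) ` S"
  have SI: "(t, y) \<in> S \<longleftrightarrow> t \<in> {lo / 2..r / 2} \<and> H t \<le> y \<and> y \<le> G t" for t y by (simp add: S_def)
  have S0: "(t, 0) \<in> S" if "t \<in> {lo / 2..r / 2}" for t using that sgn J' by (auto simp: SI)
  have WI: "D t y \<in> W" if "(t, y) \<in> S" for t y unfolding W_def using that by (auto intro!: image_eqI[of _ _ "(t, y)"])
  have WE: "\<exists>t y. w = D t y \<and> (t, y) \<in> S" if "w \<in> W" for w using that by (auto simp: W_def)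
  have WM: "W \<subseteq> M ` B"
  proof
    fix w assume "w \<in> W"
    then obtain t y where w: "w = D t y" "(t, y) \<in> S" using WE by blast
    have "t *\<^sub>R ?e + y *\<^sub>R ?f \<in> B" unfolding Beq lens_def using w(2) J' unfolding SI by blast
    moreover have "w = M (t *\<^sub>R ?e + y *\<^sub>R ?f)" using w(1) by (simp add: Mv D_def)
    ultimately show "w \<in> M ` B" by blast
  qed
  have alt: "(\<forall>h\<in>closed_segment s t. v h = v t) \<or> (\<bar>z\<bar> \<le> E * (s - t)\<^sup>2 \<and> \<bar>y\<bar> \<le> E * (s - t)\<^sup>2)"
    if st: "(s, z) \<in> S" "(t, y) \<in> S" for s t y z
  proof (cases "\<exists>c\<in>closed_segment s t. c *\<^sub>R ?e \<in> Tk 1 B")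
    case True
    then obtain c where c: "c \<in> closed_segment s t" "c *\<^sub>R ?e \<in> Tk 1 B" by blast
    hence cJ: "c \<in> {lo / 2..r / 2}" and d: "\<bar>s - c\<bar> \<le> \<bar>s - t\<bar>" "\<bar>t - c\<bar> \<le> \<bar>s - t\<bar>"
      using st by (auto simp: SI closed_segment_eq_real_ivl split: if_splits)
    have "G c = 0" "H c = 0" using deg[OF _ c(2)] cJ J' by blast+
    hence "\<bar>z\<bar> \<le> E * (s - c)\<^sup>2" "\<bar>y\<bar> \<le> E * (t - c)\<^sup>2" using sz[OF cJ] st J' unfolding SI by blast+
    thus ?thesis using sqm[OF d(1)] sqm[OF d(2)] by linarith
  next
    case False
    thus ?thesis using vgap subset_closed_segment[of _ t s t] by (meson ends_in_segment(2) subsetD)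
  qed
  have S_compact: "compact S"
  proof -
    let ?R = "{lo / 2..r / 2} \<times> {- (E * r\<^sup>2)..E * r\<^sup>2}"
    have "continuous_on {lo / 2..r / 2} G" "continuous_on {lo / 2..r / 2} H"
      using L J' lipschitz_on_continuous_on continuous_on_subset by blast+
    hence "continuous_on ?R (\<lambda>p. G (fst p))" "continuous_on ?R (\<lambda>p. H (fst p))"
      by (auto intro!: continuous_on_compose2[of "{lo / 2..r / 2}" _ _ fst] continuous_intros)
    hence "closed {p \<in> ?R. snd p \<le> G (fst p)}" "closed {p \<in> ?R. H (fst p) \<le> snd p}"
      by (auto intro!: continuous_on_closed_Collect_le continuous_intros closed_Times)
    hence "compact (?R \<inter> ({p \<in> ?R. snd p \<le> G (fst p)} \<inter> {p \<in> ?R. H (fst p) \<le> snd p}))"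
      by (intro compact_Int_closed compact_Times compact_Icc closed_Int)
    moreover have "\<bar>y\<bar> \<le> E * r\<^sup>2" if "(t, y) \<in> S" for t y
    proof -
      have "\<bar>y\<bar> \<le> E * (t - 0)\<^sup>2" using sz[of 0 t y] z0 that J' r lo unfolding SI by auto
      also have "\<dots> \<le> E * r\<^sup>2" using that E r lo by (intro mult_left_mono) (auto simp: SI abs_le_square_iff[symmetric])
      finally show ?thesis .
    qed
    hence "S = ?R \<inter> ({p \<in> ?R. snd p \<le> G (fst p)} \<inter> {p \<in> ?R. H (fst p) \<le> snd p})"
      by (auto simp: S_def abs_le_iff minus_le_iff)
    ultimately show ?thesis by simp
  qed
  have D_diff: "norm (D s z - D t y) \<le> (1 + 4 * E * r) * \<bar>s - t\<bar> + \<bar>z - y\<bar>" if "(s, z) \<in> S" "(t, y) \<in> S" for s t y z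
  proof -
    have eq: "D s z - D t y = (s - t) *\<^sub>R ?e + (z *\<^sub>R v s - y *\<^sub>R v t)" by (simp add: D_def algebra_simps)
    have 1: "norm (D s z - D t y) \<le> \<bar>s - t\<bar> + norm (z *\<^sub>R v s - y *\<^sub>R v t)"
      unfolding eq using norm_triangle_ineq[of "(s - t) *\<^sub>R ?e" "z *\<^sub>R v s - y *\<^sub>R v t"] by simp
    have k0: "0 \<le> 4 * E * r * \<bar>s - t\<bar>" using E r by simp
    from alt[OF that] show ?thesis
    proof
      assume "\<forall>h\<in>closed_segment s t. v h = v t"
      hence "v s = v t" using ends_in_segment(1)[of s t] by blast
      hence "z *\<^sub>R v s - y *\<^sub>R v t = (z - y) *\<^sub>R v t" by (simp add: scaleR_diff_left)
      thus ?thesis using 1 v(1)[of t] k0 by (simp add: distrib_right)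
    next
      assume "\<bar>z\<bar> \<le> E * (s - t)\<^sup>2 \<and> \<bar>y\<bar> \<le> E * (s - t)\<^sup>2"
      hence b: "\<bar>z\<bar> \<le> E * (s - t)\<^sup>2" "\<bar>y\<bar> \<le> E * (s - t)\<^sup>2" by blast+
      have "\<bar>s - t\<bar> \<le> 2 * r" using that lo r by (auto simp: SI abs_le_iff)
      hence "E * (\<bar>s - t\<bar> * \<bar>s - t\<bar>) \<le> E * (2 * r * \<bar>s - t\<bar>)" using E by (intro mult_left_mono mult_right_mono) auto
      hence "E * (s - t)\<^sup>2 \<le> 2 * E * r * \<bar>s - t\<bar>" by (simp add: power2_eq_square mult_ac)
      moreover have "norm (z *\<^sub>R v s - y *\<^sub>R v t) \<le> \<bar>z\<bar> + \<bar>y\<bar>"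
        using norm_triangle_ineq4[of "z *\<^sub>R v s" "y *\<^sub>R v t"] by (simp add: v(1))
      ultimately show ?thesis using 1 b abs_ge_zero[of "z - y"] unfolding distrib_right by linarith
    qed
  qed
  have D_cont: "continuous_on S (\<lambda>(t, y). D t y)"
  proof (rule lipschitz_on_continuous_on[of "2 + 4 * E * r"], rule lipschitz_onI)
    show "0 \<le> 2 + 4 * E * r" using E r by simp
    fix p q assume p: "p \<in> S" and q: "q \<in> S"
    have "(1 + 4 * E * r) * \<bar>fst p - fst q\<bar> \<le> (1 + 4 * E * r) * dist p q"
      using dist_fst_le[of p q] E r by (intro mult_left_mono) (auto simp: dist_real_def)
    moreover have "\<bar>snd p - snd q\<bar> \<le> dist p q" using dist_snd_le[of p q] by (simp add: dist_real_def)
    ultimately show "dist (case p of (t, y) \<Rightarrow> D t y) (case q of (t, y) \<Rightarrow> D t y) \<le> (2 + 4 * E * r) * dist p q"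
      using D_diff[of "fst p" "snd p" "fst q" "snd q"] p q by (simp add: case_prod_beta dist_norm[of "D _ _"] distrib_right)
  qed
  have W_compact: "compact W" unfolding W_def by (rule compact_continuous_image[OF D_cont S_compact])
  have D_inj: "inj_on (\<lambda>(t, y). D t y) S"
  proof (rule inj_onI, clarify)
    fix t y s z assume eq: "D t y = D s z"
    have ts: "t = s" using arg_cong[OF eq, of "\<lambda>w. w \<bullet> ?e"] by (simp add: De)
    have "v s \<noteq> 0" using v(1)[of s] by auto
    thus "t = s \<and> y = z" using eq ts by (simp add: D_def)
  qed
  have W_mid: "\<exists>m\<in>W. norm (m - (1/2) *\<^sub>R (p + q)) \<le> E * (norm (p - q))\<^sup>2" if p: "p \<in> W" and q: "q \<in> W" for p q
  proof -
    obtain s z where sz': "p = D s z" "(s, z) \<in> S" using WE[OF p] by blast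
    obtain t y where ty: "q = D t y" "(t, y) \<in> S" using WE[OF q] by blast
    define h where "h = (s + t) / 2"
    have hJ: "h \<in> {lo / 2..r / 2}" using sz'(2) ty(2) by (auto simp: SI h_def)
    have "\<bar>s - t\<bar> \<le> norm (p - q)" using tsn[of s t z y] sz'(1) ty(1) by simp
    hence "(s - t)\<^sup>2 \<le> (norm (p - q))\<^sup>2" by (simp add: power2_le_iff_abs_le)
    hence pq: "E * (s - t)\<^sup>2 \<le> E * (norm (p - q))\<^sup>2" using E by (intro mult_left_mono)
    from alt[OF sz'(2) ty(2)] show ?thesis
    proof
      assume vh: "\<forall>h\<in>closed_segment s t. v h = v t"
      have "h \<in> closed_segment s t" by (auto simp: h_def closed_segment_eq_real_ivl)
      hence vst: "v s = v t" "v h = v t" using vh ends_in_segment(1)[of s t] by blast+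
      have conc_mid: "(f s + f t) / 2 - E / 8 * (s - t)\<^sup>2 \<le> f h" if "concave_on {lo..r} (\<lambda>x. f x - E / 2 * x\<^sup>2)" for f :: "real \<Rightarrow> real"
      proof -
        have "s \<in> {lo..r}" "t \<in> {lo..r}" using sz'(2) ty(2) J' by (auto simp: SI)
        from concave_onD[OF that _ _ this, of "1/2"]
        have "(f s - E / 2 * s\<^sup>2) / 2 + (f t - E / 2 * t\<^sup>2) / 2 \<le> f h - E / 2 * h\<^sup>2" by (simp add: h_def add_divide_distrib)
        moreover have "E / 2 * h\<^sup>2 = (E / 2 * s\<^sup>2) / 2 + (E / 2 * t\<^sup>2) / 2 - E / 8 * (s - t)\<^sup>2"
          by (simp add: h_def power2_eq_square field_simps)
        ultimately show ?thesis by argo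
      qed
      \<comment> \<open>By semiconcavity the average (z + y)/2 leaves the slice at h by at most E/8
        (s - t)^2, so moving it back into the slice costs no more.\<close>
      define y' where "y' = max (H h) (min (G h) ((z + y) / 2))"
      have "H h \<le> G h" using sgn[of h] hJ J' by force
      hence mS: "(h, y') \<in> S" using hJ by (auto simp: SI y'_def)
      have "\<bar>y' - (z + y) / 2\<bar> \<le> E / 8 * (s - t)\<^sup>2"
      proof -
        have "z \<le> G s" "y \<le> G t" "H s \<le> z" "H t \<le> y" using sz'(2) ty(2) by (auto simp: SI)
        moreover have "0 \<le> E / 8 * (s - t)\<^sup>2" using E by simp
        ultimately show ?thesis using conc_mid[OF conc(1)] conc_mid[OF conc(2)] unfolding y'_def by argo
      qed
      also have "\<dots> \<le> E * (s - t)\<^sup>2" using E by (intro mult_right_mono) auto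
      finally have "\<bar>y' - (z + y) / 2\<bar> \<le> E * (norm (p - q))\<^sup>2" using pq by linarith
      moreover have "D h y' - (1/2) *\<^sub>R (p + q) = (y' - (z + y) / 2) *\<^sub>R v t"
        using vst unfolding sz'(1) ty(1) by (simp add: D_def h_def algebra_simps add_divide_distrib)
      ultimately show ?thesis using WI[OF mS] v(1)[of t] by (intro bexI[of _ "D h y'"]) auto
    next
      assume "\<bar>z\<bar> \<le> E * (s - t)\<^sup>2 \<and> \<bar>y\<bar> \<le> E * (s - t)\<^sup>2"
      hence b: "\<bar>z\<bar> \<le> E * (s - t)\<^sup>2" "\<bar>y\<bar> \<le> E * (s - t)\<^sup>2" by blast+
      have "D h 0 - (1/2) *\<^sub>R (p + q) = - ((1/2) *\<^sub>R (z *\<^sub>R v s + y *\<^sub>R v t))"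
        unfolding sz'(1) ty(1) by (simp add: D_def h_def algebra_simps add_divide_distrib)
      hence "norm (D h 0 - (1/2) *\<^sub>R (p + q)) \<le> (\<bar>z\<bar> + \<bar>y\<bar>) / 2"
        using norm_triangle_ineq[of "z *\<^sub>R v s" "y *\<^sub>R v t"] by (simp add: v(1))
      also have "\<dots> \<le> E * (s - t)\<^sup>2" using add_mono[OF b] by (simp add: pos_divide_le_eq)
      also note pq
      finally show ?thesis using WI[OF S0[OF hJ]] by blast
    qed
  qed
  have UF: "inj_on F U" using U(2) by (simp add: C11_diffeo_def)
  have WU: "W \<subseteq> U" using WM MU by blast
  have 00: "(0, 0) \<in> S" using r lo by (intro S0) auto
  have D0: "D t 0 = t *\<^sub>R ?e" for t by (simp add: D_def)
  have W0: "0 \<in> W" using WI[OF 00] by (simp add: D0)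
  have W_axis: "norm (p - (p \<bullet> ?e) *\<^sub>R ?e) \<le> E * (norm p)\<^sup>2" if p: "p \<in> W" for p
  proof -
    obtain t y where ty: "p = D t y" "(t, y) \<in> S" using WE[OF p] by blast
    have "\<bar>y\<bar> \<le> E * (t - 0)\<^sup>2" using sz[of 0 t y] z0 ty(2) J' r lo unfolding SI by auto
    also have "\<dots> \<le> E * (norm p)\<^sup>2" using tn[of t y] E ty(1) by (intro mult_left_mono) (simp_all add: power2_le_iff_abs_le)
    finally show ?thesis using v(1)[of t] unfolding ty(1) De by (simp add: D_def)
  qed
  let ?A = "F ` W"
  have "positive_reach ?A" by (rule positive_reach_C11_image[OF U(2) W_compact WU E W_mid])
  moreover have "covering_dim_le ?A 2"
  proof -
    have c: "continuous_on W F" by (rule C11_diffeo_jet[OF U(2) W_compact WU])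
    have "continuous_on S (F \<circ> (\<lambda>(t, y). D t y))"
      using c unfolding W_def by (intro continuous_on_compose D_cont)
    moreover have "(F \<circ> (\<lambda>(t, y). D t y)) ` S = ?A" by (simp add: W_def image_comp)
    moreover have "inj_on (F \<circ> (\<lambda>(t, y). D t y)) S"
      using D_inj inj_on_subset[OF UF WU] unfolding W_def by (rule comp_inj_on)
    ultimately obtain g where "homeomorphism S ?A (F \<circ> (\<lambda>(t, y). D t y)) g"
      using homeomorphism_compact[OF S_compact] by blast
    thus ?thesis by (rule covering_dim_le_planar[OF S_compact])
  qed
  moreover have "dim (Tan ?A a) = 1"
  proof -
    have "lo / 2 < r / 2" "0 \<in> {lo / 2..r / 2}" using r lo by auto
    then obtain P h where P: "P = 1 \<or> P = -1" and h: "\<And>n. 0 + P * h n \<in> {lo / 2..r / 2}" "h \<longlonglongrightarrow> 0" "\<And>n::nat. h n > 0"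
      by (rule interval_sequence) (rule that)
    have "(P * h n) *\<^sub>R ?e \<in> W" for n using WI[OF S0[OF h(1)[of n]]] by (simp add: D0)
    thus ?thesis unfolding a by (intro dim_Tan_C11_image[OF U(2) W_compact WU W0 norm_std_e E W_axis P _ h(2,3)])
  qed
  moreover have "\<exists>k>0. F ` M ` B \<inter> ball a k = ?A \<inter> ball a k"
  proof -
    have inv: "inv_into U F (F w) = w" if "w \<in> U" for w using inv_into_f_f[OF UF that] .
    have "a \<in> F ` U" using a U(3) by blast
    hence "isCont (inv_into U F) a" using U(2) has_derivative_continuous unfolding C11_diffeo_def C11_on_def by blast
    \<comment> \<open>Continuity of the inverse at a: points of the image close to a come from
      heights below r/2 in modulus, hence from the half that was kept.\<close>
    then obtain k where k: "k > 0" "\<And>x. dist x a < k \<Longrightarrow> dist (inv_into U F x) (inv_into U F a) < r / 2"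
      unfolding continuous_at_eps_delta using r by (meson half_gt_zero)
    have "x \<in> ?A" if x: "x \<in> F ` M ` B" "x \<in> ball a k" for x
    proof -
      obtain t y where ty: "t \<in> {lo..r}" "H t \<le> y" "y \<le> G t" and xe: "x = F (M (t *\<^sub>R ?e + y *\<^sub>R ?f))"
        and tyB: "t *\<^sub>R ?e + y *\<^sub>R ?f \<in> B" using x(1) unfolding Beq lens_def by blast
      have wU: "D t y \<in> U" using MU tyB Mv[of t y] by (auto simp: D_def)
      have xg: "x = F (D t y)" using xe by (simp add: Mv D_def)
      have "dist (inv_into U F x) (inv_into U F a) < r / 2" using x(2) by (intro k(2)) (simp add: dist_commute)
      hence "norm (D t y) < r / 2" using inv[OF wU] inv[OF U(3)] by (simp add: xg a)
      hence "\<bar>t\<bar> < r / 2" using tn[of t y] by linarith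
      hence "(t, y) \<in> S" using ty lo by (auto simp: SI abs_less_iff)
      thus ?thesis using WI xg by blast
    qed
    moreover have "?A \<subseteq> F ` M ` B" using WM by blast
    ultimately show ?thesis using k(1) by (intro exI[of _ k]) blast
  qed
  ultimately show ?thesis by blast
qed

theorem theorem1p3:
  fixes i1 i2 :: "'n::finite"
  assumes "CARD('n) \<ge> 3" and "i1 \<noteq> i2"
  shows
   "(\<forall>(A::(real^'n) set) a.
       positive_reach A \<and> covering_dim_le A 2 \<and> a \<in> A \<and> dim (Tan A a) = 1 \<longrightarrow>
       (\<exists>B \<rho> U \<Phi>. B_set i1 i2 B \<and> multirotation i1 (Tk 1 B) \<rho> \<and> open U \<and>
          C11_diffeo U \<Phi> \<and> 0 \<in> U \<and> a = \<Phi> 0 \<and> \<rho> ` B \<subseteq> U \<and>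
          nbhd_in A a (\<Phi> ` \<rho> ` B)))
    \<and>
    (\<forall>B \<rho> U \<Phi> (a::real^'n).
       B_set i1 i2 B \<and> multirotation i1 (Tk 1 B) \<rho> \<and> open U \<and> C11_diffeo U \<Phi> \<and>
       0 \<in> U \<and> \<rho> ` B \<subseteq> U \<and> a = \<Phi> 0 \<longrightarrow>
       (\<exists>A \<epsilon>. positive_reach A \<and> covering_dim_le A 2 \<and> dim (Tan A a) = 1 \<and> \<epsilon> > 0 \<and>
          \<Phi> ` \<rho> ` B \<inter> ball a \<epsilon> = A \<inter> ball a \<epsilon>))"
proof (intro conjI allI impI; elim conjE)
  fix A :: "(real^'n) set" and a
  assume "positive_reach A" "covering_dim_le A 2" "a \<in> A" "dim (Tan A a) = 1"
  then show "\<exists>B \<rho> U \<Phi>. B_set i1 i2 B \<and> multirotation i1 (Tk 1 B) \<rho> \<and> open U \<and>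
      C11_diffeo U \<Phi> \<and> 0 \<in> U \<and> a = \<Phi> 0 \<and> \<rho> ` B \<subseteq> U \<and> nbhd_in A a (\<Phi> ` \<rho> ` B)"
    by (rule B_set_chart[OF assms])
next
  fix B \<rho> U \<Phi> and a :: "real^'n"
  assume "B_set i1 i2 B" "multirotation i1 (Tk 1 B) \<rho>" "open U" "C11_diffeo U \<Phi>" "0 \<in> U" "\<rho> ` B \<subseteq> U" "a = \<Phi> 0"
  then show "\<exists>A \<epsilon>. positive_reach A \<and> covering_dim_le A 2 \<and> dim (Tan A a) = 1 \<and> \<epsilon> > 0 \<and>
      \<Phi> ` \<rho> ` B \<inter> ball a \<epsilon> = A \<inter> ball a \<epsilon>"
    by (rule rotated_B_set_image[OF assms(2)])
qed

end
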